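(* Let $N\ge1$, $s\in(0,1)$, $\beta>-1$, and let $u$ be a positive classical solution of $$\partial_tu+(-\Delta)^su+t^\beta u^p=0\quad\text{in }Q_\infty=(0,\infty)\times\mathbb{R}^N.$$ Set $p_\beta^*=1+\frac{2s(1+\beta)}{N}$, $p_\beta^{**}=1+\frac{2s(1+\beta)}{N+2s}$ and $U_{p,\beta}(t)=\left(\frac{1+\beta}{p-1}\right)^{\frac1{p-1}}t^{-\frac{1+\beta}{p-1}}$. (i) If $p\in(1,p_\beta^{**}]$ and $\mathcal S_u\neq\emptyset$, then $\mathcal S_u=\mathbb{R}^N$ and $u\ge U_{p,\beta}$ in $Q_\infty$. If moreover $u\in L^1_{loc}(0,\infty;\mathcal L^s(\mathbb{R}^N))$, then $u=U_{p,\beta}$. (ii) If there exists an integer $\kappa\in[1,N]$ such that $p\in(1,p_\beta^* )\cap\left(1,1+\frac{2s(1+\beta)}{\kappa+2s}\right]$ and $\mathcal S_u$ contains an affine plane of codimension $\kappa$, then the conclusions of (i) hold, that is: $\mathcal S_u=\mathbb{R}^N$ and $u\ge U_{p,\beta}$ in $Q_\infty$, and if moreover $u\in L^1_{loc}(0,\infty;\mathcal L^s(\mathbb{R}^N))$, then $u=U_{p,\beta}$.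
   Context: The fractional Laplacian is $(-\Delta)^s\phi(x)=\lim_{\varepsilon\to0^+}a_{N,s}\int_{|z-x|>\varepsilon}\frac{\phi(x)-\phi(z)}{|z-x|^{N+2s}}dz$, with $a_{N,s}=\frac{\Gamma(\frac N2+s)}{\pi^{N/2}\Gamma(2-s)}s(1-s)$. $\mathcal L^s(\mathbb{R}^N)$ is the space of $\phi\in L^1_{loc}(\mathbb{R}^N)$ with $\int_{\mathbb{R}^N}\frac{|\phi(x)|}{1+|x|^{N+2s}}dx<+\infty$. Solutions are understood in the classical (pointwise) sense, and it is always assumed that $u(t,\cdot)\in\mathcal L^s(\mathbb{R}^N)$ for every $t>0$. $L^1_{loc}(0,\infty;X)$ means integrable on compact subintervals of the open interval $(0,\infty)$ with values in $X$. The singular set of $u$ is $\mathcal S_u=\{z\in\mathbb{R}^N:\limsup_{t\to0}\int_{B_\rho(z)}u(t,x)dx=+\infty\text{ for any }\rho>0\}$, where $B_\rho(z)$ is the open ball of center $z$ and radius $\rho$. An affine plane of codimension $\kappa$ is an affine subspace of $\mathbb{R}^N$ of dimension $N-\kappa$ (a point if $\kappa=N$). *)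

theory Defs
  imports "HOL-Analysis.Analysis"
begin

text \<open>The space \<open>\<real>\<^sup>N\<close> is rendered by an arbitrary type \<open>'a :: euclidean_space\<close>, with
  \<open>N = DIM('a) \<ge> 1\<close>. Functions on \<open>Q\<^sub>\<infinity> = (0,\<infinity>) \<times> \<real>\<^sup>N\<close> are curried and total; only their values at
  times \<open>t > 0\<close> are ever used.\<close>

definition Q_inf :: "(real \<times> 'a::euclidean_space) set" where
  "Q_inf = {0<..} \<times> UNIV"

definition frac_const :: "nat \<Rightarrow> real \<Rightarrow> real" where
  "frac_const N s =
     Gamma (real N / 2 + s) / (pi powr (real N / 2) * Gamma (2 - s)) * (s * (1 - s))"

text \<open>The integrability conjunct only excludes the junk value \<open>0\<close> of a divergent Bochner integral;
  it holds automatically for functions in the space \<open>Ls_space\<close> below.\<close>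

definition has_frac_laplacian :: "real \<Rightarrow> ('a::euclidean_space \<Rightarrow> real) \<Rightarrow> 'a \<Rightarrow> real \<Rightarrow> bool" where
  "has_frac_laplacian s \<phi> x L \<longleftrightarrow>
     (\<forall>\<epsilon>>0. set_integrable lebesgue {z. norm (z - x) > \<epsilon>}
        (\<lambda>z. (\<phi> x - \<phi> z) / norm (z - x) powr (real DIM('a) + 2 * s))) \<and>
     ((\<lambda>\<epsilon>. frac_const DIM('a) s *
        (LINT z:{z. norm (z - x) > \<epsilon>}|lebesgue.
           (\<phi> x - \<phi> z) / norm (z - x) powr (real DIM('a) + 2 * s))) \<longlongrightarrow> L) (at_right 0)"

definition L1_loc :: "('a::euclidean_space \<Rightarrow> real) set" where
  "L1_loc = {\<phi>. \<forall>K. compact K \<longrightarrow> \<phi> absolutely_integrable_on K}"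

definition Ls_space :: "real \<Rightarrow> ('a::euclidean_space \<Rightarrow> real) set" where
  "Ls_space s = {\<phi> \<in> L1_loc.
     integrable lebesgue (\<lambda>x. \<bar>\<phi> x\<bar> / (1 + norm x powr (real DIM('a) + 2 * s)))}"

definition Ls_norm :: "real \<Rightarrow> ('a::euclidean_space \<Rightarrow> real) \<Rightarrow> real" where
  "Ls_norm s \<phi> = (LINT x|lebesgue. \<bar>\<phi> x\<bar> / (1 + norm x powr (real DIM('a) + 2 * s)))"

text \<open>\<open>L\<^sup>1\<^sub>l\<^sub>o\<^sub>c(0,\<infinity>; \<L>\<^sup>s(\<real>\<^sup>N))\<close>, for functions represented on \<open>Q\<^sub>\<infinity>\<close>. As \<open>\<L>\<^sup>s\<close> is a separable weighted
  \<open>L\<^sup>1\<close> space, joint measurability yields the strong measurability required of a Bochner integrable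
  map \<open>t \<mapsto> u(t,\<cdot>)\<close>.\<close>

definition L1_loc_Ls :: "real \<Rightarrow> (real \<Rightarrow> 'a::euclidean_space \<Rightarrow> real) set" where
  "L1_loc_Ls s = {u.
     (\<lambda>(t, x). u t x) \<in> borel_measurable (lebesgue_on Q_inf) \<and>
     (\<forall>a b. 0 < a \<and> a < b \<longrightarrow>
        (AE t in lebesgue_on {a..b}. u t \<in> Ls_space s) \<and>
        (\<lambda>t. Ls_norm s (u t)) absolutely_integrable_on {a..b})}"

text \<open>Positive classical solutions: continuous on \<open>Q\<^sub>\<infinity>\<close>, with \<open>\<partial>\<^sub>tu\<close> and \<open>(-\<Delta>)\<^sup>su\<close> existing at every
  point and satisfying the equation at every point.\<close>

definition positive_classical_solution ::
    "real \<Rightarrow> real \<Rightarrow> real \<Rightarrow> (real \<Rightarrow> 'a::euclidean_space \<Rightarrow> real) \<Rightarrow> bool" where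
  "positive_classical_solution s \<beta> p u \<longleftrightarrow>
     continuous_on Q_inf (\<lambda>(t, x). u t x) \<and>
     (\<forall>t>0. u t \<in> Ls_space s) \<and>
     (\<forall>t>0. \<forall>x. u t x > 0) \<and>
     (\<forall>t>0. \<forall>x. \<exists>ut L.
        ((\<lambda>\<tau>. u \<tau> x) has_real_derivative ut) (at t) \<and>
        has_frac_laplacian s (u t) x L \<and>
        ut + L + t powr \<beta> * u t x powr p = 0)"

definition singular_set :: "(real \<Rightarrow> 'a::euclidean_space \<Rightarrow> real) \<Rightarrow> 'a set" where
  "singular_set u = {z. \<forall>\<rho>>0.
     Limsup (at_right 0) (\<lambda>t. ereal (LINT x:ball z \<rho>|lebesgue. u t x)) = \<infinity>}"

definition p_star :: "nat \<Rightarrow> real \<Rightarrow> real \<Rightarrow> real" where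
  "p_star N s \<beta> = 1 + 2 * s * (1 + \<beta>) / real N"

definition p_star_star :: "nat \<Rightarrow> real \<Rightarrow> real \<Rightarrow> real" where
  "p_star_star N s \<beta> = 1 + 2 * s * (1 + \<beta>) / (real N + 2 * s)"

definition U_flat :: "real \<Rightarrow> real \<Rightarrow> real \<Rightarrow> real" where
  "U_flat p \<beta> t = ((1 + \<beta>) / (p - 1)) powr (1 / (p - 1)) * t powr (- ((1 + \<beta>) / (p - 1)))"

definition affine_plane_codim :: "nat \<Rightarrow> 'a::euclidean_space set \<Rightarrow> bool" where
  "affine_plane_codim \<kappa> A \<longleftrightarrow> affine A \<and> aff_dim A = int DIM('a) - int \<kappa>"

end

theory Submission
  imports Defs "HOL-Probability.Characteristic_Functions" "HOL-Real_Asymp.Real_Asymp"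
begin

text \<open>A point \<open>z\<close> at which mass concentrates forces a lower bound \<open>u \<ge> c t\<^sup>-\<^sup>\<alpha>\<close>, \<open>\<alpha> = (1 + \<beta>) / (p - 1)\<close>, on
  \<open>|x - z| \<le> \<delta> t\<^bsup>1/2s\<^esup>\<close>: at a small time \<open>t\<^sub>0\<close> the truncation \<open>min u (C t\<^sub>0\<^sup>-\<^sup>\<alpha>)\<close> still has large mass near \<open>z\<close>,
  because wherever \<open>u\<close> exceeds \<open>C t\<^sub>0\<^sup>-\<^sup>\<alpha>\<close> it is at least \<open>c t\<^sub>0\<^sup>-\<^sup>\<alpha>\<close> on a ball of radius \<open>t\<^sub>0\<^bsup>1/2s\<^esup>\<close>, and a
  time-dependent multiple of the linear fractional heat flow of these data is a subsolution.
  The solution is therefore large on a tube of radius \<open>\<delta> t\<^bsup>1/2s\<^esup>\<close> about a singular plane of codimension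
  \<open>\<kappa>\<close>. The jumps out of the tube bring the mass \<open>\<integral> t\<^bsup>\<kappa>/2s - \<alpha>\<^esup> dt\<close> into any ball, which diverges at
  \<open>t = 0\<close> precisely when \<open>p \<le> 1 + 2s(1 + \<beta>) / (\<kappa> + 2s)\<close>. So \<open>u\<close> tends to infinity locally uniformly as
  \<open>t \<rightarrow> 0\<close>, and comparison with the flat solution cut off by a large bump gives \<open>u \<ge> U\<close>.

  For the reverse inequality, a barrier blowing up like \<open>(1 - |x - x\<^sub>0|\<^sup>2 / R\<^sup>2)\<^bsup>-q\<^esup>\<close> bounds \<open>u\<close> by the flat
  solution started at infinity at a time \<open>a\<close>, up to the time integral of the tail of \<open>u\<close> at distance
  \<open>R\<close>; local integrability in time with values in \<open>\<L>\<^sup>s\<close> makes this error vanish as \<open>R \<rightarrow> \<infinity>\<close>, and then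
  \<open>a \<rightarrow> 0\<close>.\<close>

text \<open>Of \<open>u\<close> only the pointwise existence of the principal value is known; no
  integral formulation, semigroup representation or regularity in space comes with it. Every
  estimate is therefore made at an extremal point of \<open>u\<close> against an explicit barrier:
  the odd part of the jumps cancels, a one-sided quadratic bound controls the short jumps, and an
  integrable minorant collects the long ones. A barrier that lives on a ball of radius R costs an
  error of order R^(-2s), which disappears as R grows, so no behaviour of \<open>u\<close> at
  infinity has to be controlled. The constants of the local estimates do not depend on
  \<open>u\<close>. Hence each of them is proved at time 1 near the origin and carried elsewhere by
  the scaling of the equation. The truncation at height C t0^(-\<alpha>) has a quantitative reason:
  along the linear flow v the absorption acts as the rate t^\<beta> v^(p-1), and with \<alpha> (p -
  1) = 1 + \<beta> its integral over [t0, 2 t0] is bounded independently of t0. After 2 t0 the decay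
  of the flow takes over, and this is where p < 1 + 2s(1 + \<beta>)/N enters; the codimension enters
  only through the mass that leaves the tube.\<close>

section \<open>Affine changes of variables and integrability of power weights\<close>

lemma distr_lborel_affine:
  fixes t :: "'a::euclidean_space"
  assumes "c \<noteq> 0"
  shows "lborel = density (distr lborel borel (\<lambda>x. t + c *\<^sub>R x)) (\<lambda>_. ennreal (\<bar>c\<bar>^DIM('a)))"
  using lborel_affine[OF assms, of t] by (simp add: ennreal_power)

lemma lborel_integrable_affine:
  fixes f :: "'a::euclidean_space \<Rightarrow> real"
  assumes [measurable]: "f \<in> borel_measurable borel" and c: "c \<noteq> 0"
  shows "integrable lborel (\<lambda>x. f (t + c *\<^sub>R x)) \<longleftrightarrow> integrable lborel f"
proof -
  have "integrable lborel f \<longleftrightarrow> integrable (density (distr lborel borel (\<lambda>x. t + c *\<^sub>R x)) (\<lambda>_. ennreal (\<bar>c\<bar>^DIM('a)))) f"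
    using distr_lborel_affine[OF c, of t] by simp
  also have "\<dots> \<longleftrightarrow> integrable (distr lborel borel (\<lambda>x. t + c *\<^sub>R x)) (\<lambda>x. \<bar>c\<bar>^DIM('a) * f x)"
    by (subst integrable_density) auto
  also have "\<dots> \<longleftrightarrow> integrable lborel (\<lambda>x. \<bar>c\<bar>^DIM('a) * f (t + c *\<^sub>R x))"
    by (subst integrable_distr_eq) auto
  also have "\<dots> \<longleftrightarrow> integrable lborel (\<lambda>x. f (t + c *\<^sub>R x))"
    using c by (simp add: integrable_mult_left_iff)
  finally show ?thesis by simp
qed

lemma lborel_integral_affine:
  fixes f :: "'a::euclidean_space \<Rightarrow> real"
  assumes [measurable]: "f \<in> borel_measurable borel" and c: "c \<noteq> 0"
  shows "(\<integral>x. f (t + c *\<^sub>R x) \<partial>lborel) = integral\<^sup>L lborel f / \<bar>c\<bar>^DIM('a)"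
proof -
  have "integral\<^sup>L lborel f = integral\<^sup>L (density (distr lborel borel (\<lambda>x. t + c *\<^sub>R x)) (\<lambda>_. ennreal (\<bar>c\<bar>^DIM('a)))) f"
    using distr_lborel_affine[OF c, of t] by simp
  also have "\<dots> = (\<integral>x. \<bar>c\<bar>^DIM('a) * f x \<partial>distr lborel borel (\<lambda>x. t + c *\<^sub>R x))"
    by (subst integral_density) auto
  also have "\<dots> = (\<integral>x. \<bar>c\<bar>^DIM('a) * f (t + c *\<^sub>R x) \<partial>lborel)"
    by (subst integral_distr) auto
  finally show ?thesis using c by simp
qed

text \<open>\<open>f\<close> is at most the sum of \<open>c j\<close> times the indicators of the
  balls, which is integrated term by term. Full balls instead of annuli cost only a constant factor
  when the radii are geometric, as in both applications.\<close>

lemma integrable_annuli: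
  fixes f :: "'a::euclidean_space \<Rightarrow> real"
  assumes [measurable]: "f \<in> borel_measurable borel" and nn: "\<And>z. f z \<ge> 0"
    and cov: "\<And>z. f z \<noteq> 0 \<Longrightarrow> \<exists>j. norm z < \<rho> j \<and> f z \<le> c j"
    and c: "\<And>j. c j \<ge> 0" and rho: "\<And>j. \<rho> j \<ge> 0"
    and sm: "summable (\<lambda>j. c j * \<rho> j ^ DIM('a))"
  shows "integrable lborel f"
proof -
  let ?g = "\<lambda>(j::nat) z. ennreal (c j) * indicator (ball (0::'a) (\<rho> j)) z"
  have le: "ennreal (f z) \<le> (\<Sum>j. ?g j z)" for z
  proof (cases "f z = 0")
    case False
    then obtain j where j: "norm z < \<rho> j" "f z \<le> c j" using cov by blast
    have "ennreal (f z) \<le> ?g j z" using j by (simp add: ennreal_leI)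
    also have "\<dots> = sum (\<lambda>j. ?g j z) {j}" by (subst sum.insert) auto
    also have "\<dots> \<le> (\<Sum>j. ?g j z)"
      by (intro sum_le_suminf summableI) auto
    finally show ?thesis .
  qed simp
  have "(\<integral>\<^sup>+z. ennreal (f z) \<partial>lborel) \<le> (\<integral>\<^sup>+z. (\<Sum>j. ?g j z) \<partial>lborel)"
    by (intro nn_integral_mono le)
  also have "\<dots> = (\<Sum>j. \<integral>\<^sup>+z. ?g j z \<partial>lborel)"
    by (intro nn_integral_suminf borel_measurable_times_ennreal borel_measurable_indicator) auto
  also have "\<dots> = (\<Sum>j. ennreal (unit_ball_vol (real DIM('a)) * (c j * \<rho> j ^ DIM('a))))"
  proof (rule suminf_cong)
    fix j
    have "(\<integral>\<^sup>+z. ?g j z \<partial>lborel) = ennreal (c j) * emeasure lborel (ball (0::'a) (\<rho> j))"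
      by (subst nn_integral_cmult_indicator) auto
    also have "\<dots> = ennreal (unit_ball_vol (real DIM('a)) * (c j * \<rho> j ^ DIM('a)))"
      using c rho by (simp add: emeasure_ball ennreal_mult[symmetric] mult_ac)
    finally show "(\<integral>\<^sup>+z. ?g j z \<partial>lborel) = \<dots>" .
  qed
  also have "\<dots> = ennreal (\<Sum>j. unit_ball_vol (real DIM('a)) * (c j * \<rho> j ^ DIM('a)))"
    by (rule suminf_ennreal2) (use c rho sm in \<open>auto intro!: summable_mult\<close>)
  also have "\<dots> < \<infinity>" by simp
  finally show ?thesis using nn by (intro integrableI_nonneg) auto
qed

lemma exists_dyadic:
  assumes "x \<ge> (1::real)" shows "\<exists>j::nat. 2 ^ j \<le> x \<and> x < 2 ^ (j+1)"
proof -
  define j where "j = nat \<lfloor>log 2 x\<rfloor>"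
  have "log 2 x \<ge> 0" using assms by simp
  then have "real j \<le> log 2 x" "log 2 x < real (j+1)" unfolding j_def by linarith+
  then have "2 powr real j \<le> x" "x < 2 powr real (j+1)"
    using assms le_log_iff[of 2 x "real j"] log_less_iff[of 2 x "real (j+1)"] by simp_all
  then have "2 ^ j \<le> x" "x < 2 ^ (j+1)" by (simp_all only: powr_realpow zero_less_numeral)
  then show ?thesis by blast
qed

text \<open>The shell where \<open>1 + norm z\<close> is about \<open>2^j\<close> contributes a term
  of order \<open>2^(-j \<sigma>)\<close>, so a geometric series results.\<close>

lemma integrable_weight:
  assumes "\<sigma> > 0"
  shows "integrable lborel (\<lambda>z::'a::euclidean_space. 1 / (1 + norm z) powr (real DIM('a) + \<sigma>))"
proof (rule integrable_annuli)
  let ?e = "real DIM('a) + \<sigma>"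
  fix z :: 'a
  obtain j :: nat where j: "2 ^ j \<le> 1 + norm z" "1 + norm z < 2 ^ (j+1)"
    using exists_dyadic[of "1 + norm z"] by auto
  have "1 / (1 + norm z) powr ?e \<le> 1 / (2^j) powr ?e"
    using j(1) assms by (intro divide_left_mono powr_mono2 mult_pos_pos) (auto simp: add_pos_nonneg less_imp_neq[symmetric] add_nonneg_eq_0_iff)
  then show "\<exists>j. norm z < 2 ^ (j+1) \<and> 1 / (1 + norm z) powr ?e \<le> 1 / (2^j) powr ?e"
    using j(2) by (intro exI[of _ j]) auto
next
  let ?e = "real DIM('a) + \<sigma>"
  have eq: "1 / (2^j) powr ?e * (2 ^ (j+1)) ^ DIM('a) = 2 ^ DIM('a) * ((1/2) powr \<sigma>) ^ j" for j
  proof -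
    have a: "(2^j::real) powr ?e = 2 ^ (j * DIM('a)) * (2 powr \<sigma>) ^ j"
    proof -
      have "(2^j::real) powr ?e = (2^j) powr real DIM('a) * (2^j) powr \<sigma>" by (rule powr_add)
      also have "(2^j::real) powr real DIM('a) = 2 ^ (j * DIM('a))" by (subst powr_realpow) (auto simp: power_mult)
      also have "(2^j::real) powr \<sigma> = (2 powr \<sigma>) ^ j"
        by (simp add: powr_powr powr_realpow[symmetric] mult.commute)
      finally show ?thesis .
    qed
    have b: "((2::real) ^ (j+1)) ^ DIM('a) = 2 ^ (j * DIM('a)) * 2 ^ DIM('a)"
      by (simp add: power_mult_distrib power_mult)
    have c: "((1/2::real) powr \<sigma>) ^ j = 1 / (2 powr \<sigma>) ^ j"
      by (simp add: powr_divide power_one_over)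
    show ?thesis unfolding a b c by simp
  qed
  have "(1/2::real) powr \<sigma> < 1" using assms powr_less_mono2[of \<sigma> "1/2" 1] by simp
  then show "summable (\<lambda>j. 1 / (2^j) powr ?e * (2 ^ (j+1)) ^ DIM('a))"
    unfolding eq by (intro summable_mult summable_geometric) auto
qed auto

section \<open>The fractional Laplacian and touching functions\<close>

text \<open>The jump density of the fractional Laplacian without the factor
  \<open>frac_const\<close>. At \<open>z = 0\<close> its value is \<open>1 / 0 = 0\<close>, so lower
  bounds such as \<open>jump_kernel_ge\<close> exclude this point.\<close>

definition jump_kernel :: "real \<Rightarrow> 'a::euclidean_space \<Rightarrow> real" where
  "jump_kernel s z = 1 / norm z powr (real DIM('a) + 2 * s)"

lemma jump_kernel_nonneg [simp]: "jump_kernel s z \<ge> 0" by (simp add: jump_kernel_def)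

lemma jump_kernel_minus [simp]: "jump_kernel s (- z) = jump_kernel s z" by (simp add: jump_kernel_def)

lemma jump_kernel_measurable [measurable]: "jump_kernel s \<in> borel_measurable borel"
  unfolding jump_kernel_def by measurable

lemma jump_kernel_scale:
  fixes z :: "'a::euclidean_space"
  assumes "c > 0"
  shows "jump_kernel s (c *\<^sub>R z) = jump_kernel s z / c powr (real DIM('a) + 2 * s)"
  using assms by (simp add: jump_kernel_def powr_mult)

lemma jump_kernel_ge:
  fixes z :: "'a::euclidean_space"
  assumes "s > 0" "z \<noteq> 0" "norm z \<le> b"
  shows "1 / b powr (real DIM('a) + 2 * s) \<le> jump_kernel s z"
  unfolding jump_kernel_def using assms by (intro divide_left_mono powr_mono2 mult_pos_pos) auto

lemma jump_kernel_le:
  fixes z :: "'a::euclidean_space"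
  assumes "s > 0" "0 < b" "b \<le> norm z"
  shows "jump_kernel s z \<le> 1 / b powr (real DIM('a) + 2 * s)"
  unfolding jump_kernel_def using assms by (intro divide_left_mono powr_mono2 mult_pos_pos) auto

lemma jump_kernel_le_weight:
  fixes z :: "'a::euclidean_space"
  assumes s: "s > 0" and r: "0 < r" "r \<le> norm z"
  shows "jump_kernel s z \<le> ((1 + r) / r) powr (real DIM('a) + 2 * s) * (1 / (1 + norm z) powr (real DIM('a) + 2 * s))"
proof -
  have "r / (1 + r) * (1 + norm z) \<le> norm z"
    using r by (simp add: field_simps)
  then have "jump_kernel s z \<le> 1 / (r / (1 + r) * (1 + norm z)) powr (real DIM('a) + 2 * s)"
    using r s by (intro jump_kernel_le) (auto intro!: mult_pos_pos divide_pos_pos add_pos_nonneg)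
  also have "\<dots> = ((1 + r) / r) powr (real DIM('a) + 2 * s) * (1 / (1 + norm z) powr (real DIM('a) + 2 * s))"
    using r by (simp add: powr_mult powr_divide)
  finally show ?thesis .
qed

lemma jump_kernel_outer_integrable:
  assumes s: "s > 0" and r: "r > 0"
  shows "integrable lborel (\<lambda>z::'a::euclidean_space. indicator {z. r \<le> norm z} z * jump_kernel s z)"
proof (rule Bochner_Integration.integrable_bound)
  show "integrable lborel (\<lambda>z::'a. ((1 + r) / r) powr (real DIM('a) + 2 * s) * (1 / (1 + norm z) powr (real DIM('a) + 2 * s)))"
    using integrable_weight[of "2 * s", where 'a='a] s by (intro integrable_mult_right) auto
  show "AE z in lborel. norm (indicator {z. r \<le> norm z} z * jump_kernel s (z::'a)) \<le>
     norm (((1 + r) / r) powr (real DIM('a) + 2 * s) * (1 / (1 + norm z) powr (real DIM('a) + 2 * s)))"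
    using jump_kernel_le_weight[OF s r, where 'a='a] by (intro AE_I2) (auto split: split_indicator)
qed measurable

text \<open>The shell of radius about \<open>2^(-j)\<close> contributes a term of order
  \<open>2^(-j (2 - 2 s))\<close>, and \<open>s < 1\<close> makes the series converge. Other radii
  follow by scaling in \<open>jump_kernel_inner\<close>.\<close>

lemma jump_kernel_inner_integrable_1:
  assumes s: "s > 0" "s < 1"
  shows "integrable lborel (\<lambda>z::'a::euclidean_space. indicator (ball 0 1) z * ((norm z)\<^sup>2 * jump_kernel s z))"
proof (rule integrable_annuli)
  let ?e = "real DIM('a) + 2 * s"
  let ?c = "\<lambda>j::nat. (2 * (1/2)^(j+1))\<^sup>2 / ((1/2)^(j+1)) powr ?e"
  fix z :: 'a
  assume "indicator (ball 0 1) z * ((norm z)\<^sup>2 * jump_kernel s z) \<noteq> 0"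
  then have z: "norm z < 1" "z \<noteq> 0" by (auto split: split_indicator_asm)
  obtain j :: nat where j: "2 ^ j \<le> 1 / norm z" "1 / norm z < 2 ^ (j+1)"
    using exists_dyadic[of "1 / norm z"] z by auto
  have 1: "norm z \<le> 2 * (1/2)^(j+1)" using j(1) z by (simp add: field_simps power_one_over)
  have 2: "(1/2)^(j+1) < norm z" using j(2) z by (simp add: field_simps power_one_over)
  have "(norm z)\<^sup>2 * jump_kernel s z \<le> (2 * (1/2)^(j+1))\<^sup>2 * (1 / ((1/2)^(j+1)) powr ?e)"
    using 1 2 s by (intro mult_mono power_mono jump_kernel_le) auto
  moreover have "norm z < 4 * (1/2)^(j+1)" using 1 by (smt (verit) z(2) norm_le_zero_iff)
  ultimately show "\<exists>j. norm z < 4 * (1/2)^(j+1) \<and> indicator (ball 0 1) z * ((norm z)\<^sup>2 * jump_kernel s z) \<le> ?c j"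
    using z by (intro exI[of _ j]) auto
next
  let ?e = "real DIM('a) + 2 * s"
  let ?c = "\<lambda>j::nat. (2 * (1/2)^(j+1))\<^sup>2 / ((1/2)^(j+1)) powr ?e"
  have eq: "?c j * (4 * (1/2)^(j+1)) ^ DIM('a) = 4 * 4 ^ DIM('a) * (1/2) powr (2 - 2 * s) * ((1/2) powr (2 - 2 * s)) ^ j" for j
  proof -
    define x :: real where "x = (1/2)^(j+1)"
    have x: "x > 0" by (simp add: x_def)
    have "x ^ 2 = x powr 2" "x ^ DIM('a) = x powr real DIM('a)" using x by (simp_all add: powr_realpow)
    then have "(2 * x)\<^sup>2 / x powr ?e * (4 * x) ^ DIM('a) = 4 * 4 ^ DIM('a) * (x powr 2 * x powr DIM('a) / x powr ?e)"
      by (simp add: power_mult_distrib)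
    also have "x powr 2 * x powr DIM('a) / x powr ?e = x powr (2 - 2 * s)"
      by (simp only: powr_add[symmetric] powr_diff[symmetric]) simp
    also have "x powr (2 - 2 * s) = ((1/2) powr (2 - 2 * s)) ^ (j+1)"
    proof -
      have "x = (1/2) powr real (j+1)" unfolding x_def by (subst powr_realpow) auto
      then have "x powr (2 - 2 * s) = ((1/2) powr (2 - 2 * s)) powr real (j+1)"
        by (simp only: powr_powr mult.commute)
      also have "\<dots> = ((1/2) powr (2 - 2 * s)) ^ (j+1)" by (rule powr_realpow) simp
      finally show ?thesis .
    qed
    finally show ?thesis by (simp add: x_def)
  qed
  have "(1/2::real) powr (2 - 2 * s) < 1" using s powr_less_mono2[of "2 - 2 * s" "1/2" 1] by simp
  then show "summable (\<lambda>j. ?c j * (4 * (1/2)^(j+1)) ^ DIM('a))"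
    unfolding eq by (intro summable_mult summable_geometric) auto
qed (auto split: split_indicator intro!: borel_measurable_times borel_measurable_indicator)

text \<open>The type is an argument because the dimension enters only through the bound variable. By
  scaling, this number and \<open>outer_mass\<close> give the moments of the kernel at every radius:
  \<open>r powr (2 - 2 * s)\<close> inside, \<open>r powr (- (2 * s))\<close> outside.\<close>

definition inner_moment :: "'a::euclidean_space itself \<Rightarrow> real \<Rightarrow> real" where
  "inner_moment _ s = (LBINT z::'a. indicator (ball 0 1) z * ((norm z)\<^sup>2 * jump_kernel s z))"

definition outer_mass :: "'a::euclidean_space itself \<Rightarrow> real \<Rightarrow> real" where
  "outer_mass _ s = (LBINT z::'a. indicator {z. 1 \<le> norm z} z * jump_kernel s z)"

lemma inner_moment_nonneg [simp]: "inner_moment TYPE('a::euclidean_space) s \<ge> 0"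
  unfolding inner_moment_def by (intro integral_nonneg_AE AE_I2) auto

lemma outer_mass_nonneg [simp]: "outer_mass TYPE('a::euclidean_space) s \<ge> 0"
  unfolding outer_mass_def by (intro integral_nonneg_AE AE_I2) auto

lemma jump_kernel_inner:
  assumes s: "s > 0" "s < 1" and r: "r > 0"
  shows jump_kernel_inner_integrable: "integrable lborel (\<lambda>z::'a::euclidean_space. indicator (ball 0 r) z * ((norm z)\<^sup>2 * jump_kernel s z))"
    and jump_kernel_inner_integral: "(LBINT z::'a. indicator (ball 0 r) z * ((norm z)\<^sup>2 * jump_kernel s z)) = inner_moment TYPE('a) s * r powr (2 - 2 * s)"
proof -
  let ?f = "\<lambda>z::'a. indicator (ball 0 r) z * ((norm z)\<^sup>2 * jump_kernel s z)"
  let ?g = "\<lambda>z::'a. indicator (ball 0 1) z * ((norm z)\<^sup>2 * jump_kernel s z)"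
  have eq: "?f (0 + r *\<^sub>R z) = r powr (2 - 2 * s) / r ^ DIM('a) * ?g z" for z
  proof -
    have "r ^ 2 = r powr 2" "r ^ DIM('a) = r powr real DIM('a)" using r by (simp_all add: powr_realpow)
    then have "r\<^sup>2 / r powr (real DIM('a) + 2 * s) = r powr (2 - 2 * s) / r ^ DIM('a)"
      by (simp only: powr_diff[symmetric]) (simp add: algebra_simps)
    moreover have "indicator (ball 0 r) (r *\<^sub>R z) = (indicator (ball 0 1) z :: real)"
      using r by (auto simp: indicator_def)
    ultimately show ?thesis using r by (simp add: jump_kernel_scale power_mult_distrib) (simp add: divide_simps)
  qed
  have m: "?f \<in> borel_measurable borel" by (intro borel_measurable_times borel_measurable_indicator borel_measurable_power) auto
  have i: "integrable lborel (\<lambda>z. ?f (0 + r *\<^sub>R z))"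
    unfolding eq by (intro integrable_mult_right jump_kernel_inner_integrable_1 s)
  then show "integrable lborel ?f" using lborel_integrable_affine[OF m, of r 0] r by blast
  have "(\<integral>z. ?f (0 + r *\<^sub>R z) \<partial>lborel) = r powr (2 - 2 * s) / r ^ DIM('a) * inner_moment TYPE('a) s"
    unfolding eq inner_moment_def by simp
  then show "integral\<^sup>L lborel ?f = inner_moment TYPE('a) s * r powr (2 - 2 * s)"
    using lborel_integral_affine[OF m, of r 0] r by (simp add: field_simps)
qed

lemma jump_kernel_outer_integral:
  assumes s: "s > 0" and r: "r > 0"
  shows "integral\<^sup>L lborel (\<lambda>z::'a::euclidean_space. indicator {z. r \<le> norm z} z * jump_kernel s z) = outer_mass TYPE('a) s * r powr (- (2 * s))"
proof -
  let ?f = "\<lambda>z::'a. indicator {z. r \<le> norm z} z * jump_kernel s z"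
  let ?g = "\<lambda>z::'a. indicator {z. 1 \<le> norm z} z * jump_kernel s z"
  have eq: "?f (0 + r *\<^sub>R z) = r powr (- (2 * s)) / r ^ DIM('a) * ?g z" for z
  proof -
    have "r powr (real DIM('a) + 2 * s) = r ^ DIM('a) * r powr (2 * s)" using r by (simp add: powr_add powr_realpow)
    then have "1 / r powr (real DIM('a) + 2 * s) = r powr (-(2 * s)) / r ^ DIM('a)"
      using r by (simp add: powr_minus divide_simps)
    moreover have "indicator {z. r \<le> norm z} (r *\<^sub>R z) = (indicator {z. 1 \<le> norm z} z :: real)"
      using r by (auto simp: indicator_def)
    ultimately show ?thesis using r by (simp add: jump_kernel_scale) (simp add: divide_simps)
  qed
  have m: "?f \<in> borel_measurable borel" by (intro borel_measurable_times borel_measurable_indicator borel_measurable_power) auto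
  have "(\<integral>z. ?f (0 + r *\<^sub>R z) \<partial>lborel) = r powr (- (2 * s)) / r ^ DIM('a) * outer_mass TYPE('a) s"
    unfolding eq outer_mass_def by simp
  then show "integral\<^sup>L lborel ?f = outer_mass TYPE('a) s * r powr (- (2 * s))"
    using lborel_integral_affine[OF m, of r 0] r by (simp add: field_simps)
qed

text \<open>The reflection of the jump variable. It cancels the linear part of a touching function
  and the sine terms in the Fourier computations.\<close>

lemma lborel_integral_odd:
  fixes f :: "'a::euclidean_space \<Rightarrow> real"
  assumes "f \<in> borel_measurable borel" "\<And>z. f (- z) = - f z"
  shows "integral\<^sup>L lborel f = 0"
  using lborel_integral_affine[OF assms(1), of "-1" 0] assms(2) by simp

lemma frac_const_pos:
  assumes "0 < s" "s < 1"
  shows "frac_const N s > 0"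
proof -
  have "Gamma (real N / 2 + s) > 0" "Gamma (2 - s) > 0"
    using assms by (auto intro!: Gamma_real_pos add_nonneg_pos)
  then show ?thesis using assms unfolding frac_const_def by (intro mult_pos_pos divide_pos_pos) auto
qed

text \<open>The integration variable is the jump \<open>z\<close> itself and not, as in \<^const>\<open>has_frac_laplacian\<close>, its end point.\<close>

definition frac_lap :: "real \<Rightarrow> ('a::euclidean_space \<Rightarrow> real) \<Rightarrow> 'a \<Rightarrow> real \<Rightarrow> bool" where
  "frac_lap s \<phi> x L \<longleftrightarrow>
    (\<forall>\<epsilon>>0. integrable lborel (\<lambda>z. indicator {z. norm z > \<epsilon>} z * ((\<phi> x - \<phi> (x + z)) * jump_kernel s z))) \<and>
    ((\<lambda>\<epsilon>. frac_const DIM('a) s *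
       (LBINT z. indicator {z. norm z > \<epsilon>} z * ((\<phi> x - \<phi> (x + z)) * jump_kernel s z)))
      \<longlongrightarrow> L) (at_right 0)"

text \<open>For a Borel function the completion of the measure changes neither integrability nor the
  integral; then \<open>x + z\<close> is substituted for the end point of the jump.\<close>

lemma has_frac_laplacian_imp_frac_lap:
  fixes \<phi> :: "'a::euclidean_space \<Rightarrow> real"
  assumes [measurable]: "\<phi> \<in> borel_measurable borel" and h: "has_frac_laplacian s \<phi> x L"
  shows "frac_lap s \<phi> x L"
proof -
  let ?f = "\<lambda>\<epsilon> z. indicator {z. norm (z - x) > \<epsilon>} z * ((\<phi> x - \<phi> z) * jump_kernel s (z - x))"
  have m: "?f \<epsilon> \<in> borel_measurable borel" for \<epsilon>
    by (intro borel_measurable_times borel_measurable_indicator) (auto intro: measurable_compose[OF _ jump_kernel_measurable])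
  have e1: "set_integrable lebesgue {z. norm (z - x) > \<epsilon>} (\<lambda>z. (\<phi> x - \<phi> z) / norm (z - x) powr (real DIM('a) + 2 * s))
      \<longleftrightarrow> integrable lborel (?f \<epsilon>)" for \<epsilon>
    using integrable_completion[of "?f \<epsilon>" lborel] by (simp add: set_integrable_def jump_kernel_def m)
  have e2: "(LINT z:{z. norm (z - x) > \<epsilon>}|lebesgue. (\<phi> x - \<phi> z) / norm (z - x) powr (real DIM('a) + 2 * s))
      = integral\<^sup>L lborel (?f \<epsilon>)" for \<epsilon>
    using integral_completion[of "?f \<epsilon>" lborel] by (simp add: set_lebesgue_integral_def jump_kernel_def m)
  have i: "indicator {z. \<epsilon> < norm (z - x)} (x + z) = (indicator {z. \<epsilon> < norm z} z :: real)" for \<epsilon> z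
    by (simp add: indicator_def)
  show ?thesis
    using h lborel_integrable_affine[OF m, where c=1 and t=x] lborel_integral_affine[OF m, where c=1 and t=x]
    unfolding frac_lap_def has_frac_laplacian_def e1 e2 by (simp add: i)
qed

text \<open>The comparison argument applies the operator to a difference; with a constant as first
  function the same statement yields negation and scalar multiples.\<close>

lemma frac_lap_lincomb:
  assumes "frac_lap s f x L1" "frac_lap s g x L2"
  shows "frac_lap s (\<lambda>z. f z - c * g z) x (L1 - c * L2)"
proof -
  let ?F = "\<lambda>f \<epsilon> z. indicator {z. norm z > \<epsilon>} z * ((f x - f (x + z)) * jump_kernel s z)"
  have eq: "?F (\<lambda>z. f z - c * g z) \<epsilon> = (\<lambda>z. ?F f \<epsilon> z - c * ?F g \<epsilon> z)" for \<epsilon>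
    by (auto simp: algebra_simps)
  have int: "integrable lborel (?F f \<epsilon>)" "integrable lborel (?F g \<epsilon>)" if "\<epsilon> > 0" for \<epsilon>
    using assms that by (auto simp: frac_lap_def)
  have "((\<lambda>\<epsilon>. frac_const DIM('a) s * integral\<^sup>L lborel (?F f \<epsilon>) - c * (frac_const DIM('a) s * integral\<^sup>L lborel (?F g \<epsilon>)))
     \<longlongrightarrow> L1 - c * L2) (at_right 0)"
    using assms by (intro tendsto_intros) (auto simp: frac_lap_def)
  moreover have "\<forall>\<^sub>F \<epsilon> in at_right 0. frac_const DIM('a) s * integral\<^sup>L lborel (?F f \<epsilon>) - c * (frac_const DIM('a) s * integral\<^sup>L lborel (?F g \<epsilon>))
     = frac_const DIM('a) s * integral\<^sup>L lborel (?F (\<lambda>z. f z - c * g z) \<epsilon>)"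
    using eventually_at_right_less[of 0]
  proof eventually_elim
    case (elim \<epsilon>)
    show ?case unfolding eq Bochner_Integration.integral_diff[OF int(1)[OF elim] integrable_mult_right[OF int(2)[OF elim]]]
      by (simp add: right_diff_distrib mult.left_commute)
  qed
  ultimately have "((\<lambda>\<epsilon>. frac_const DIM('a) s * integral\<^sup>L lborel (?F (\<lambda>z. f z - c * g z) \<epsilon>)) \<longlongrightarrow> L1 - c * L2) (at_right 0)"
    by (rule Lim_transform_eventually)
  moreover have "integrable lborel (?F (\<lambda>z. f z - c * g z) \<epsilon>)" if "\<epsilon> > 0" for \<epsilon>
    unfolding eq using int[OF that] by auto
  ultimately show ?thesis unfolding frac_lap_def by blast
qed

lemma frac_lap_const: "frac_lap s (\<lambda>_. B) x 0"
  by (simp add: frac_lap_def)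

lemma frac_lap_minus: "frac_lap s f x L \<Longrightarrow> frac_lap s (\<lambda>z. - f z) x (- L)"
  using frac_lap_lincomb[OF frac_lap_const[of s 0 x], of f L 1] by simp

lemma frac_lap_cmult: "frac_lap s f x L \<Longrightarrow> frac_lap s (\<lambda>z. c * f z) x (c * L)"
  using frac_lap_lincomb[OF frac_lap_const[of s 0 x], of f L "-c"] by simp

text \<open>A one-sided bound on the increments at a single point suffices. The linear term
  \<open>l \<bullet> z\<close> is odd and drops out of every truncated integral, the quadratic term
  produces the moment \<open>r powr (2 - 2 * s)\<close>, and \<open>E\<close>, of either sign,
  collects whatever is known about the remaining jumps.\<close>

lemma frac_lap_touching:
  fixes D :: "'a::euclidean_space \<Rightarrow> real"
  assumes s: "0 < s" "s < 1" and D: "frac_lap s D x L" and r: "r > 0" and M: "M \<ge> 0"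
    and E: "integrable lborel E"
    and below: "\<And>z. z \<noteq> 0 \<Longrightarrow>
      indicator (ball 0 r) z * ((l \<bullet> z - M * (norm z)\<^sup>2) * jump_kernel s z) + E z \<le> (D (x + z) - D x) * jump_kernel s z"
  shows "L \<le> frac_const DIM('a) s * (M * (inner_moment TYPE('a) s * r powr (2 - 2 * s)) - integral\<^sup>L lborel E)"
proof -
  \<comment> \<open>The principal value is followed along a sequence, so that dominated convergence
    with the bound \<open>norm (E z)\<close> applies.\<close>
  define \<epsilon> :: "nat \<Rightarrow> real" where "\<epsilon> n = r / (real n + 2)" for n
  have e: "\<epsilon> n > 0" "\<epsilon> n < r" for n using r by (auto simp: \<epsilon>_def field_simps intro!: add_pos_nonneg)
  have e0: "\<epsilon> \<longlonglongrightarrow> 0" unfolding \<epsilon>_def by real_asymp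
  have e0r: "filterlim \<epsilon> (at_right 0) sequentially"
    unfolding filterlim_at using e0 e(1) by (auto simp: less_le)
  let ?I = "\<lambda>n z. indicator {z. norm z > \<epsilon> n} z :: real"
  let ?A = "frac_const DIM('a) s"
  have A: "?A > 0" by (rule frac_const_pos[OF s])
  have [measurable]: "E \<in> borel_measurable borel" using E by auto
  have le: "?A * (LBINT z. ?I n z * ((D x - D (x + z)) * jump_kernel s z))
      \<le> ?A * (M * (inner_moment TYPE('a) s * r powr (2 - 2 * s)) - (LBINT z. ?I n z * E z))" for n
  proof (rule mult_left_mono)
    let ?l = "\<lambda>z. ?I n z * (indicator (ball 0 r) z * ((l \<bullet> z) * jump_kernel s z))"
    have mI: "(\<lambda>z::'a. ?I n z) \<in> borel_measurable borel" by auto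
    have ml: "?l \<in> borel_measurable borel"
      by (intro borel_measurable_times borel_measurable_indicator) auto
    have il: "integrable lborel ?l"
    proof (rule Bochner_Integration.integrable_bound)
      show "integrable lborel (\<lambda>z::'a. (norm l * r) * (indicator {z. \<epsilon> n \<le> norm z} z * jump_kernel s z))"
        using jump_kernel_outer_integrable[OF s(1) e(1), where 'a='a] by auto
      have "\<bar>l \<bullet> z\<bar> * jump_kernel s z \<le> norm l * r * jump_kernel s z" if "norm z < r" for z :: 'a
        using that by (intro mult_right_mono order_trans[OF Cauchy_Schwarz_ineq2] mult_left_mono) auto
      then show "AE z in lborel. norm (?l z) \<le> norm ((norm l * r) * (indicator {z. \<epsilon> n \<le> norm z} z * jump_kernel s z))"
        using r by (intro AE_I2) (auto simp: abs_mult split: split_indicator)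
    qed (use ml in simp)
    have l0: "integral\<^sup>L lborel ?l = 0"
      by (rule lborel_integral_odd[OF ml]) (auto split: split_indicator)
    have iE: "integrable lborel (\<lambda>z. ?I n z * E z)"
      by (rule Bochner_Integration.integrable_bound[OF E]) (auto split: split_indicator)
    have iq: "integrable lborel (\<lambda>z::'a. M * (indicator (ball 0 r) z * ((norm z)\<^sup>2 * jump_kernel s z)))"
      by (intro integrable_mult_right jump_kernel_inner_integrable s r)
    have "(LBINT z. ?I n z * ((D x - D (x + z)) * jump_kernel s z)) \<le>
      (LBINT z. M * (indicator (ball 0 r) z * ((norm z)\<^sup>2 * jump_kernel s z)) - ?l z - ?I n z * E z)"
    proof (rule integral_mono)
      show "integrable lborel (\<lambda>z. ?I n z * ((D x - D (x + z)) * jump_kernel s z))"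
        using D e unfolding frac_lap_def by auto
      show "integrable lborel (\<lambda>z. M * (indicator (ball 0 r) z * ((norm z)\<^sup>2 * jump_kernel s z)) - ?l z - ?I n z * E z)"
        by (intro Bochner_Integration.integrable_diff il iE iq)
      fix z :: 'a
      show "?I n z * ((D x - D (x + z)) * jump_kernel s z) \<le>
        M * (indicator (ball 0 r) z * ((norm z)\<^sup>2 * jump_kernel s z)) - ?l z - ?I n z * E z"
      proof (cases "norm z > \<epsilon> n")
        case True
        then have "z \<noteq> 0" using e(1)[of n] by auto
        from below[OF this] True show ?thesis by (auto simp: algebra_simps split: split_indicator)
      next
        case False
        then show ?thesis using M by (auto split: split_indicator)
      qed
    qed
    also have "\<dots> = M * (inner_moment TYPE('a) s * r powr (2 - 2 * s)) - 0 - (LBINT z. ?I n z * E z)"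
      using il iE iq l0 jump_kernel_inner_integral[OF s r, where 'a='a] by (simp add: Bochner_Integration.integral_diff)
    finally show "(LBINT z. ?I n z * ((D x - D (x + z)) * jump_kernel s z))
       \<le> M * (inner_moment TYPE('a) s * r powr (2 - 2 * s)) - (LBINT z. ?I n z * E z)" by simp
  qed (use A in simp)
  have "(\<lambda>n. (LBINT z. ?I n z * E z)) \<longlonglongrightarrow> integral\<^sup>L lborel E"
  proof (rule integral_dominated_convergence[where w="\<lambda>z. norm (E z)"])
    \<comment> \<open>Convergence can fail only at \<open>z = 0\<close>, which no truncation reaches
      and where \<open>E\<close> is arbitrary.\<close>
    show "AE z in lborel. (\<lambda>n. ?I n z * E z) \<longlonglongrightarrow> E z"
    proof (rule AE_I')
      show "{0::'a} \<in> null_sets lborel" by (rule finite_imp_null_set_lborel) simp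
      show "{z \<in> space lborel. \<not> (\<lambda>n. ?I n z * E z) \<longlonglongrightarrow> E z} \<subseteq> {0}"
      proof safe
        fix z assume n: "\<not> (\<lambda>n. ?I n z * E z) \<longlonglongrightarrow> E z"
        show "z = 0"
        proof (rule ccontr)
          assume "z \<noteq> 0"
          then have "\<forall>\<^sub>F n in sequentially. \<epsilon> n < norm z"
            using order_tendstoD(2)[OF e0] by simp
          then have "\<forall>\<^sub>F n in sequentially. ?I n z * E z = E z" by eventually_elim simp
          then have "(\<lambda>n. ?I n z * E z) \<longlonglongrightarrow> E z" by (rule tendsto_eventually)
          then show False using n by contradiction
        qed
      qed
    qed
  qed (use E in \<open>auto split: split_indicator\<close>)
  then have "(\<lambda>n. ?A * (M * (inner_moment TYPE('a) s * r powr (2 - 2 * s)) - (LBINT z. ?I n z * E z)))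
    \<longlonglongrightarrow> ?A * (M * (inner_moment TYPE('a) s * r powr (2 - 2 * s)) - integral\<^sup>L lborel E)"
    by (intro tendsto_intros)
  moreover have "(\<lambda>n. ?A * (LBINT z. ?I n z * ((D x - D (x + z)) * jump_kernel s z))) \<longlonglongrightarrow> L"
    using filterlim_compose[OF conjunct2[OF D[unfolded frac_lap_def]] e0r] .
  ultimately show ?thesis using le by (intro LIMSEQ_le) auto
qed

section \<open>The bump function and its touching property\<close>

lemma norm_divideR: "R > 0 \<Longrightarrow> norm (x /\<^sub>R R) = norm x / R" for x :: "'a::real_normed_vector"
  by (simp only: norm_scaleR) (simp add: divide_inverse)

lemma norm_divideR_less: "R > 0 \<Longrightarrow> norm x < R \<Longrightarrow> norm (x /\<^sub>R R) < 1" for x :: "'a::real_normed_vector"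
  unfolding norm_divideR by simp

text \<open>The profile of all lower barriers, explicit enough that a paraboloid of fixed opening
  touches it from below at every point of the ball (\<open>bump_lower\<close>).\<close>

definition bump :: "'a::euclidean_space \<Rightarrow> real" where
  "bump z = (max 0 (1 - (norm z)\<^sup>2))\<^sup>2"

lemma bump_bounds [simp]: "0 \<le> bump z" "bump z \<le> 1"
  unfolding bump_def by (auto intro!: power_le_one)

lemma bump_eq_0_iff: "bump z = 0 \<longleftrightarrow> norm z \<ge> 1"
proof -
  have "norm z \<ge> 1 \<longleftrightarrow> (norm z)\<^sup>2 \<ge> 1" using abs_le_square_iff[of 1 "norm z"] by simp
  then show ?thesis by (auto simp: bump_def max_def)
qed

lemma bump_outside: "R > 0 \<Longrightarrow> norm x \<ge> R \<Longrightarrow> bump (x /\<^sub>R R) = 0"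
  unfolding bump_eq_0_iff norm_divideR by simp

lemma bump_pos_iff: "bump z > 0 \<longleftrightarrow> norm z < 1"
  using bump_eq_0_iff[of z] bump_bounds(1)[of z] by linarith

lemma bump_0 [simp]: "bump 0 = 1" by (simp add: bump_def)

lemma bump_cont: "continuous_on A bump"
  unfolding bump_def by (intro continuous_intros)

lemma bump_cont' [continuous_intros]: "continuous_on A f \<Longrightarrow> continuous_on A (\<lambda>x. bump (f x))"
  using continuous_on_compose2[OF bump_cont[of UNIV]] by auto

lemma bump_measurable [measurable]: "bump \<in> borel_measurable borel"
  by (intro borel_measurable_continuous_onI bump_cont)

lemma bump_ge: "norm z \<le> r \<Longrightarrow> r \<le> 1 \<Longrightarrow> bump z \<ge> (1 - r\<^sup>2)\<^sup>2"
proof -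
  assume a: "norm z \<le> r" "r \<le> 1"
  have "0 \<le> r" using a(1) norm_ge_zero order_trans by blast
  then have "r\<^sup>2 \<le> 1" "(norm z)\<^sup>2 \<le> r\<^sup>2" using a by (auto intro: power_mono power_le_one)
  then show ?thesis unfolding bump_def by (intro power_mono) auto
qed

text \<open>With \<open>d\<close> and \<open>e\<close> the values of \<open>1 - |.|^2\<close> at
  \<open>x\<close> and \<open>x + z\<close>, convexity of the square gives
  \<open>(max 0 e)^2 >= 2 d e - d^2\<close>, and \<open>e\<close> is a quadratic polynomial in
  \<open>z\<close>. The bound is global in \<open>z\<close>, also beyond the support, and its
  opening 2 does not depend on \<open>x\<close>.\<close>

lemma bump_lower:
  assumes "norm x < 1"
  shows "(- (4 * (1 - (norm x)\<^sup>2))) *\<^sub>R x \<bullet> z - 2 * (norm z)\<^sup>2 \<le> bump (x + z) - bump x"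
proof -
  define d where "d = 1 - (norm x)\<^sup>2"
  define e where "e = 1 - (norm (x + z))\<^sup>2"
  have d: "0 < d" "d \<le> 1" using assms by (auto simp: d_def power_less_one_iff abs_square_less_1)
  have e: "e = d - 2 * (x \<bullet> z) - (norm z)\<^sup>2"
    unfolding e_def d_def by (simp add: power2_norm_eq_inner inner_commute algebra_simps)
  have "2 * d * e - d\<^sup>2 \<le> 2 * d * max 0 e - d\<^sup>2" using d by (auto intro!: mult_left_mono)
  also have "\<dots> \<le> (max 0 e)\<^sup>2"
    using zero_le_power2[of "max 0 e - d"] by (simp add: power2_diff mult_ac)
  finally have "2 * d * e - d\<^sup>2 \<le> bump (x + z)" by (simp add: bump_def e_def)
  moreover have "bump x = d\<^sup>2" using d by (simp add: bump_def d_def)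
  moreover have "2 * d * (norm z)\<^sup>2 \<le> 2 * (norm z)\<^sup>2" using d by (simp add: mult_left_le_one_le)
  ultimately show ?thesis unfolding e d_def[symmetric]
    by (simp add: algebra_simps power2_eq_square)
qed

lemma bump_ge_scaled:
  assumes "R > 0" "norm x \<le> c * R" "c \<le> 1"
  shows "bump (x /\<^sub>R R) \<ge> (1 - c\<^sup>2)\<^sup>2"
proof (rule bump_ge)
  show "norm (x /\<^sub>R R) \<le> c" unfolding norm_divideR[OF assms(1)] using assms by (simp add: divide_le_eq)
qed (use assms in auto)

text \<open>Lifting the bump costs at most a multiple of its own height, although the curvature error near
  the edge of its support does not vanish there: where the bump is at most \<open>1/16\<close>, this error, taken over
  jumps of length less than \<open>\<eta> R\<close> with \<open>\<eta>\<close> small, is absorbed by the jumps into the centre of the ball.\<close>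

lemma bump_touching:
  assumes s: "0 < s" "s < 1"
  shows "\<exists>C\<ge>0. \<forall>(x0::'a::euclidean_space) R x h L D E.
    R > 0 \<longrightarrow> norm (x - x0) < R \<longrightarrow> h \<ge> 0 \<longrightarrow> frac_lap s D x L \<longrightarrow> integrable lborel E \<longrightarrow>
    (\<forall>z. z \<noteq> 0 \<longrightarrow> h * (bump ((x + z - x0) /\<^sub>R R) - bump ((x - x0) /\<^sub>R R)) * jump_kernel s z + E z \<le> (D (x + z) - D x) * jump_kernel s z) \<longrightarrow>
    L \<le> C * R powr (- (2 * s)) * h * bump ((x - x0) /\<^sub>R R) - frac_const DIM('a) s * integral\<^sup>L lborel E"
proof -
  let ?A = "frac_const DIM('a) s" and ?e = "real DIM('a) + 2 * s"
  have A: "?A > 0" by (rule frac_const_pos[OF s])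
  let ?Ki = "inner_moment TYPE('a) s" and ?Ko = "outer_mass TYPE('a) s"
  \<comment> \<open>The gain, in units of \<open>R powr (- (2 * s))\<close>, from jumps into the
    concentric ball of radius \<open>R / 2\<close>: the bump is at least
    \<open>(1 - 1/4)^2 = 9/16\<close> there, the volume gives \<open>(1/2) ^ DIM('a)\<close>, and
    the jumps are at most \<open>2 * R\<close> long.\<close>
  define g0 :: real where "g0 = 9/16 * unit_ball_vol (real DIM('a)) * (1/2) ^ DIM('a) / 2 powr ?e"
  have g0: "g0 > 0" unfolding g0_def by (intro divide_pos_pos mult_pos_pos) auto
  \<comment> \<open>Small enough for the curvature error
    \<open>2 * ?Ki * \<eta> powr (2 - 2 * s)\<close> to be at most \<open>g0\<close>; the
    \<open>+ 1\<close> guards the division. The cap \<open>1/4\<close> keeps the central ball, at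
    distance at least \<open>R / 4\<close> from points near the edge, out of the ball of short
    jumps.\<close>
  define \<eta> where "\<eta> = min (1/4) ((g0 / (2 * ?Ki + 1)) powr (1 / (2 - 2 * s)))"
  have eta: "0 < \<eta>" "\<eta> \<le> 1/4"
    using g0 inner_moment_nonneg[where 'a='a, of s] by (auto simp: \<eta>_def simp del: inner_moment_nonneg)
  have etaK: "2 * ?Ki * \<eta> powr (2 - 2 * s) \<le> g0"
  proof -
    have kk: "2 * ?Ki + 1 > 0" using inner_moment_nonneg[where 'a='a, of s] by linarith
    have "\<eta> powr (2 - 2 * s) \<le> ((g0 / (2 * ?Ki + 1)) powr (1 / (2 - 2 * s))) powr (2 - 2 * s)"
      using s eta by (intro powr_mono2) (auto simp: \<eta>_def)
    also have "\<dots> = g0 / (2 * ?Ki + 1)"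
      using s g0 kk by (simp add: powr_powr)
    finally have "2 * ?Ki * \<eta> powr (2 - 2 * s) \<le> 2 * ?Ki * (g0 / (2 * ?Ki + 1))"
      by (intro mult_left_mono) auto
    also have "\<dots> = g0 * (2 * ?Ki / (2 * ?Ki + 1))" by simp
    also have "\<dots> \<le> g0 * 1"
      using g0 kk by (intro mult_left_mono) (auto simp: divide_simps)
    finally show ?thesis by simp
  qed
  \<comment> \<open>\<open>32 = 2 * 16\<close>: where the bump exceeds \<open>1/16\<close>, the
    curvature error grows when multiplied by 16 times the bump. The term with \<open>?Ko\<close>
    bounds the drop of the bump, at most its own height, over all longer jumps.\<close>
  define C where "C = ?A * (32 * ?Ki * \<eta> powr (2 - 2 * s) + ?Ko * \<eta> powr (- (2 * s)))"
  have C: "C \<ge> 0" unfolding C_def using A by (intro mult_nonneg_nonneg add_nonneg_nonneg) auto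
  show ?thesis
  proof (intro exI[of _ C] conjI C allI impI)
    fix x0 :: 'a and R x h L D E
    assume R: "R > 0" and x: "norm (x - x0) < R" and h: "h \<ge> 0" and D: "frac_lap s D x L" and E: "integrable lborel E"
      and below: "\<forall>z. z \<noteq> 0 \<longrightarrow> h * (bump ((x + z - x0) /\<^sub>R R) - bump ((x - x0) /\<^sub>R R)) * jump_kernel s z + E z \<le> (D (x + z) - D x) * jump_kernel s z"
    let ?\<psi> = "\<lambda>z. bump ((z - x0) /\<^sub>R R)"
    let ?r = "\<eta> * R"
    let ?O = "\<lambda>z. indicator {z. ?r \<le> norm z} z :: real"
    have r: "?r > 0" using eta R by simp
    have mpsi: "(\<lambda>z. ?\<psi> (x + z)) \<in> borel_measurable borel" by measurable
    have mO: "?O \<in> borel_measurable borel" by auto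
    have io: "integrable lborel (\<lambda>z. ?O z * jump_kernel s z)" by (rule jump_kernel_outer_integrable[OF s(1) r])
    have i1: "integrable lborel (\<lambda>z. ?\<psi> (x + z) * (?O z * jump_kernel s z))"
    proof (rule Bochner_Integration.integrable_bound[OF io])
      show "(\<lambda>z. ?\<psi> (x + z) * (?O z * jump_kernel s z)) \<in> borel_measurable lborel"
        using mpsi mO by (intro borel_measurable_times) auto
    qed (auto intro!: AE_I2 mult_left_le_one_le simp: abs_mult)
    define G where "G = (LBINT z. ?\<psi> (x + z) * (?O z * jump_kernel s z))"
    \<comment> \<open>Beyond \<open>?r\<close> the exact increment of the bump joins the remainder;
      the paraboloid serves only below \<open>?r\<close>.\<close>
    let ?E = "\<lambda>z. E z + h * (?\<psi> (x + z) * (?O z * jump_kernel s z) - ?\<psi> x * (?O z * jump_kernel s z))"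
    let ?M = "h * (2 / R\<^sup>2)"
    define d where "d = 1 - (norm ((x - x0) /\<^sub>R R))\<^sup>2"
    have nx: "norm ((x - x0) /\<^sub>R R) < 1" by (rule norm_divideR_less[OF R x])
    have "L \<le> ?A * (?M * (?Ki * ?r powr (2 - 2 * s)) - integral\<^sup>L lborel ?E)"
    proof (rule frac_lap_touching[OF s D r, where l = "(h / R) *\<^sub>R (- (4 * d)) *\<^sub>R ((x - x0) /\<^sub>R R)"])
      show "?M \<ge> 0" using h by simp
      show "integrable lborel ?E"
        by (rule Bochner_Integration.integrable_add[OF E integrable_mult_right[OF Bochner_Integration.integrable_diff[OF i1 integrable_mult_right[OF io]]]])
      fix z :: 'a assume z: "z \<noteq> 0"
      have "(- (4 * d)) *\<^sub>R ((x - x0) /\<^sub>R R) \<bullet> (z /\<^sub>R R) - 2 * (norm (z /\<^sub>R R))\<^sup>2 \<le> ?\<psi> (x + z) - ?\<psi> x"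
      proof -
        have "(x + z - x0) /\<^sub>R R = (x - x0) /\<^sub>R R + z /\<^sub>R R"
          by (simp add: scaleR_diff_right scaleR_add_right)
        then show ?thesis using bump_lower[OF nx, of "z /\<^sub>R R"] by (simp only: d_def)
      qed
      then have "h * ((- (4 * d)) *\<^sub>R ((x - x0) /\<^sub>R R) \<bullet> (z /\<^sub>R R) - 2 * (norm (z /\<^sub>R R))\<^sup>2) \<le> h * (?\<psi> (x + z) - ?\<psi> x)"
        using h by (rule mult_left_mono)
      moreover have "h * ((- (4 * d)) *\<^sub>R ((x - x0) /\<^sub>R R) \<bullet> (z /\<^sub>R R) - 2 * (norm (z /\<^sub>R R))\<^sup>2)
         = (h / R) *\<^sub>R (- (4 * d)) *\<^sub>R ((x - x0) /\<^sub>R R) \<bullet> z - ?M * (norm z)\<^sup>2"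
      proof -
        have "h * ((c *\<^sub>R w) \<bullet> (z /\<^sub>R R) - 2 * (norm (z /\<^sub>R R))\<^sup>2) = ((h / R) *\<^sub>R c *\<^sub>R w) \<bullet> z - ?M * (norm z)\<^sup>2" for c w
          using R by (simp add: power_mult_distrib power2_eq_square divide_inverse algebra_simps)
        then show ?thesis .
      qed
      ultimately have le: "((h / R) *\<^sub>R (- (4 * d)) *\<^sub>R ((x - x0) /\<^sub>R R) \<bullet> z - ?M * (norm z)\<^sup>2) * jump_kernel s z \<le> h * (?\<psi> (x + z) - ?\<psi> x) * jump_kernel s z"
        by (intro mult_right_mono) auto
      show "indicator (ball 0 ?r) z * (((h / R) *\<^sub>R (- (4 * d)) *\<^sub>R ((x - x0) /\<^sub>R R) \<bullet> z - ?M * (norm z)\<^sup>2) * jump_kernel s z) + ?E z \<le> (D (x + z) - D x) * jump_kernel s z"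
      proof (cases "norm z < ?r")
        case True
        then show ?thesis using le below z by fastforce
      next
        case False
        then show ?thesis using below z by (auto simp: algebra_simps)
      qed
    qed
    also have "integral\<^sup>L lborel ?E = integral\<^sup>L lborel E + h * (G - ?\<psi> x * (?Ko * ?r powr (- (2 * s))))"
      using Bochner_Integration.integral_add[OF E integrable_mult_right[OF Bochner_Integration.integrable_diff[OF i1 integrable_mult_right[OF io]]]]
        Bochner_Integration.integral_diff[OF i1 integrable_mult_right[OF io]] jump_kernel_outer_integral[OF s(1) r, where 'a='a]
      by (simp only: G_def integral_mult_right_zero)
    finally have L: "L \<le> ?A * (?M * (?Ki * ?r powr (2 - 2 * s)) - (integral\<^sup>L lborel E + h * (G - ?\<psi> x * (?Ko * ?r powr (- (2 * s))))))" .
    have p1: "?M * (?Ki * ?r powr (2 - 2 * s)) = h * R powr (- (2 * s)) * (2 * ?Ki * \<eta> powr (2 - 2 * s))"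
    proof -
      have "R powr (2 - 2 * s) = R powr (2 + - (2 * s))" by simp
      also have "\<dots> = R\<^sup>2 * R powr (- (2 * s))" using R by (simp only: powr_add) (simp add: powr_realpow)
      finally have "R powr (2 - 2 * s) = R\<^sup>2 * R powr (- (2 * s))" .
      moreover have "?r powr (2 - 2 * s) = \<eta> powr (2 - 2 * s) * R powr (2 - 2 * s)"
        using R eta by (simp add: powr_mult)
      ultimately show ?thesis using R by (simp only:) simp
    qed
    have p2: "?r powr (- (2 * s)) = \<eta> powr (- (2 * s)) * R powr (- (2 * s))"
      using R eta by (simp add: powr_mult)
    have G: "G \<ge> (if ?\<psi> x \<le> 1/16 then g0 * R powr (- (2 * s)) else 0)"
    proof (cases "?\<psi> x \<le> 1/16")
      case True
      \<comment> \<open>Closer to the centre the bump would be at least \<open>(7/16)^2\<close>,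
        which exceeds \<open>1/16\<close>.\<close>
      have f: "norm (x - x0) \<ge> 3/4 * R"
      proof (rule ccontr)
        assume "\<not> ?thesis"
        then have "?\<psi> x \<ge> (1 - (3/4)\<^sup>2)\<^sup>2" using R by (intro bump_ge_scaled) auto
        then show False using True by (simp add: power2_eq_square)
      qed
      let ?B = "ball (x0 - x) (R / 2)"
      have "9/16 / (2 * R) powr ?e * measure lborel ?B = (LBINT z. 9/16 / (2 * R) powr ?e * indicator ?B z)"
        by simp
      also have "\<dots> \<le> G" unfolding G_def
      proof (rule integral_mono)
        show "integrable lborel (\<lambda>z. 9/16 / (2 * R) powr ?e * indicator ?B z)"
          using emeasure_lborel_ball_finite[of "x0 - x" "R/2"] by (intro integrable_mult_right integrable_real_indicator) auto
        show "integrable lborel (\<lambda>z. ?\<psi> (x + z) * (?O z * jump_kernel s z))" by (rule i1)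
        fix z
        show "9/16 / (2 * R) powr ?e * indicator ?B z \<le> ?\<psi> (x + z) * (?O z * jump_kernel s z)"
        proof (cases "z \<in> ?B")
          case True
          then have z: "norm (x + z - x0) < R / 2" by (simp add: dist_norm norm_minus_commute algebra_simps)
          have "?\<psi> (x + z) \<ge> (1 - (1/2)\<^sup>2)\<^sup>2" using z R by (intro bump_ge_scaled) auto
          then have 1: "?\<psi> (x + z) \<ge> 9/16" by (simp add: power2_eq_square)
          have tri: "norm (x - x0) \<le> norm (x + z - x0) + norm z" "norm z \<le> norm (x + z - x0) + norm (x - x0)"
            using norm_triangle_ineq4[of "x + z - x0" z] norm_triangle_ineq4[of "x + z - x0" "x - x0"] by (auto simp: algebra_simps)
          have 2: "norm z \<ge> R / 4" "norm z \<le> 2 * R" using z f x tri R by auto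
          then have "z \<noteq> 0" using R by auto
          have "?r \<le> norm z" using 2(1) mult_right_mono[of \<eta> "1/4" R] eta R by linarith
          then have 3: "?O z = 1" by simp
          have 4: "1 / (2 * R) powr ?e \<le> jump_kernel s z" by (rule jump_kernel_ge[OF s(1) \<open>z \<noteq> 0\<close> 2(2)])
          have "9/16 * (1 / (2 * R) powr ?e) \<le> ?\<psi> (x + z) * jump_kernel s z"
            by (intro mult_mono 1 4) auto
          then show ?thesis using True 3 by simp
        qed auto
      qed
      finally have "9/16 / (2 * R) powr ?e * measure lborel ?B \<le> G" .
      moreover have "9/16 / (2 * R) powr ?e * measure lborel ?B = g0 * R powr (- (2 * s))"
      proof -
        have "measure lborel ?B = unit_ball_vol (real DIM('a)) * (R/2) ^ DIM('a)"
          using R by (simp add: content_ball)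
        moreover have "(2 * R) powr ?e = 2 powr ?e * (R ^ DIM('a) * R powr (2 * s))"
          using R by (simp add: powr_mult powr_add powr_realpow)
        ultimately show ?thesis using R by (simp add: g0_def powr_minus divide_simps power_divide)
      qed
      ultimately show ?thesis using True by simp
    next
      case False
      then show ?thesis unfolding G_def by (auto intro!: integral_nonneg_AE AE_I2)
    qed
    have key: "2 * ?Ki * \<eta> powr (2 - 2 * s) * R powr (- (2 * s)) - G + ?\<psi> x * (?Ko * ?r powr (- (2 * s)))
       \<le> R powr (- (2 * s)) * (32 * ?Ki * \<eta> powr (2 - 2 * s) + ?Ko * \<eta> powr (- (2 * s))) * ?\<psi> x"
    proof (cases "?\<psi> x \<le> 1/16")
      case True
      have eq: "R powr (- (2 * s)) * (32 * ?Ki * \<eta> powr (2 - 2 * s) + ?Ko * \<eta> powr (- (2 * s))) * ?\<psi> x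
        = R powr (- (2 * s)) * (32 * ?Ki * \<eta> powr (2 - 2 * s)) * ?\<psi> x + ?\<psi> x * (?Ko * ?r powr (- (2 * s)))"
        unfolding p2 by (simp only: distrib_left distrib_right mult_ac)
      have "2 * ?Ki * \<eta> powr (2 - 2 * s) * R powr (- (2 * s)) \<le> g0 * R powr (- (2 * s))"
        by (intro mult_right_mono etaK) auto
      moreover have "g0 * R powr (- (2 * s)) \<le> G" using G True by simp
      moreover have "0 \<le> R powr (- (2 * s)) * (32 * ?Ki * \<eta> powr (2 - 2 * s)) * ?\<psi> x" by auto
      ultimately show ?thesis unfolding eq by linarith
    next
      case False
      then have "2 * ?Ki * \<eta> powr (2 - 2 * s) * R powr (- (2 * s)) * 1 \<le> 2 * ?Ki * \<eta> powr (2 - 2 * s) * R powr (- (2 * s)) * (16 * ?\<psi> x)"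
        by (intro mult_left_mono) auto
      moreover have "0 \<le> G" using G False by simp
      ultimately show ?thesis unfolding p2 by (simp add: algebra_simps)
    qed
    have "L \<le> ?A * h * (2 * ?Ki * \<eta> powr (2 - 2 * s) * R powr (- (2 * s)) - G + ?\<psi> x * (?Ko * ?r powr (- (2 * s)))) - ?A * integral\<^sup>L lborel E"
      using L unfolding p1 by (simp add: algebra_simps)
    also have "\<dots> \<le> ?A * h * (R powr (- (2 * s)) * (32 * ?Ki * \<eta> powr (2 - 2 * s) + ?Ko * \<eta> powr (- (2 * s))) * ?\<psi> x) - ?A * integral\<^sup>L lborel E"
      using A h by (intro diff_right_mono mult_left_mono key) auto
    finally show "L \<le> C * R powr (- (2 * s)) * h * ?\<psi> x - ?A * integral\<^sup>L lborel E"
      by (simp add: C_def mult_ac)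
  qed
qed

section \<open>Comparison and barriers\<close>

text \<open>A maximum over a time interval may sit at its right end, so only earlier times are
  compared. The derivative is taken within \<open>S\<close> because the barriers are differentiable
  only within their interval.\<close>

lemma left_maximum_deriv_nonneg:
  assumes "(f has_real_derivative f') (at t within S)" "{a..t} \<subseteq> S" "a < t"
    and "\<And>\<tau>. \<tau> \<in> {a..t} \<Longrightarrow> f \<tau> \<le> f t"
  shows "f' \<ge> (0::real)"
proof (rule ccontr)
  assume "\<not> f' \<ge> 0"
  then obtain d where d: "d > 0" "\<And>h. h > 0 \<Longrightarrow> t - h \<in> S \<Longrightarrow> h < d \<Longrightarrow> f t < f (t - h)"
    using has_real_derivative_neg_dec_left[OF assms(1)] by force
  define h where "h = min (d/2) (t - a)"
  have "h > 0" "h < d" "t - h \<in> {a..t}" using d(1) assms(3) by (auto simp: h_def)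
  then show False using d(2)[of h] assms(2) assms(4)[of "t - h"] by fastforce
qed

text \<open>The Borel form of \<open>positive_classical_solution\<close>, with
  \<open>frac_lap\<close> as the operator. The weight \<open>1 / (1 + norm y) powr (N + 2 s)\<close>
  is comparable to that of \<open>Ls_space\<close> and better suited to translations and
  dilations.\<close>

definition absorption_sol :: "real \<Rightarrow> real \<Rightarrow> real \<Rightarrow> (real \<Rightarrow> 'a::euclidean_space \<Rightarrow> real) \<Rightarrow> bool" where
  "absorption_sol s \<beta> p u \<longleftrightarrow>
     continuous_on ({0<..} \<times> UNIV) (\<lambda>(t, x). u t x) \<and>
     (\<forall>t>0. integrable lborel (\<lambda>y. u t y * (1 / (1 + norm y) powr (real DIM('a) + 2 * s)))) \<and>
     (\<forall>t>0. \<forall>x. u t x > 0) \<and>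
     (\<forall>t>0. \<forall>x. \<exists>ut L.
        ((\<lambda>\<tau>. u \<tau> x) has_real_derivative ut) (at t) \<and> frac_lap s (u t) x L \<and>
        ut + L + t powr \<beta> * u t x powr p = 0)"

lemma sol_cont: "absorption_sol s \<beta> p u \<Longrightarrow> T \<subseteq> {0<..} \<Longrightarrow> continuous_on (T \<times> S) (\<lambda>(t, x). u t x)"
  unfolding absorption_sol_def by (auto elim!: continuous_on_subset)

lemma sol_cont_x: "absorption_sol s \<beta> p u \<Longrightarrow> t > 0 \<Longrightarrow> continuous_on S (u t)"
  using continuous_on_compose2[OF sol_cont[of s \<beta> p u "{t}" UNIV], of S "\<lambda>x. (t, x)"]
  by (force intro!: continuous_intros)

lemma sol_measurable: "absorption_sol s \<beta> p u \<Longrightarrow> t > 0 \<Longrightarrow> u t \<in> borel_measurable borel"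
  by (intro borel_measurable_continuous_onI sol_cont_x)

lemma sol_pos: "absorption_sol s \<beta> p u \<Longrightarrow> t > 0 \<Longrightarrow> u t x > 0"
  unfolding absorption_sol_def by auto

text \<open>No decay at infinity is assumed: the penalty \<open>N (1 - bump (x / R)) + \<delta> (t - t\<^sub>0)\<close> makes the difference
  attain its maximum, and it is small at any given point once \<open>R\<close> is large and \<open>\<delta>\<close> small.\<close>

lemma comparison:
  fixes V U :: "real \<Rightarrow> 'a::euclidean_space \<Rightarrow> real"
  assumes s: "0 < s" "s < 1"
    and cV: "continuous_on ({t0..t2} \<times> UNIV) (\<lambda>(t, x). V t x)"
    and cU: "continuous_on ({t0..t2} \<times> UNIV) (\<lambda>(t, x). U t x)"
    and VM: "\<And>t x. t \<in> {t0..t2} \<Longrightarrow> V t x \<le> M"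
    and U0: "\<And>t x. t \<in> {t0..t2} \<Longrightarrow> 0 \<le> U t x"
    and init: "\<And>x. V t0 x \<le> U t0 x + \<epsilon>" and eps: "\<epsilon> \<ge> 0"
    and eq: "\<And>t x. t \<in> {t0<..t2} \<Longrightarrow> \<exists>Vt LV Ut LU.
      ((\<lambda>\<tau>. V \<tau> x) has_real_derivative Vt) (at t) \<and> ((\<lambda>\<tau>. U \<tau> x) has_real_derivative Ut) (at t) \<and>
      frac_lap s (V t) x LV \<and> frac_lap s (U t) x LU \<and> (V t x > U t x \<longrightarrow> Vt + LV \<le> Ut + LU)"
    and t: "t \<in> {t0..t2}"
  shows "V t x \<le> U t x + \<epsilon>"
proof (rule ccontr)
  assume "\<not> V t x \<le> U t x + \<epsilon>"
  define \<eta> where "\<eta> = V t x - U t x - \<epsilon>"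
  have eta: "\<eta> > 0" using \<open>\<not> _\<close> by (simp add: \<eta>_def)
  have tt: "t0 < t" "t \<le> t2" using t init[of x] \<open>\<not> _\<close> by (cases "t = t0"; force)+
  \<comment> \<open>Not below the bound \<open>M\<close> of \<open>V\<close>: where the bump
    vanishes the penalised difference is then nonpositive, so a positive maximum lies strictly
    inside the ball of radius \<open>R\<close>.\<close>
  define N where "N = max M 0 + 1"
  have N: "N > 0" "N \<ge> M" by (auto simp: N_def)
  obtain C where C: "C \<ge> 0" and bt: "\<And>(x0::'a) R x h L D E.
    R > 0 \<Longrightarrow> norm (x - x0) < R \<Longrightarrow> h \<ge> 0 \<Longrightarrow> frac_lap s D x L \<Longrightarrow> integrable lborel E \<Longrightarrow>
    (\<And>z. z \<noteq> 0 \<Longrightarrow> h * (bump ((x + z - x0) /\<^sub>R R) - bump ((x - x0) /\<^sub>R R)) * jump_kernel s z + E z \<le> (D (x + z) - D x) * jump_kernel s z) \<Longrightarrow>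
    L \<le> C * R powr (- (2 * s)) * h * bump ((x - x0) /\<^sub>R R) - frac_const DIM('a) s * integral\<^sup>L lborel E"
    using bump_touching[OF s, where 'a='a] by blast
  \<comment> \<open>Of the excess \<open>\<eta>\<close> at \<open>x\<close>, one quarter is spent on
    the time penalty and one quarter on the space penalty. Afterwards \<open>R\<close> is taken so
    large that the cost \<open>C * N * R powr (- (2 * s))\<close> of the space penalty is below
    \<open>\<delta>\<close>.\<close>
  define \<delta> where "\<delta> = \<eta> / (4 * (t2 - t0))"
  have delta: "\<delta> > 0" "\<delta> * (t2 - t0) = \<eta> / 4" using eta tt by (auto simp: \<delta>_def field_simps)
  have ev1: "\<forall>\<^sub>F R in at_top. C * N * R powr (- (2 * s)) < \<delta>"
  proof -
    have "((\<lambda>R. C * N * R powr (- (2 * s))) \<longlongrightarrow> C * N * 0) at_top"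
      using s by (intro tendsto_intros tendsto_neg_powr filterlim_ident) auto
    then show ?thesis using delta by (intro order_tendstoD(2)) auto
  qed
  have ev2: "\<forall>\<^sub>F R in at_top. N * (1 - bump (x /\<^sub>R R)) < \<eta> / 4"
  proof -
    have "((\<lambda>R. inverse R *\<^sub>R x) \<longlongrightarrow> 0 *\<^sub>R x) at_top"
      by (intro tendsto_intros tendsto_inverse_0_at_top filterlim_ident)
    then have "((\<lambda>R. bump (x /\<^sub>R R)) \<longlongrightarrow> bump (0::'a)) at_top"
      using bump_cont[of UNIV] by (intro isCont_tendsto_compose[of 0 bump]) (auto simp: continuous_on_eq_continuous_at)
    then have "((\<lambda>R. N * (1 - bump (x /\<^sub>R R))) \<longlongrightarrow> N * (1 - 1)) at_top"
      by (intro tendsto_intros) auto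
    then show ?thesis using eta by (intro order_tendstoD(2)) auto
  qed
  have "\<forall>\<^sub>F R in at_top. norm x < R \<and> C * N * R powr (- (2 * s)) < \<delta> \<and> N * (1 - bump (x /\<^sub>R R)) < \<eta> / 4"
    by (intro eventually_conj ev1 ev2 eventually_gt_at_top)
  then obtain R where R': "norm x < R \<and> C * N * R powr (- (2 * s)) < \<delta> \<and> N * (1 - bump (x /\<^sub>R R)) < \<eta> / 4"
    using eventually_happens'[OF trivial_limit_at_top_linorder] by blast
  have R: "R > 0" "norm x < R" "C * N * R powr (- (2 * s)) < \<delta>" "N * (1 - bump (x /\<^sub>R R)) < \<eta> / 4"
    using R' order_le_less_trans[OF norm_ge_zero[of x], of R] by auto
  let ?Z = "\<lambda>t x. V t x - U t x - \<epsilon> - N * (1 - bump (x /\<^sub>R R)) - \<delta> * (t - t0)"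
  let ?K = "{t0..t2} \<times> cball (0::'a) R"
  have "compact ?K" by (intro compact_Times) auto
  moreover have "?K \<noteq> {}" using tt R by auto
  moreover have "continuous_on ?K (\<lambda>q. ?Z (fst q) (snd q))"
  proof -
    have sub: "?K \<subseteq> {t0..t2} \<times> UNIV" by auto
    have "continuous_on ?K (\<lambda>q. V (fst q) (snd q))" "continuous_on ?K (\<lambda>q. U (fst q) (snd q))"
      using continuous_on_subset[OF cV sub] continuous_on_subset[OF cU sub] by (simp_all only: split_def)
    then show ?thesis by (intro continuous_on_diff continuous_on_mult continuous_on_const bump_cont' continuous_on_scaleR continuous_on_fst continuous_on_snd continuous_on_id)
  qed
  ultimately have "\<exists>q\<in>?K. \<forall>r\<in>?K. ?Z (fst r) (snd r) \<le> ?Z (fst q) (snd q)"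
    by (rule continuous_attains_sup)
  then obtain q where q: "q \<in> ?K" "\<And>r. r \<in> ?K \<Longrightarrow> ?Z (fst r) (snd r) \<le> ?Z (fst q) (snd q)"
    by blast
  obtain t' y where ty: "q = (t', y)" by (cases q)
  have t': "t' \<in> {t0..t2}" and y: "norm y \<le> R" using q(1) ty by auto
  have mx: "?Z \<tau> z \<le> ?Z t' y" if "\<tau> \<in> {t0..t2}" "norm z \<le> R" for \<tau> z
    using q(2)[of "(\<tau>, z)"] ty that by auto
  have "?Z t x \<le> ?Z t' y" using mx[of t x] t R by auto
  moreover have "?Z t x > 0"
  proof -
    have "\<delta> * (t - t0) \<le> \<eta> / 4" unfolding delta(2)[symmetric] using tt delta by (intro mult_left_mono) auto
    then show ?thesis using R(4) eta by (simp add: \<eta>_def)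
  qed
  ultimately have Zp: "?Z t' y > 0" by simp
  have yR: "norm y < R"
  proof (rule ccontr)
    assume "\<not> norm y < R"
    then have "bump (y /\<^sub>R R) = 0" using R(1) by (intro bump_outside) auto
    moreover have "\<delta> * (t' - t0) \<ge> 0" using t' delta by auto
    ultimately show False using Zp VM[OF t', of y] U0[OF t', of y] N eps by (simp; linarith)
  qed
  have t0': "t0 < t'"
  proof (rule ccontr)
    assume "\<not> t0 < t'"
    then have "t' = t0" using t' by auto
    moreover have "N * (1 - bump (y /\<^sub>R R)) \<ge> 0" using N by (intro mult_nonneg_nonneg) auto
    ultimately show False using Zp init[of y] by simp
  qed
  have mx': "?Z t' z \<le> ?Z t' y" for z
  proof (cases "norm z \<le> R")
    case False
    then have "bump (z /\<^sub>R R) = 0" using R(1) by (intro bump_outside) auto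
    moreover have "\<delta> * (t' - t0) \<ge> 0" using t' delta by auto
    ultimately have "?Z t' z \<le> 0" using VM[OF t', of z] U0[OF t', of z] N eps by (simp; linarith)
    then show ?thesis using Zp by linarith
  qed (use mx t' in auto)
  obtain Vt LV Ut LU where d: "((\<lambda>\<tau>. V \<tau> y) has_real_derivative Vt) (at t')" "((\<lambda>\<tau>. U \<tau> y) has_real_derivative Ut) (at t')"
    "frac_lap s (V t') y LV" "frac_lap s (U t') y LU" "V t' y > U t' y \<longrightarrow> Vt + LV \<le> Ut + LU"
    using eq[of t' y] t' t0' by auto
  have "V t' y > U t' y"
  proof -
    have "N * (1 - bump (y /\<^sub>R R)) \<ge> 0" using N by (intro mult_nonneg_nonneg) auto
    moreover have "\<delta> * (t' - t0) \<ge> 0" using t' delta by auto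
    ultimately show ?thesis using Zp eps by linarith
  qed
  then have e: "Vt + LV \<le> Ut + LU" using d(5) by simp
  \<comment> \<open>At the maximum the time derivatives differ by at least \<open>\<delta>\<close>,
    whereas \<open>U - V\<close> is touched from below by \<open>N\<close> times the bump, so that
    \<open>LU - LV\<close> is less than \<open>\<delta>\<close>. This contradicts the differential
    inequality \<open>e\<close>.\<close>
  have "0 \<le> Vt - Ut - \<delta>"
  proof (rule left_maximum_deriv_nonneg[where t=t' and a=t0 and S=UNIV])
    show "((\<lambda>\<tau>. V \<tau> y - U \<tau> y - \<delta> * \<tau>) has_real_derivative Vt - Ut - \<delta>) (at t')"
      using d by (auto intro!: derivative_eq_intros)
    fix \<tau> assume "\<tau> \<in> {t0..t'}"
    then show "V \<tau> y - U \<tau> y - \<delta> * \<tau> \<le> V t' y - U t' y - \<delta> * t'"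
      using mx[of \<tau> y] yR t' by (auto simp: algebra_simps)
  qed (use t0' in auto)
  moreover have "LU - LV \<le> C * R powr (- (2 * s)) * N * bump ((y - 0) /\<^sub>R R) - frac_const DIM('a) s * (LBINT z::'a. 0)"
  proof (rule bt)
    show "frac_lap s (\<lambda>z. U t' z - V t' z) y (LU - LV)" using frac_lap_lincomb[OF d(4,3), of 1] by simp
    fix z :: 'a
    show "N * (bump ((y + z - 0) /\<^sub>R R) - bump ((y - 0) /\<^sub>R R)) * jump_kernel s z + 0 \<le> (U t' (y + z) - V t' (y + z) - (U t' y - V t' y)) * jump_kernel s z"
      using mx'[of "y + z"] by (simp only: add_0_right diff_zero, intro mult_right_mono) (auto simp: algebra_simps)
  qed (use R yR N in auto)
  moreover have "C * R powr (- (2 * s)) * N * bump ((y - 0) /\<^sub>R R) \<le> C * R powr (- (2 * s)) * N * 1"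
    using C N by (intro mult_left_mono) auto
  moreover have "C * R powr (- (2 * s)) * N * 1 < \<delta>" using R(3) by (simp add: mult_ac)
  ultimately show False using e by simp
qed

text \<open>The function \<open>k t\<close> selects the part of the mass of \<open>u\<close> whose jumps into the ball are exploited: none, a
  truncated tail, or a tube about a plane.\<close>

lemma lower_barrier:
  assumes s: "0 < s" "s < 1" and p: "p > 1"
  obtains C where "C \<ge> 0" and "\<And>(u :: real \<Rightarrow> 'a::euclidean_space \<Rightarrow> real) x0 R t1 t2 h h' k.
    \<lbrakk>absorption_sol s \<beta> p u; R > 0; 0 < t1;
    \<And>t. t \<in> {t1..t2} \<Longrightarrow> h t \<ge> 0;
    \<And>t. t \<in> {t1..t2} \<Longrightarrow> (h has_real_derivative h' t) (at t within {t1..t2});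
    \<And>x. h t1 * bump ((x - x0) /\<^sub>R R) \<le> u t1 x;
    \<And>t. t \<in> {t1<..t2} \<Longrightarrow> k t \<in> borel_measurable borel;
    \<And>t x z. t \<in> {t1<..t2} \<Longrightarrow> norm (x - x0) < R \<Longrightarrow> z \<noteq> x \<Longrightarrow> k t z \<le> jump_kernel s (z - x);
    \<And>t z. t \<in> {t1<..t2} \<Longrightarrow> 0 \<le> k t z;
    \<And>t. t \<in> {t1<..t2} \<Longrightarrow> integrable lborel (\<lambda>z. max 0 (u t z - h t * bump ((z - x0) /\<^sub>R R)) * k t z);
    \<And>t. t \<in> {t1<..t2} \<Longrightarrow> h' t + C * R powr (- (2 * s)) * h t + t powr \<beta> * h t powr p
      \<le> frac_const DIM('a) s * (LBINT z. max 0 (u t z - h t * bump ((z - x0) /\<^sub>R R)) * k t z)\<rbrakk>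
    \<Longrightarrow> \<forall>t\<in>{t1..t2}. \<forall>x. h t * bump ((x - x0) /\<^sub>R R) \<le> u t x"
proof -
  obtain C where C: "C \<ge> 0" and bt: "\<And>(x0::'a) R x h L D E.
    R > 0 \<Longrightarrow> norm (x - x0) < R \<Longrightarrow> h \<ge> 0 \<Longrightarrow> frac_lap s D x L \<Longrightarrow> integrable lborel E \<Longrightarrow>
    (\<And>z. z \<noteq> 0 \<Longrightarrow> h * (bump ((x + z - x0) /\<^sub>R R) - bump ((x - x0) /\<^sub>R R)) * jump_kernel s z + E z \<le> (D (x + z) - D x) * jump_kernel s z) \<Longrightarrow>
    L \<le> C * R powr (- (2 * s)) * h * bump ((x - x0) /\<^sub>R R) - frac_const DIM('a) s * integral\<^sup>L lborel E"
    using bump_touching[OF s, where 'a='a] by blast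
  show thesis
  proof (rule that[OF C], intro ballI allI, rule ccontr)
    fix u :: "real \<Rightarrow> 'a \<Rightarrow> real" and x0 R t1 t2 h h' k t x
    assume u: "absorption_sol s \<beta> p u" and R: "R > 0" and t1: "0 < t1"
      and h0: "\<And>t. t \<in> {t1..t2} \<Longrightarrow> h t \<ge> 0"
      and dh: "\<And>t. t \<in> {t1..t2} \<Longrightarrow> (h has_real_derivative h' t) (at t within {t1..t2})"
      and init: "\<And>x. h t1 * bump ((x - x0) /\<^sub>R R) \<le> u t1 x"
      and k: "\<And>t. t \<in> {t1<..t2} \<Longrightarrow> k t \<in> borel_measurable borel"
        "\<And>t x z. t \<in> {t1<..t2} \<Longrightarrow> norm (x - x0) < R \<Longrightarrow> z \<noteq> x \<Longrightarrow> k t z \<le> jump_kernel s (z - x)"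
        "\<And>t z. t \<in> {t1<..t2} \<Longrightarrow> 0 \<le> k t z"
        "\<And>t. t \<in> {t1<..t2} \<Longrightarrow> integrable lborel (\<lambda>z. max 0 (u t z - h t * bump ((z - x0) /\<^sub>R R)) * k t z)"
        "\<And>t. t \<in> {t1<..t2} \<Longrightarrow> h' t + C * R powr (- (2 * s)) * h t + t powr \<beta> * h t powr p
          \<le> frac_const DIM('a) s * (LBINT z. max 0 (u t z - h t * bump ((z - x0) /\<^sub>R R)) * k t z)"
      and t: "t \<in> {t1..t2}" and neg: "\<not> h t * bump ((x - x0) /\<^sub>R R) \<le> u t x"
    let ?\<psi> = "\<lambda>z. bump ((z - x0) /\<^sub>R R)"
    let ?F = "\<lambda>t x. u t x - h t * ?\<psi> x"
    have psi0: "?\<psi> z = 0" if "norm (z - x0) \<ge> R" for z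
      using that R by (intro bump_outside) auto
    have ch: "continuous_on {t1..t2} h"
      unfolding continuous_on_eq_continuous_within using dh DERIV_continuous by blast
    let ?K = "{t1..t2} \<times> cball x0 R"
    have up: "u t x > 0" if "t \<in> {t1..t2}" for t x using sol_pos[OF u] t1 that by auto
    have xR: "norm (x - x0) \<le> R" using psi0[of x] neg up[OF t, of x] by force
    have "compact ?K" by (intro compact_Times) auto
    moreover have "?K \<noteq> {}" using t R by auto
    moreover have "continuous_on ?K (\<lambda>q. ?F (fst q) (snd q))"
    proof -
      have "continuous_on ?K (\<lambda>q. h (fst q))"
        by (rule continuous_on_compose2[OF ch]) (auto intro!: continuous_intros)
      moreover have "continuous_on ?K (\<lambda>q. u (fst q) (snd q))"
        using sol_cont[OF u, of "{t1..t2}" "cball x0 R"] t1 by (simp add: split_def subset_iff)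
      ultimately show ?thesis by (intro continuous_on_diff continuous_on_mult continuous_on_const bump_cont' continuous_on_scaleR continuous_on_snd continuous_on_id)
    qed
    ultimately have "\<exists>q\<in>?K. \<forall>r\<in>?K. ?F (fst q) (snd q) \<le> ?F (fst r) (snd r)"
      by (rule continuous_attains_inf)
    then obtain q where q: "q \<in> ?K" "\<And>r. r \<in> ?K \<Longrightarrow> ?F (fst q) (snd q) \<le> ?F (fst r) (snd r)"
      by blast
    obtain t' y where ty: "q = (t', y)" by (cases q)
    have t': "t' \<in> {t1..t2}" using q(1) ty by auto
    have mn: "?F t' y \<le> ?F \<tau> z" if "\<tau> \<in> {t1..t2}" "norm (z - x0) \<le> R" for \<tau> z
      using q(2)[of "(\<tau>, z)"] ty that by (auto simp: dist_norm norm_minus_commute)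
    have F: "?F t' y < 0" using mn[OF t xR] neg by simp
    have yR: "norm (y - x0) < R" using psi0[of y] F up[OF t', of y] by force
    have tp: "t1 < t'" using F init[of y] t' by (cases "t' = t1") auto
    have t'2: "t' \<in> {t1<..t2}" "t' > 0" using t' tp t1 by auto
    have mn': "?F t' y \<le> ?F t' z" for z
    proof (cases "norm (z - x0) \<le> R")
      case False
      then show ?thesis using psi0[of z] F up[OF t', of z] by auto
    qed (use mn t' in auto)
    obtain ut L where d: "((\<lambda>\<tau>. u \<tau> y) has_real_derivative ut) (at t')" "frac_lap s (u t') y L"
        "ut + L + t' powr \<beta> * u t' y powr p = 0"
      using u t'2(2) unfolding absorption_sol_def by blast
    have ht: "h t' \<ge> 0" by (rule h0[OF t'])
    have py: "0 < ?\<psi> y" "?\<psi> y \<le> 1" using norm_divideR_less[OF R yR] by (auto simp: bump_pos_iff simp del: norm_scaleR)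
    have "0 \<le> h' t' * ?\<psi> y - ut"
    proof (rule left_maximum_deriv_nonneg[where t=t' and a=t1 and S="{t1..t2}"])
      have "(h has_real_derivative h' t') (at t' within {t1..t2})" by (rule dh[OF t'])
      then show "((\<lambda>\<tau>. h \<tau> * ?\<psi> y - u \<tau> y) has_real_derivative h' t' * ?\<psi> y - ut) (at t' within {t1..t2})"
        using has_field_derivative_at_within[OF d(1)] by (auto intro!: derivative_eq_intros)
      fix \<tau> assume "\<tau> \<in> {t1..t'}"
      then show "h \<tau> * ?\<psi> y - u \<tau> y \<le> h t' * ?\<psi> y - u t' y"
        using mn[of \<tau> y] yR t' by auto
    qed (use tp t' in auto)
    \<comment> \<open>The minimum of \<open>?F t'\<close> is negative and attained at
      \<open>y\<close>, so every increment \<open>?F t' (y + z) - ?F t' y\<close> is at least the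
      positive part of \<open>?F t' (y + z)\<close>. This is why the part \<open>k\<close> of the
      kernel may be integrated against a positive part.\<close>
    let ?e = "\<lambda>z. max 0 (u t' z - h t' * ?\<psi> z) * k t' z"
    have ie: "integrable lborel ?e" by (rule k(4)[OF t'2(1)])
    have me: "?e \<in> borel_measurable borel" using ie by auto
    have "L \<le> C * R powr (- (2 * s)) * h t' * ?\<psi> y - frac_const DIM('a) s * (LBINT z. ?e (y + 1 *\<^sub>R z))"
    proof (rule bt[OF R yR ht d(2)])
      show "integrable lborel (\<lambda>z. ?e (y + 1 *\<^sub>R z))"
        using lborel_integrable_affine[OF me, where c=1 and t=y] ie by simp
      fix z :: 'a assume z: "z \<noteq> 0"
      have k1: "k t' (y + z) \<le> jump_kernel s z" "0 \<le> k t' (y + z)"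
        using k(2)[OF t'2(1) yR, of "y + z"] k(3)[OF t'2(1)] z by auto
      have "max 0 (?F t' (y + z)) \<le> ?F t' (y + z) - ?F t' y" using mn'[of "y + z"] F by auto
      then have "?e (y + z) \<le> (?F t' (y + z) - ?F t' y) * jump_kernel s z"
        using k1 mn'[of "y + z"] by (intro mult_mono) auto
      then show "h t' * (?\<psi> (y + z) - ?\<psi> y) * jump_kernel s z + ?e (y + 1 *\<^sub>R z) \<le> (u t' (y + z) - u t' y) * jump_kernel s z"
        by (simp add: algebra_simps)
    qed
    then have L: "L \<le> C * R powr (- (2 * s)) * h t' * ?\<psi> y - frac_const DIM('a) s * integral\<^sup>L lborel ?e"
      using lborel_integral_affine[OF me, where c=1 and t=y] by simp
    have inth: "h' t' + C * R powr (- (2 * s)) * h t' + t' powr \<beta> * h t' powr p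
         \<le> frac_const DIM('a) s * integral\<^sup>L lborel ?e" by (rule k(5)[OF t'2(1)])
    have "integral\<^sup>L lborel ?e \<ge> 0"
      using k(3)[OF t'2(1)] by (intro integral_nonneg_AE AE_I2) auto
    \<comment> \<open>The inequality for \<open>h\<close> gets multiplied by the bump at
      \<open>y\<close>. As this number is at most 1, the integral only loses by it, and its power
      \<open>p\<close> in the absorption term may be replaced by its first power.\<close>
    then have "frac_const DIM('a) s * integral\<^sup>L lborel ?e * ?\<psi> y \<le> frac_const DIM('a) s * integral\<^sup>L lborel ?e * 1"
      using frac_const_pos[OF s, of "DIM('a)"] by (intro mult_left_mono) auto
    moreover have "(h' t' + C * R powr (- (2 * s)) * h t' + t' powr \<beta> * h t' powr p) * ?\<psi> y
      \<le> frac_const DIM('a) s * integral\<^sup>L lborel ?e * ?\<psi> y"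
      using inth py by (intro mult_right_mono) auto
    moreover have "u t' y powr p < h t' powr p * ?\<psi> y"
    proof -
      have "u t' y powr p < (h t' * ?\<psi> y) powr p" using F up[OF t', of y] p by (intro powr_less_mono2) auto
      also have "\<dots> = h t' powr p * ?\<psi> y powr p" using ht py by (simp add: powr_mult)
      also have "\<dots> \<le> h t' powr p * ?\<psi> y powr 1" using py p by (intro mult_left_mono powr_mono') auto
      finally show ?thesis using py by simp
    qed
    then have "t' powr \<beta> * u t' y powr p < t' powr \<beta> * (h t' powr p * ?\<psi> y)"
      using t'2 by (intro mult_strict_left_mono) auto
    ultimately show False using L d(3) \<open>0 \<le> h' t' * ?\<psi> y - ut\<close> by (simp add: algebra_simps)
  qed
qed

text \<open>The tail is only lower semicontinuous in time, its truncation to a cube is continuous; the upper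
  barrier is differentiated in time with truncated tails.\<close>

definition tail :: "real \<Rightarrow> real \<Rightarrow> 'a::euclidean_space \<Rightarrow> (real \<Rightarrow> 'a \<Rightarrow> real) \<Rightarrow> real \<Rightarrow> real" where
  "tail s R x0 u t = (LBINT z. u t z * (1 / (R + norm (z - x0)) powr (real DIM('a) + 2 * s)))"

definition tail_cbox :: "real \<Rightarrow> real \<Rightarrow> 'a::euclidean_space \<Rightarrow> (real \<Rightarrow> 'a \<Rightarrow> real) \<Rightarrow> nat \<Rightarrow> real \<Rightarrow> real" where
  "tail_cbox s R x0 u n t = integral (cbox (- real n *\<^sub>R One) (real n *\<^sub>R One))
     (\<lambda>z. u t z * (1 / (R + norm (z - x0)) powr (real DIM('a) + 2 * s)))"

text \<open>Moving the centre and the scale of the weight costs a constant, since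
  \<open>1 + |z| <= K (R + |z - x0|)\<close> with \<open>K = (1 + |x0|) / R + 1\<close>. One
  integrability assumption thus covers all tails.\<close>

lemma weight_compare:
  fixes z x0 :: "'a::euclidean_space"
  assumes "s > 0" "R > 0"
  shows "1 / (R + norm (z - x0)) powr (real DIM('a) + 2 * s)
    \<le> ((1 + norm x0) / R + 1) powr (real DIM('a) + 2 * s) * (1 / (1 + norm z) powr (real DIM('a) + 2 * s))"
proof -
  let ?K = "(1 + norm x0) / R + 1" and ?e = "real DIM('a) + 2 * s"
  have K: "?K > 0" using assms by (auto intro!: add_nonneg_pos)
  have "1 + norm z \<le> 1 + norm x0 + norm (z - x0)" using norm_triangle_sub[of z x0] by simp
  also have "\<dots> \<le> ?K * (R + norm (z - x0))"
  proof -
    have "?K * (R + norm (z - x0)) = (1 + norm x0) / R * R + (1 + norm x0) / R * norm (z - x0) + (R + norm (z - x0))"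
      by (simp only: distrib_left distrib_right mult_1_left)
    moreover have "(1 + norm x0) / R * R = 1 + norm x0" using assms by simp
    moreover have "(1 + norm x0) / R * norm (z - x0) \<ge> 0" using assms by simp
    ultimately show ?thesis using assms by linarith
  qed
  finally have le: "(1 + norm z) / ?K \<le> R + norm (z - x0)" by (simp only: pos_divide_le_eq[OF K] mult.commute)
  have pos: "0 < (1 + norm z) / ?K" by (rule divide_pos_pos[OF _ K]) (simp add: add_pos_nonneg)
  have "1 / (R + norm (z - x0)) powr ?e \<le> 1 / ((1 + norm z) / ?K) powr ?e"
    using le pos assms add_pos_nonneg[OF assms(2) norm_ge_zero[of "z - x0"]] by (intro divide_left_mono powr_mono2 mult_pos_pos) auto
  also have "\<dots> = ?K powr ?e * (1 / (1 + norm z) powr ?e)"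
    using K by (simp add: powr_divide)
  finally show ?thesis .
qed

context
  fixes s \<beta> p :: real and u :: "real \<Rightarrow> 'a::euclidean_space \<Rightarrow> real"
  assumes s: "0 < s" "s < 1" and u: "absorption_sol s \<beta> p u"
begin

lemma tail_integrable:
  assumes "t > 0" "R > 0"
  shows "integrable lborel (\<lambda>z. u t z * (1 / (R + norm (z - x0)) powr (real DIM('a) + 2 * s)))"
proof (rule Bochner_Integration.integrable_bound)
  let ?e = "real DIM('a) + 2 * s"
  let ?K = "((1 + norm x0) / R + 1) powr ?e"
  show "integrable lborel (\<lambda>z. ?K * (u t z * (1 / (1 + norm z) powr ?e)))"
    using u assms by (intro integrable_mult_right) (auto simp: absorption_sol_def)
  show "(\<lambda>z. u t z * (1 / (R + norm (z - x0)) powr ?e)) \<in> borel_measurable lborel"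
    using sol_measurable[OF u assms(1)] by measurable
  show "AE z in lborel. norm (u t z * (1 / (R + norm (z - x0)) powr ?e)) \<le> norm (?K * (u t z * (1 / (1 + norm z) powr ?e)))"
  proof (rule AE_I2)
    fix z
    have "u t z * (1 / (R + norm (z - x0)) powr ?e) \<le> u t z * (?K * (1 / (1 + norm z) powr ?e))"
      using sol_pos[OF u assms(1), of z] by (intro mult_left_mono weight_compare s assms) auto
    then show "norm (u t z * (1 / (R + norm (z - x0)) powr ?e)) \<le> norm (?K * (u t z * (1 / (1 + norm z) powr ?e)))"
      using sol_pos[OF u assms(1), of z] by (simp add: abs_mult mult_ac)
  qed
qed

text \<open>The gauge integral over a box in the definition suits the proof of continuity in time;
  positivity, monotonicity in \<open>n\<close> and the limit are read off from the Lebesgue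
  form.\<close>

lemma tail_cbox_eq:
  assumes "t > 0" "R > 0"
  shows "tail_cbox s R x0 u n t = (LBINT z. indicator (cbox (- real n *\<^sub>R One) (real n *\<^sub>R One)) z *
     (u t z * (1 / (R + norm (z - x0)) powr (real DIM('a) + 2 * s))))"
proof -
  let ?f = "\<lambda>z. u t z * (1 / (R + norm (z - x0)) powr (real DIM('a) + 2 * s))"
  have "set_integrable lborel (cbox (- real n *\<^sub>R One) (real n *\<^sub>R One)) ?f"
    unfolding set_integrable_def using integrable_mult_indicator[OF _ tail_integrable[OF assms]] by simp
  from set_borel_integral_eq_integral(2)[OF this] show ?thesis
    by (simp add: tail_cbox_def set_lebesgue_integral_def)
qed

lemma tail_cbox_continuous:
  assumes "R > 0"
  shows "continuous_on {0<..} (tail_cbox s R x0 u n)"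
  unfolding tail_cbox_def
proof (rule integral_continuous_on_param)
  have "continuous_on ({0<..} \<times> cbox (- real n *\<^sub>R One) (real n *\<^sub>R One)) (\<lambda>q. u (fst q) (snd q))"
    using sol_cont[OF u, of "{0<..}"] by (simp add: split_def)
  moreover have "R + norm (snd q - x0) \<noteq> 0" for q :: "real \<times> 'a" using assms norm_ge_zero[of "snd q - x0"] by linarith
  ultimately show "continuous_on ({0<..} \<times> cbox (- real n *\<^sub>R One) (real n *\<^sub>R One))
     (\<lambda>(t, z). u t z * (1 / (R + norm (z - x0)) powr (real DIM('a) + 2 * s)))"
    unfolding split_def
    by (intro continuous_on_mult continuous_on_divide continuous_on_powr continuous_on_add continuous_on_norm continuous_on_diff
        continuous_on_const continuous_on_snd continuous_on_id) auto
qed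

lemma tail_term_nonneg: "t > 0 \<Longrightarrow> R > 0 \<Longrightarrow> 0 \<le> u t z * (1 / (R + norm (z - x0)) powr (real DIM('a) + 2 * s))"
  using sol_pos[OF u, of t z] by simp

lemma tail_cbox_nonneg: "t > 0 \<Longrightarrow> R > 0 \<Longrightarrow> 0 \<le> tail_cbox s R x0 u n t"
  unfolding tail_cbox_eq by (intro integral_nonneg_AE AE_I2 mult_nonneg_nonneg tail_term_nonneg) auto

lemma cbox_One_mono: "n \<le> m \<Longrightarrow> cbox (- real n *\<^sub>R One) (real n *\<^sub>R One) \<subseteq> cbox (- real m *\<^sub>R One) (real m *\<^sub>R (One::'a))"
  by (simp add: subset_box)

lemma tail_cbox_mono:
  assumes "t > 0" "R > 0" "n \<le> m"
  shows "tail_cbox s R x0 u n t \<le> tail_cbox s R x0 u m t"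
  unfolding tail_cbox_eq[OF assms(1,2)]
proof (rule integral_mono)
  have i: "integrable lborel (\<lambda>z. indicator (cbox (- real k *\<^sub>R One) (real k *\<^sub>R One)) z *
     (u t z * (1 / (R + norm (z - x0)) powr (real DIM('a) + 2 * s))))" for k
    using integrable_mult_indicator[OF _ tail_integrable[OF assms(1,2)]] by simp
  show "integrable lborel (\<lambda>z. indicator (cbox (- real n *\<^sub>R One) (real n *\<^sub>R One)) z *
     (u t z * (1 / (R + norm (z - x0)) powr (real DIM('a) + 2 * s))))"
   "integrable lborel (\<lambda>z. indicator (cbox (- real m *\<^sub>R One) (real m *\<^sub>R One)) z *
     (u t z * (1 / (R + norm (z - x0)) powr (real DIM('a) + 2 * s))))"
    by (rule i)+
  show "indicator (cbox (- real n *\<^sub>R One) (real n *\<^sub>R One)) z * (u t z * (1 / (R + norm (z - x0)) powr (real DIM('a) + 2 * s)))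
    \<le> indicator (cbox (- real m *\<^sub>R One) (real m *\<^sub>R One)) z * (u t z * (1 / (R + norm (z - x0)) powr (real DIM('a) + 2 * s)))" for z
    using tail_term_nonneg[OF assms(1,2)] cbox_One_mono[OF assms(3)]
    by (intro mult_right_mono) (auto split: split_indicator)
qed

lemma tailn_LIMSEQ:
  assumes "t > 0" "R > 0"
  shows "(\<lambda>n. tail_cbox s R x0 u n t) \<longlonglongrightarrow> tail s R x0 u t"
  unfolding tail_cbox_eq[OF assms] tail_def
proof (rule integral_dominated_convergence[OF _ _ tail_integrable[OF assms]])
  let ?f = "\<lambda>z. u t z * (1 / (R + norm (z - x0)) powr (real DIM('a) + 2 * s))"
  show m: "?f \<in> borel_measurable lborel" by (rule borel_measurable_integrable[OF tail_integrable[OF assms]])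
  show "(\<lambda>z. indicator (cbox (- real n *\<^sub>R One) (real n *\<^sub>R One)) z * ?f z) \<in> borel_measurable lborel" for n
    by (rule borel_measurable_times[OF borel_measurable_indicator m]) auto
  show "AE z in lborel. norm (indicator (cbox (- real n *\<^sub>R One) (real n *\<^sub>R One)) z * ?f z) \<le> ?f z" for n
    using sol_pos[OF u assms(1)] by (intro AE_I2) (auto simp: abs_mult less_imp_le split: split_indicator)
  show "AE z in lborel. (\<lambda>n. indicator (cbox (- real n *\<^sub>R One) (real n *\<^sub>R One)) z * ?f z) \<longlonglongrightarrow> ?f z"
  proof (rule AE_I2, rule tendsto_eventually)
    fix z :: 'a
    obtain n0 :: nat where n0: "norm z \<le> real n0" using real_arch_simple by blast
    show "\<forall>\<^sub>F n in sequentially. indicator (cbox (- real n *\<^sub>R One) (real n *\<^sub>R One)) z * ?f z = ?f z"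
      using eventually_ge_at_top[of n0]
    proof eventually_elim
      case (elim n)
      have "\<bar>z \<bullet> i\<bar> \<le> real n" if "i \<in> Basis" for i
        using Basis_le_norm[OF that, of z] n0 elim by linarith
      then have "z \<in> cbox (- real n *\<^sub>R One) (real n *\<^sub>R One)" by (auto simp: mem_box abs_le_iff dest: minus_le_iff[THEN iffD1])
      then show ?case by simp
    qed
  qed
qed

text \<open>Monotone convergence turns a uniform bound on the truncated integrals into integrability
  of the tail. The last conclusion replaces differentiation of the primitive: its increments
  dominate those of the truncated primitive, which is continuously differentiable.\<close>

lemma tail_primitive:
  assumes ab: "0 < a" "a \<le> b" and R: "R > 0" and B: "\<And>n. integral {a..b} (tail_cbox s R x0 u n) \<le> B"
  shows "tail s R x0 u integrable_on {a..b}" "integral {a..b} (tail s R x0 u) \<le> B"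
    "continuous_on {a..b} (\<lambda>t. integral {a..t} (tail s R x0 u))"
    "\<And>n t t'. a \<le> t \<Longrightarrow> t \<le> t' \<Longrightarrow> t' \<le> b \<Longrightarrow>
      integral {a..t} (tail s R x0 u) + integral {t..t'} (tail_cbox s R x0 u n) \<le> integral {a..t'} (tail s R x0 u)"
proof -
  let ?T = "tail s R x0 u" and ?Tn = "tail_cbox s R x0 u"
  have pos: "t > 0" if "t \<in> {a..b}" for t using that ab by auto
  have in_n: "?Tn n integrable_on {c..d}" if "a \<le> c" "d \<le> b" for n c d
    by (rule integrable_continuous_interval, rule continuous_on_subset[OF tail_cbox_continuous[OF R]]) (use that ab in auto)
  have bdd: "bounded (range (\<lambda>n. integral {a..b} (?Tn n)))"
  proof (rule boundedI[of _ "B"], safe)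
    fix n
    have "0 \<le> integral {a..b} (?Tn n)"
      by (rule Henstock_Kurzweil_Integration.integral_nonneg[OF in_n]) (use tail_cbox_nonneg R pos in auto)
    then show "norm (integral {a..b} (?Tn n)) \<le> B" using B[of n] by simp
  qed
  have mc: "?T integrable_on {a..b} \<and> (\<lambda>n. integral {a..b} (?Tn n)) \<longlonglongrightarrow> integral {a..b} ?T"
    by (rule monotone_convergence_increasing[OF in_n _ _ bdd]) (use tail_cbox_mono tailn_LIMSEQ R pos in auto)
  then show it: "?T integrable_on {a..b}" by simp
  show "integral {a..b} ?T \<le> B" using mc B by (intro LIMSEQ_le_const2[OF conjunct2[OF mc]]) auto
  show "continuous_on {a..b} (\<lambda>t. integral {a..t} ?T)"
    by (rule indefinite_integral_continuous_1[OF it])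
  fix n t t' assume t: "a \<le> t" "t \<le> t'" "t' \<le> b"
  have "integral {a..t} ?T + integral {t..t'} ?T = integral {a..t'} ?T"
    using t by (intro Henstock_Kurzweil_Integration.integral_combine integrable_on_subinterval[OF it]) auto
  moreover have "integral {t..t'} (?Tn n) \<le> integral {t..t'} ?T"
  proof (rule integral_le)
    show "?Tn n integrable_on {t..t'}" by (rule in_n) (use t in auto)
    show "?T integrable_on {t..t'}" using t by (intro integrable_on_subinterval[OF it]) auto
    fix \<tau> assume "\<tau> \<in> {t..t'}"
    then have "\<tau> > 0" using t ab by auto
    then show "?Tn n \<tau> \<le> ?T \<tau>"
      using tail_cbox_mono[OF _ R] by (intro LIMSEQ_le_const[OF tailn_LIMSEQ[OF _ R]]) (auto intro!: exI[of _ n])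
  qed
  ultimately show "integral {a..t} ?T + integral {t..t'} (?Tn n) \<le> integral {a..t'} ?T" by linarith
qed

end

section \<open>An upper barrier that is infinite on a sphere\<close>

text \<open>Induction on \<open>q\<close>: with \<open>w = \<theta> - 1\<close>, dividing
  \<open>1 - q w + K w^2\<close> by \<open>\<theta>\<close> gives exactly
  \<open>1 - (q + 1) w + (K + q + 1) w^2 / \<theta>\<close>, and
  \<open>1 / \<theta> <= 4\<close>.\<close>

lemma inverse_power_quadratic:
  "\<exists>K\<ge>0. \<forall>\<theta>::real. 1/4 \<le> \<theta> \<longrightarrow> 1 / \<theta> ^ q \<le> 1 - real q * (\<theta> - 1) + K * (\<theta> - 1)\<^sup>2"
proof (induction q)
  case 0
  show ?case by (rule exI[of _ 0]) auto
next
  case (Suc q)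
  then obtain K where K: "K \<ge> 0" "\<And>\<theta>::real. 1/4 \<le> \<theta> \<Longrightarrow> 1 / \<theta> ^ q \<le> 1 - real q * (\<theta> - 1) + K * (\<theta> - 1)\<^sup>2" by blast
  let ?K = "4 * (K + real q + 1)"
  show ?case
  proof (intro exI[of _ ?K] conjI allI impI)
    fix \<theta> :: real assume t: "1/4 \<le> \<theta>"
    define w where "w = \<theta> - 1"
    have "1 / \<theta> ^ Suc q = (1 / \<theta> ^ q) / \<theta>" by simp
    also have "\<dots> \<le> (1 - real q * w + K * w\<^sup>2) / \<theta>"
      using K(2)[OF t] t unfolding w_def by (intro divide_right_mono) auto
    also have "\<dots> \<le> 1 - real (Suc q) * w + ?K * w\<^sup>2"
    proof -
      have "(K + real q + 1) * 1 \<le> (K + real q + 1) * (4 * \<theta>)" using t K(1) by (intro mult_left_mono) auto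
      then have "K * w\<^sup>2 \<le> (?K * \<theta> - real q - 1) * w\<^sup>2" by (intro mult_right_mono) (auto simp: algebra_simps)
      moreover have "(1 - real (Suc q) * w + ?K * w\<^sup>2) * \<theta> = 1 - real q * w + (?K * \<theta> - real q - 1) * w\<^sup>2"
        unfolding w_def by (simp add: algebra_simps power2_eq_square power3_eq_cube)
      ultimately show ?thesis using t by (subst pos_divide_le_eq) auto
    qed
    finally show "1 / \<theta> ^ Suc q \<le> 1 - real (Suc q) * (\<theta> - 1) + ?K * (\<theta> - 1)\<^sup>2" by (simp add: w_def)
  qed (use K in auto)
qed

text \<open>Near a point where \<open>1 - |.|^2 / R^2\<close> has the value \<open>d\<close>, the
  profile varies, relative to its own size, on the length scale \<open>R d\<close>. On the ball of
  radius \<open>R d / 4\<close> the value stays above \<open>d / 4\<close>, so that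
  \<open>inverse_power_quadratic\<close> applies to the ratio of the two values.\<close>

lemma barrier_profile:
  fixes q :: nat
  shows "\<exists>K\<ge>0. \<forall>(x0::'a::euclidean_space) R x. R > 0 \<longrightarrow> norm (x - x0) < R \<longrightarrow>
    (\<exists>l. \<forall>z. norm z < R * (1 - (norm (x - x0))\<^sup>2 / R\<^sup>2) / 4 \<longrightarrow>
      0 < 1 - (norm (x + z - x0))\<^sup>2 / R\<^sup>2 \<and>
      1 / (1 - (norm (x + z - x0))\<^sup>2 / R\<^sup>2) ^ q \<le>
        1 / (1 - (norm (x - x0))\<^sup>2 / R\<^sup>2) ^ q * (1 + l \<bullet> z + K * (norm z)\<^sup>2 / (R\<^sup>2 * (1 - (norm (x - x0))\<^sup>2 / R\<^sup>2)\<^sup>2)))"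
proof -
  obtain K where K: "K \<ge> 0" "\<And>\<theta>::real. 1/4 \<le> \<theta> \<Longrightarrow> 1 / \<theta> ^ q \<le> 1 - real q * (\<theta> - 1) + K * (\<theta> - 1)\<^sup>2"
    using inverse_power_quadratic[of q] by blast
  show ?thesis
  \<comment> \<open>\<open>9 * K\<close> because the ratio moves by at most
    \<open>3 * \<zeta> / d\<close> with \<open>\<zeta> = norm z / R\<close>; the summand
    \<open>q\<close> absorbs the second order part of the ratio itself.\<close>
  proof (intro exI[of _ "real q + 9 * K"] conjI allI impI)
    fix x0 x :: 'a and R :: real assume R: "R > 0" and x: "norm (x - x0) < R"
    define y where "y = x - x0"
    define d where "d = 1 - (norm y)\<^sup>2 / R\<^sup>2"
    have y: "norm y < R" using x by (simp add: y_def)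
    then have "(norm y)\<^sup>2 < R\<^sup>2" by (intro power_strict_mono) auto
    then have d: "0 < d" "d \<le> 1" using R by (auto simp: d_def)
    define l where "l = (2 * real q / (R\<^sup>2 * d)) *\<^sub>R y"
    show "\<exists>l. \<forall>z. norm z < R * (1 - (norm (x - x0))\<^sup>2 / R\<^sup>2) / 4 \<longrightarrow>
      0 < 1 - (norm (x + z - x0))\<^sup>2 / R\<^sup>2 \<and>
      1 / (1 - (norm (x + z - x0))\<^sup>2 / R\<^sup>2) ^ q \<le>
        1 / (1 - (norm (x - x0))\<^sup>2 / R\<^sup>2) ^ q * (1 + l \<bullet> z + (real q + 9 * K) * (norm z)\<^sup>2 / (R\<^sup>2 * (1 - (norm (x - x0))\<^sup>2 / R\<^sup>2)\<^sup>2))"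
    proof (intro exI[of _ l] allI impI)
      fix z :: 'a assume z: "norm z < R * (1 - (norm (x - x0))\<^sup>2 / R\<^sup>2) / 4"
      define \<zeta> where "\<zeta> = norm z / R"
      have zeta: "0 \<le> \<zeta>" "\<zeta> < d / 4" using z R by (auto simp: \<zeta>_def d_def y_def field_simps)
      define e where "e = 1 - (norm (x + z - x0))\<^sup>2 / R\<^sup>2"
      define i where "i = 2 * (y \<bullet> z) / R\<^sup>2"
      have e: "e = d - i - \<zeta>\<^sup>2"
      proof -
        have "x + z - x0 = y + z" by (simp add: y_def)
        then show ?thesis
          by (simp add: e_def d_def i_def \<zeta>_def power2_norm_eq_inner inner_commute inner_add power_divide add_divide_distrib algebra_simps)
      qed
      have i: "\<bar>i\<bar> \<le> 2 * \<zeta>"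
      proof -
        have "\<bar>y \<bullet> z\<bar> \<le> norm y * norm z" by (rule Cauchy_Schwarz_ineq2)
        also have "\<dots> \<le> R * norm z" using y by (intro mult_right_mono) auto
        finally have "\<bar>i\<bar> \<le> 2 * (R * norm z) / R\<^sup>2" unfolding i_def by (simp add: abs_mult divide_right_mono)
        then show ?thesis using R by (simp add: \<zeta>_def power2_eq_square)
      qed
      have z2: "\<zeta>\<^sup>2 \<le> \<zeta> * (1/4)" unfolding power2_eq_square using zeta d by (intro mult_left_mono) auto
      have e4: "e \<ge> d / 4" using e i z2 zeta d by (auto simp: abs_le_iff)
      have ed: "\<bar>e / d - 1\<bar> \<le> 3 * \<zeta> / d"
      proof -
        have "i \<le> 2 * \<zeta>" "- i \<le> 2 * \<zeta>" using i by auto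
        then have "\<bar>e - d\<bar> \<le> 3 * \<zeta>" unfolding e abs_le_iff using z2 zeta(1) zero_le_power2[of \<zeta>] by linarith
        moreover have "e / d - 1 = (e - d) / d" using d by (simp add: diff_divide_distrib)
        ultimately show ?thesis using d by (simp add: abs_divide divide_right_mono)
      qed
      have "1 / e ^ q = 1 / d ^ q * (1 / (e / d) ^ q)" using d e4 by (simp add: power_divide)
      also have "\<dots> \<le> 1 / d ^ q * (1 - real q * (e / d - 1) + K * (e / d - 1)\<^sup>2)"
        using K(2)[of "e / d"] e4 d by (intro mult_left_mono) (auto simp: field_simps)
      also have "\<dots> \<le> 1 / d ^ q * (1 + l \<bullet> z + (real q + 9 * K) * (norm z)\<^sup>2 / (R\<^sup>2 * d\<^sup>2))"
      proof (rule mult_left_mono)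
        have "(e / d - 1)\<^sup>2 \<le> (3 * \<zeta> / d)\<^sup>2"
          using power_mono[OF ed, of 2] by simp
        then have "K * (e / d - 1)\<^sup>2 \<le> K * (9 * \<zeta>\<^sup>2 / d\<^sup>2)"
          using K(1) by (intro mult_left_mono) (auto simp: power_divide power_mult_distrib)
        moreover have "- (real q * (e / d - 1)) \<le> l \<bullet> z + real q * (\<zeta>\<^sup>2 / d\<^sup>2)"
        proof -
          have "- (real q * (e / d - 1)) = real q * i / d + real q * (\<zeta>\<^sup>2 / d)"
            using d by (simp add: e field_simps)
          moreover have "real q * i / d = l \<bullet> z" by (simp add: l_def i_def)
          moreover have "\<zeta>\<^sup>2 / d \<le> \<zeta>\<^sup>2 / d\<^sup>2" using d by (intro divide_left_mono) (auto simp: power2_eq_square mult_le_cancel_left1)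
          then have "real q * (\<zeta>\<^sup>2 / d) \<le> real q * (\<zeta>\<^sup>2 / d\<^sup>2)" by (intro mult_left_mono) auto
          ultimately show ?thesis by linarith
        qed
        moreover have "(real q + 9 * K) * (norm z)\<^sup>2 / (R\<^sup>2 * d\<^sup>2) = real q * (\<zeta>\<^sup>2 / d\<^sup>2) + K * (9 * \<zeta>\<^sup>2 / d\<^sup>2)"
          using R by (simp add: \<zeta>_def power_divide distrib_right add_divide_distrib)
        ultimately show "1 - real q * (e / d - 1) + K * (e / d - 1)\<^sup>2 \<le> 1 + l \<bullet> z + (real q + 9 * K) * (norm z)\<^sup>2 / (R\<^sup>2 * d\<^sup>2)"
          by linarith
      qed (use d in auto)
      finally show "0 < 1 - (norm (x + z - x0))\<^sup>2 / R\<^sup>2 \<and>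
      1 / (1 - (norm (x + z - x0))\<^sup>2 / R\<^sup>2) ^ q \<le>
        1 / (1 - (norm (x - x0))\<^sup>2 / R\<^sup>2) ^ q * (1 + l \<bullet> z + (real q + 9 * K) * (norm z)\<^sup>2 / (R\<^sup>2 * (1 - (norm (x - x0))\<^sup>2 / R\<^sup>2)\<^sup>2))"
        using e4 d by (simp add: e_def d_def y_def)
    qed
  qed (use K in auto)
qed

text \<open>\<open>flat_sol p \<beta> a\<close> solves \<open>Y' = - t^\<beta> Y^p\<close> and tends
  to infinity as \<open>t\<close> decreases to \<open>a\<close>. \<open>flat_base\<close> is
  \<open>Y^(1 - p)\<close>, for which the equation can be integrated directly. At
  \<open>t = a\<close> both take the default value 0, as \<open>0 powr x = 0\<close>.\<close>

definition flat_base :: "real \<Rightarrow> real \<Rightarrow> real \<Rightarrow> real \<Rightarrow> real" where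
  "flat_base p \<beta> a t = (p - 1) / (1 + \<beta>) * (t powr (1 + \<beta>) - a powr (1 + \<beta>))"

definition flat_sol :: "real \<Rightarrow> real \<Rightarrow> real \<Rightarrow> real \<Rightarrow> real" where
  "flat_sol p \<beta> a t = flat_base p \<beta> a t powr (- (1 / (p - 1)))"

lemma flat_base_pos:
  assumes "p > 1" "\<beta> > -1" "0 \<le> a" "a < t" shows "flat_base p \<beta> a t > 0"
  unfolding flat_base_def using assms powr_less_mono2[of "1 + \<beta>" a t] by (intro mult_pos_pos divide_pos_pos) auto

lemma flat_sol_pos:
  assumes "p > 1" "\<beta> > -1" "0 \<le> a" "a < t" shows "flat_sol p \<beta> a t > 0"
  using flat_base_pos[OF assms] by (simp add: flat_sol_def)

lemma flat_sol_powr: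
  assumes "p > 1" "\<beta> > -1" "0 \<le> a" "a < t" shows "flat_sol p \<beta> a t powr (p - 1) = 1 / flat_base p \<beta> a t"
proof -
  have "- (1 / (p - 1)) * (p - 1) = - 1" using assms by simp
  then have "flat_sol p \<beta> a t powr (p - 1) = flat_base p \<beta> a t powr (- 1)" by (simp only: flat_sol_def powr_powr)
  then show ?thesis using flat_base_pos[OF assms] by (simp add: powr_minus_divide)
qed

lemma flat_sol_deriv:
  assumes "p > 1" "\<beta> > -1" "0 \<le> a" "a < t"
  shows "(flat_sol p \<beta> a has_real_derivative - (t powr \<beta> * flat_sol p \<beta> a t powr p)) (at t)"
proof -
  have X: "flat_base p \<beta> a t > 0" by (rule flat_base_pos[OF assms])
  have "(flat_base p \<beta> a has_real_derivative (p - 1) / (1 + \<beta>) * ((1 + \<beta>) * t powr \<beta>)) (at t)"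
    unfolding flat_base_def using assms by (auto intro!: derivative_eq_intros)
  then have dX: "(flat_base p \<beta> a has_real_derivative (p - 1) * t powr \<beta>) (at t)"
    using assms by simp
  have "(flat_sol p \<beta> a has_real_derivative - (1 / (p - 1)) * flat_base p \<beta> a t powr (- (1 / (p - 1)) - 1) * ((p - 1) * t powr \<beta>)) (at t)"
    using DERIV_fun_powr[OF dX X, of "- (1 / (p - 1))"] by (simp add: flat_sol_def[abs_def])
  moreover have "flat_base p \<beta> a t powr (- (1 / (p - 1)) - 1) = flat_sol p \<beta> a t powr p"
  proof -
    have "- (1 / (p - 1)) - 1 = - (1 / (p - 1)) * p" using assms by (simp add: field_simps)
    then show ?thesis by (simp add: flat_sol_def powr_powr)
  qed
  ultimately show ?thesis using assms by (simp add: mult.commute)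
qed

text \<open>If the bound fails, a multiple \<open>\<sigma> > 1\<close> of the barrier touches
  \<open>u\<close> from above. At the touching point the growth of the tail integral pays for the
  mass that jumps in from afar, and the surplus absorption due to \<open>\<Lambda> > 1\<close> pays
  for the curvature of the profile. The condition on \<open>C1\<close> is this second balance, in a
  form valid for all times up to \<open>b\<close>.\<close>

lemma upper_barrier:
  assumes s: "0 < s" "s < 1" and p: "p > 1" and \<beta>: "\<beta> > -1"
  obtains C1 C2 where "C1 \<ge> 0" "C2 \<ge> 0" and "\<And>(u :: real \<Rightarrow> 'a::euclidean_space \<Rightarrow> real) x0 R a b \<Lambda> B.
    \<lbrakk>absorption_sol s \<beta> p u; R > 0; 0 < a; a < b; \<Lambda> > 1;
    C1 * R powr (- (2 * s)) < (\<Lambda> powr (p - 1) - 1) * ((1 + \<beta>) / ((p - 1) * b));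
    \<And>n. integral {a..b} (tail_cbox s R x0 u n) \<le> B\<rbrakk> \<Longrightarrow>
    u b x0 \<le> \<Lambda> * flat_sol p \<beta> a b + C2 * B"
proof -
  let ?e = "real DIM('a) + 2 * s" and ?A = "frac_const DIM('a) s"
  have A: "?A > 0" by (rule frac_const_pos[OF s])
  \<comment> \<open>Two demands near the sphere: \<open>q >= N + 2 s\<close>, so that the barrier
    outgrows the tail seen through jumps of length at least \<open>R d / 4\<close>, and
    \<open>q (p - 1) >= 2 s\<close>, so that absorption outgrows the curvature term of relative size
    \<open>d powr (- (2 * s))\<close>.\<close>
  define q :: nat where "q = nat \<lceil>max ?e (2 * s / (p - 1))\<rceil>"
  have q1: "?e \<le> real q" and "2 * s / (p - 1) \<le> real q" unfolding q_def by linarith+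
  then have q2: "2 * s \<le> real q * (p - 1)" using p by (simp add: divide_le_eq)
  obtain K where K: "K \<ge> 0" and prof: "\<And>(x0::'a) R x. R > 0 \<Longrightarrow> norm (x - x0) < R \<Longrightarrow>
    (\<exists>l. \<forall>z. norm z < R * (1 - (norm (x - x0))\<^sup>2 / R\<^sup>2) / 4 \<longrightarrow>
      0 < 1 - (norm (x + z - x0))\<^sup>2 / R\<^sup>2 \<and>
      1 / (1 - (norm (x + z - x0))\<^sup>2 / R\<^sup>2) ^ q \<le>
        1 / (1 - (norm (x - x0))\<^sup>2 / R\<^sup>2) ^ q * (1 + l \<bullet> z + K * (norm z)\<^sup>2 / (R\<^sup>2 * (1 - (norm (x - x0))\<^sup>2 / R\<^sup>2)\<^sup>2)))"
    using barrier_profile[of q, where 'a='a] by blast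
  define C1 where "C1 = ?A * (K * inner_moment TYPE('a) s)"
  define C2 where "C2 = ?A * 9 powr ?e"
  have C1: "C1 \<ge> 0" unfolding C1_def using A K by (intro mult_nonneg_nonneg) auto
  have C2: "C2 \<ge> 0" unfolding C2_def using A by (intro mult_nonneg_nonneg) auto
  show thesis
  proof (rule that[OF C1 C2], rule ccontr)
    fix u :: "real \<Rightarrow> 'a \<Rightarrow> real" and x0 R a b \<Lambda> B
    assume u: "absorption_sol s \<beta> p u" and R: "R > 0" and a: "0 < a" and ab: "a < b" and L1: "\<Lambda> > 1"
      and cond: "C1 * R powr (- (2 * s)) < (\<Lambda> powr (p - 1) - 1) * ((1 + \<beta>) / ((p - 1) * b))"
      and B: "\<And>n. integral {a..b} (tail_cbox s R x0 u n) \<le> B"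
      and neg: "\<not> u b x0 \<le> \<Lambda> * flat_sol p \<beta> a b + C2 * B"
    let ?T = "tail s R x0 u" and ?Tn = "tail_cbox s R x0 u"
    note prim = tail_primitive[OF s u a less_imp_le[OF ab] R B]
    define I where "I t = integral {a..t} ?T" for t
    have I0: "I t \<ge> 0" if "t \<in> {a..b}" for t
    proof -
      have "integral {a..a} ?T + integral {a..t} (?Tn 0) \<le> I t" unfolding I_def by (rule prim(4)) (use that in auto)
      moreover have "0 \<le> integral {a..t} (?Tn 0)"
      proof (rule Henstock_Kurzweil_Integration.integral_nonneg)
        show "?Tn 0 integrable_on {a..t}"
          by (rule integrable_continuous_interval, rule continuous_on_subset[OF tail_cbox_continuous[OF s u R]]) (use a in auto)
      qed (use tail_cbox_nonneg[OF s u _ R] a in auto)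
      ultimately show ?thesis by simp
    qed
    have Ib: "I b \<le> B" unfolding I_def by (rule prim(2))
    define e where "e y = 1 - (norm (y - x0))\<^sup>2 / R\<^sup>2" for y
    define Xi where "Xi t = flat_base p \<beta> a t powr (1 / (p - 1))" for t
    have X0: "flat_base p \<beta> a t \<ge> 0" if "t \<in> {a..b}" for t
      using flat_base_pos[OF p \<beta>, of a t] that a by (cases "t = a") (auto simp: flat_base_def)
    have Xi0: "Xi t \<ge> 0" for t by (simp add: Xi_def)
    have Xia: "Xi a = 0" by (simp add: Xi_def flat_base_def)
    \<comment> \<open>The barrier is \<open>W t / e y ^ q\<close> with \<open>W = \<Lambda> Y + C2 I\<close>. Written in terms of \<open>Xi = 1 / Y\<close>, the quotient of
      \<open>u\<close> by the barrier extends continuously to \<open>t = a\<close>, where \<open>Y\<close> is infinite.\<close>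
    define F where "F t y = u t y * max 0 (e y) ^ q * Xi t / (\<Lambda> + C2 * I t * Xi t)" for t y
    have den: "\<Lambda> + C2 * I t * Xi t > 0" if "t \<in> {a..b}" for t
      using I0[OF that] C2 Xi0[of t] L1 by (intro add_pos_nonneg mult_nonneg_nonneg) auto
    let ?Q = "{a..b} \<times> cball x0 R"
    have "compact ?Q" by (intro compact_Times) auto
    moreover have "?Q \<noteq> {}" using ab R by auto
    moreover have "continuous_on ?Q (\<lambda>r. F (fst r) (snd r))"
    proof -
      have cI: "continuous_on ?Q (\<lambda>r. I (fst r))"
        by (rule continuous_on_compose2[OF prim(3)[folded I_def]]) (auto intro!: continuous_intros)
      have "continuous_on {a..b} (flat_base p \<beta> a)"
        unfolding flat_base_def using a \<beta> by (intro continuous_intros) auto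
      then have "continuous_on {a..b} Xi"
        unfolding Xi_def using X0 p by (intro continuous_on_powr' continuous_on_const) auto
      then have cX: "continuous_on ?Q (\<lambda>r. Xi (fst r))"
        by (rule continuous_on_compose2) (auto intro!: continuous_intros)
      have cu: "continuous_on ?Q (\<lambda>r. u (fst r) (snd r))"
        using sol_cont[OF u, of "{a..b}" "cball x0 R"] a by (simp add: split_def subset_iff)
      have ce: "continuous_on ?Q (\<lambda>r. max 0 (e (snd r)) ^ q)"
        unfolding e_def using R by (intro continuous_intros) auto
      have "\<forall>r\<in>?Q. \<Lambda> + C2 * I (fst r) * Xi (fst r) \<noteq> 0" using den by force
      then show ?thesis unfolding F_def
        by (intro continuous_on_divide continuous_on_mult continuous_on_add continuous_on_const cI cX cu ce)
    qed
    ultimately have "\<exists>r\<in>?Q. \<forall>r'\<in>?Q. F (fst r') (snd r') \<le> F (fst r) (snd r)"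
      by (rule continuous_attains_sup)
    then obtain r where r: "r \<in> ?Q" "\<forall>r'\<in>?Q. F (fst r') (snd r') \<le> F (fst r) (snd r)" by blast
    define t' where "t' = fst r"
    define y where "y = snd r"
    have ty: "t' \<in> {a..b}" "y \<in> cball x0 R" using r(1) unfolding t'_def y_def mem_Times_iff by blast+
    have mx: "F t x \<le> F t' y" if "t \<in> {a..b}" "x \<in> cball x0 R" for t x
      using bspec[OF r(2), of "(t, x)"] that by (simp add: t'_def y_def)
    define \<sigma> where "\<sigma> = F t' y"
    define Y where "Y = flat_sol p \<beta> a"
    define W where "W t = \<Lambda> * Y t + C2 * I t" for t
    have Yp: "Y t > 0" if "t \<in> {a<..b}" for t using flat_sol_pos[OF p \<beta>, of a t] that a by (auto simp: Y_def)
    have Wp: "W t > 0" if "t \<in> {a<..b}" for t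
      unfolding W_def using Yp[OF that] I0[of t] that L1 C2 by (intro add_pos_nonneg mult_pos_pos mult_nonneg_nonneg) auto
    have FW: "F t x = u t x * max 0 (e x) ^ q / W t" if "t \<in> {a<..b}" for t x
    proof -
      have X: "flat_base p \<beta> a t > 0" using flat_base_pos[OF p \<beta>, of a t] that a by auto
      have "Y t = 1 / Xi t" using X by (simp add: Y_def Xi_def flat_sol_def powr_minus_divide)
      moreover have "Xi t > 0" using X by (simp add: Xi_def)
      ultimately have "W t = (\<Lambda> + C2 * I t * Xi t) / Xi t" unfolding W_def by (simp add: field_simps)
      then show ?thesis unfolding F_def by simp
    qed
    have s1: "\<sigma> > 1"
    proof -
      have bb: "b \<in> {a<..b}" using ab by auto
      have "W b \<le> \<Lambda> * flat_sol p \<beta> a b + C2 * B"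
        unfolding W_def Y_def using Ib C2 by (intro add_left_mono mult_left_mono) auto
      then have "u b x0 > W b" using neg by simp
      then have "F b x0 > 1" using Wp[OF bb] by (simp add: FW[OF bb] e_def)
      then show ?thesis using mx[of b x0] ab R by (auto simp: \<sigma>_def)
    qed
    have ta: "t' \<in> {a<..b}"
    proof -
      have "t' \<noteq> a" using s1 Xia by (auto simp: \<sigma>_def F_def)
      then show ?thesis using ty by auto
    qed
    then have t'0: "t' > 0" "a < t'" "t' \<le> b" using a by auto
    have qpos: "q > 0" using q1 s by (intro gr0I) auto
    define d where "d = e y"
    have d0: "d > 0"
    proof (rule ccontr)
      assume "\<not> d > 0"
      then have "max 0 (e y) ^ q = 0" using qpos by (simp add: d_def max_def)
      then have "F t' y = 0" unfolding F_def by (simp only: mult_zero_right mult_zero_left div_0)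
      then show False using s1 by (simp add: \<sigma>_def)
    qed
    have d1: "d \<le> 1" by (simp add: d_def e_def)
    have yR: "norm (y - x0) < R"
    proof -
      have "(norm (y - x0))\<^sup>2 < R\<^sup>2" using d0 R by (simp add: d_def e_def)
      then show ?thesis by (rule power2_less_imp_less) (use R in simp)
    qed
    have uy: "u t' y = \<sigma> * W t' / d ^ q"
    proof -
      have "\<sigma> = u t' y * d ^ q / W t'" unfolding \<sigma>_def FW[OF ta] d_def[symmetric] using d0 by simp
      then show ?thesis using Wp[OF ta] d0 by simp
    qed
    have ule: "u t x \<le> \<sigma> * W t / e x ^ q" if "t \<in> {a<..b}" "e x > 0" for t x
    proof -
      have "(norm (x - x0))\<^sup>2 < R\<^sup>2" using that(2) R by (simp add: e_def)
      then have "x \<in> cball x0 R" using R power2_less_imp_less[of "norm (x - x0)" R] by (simp add: dist_norm norm_minus_commute)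
      then have "F t x \<le> \<sigma>" unfolding \<sigma>_def using that by (intro mx) auto
      then have "u t x * e x ^ q / W t \<le> \<sigma>" using that(2) by (simp add: FW[OF that(1)])
      then show ?thesis using Wp[OF that(1)] that(2) by (simp add: field_simps)
    qed
    obtain ut L where dd: "((\<lambda>\<tau>. u \<tau> y) has_real_derivative ut) (at t')" "frac_lap s (u t') y L"
        "ut + L + t' powr \<beta> * u t' y powr p = 0"
      using u t'0(1) unfolding absorption_sol_def by blast
    define c where "c = \<sigma> / d ^ q"
    have c0: "c > 0" using s1 d0 by (simp add: c_def)
    have cge: "1 / d powr ?e \<le> c"
    proof -
      have "d powr real q \<le> d powr ?e" using d0 d1 q1 by (intro powr_mono') auto
      then have "1 / d powr ?e \<le> 1 / d ^ q" using d0 by (simp add: powr_realpow divide_left_mono)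
      also have "\<dots> \<le> c" unfolding c_def using s1 d0 by (intro divide_right_mono) auto
      finally show ?thesis .
    qed
    \<comment> \<open>\<open>I\<close> need not be differentiable. At earlier times it lies below
      \<open>I t' - J t' + J \<tau>\<close>, with equality at \<open>t'\<close>, and this majorant
      has the derivative \<open>?Tn n t'\<close>; the limit in \<open>n\<close> is taken
      afterwards.\<close>
    have time_n: "c * (\<Lambda> * (- (t' powr \<beta> * Y t' powr p)) + C2 * ?Tn n t') \<le> ut" for n
    proof -
      define J where "J \<tau> = integral {a..\<tau>} (?Tn n)" for \<tau>
      have cT: "continuous_on {a..b} (?Tn n)" by (rule continuous_on_subset[OF tail_cbox_continuous[OF s u R]]) (use a in auto)
      have "0 \<le> ut - c * (\<Lambda> * (- (t' powr \<beta> * Y t' powr p)) + C2 * ?Tn n t')"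
      \<comment> \<open>Starting halfway keeps the interval away from \<open>a\<close>, where
        \<open>Y\<close> has the default value 0 instead of infinity.\<close>
      proof (rule left_maximum_deriv_nonneg[where t=t' and a="(a + t') / 2" and S="{a..b}"])
        have dY: "(Y has_real_derivative - (t' powr \<beta> * Y t' powr p)) (at t' within {a..b})"
          unfolding Y_def using flat_sol_deriv[OF p \<beta> less_imp_le[OF a] t'0(2)] by (rule has_field_derivative_at_within)
        have dJ: "(J has_real_derivative ?Tn n t') (at t' within {a..b})"
          unfolding J_def by (rule integral_has_real_derivative[OF cT ty(1)])
        show "((\<lambda>\<tau>. u \<tau> y - c * (\<Lambda> * Y \<tau> + C2 * (I t' - J t' + J \<tau>))) has_real_derivative
          ut - c * (\<Lambda> * (- (t' powr \<beta> * Y t' powr p)) + C2 * ?Tn n t')) (at t' within {a..b})"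
          by (rule derivative_eq_intros has_field_derivative_at_within[OF dd(1)] dY dJ refl)+ simp
        fix \<tau> assume tau: "\<tau> \<in> {(a + t') / 2..t'}"
        then have tau': "\<tau> \<in> {a<..b}" "a \<le> \<tau>" "\<tau> \<le> t'" using t'0 by auto
        have "integral {a..\<tau>} (?Tn n) + integral {\<tau>..t'} (?Tn n) = integral {a..t'} (?Tn n)"
          using tau' t'0 by (intro Henstock_Kurzweil_Integration.integral_combine integrable_continuous_interval continuous_on_subset[OF cT]) auto
        moreover have "I \<tau> + integral {\<tau>..t'} (?Tn n) \<le> I t'"
          unfolding I_def using tau' t'0 by (intro prim(4)) auto
        ultimately have "I \<tau> \<le> I t' - J t' + J \<tau>" unfolding J_def by linarith
        then have "W \<tau> \<le> \<Lambda> * Y \<tau> + C2 * (I t' - J t' + J \<tau>)"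
          unfolding W_def using C2 by (intro add_left_mono mult_left_mono) auto
        then have "c * W \<tau> \<le> c * (\<Lambda> * Y \<tau> + C2 * (I t' - J t' + J \<tau>))" using c0 by (intro mult_left_mono) auto
        moreover have "u \<tau> y \<le> c * W \<tau>" using ule[OF tau'(1), of y] d0 by (simp add: c_def d_def)
        moreover have "u t' y = c * W t'" by (simp add: uy c_def)
        ultimately show "u \<tau> y - c * (\<Lambda> * Y \<tau> + C2 * (I t' - J t' + J \<tau>)) \<le> u t' y - c * (\<Lambda> * Y t' + C2 * (I t' - J t' + J t'))"
          by (simp add: W_def)
      qed (use t'0 in auto)
      then show ?thesis by simp
    qed
    have time: "c * (\<Lambda> * (- (t' powr \<beta> * Y t' powr p)) + C2 * ?T t') \<le> ut"
    proof (rule LIMSEQ_le_const2)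
      show "(\<lambda>n. c * (\<Lambda> * (- (t' powr \<beta> * Y t' powr p)) + C2 * ?Tn n t')) \<longlonglongrightarrow> c * (\<Lambda> * (- (t' powr \<beta> * Y t' powr p)) + C2 * ?T t')"
        by (intro tendsto_intros tailn_LIMSEQ[OF s u t'0(1) R])
    qed (use time_n in auto)
    let ?r = "R * d / 4"
    have rp: "?r > 0" using R d0 by simp
    obtain l where l: "\<And>z. norm z < ?r \<Longrightarrow> 0 < e (y + z) \<and> 1 / e (y + z) ^ q \<le> 1 / d ^ q * (1 + l \<bullet> z + K * (norm z)\<^sup>2 / (R\<^sup>2 * d\<^sup>2))"
      using prof[OF R yR] unfolding e_def d_def by blast
    let ?M = "c * W t' * (K / (R\<^sup>2 * d\<^sup>2))"
    let ?w = "\<lambda>z. u t' z * (1 / (R + norm (z - x0)) powr ?e)"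
    let ?E = "\<lambda>z. - ((9 / d) powr ?e * ?w (y + 1 *\<^sub>R z))"
    have iw: "integrable lborel ?w" by (rule tail_integrable[OF s u t'0(1) R])
    have mw: "?w \<in> borel_measurable borel" using borel_measurable_integrable[OF iw] by simp
    have iE: "integrable lborel ?E"
      using lborel_integrable_affine[OF mw, where c=1 and t=y] iw
      by (intro Bochner_Integration.integrable_minus integrable_mult_right) simp
    have intE: "integral\<^sup>L lborel ?E = - ((9 / d) powr ?e * ?T t')"
    proof -
      have "integral\<^sup>L lborel ?E = - ((9 / d) powr ?e * (LBINT z. ?w (y + 1 *\<^sub>R z)))"
        by (simp only: Bochner_Integration.integral_minus integral_mult_right_zero)
      also have "(LBINT z. ?w (y + 1 *\<^sub>R z)) = ?T t'"
        using lborel_integral_affine[OF mw, where c=1 and t=y] by (simp add: tail_def)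
      finally show ?thesis .
    qed
    have "- L \<le> ?A * (?M * (inner_moment TYPE('a) s * ?r powr (2 - 2 * s)) - integral\<^sup>L lborel ?E)"
    proof (rule frac_lap_touching[OF s frac_lap_minus[OF dd(2)] rp _ iE, where l = "- ((c * W t') *\<^sub>R l)"])
      show "?M \<ge> 0" using c0 Wp[OF ta] K by (intro mult_nonneg_nonneg divide_nonneg_nonneg) auto
      fix z :: 'a assume z: "z \<noteq> 0"
      have wpos: "0 \<le> (9 / d) powr ?e * ?w (y + 1 *\<^sub>R z)"
        by (rule mult_nonneg_nonneg[OF _ tail_term_nonneg[OF s u t'0(1) R]]) simp
      show "indicator (ball 0 ?r) z * ((- ((c * W t') *\<^sub>R l) \<bullet> z - ?M * (norm z)\<^sup>2) * jump_kernel s z) + ?E z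
          \<le> (- u t' (y + z) - - u t' y) * jump_kernel s z"
      proof (cases "norm z < ?r")
        case True
        have "u t' (y + z) \<le> \<sigma> * W t' * (1 / e (y + z) ^ q)" using ule[OF ta, of "y + z"] l[OF True] by simp
        also have "\<dots> \<le> \<sigma> * W t' * (1 / d ^ q * (1 + l \<bullet> z + K * (norm z)\<^sup>2 / (R\<^sup>2 * d\<^sup>2)))"
          using l[OF True] s1 Wp[OF ta] by (intro mult_left_mono) auto
        also have "\<dots> = u t' y + (c * W t') * (l \<bullet> z) + ?M * (norm z)\<^sup>2"
          by (simp add: uy c_def algebra_simps add_divide_distrib)
        finally have "- ((c * W t') *\<^sub>R l) \<bullet> z - ?M * (norm z)\<^sup>2 \<le> - u t' (y + z) - - u t' y" by simp
        then have a1: "(- ((c * W t') *\<^sub>R l) \<bullet> z - ?M * (norm z)\<^sup>2) * jump_kernel s z \<le> (- u t' (y + z) - - u t' y) * jump_kernel s z"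
          by (intro mult_right_mono) auto
        have i1: "indicator (ball 0 ?r) z = (1::real)" using True by simp
        show ?thesis unfolding i1 mult_1_left using a1 wpos by linarith
      next
        case False
        \<comment> \<open>From \<open>norm z >= R * d / 4\<close> follows
          \<open>2 * R <= (8 / d) * norm z\<close>, and \<open>d <= 1\<close> gives the ninth part.
          This is the origin of the 9 in \<open>C2\<close>.\<close>
        have "(R + norm (y + z - x0)) \<le> (9 / d) * norm z"
        proof -
          have "norm (y + z - x0) \<le> norm (y - x0) + norm z" using norm_triangle_ineq[of "y - x0" z] by (simp add: algebra_simps)
          then have "R + norm (y + z - x0) \<le> 2 * R + norm z" using yR by linarith
          moreover have "2 * R \<le> (8 / d) * norm z" using False d0 by (simp add: field_simps)
          moreover have "1 * norm z \<le> (1 / d) * norm z" using d0 d1 by (intro mult_right_mono) auto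
          moreover have "(9 / d) * norm z = (8 / d) * norm z + (1 / d) * norm z" by (simp add: add_divide_distrib[symmetric])
          ultimately show ?thesis by linarith
        qed
        moreover have d9: "9 / d > 0" using d0 by simp
        ultimately have "(R + norm (y + z - x0)) / (9 / d) \<le> norm z" by (simp only: pos_divide_le_eq[OF d9] mult.commute)
        then have "jump_kernel s z \<le> 1 / ((R + norm (y + z - x0)) / (9 / d)) powr ?e"
          using d0 R by (intro jump_kernel_le s divide_pos_pos add_pos_nonneg) auto
        also have "\<dots> = (9 / d) powr ?e * (1 / (R + norm (y + z - x0)) powr ?e)"
        proof -
          have "((R + norm (y + z - x0)) / (9 / d)) powr ?e = (R + norm (y + z - x0)) powr ?e / (9 / d) powr ?e"
            using d0 R by (intro powr_divide)
          then show ?thesis by simp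
        qed
        finally have "u t' (y + z) * jump_kernel s z \<le> u t' (y + z) * ((9 / d) powr ?e * (1 / (R + norm (y + z - x0)) powr ?e))"
          using sol_pos[OF u t'0(1), of "y + z"] by (intro mult_left_mono) auto
        then have "?E z \<le> - (u t' (y + z) * jump_kernel s z)" by (simp add: mult_ac)
        also have "\<dots> \<le> (- u t' (y + z) - - u t' y) * jump_kernel s z"
          using sol_pos[OF u t'0(1), of y] by (simp add: algebra_simps)
        finally have E1: "?E z \<le> (- u t' (y + z) - - u t' y) * jump_kernel s z" .
        have i0: "indicator (ball 0 ?r) z = (0::real)" using False by simp
        show ?thesis unfolding i0 mult_zero_left add_0_left by (rule E1)
      qed
    qed
    then have mL: "- L \<le> ?A * (?M * (inner_moment TYPE('a) s * ?r powr (2 - 2 * s))) + ?A * ((9 / d) powr ?e * ?T t')"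
      unfolding intE by (simp add: algebra_simps)
    \<comment> \<open>The curvature term and the absorption term at the touching point are both
      compared as multiples of \<open>c * D\<close>; \<open>D >= 1\<close> then lets the term of the
      flat solution be multiplied by \<open>D\<close> as well.\<close>
    define D where "D = d powr (- (2 * s))"
    have D1: "D \<ge> 1" unfolding D_def using d0 d1 s powr_mono'[of "- (2 * s)" 0 d] by simp
    have t1: "?A * (?M * (inner_moment TYPE('a) s * ?r powr (2 - 2 * s))) \<le> c * (C1 * R powr (- (2 * s)) * W t' * D)"
    proof -
      have "?r powr (2 - 2 * s) \<le> (R * d) powr (2 - 2 * s)" using R d0 s by (intro powr_mono2) auto
      also have "\<dots> = (R * d) powr 2 * (R * d) powr (- (2 * s))" by (simp only: powr_add[symmetric]) simp
      also have "\<dots> = R\<^sup>2 * d\<^sup>2 * (R powr (- (2 * s)) * D)"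
        using R d0 by (simp add: D_def powr_mult power_mult_distrib)
      finally have "?r powr (2 - 2 * s) \<le> R\<^sup>2 * d\<^sup>2 * (R powr (- (2 * s)) * D)" .
      then have "?A * (?M * (inner_moment TYPE('a) s * ?r powr (2 - 2 * s))) \<le> ?A * (?M * (inner_moment TYPE('a) s * (R\<^sup>2 * d\<^sup>2 * (R powr (- (2 * s)) * D))))"
        using A c0 Wp[OF ta] K by (intro mult_left_mono mult_nonneg_nonneg divide_nonneg_nonneg) auto
      also have "\<dots> = c * (C1 * R powr (- (2 * s)) * W t' * D)"
        using R d0 by (simp add: C1_def)
      finally show ?thesis .
    qed
    have T0: "?T t' \<ge> 0" unfolding tail_def by (intro integral_nonneg_AE AE_I2 tail_term_nonneg[OF s u t'0(1) R])
    have t2: "?A * ((9 / d) powr ?e * ?T t') \<le> c * (C2 * ?T t')"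
    proof -
      have "(9 / d) powr ?e = 9 powr ?e * (1 / d powr ?e)" using d0 by (simp add: powr_divide)
      also have "\<dots> \<le> 9 powr ?e * c" by (intro mult_left_mono cge) auto
      finally have "?A * ((9 / d) powr ?e * ?T t') \<le> ?A * ((9 powr ?e * c) * ?T t')"
        using A T0 by (intro mult_left_mono mult_right_mono) auto
      then show ?thesis by (simp add: C2_def mult_ac)
    qed
    have up: "u t' y powr p \<ge> c * (W t' powr p * D)"
    proof -
      have "u t' y = c * W t'" by (simp add: uy c_def)
      then have "u t' y powr p = c powr p * W t' powr p" using c0 Wp[OF ta] by (simp add: powr_mult)
      also have "c powr p = c * c powr (p - 1)" using c0 powr_add[of c 1 "p - 1"] by simp
      also have "c powr (p - 1) \<ge> D"
      proof -
        have "D \<le> (1 / d ^ q) powr (p - 1)"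
        proof -
          have "(1 / d ^ q) powr (p - 1) = d powr (- (real q * (p - 1)))"
            using d0 by (simp add: powr_divide powr_minus_divide powr_powr powr_realpow[symmetric])
          then show ?thesis unfolding D_def using d0 d1 q2 by (simp add: powr_mono')
        qed
        also have "\<dots> \<le> c powr (p - 1)"
          unfolding c_def using s1 d0 p by (intro powr_mono2 divide_right_mono) auto
        finally show ?thesis .
      qed
      then have "c * c powr (p - 1) * W t' powr p \<ge> c * D * W t' powr p"
        using c0 by (intro mult_right_mono mult_left_mono) auto
      finally show ?thesis by (simp add: mult_ac)
    qed
    then have up': "t' powr \<beta> * u t' y powr p \<ge> t' powr \<beta> * (c * (W t' powr p * D))"
      by (intro mult_left_mono) auto
    have main: "c * (- (\<Lambda> * (t' powr \<beta> * Y t' powr p))) \<le> c * (C1 * R powr (- (2 * s)) * W t' * D - t' powr \<beta> * (W t' powr p * D))"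
      using time mL t1 t2 up' dd(3) by (simp add: algebra_simps)
    then have main': "t' powr \<beta> * (W t' powr p * D) \<le> C1 * R powr (- (2 * s)) * W t' * D + \<Lambda> * (t' powr \<beta> * Y t' powr p)"
    proof -
      have "- (\<Lambda> * (t' powr \<beta> * Y t' powr p)) \<le> C1 * R powr (- (2 * s)) * W t' * D - t' powr \<beta> * (W t' powr p * D)"
        using main by (simp only: mult_le_cancel_left_pos[OF c0])
      then show ?thesis by linarith
    qed
    have Yt: "Y t' > 0" and Wt: "W t' > 0" using Yp Wp ta by auto
    have YW: "\<Lambda> * Y t' \<le> W t'" unfolding W_def using C2 I0[OF ty(1)] by simp
    \<comment> \<open>The hypothesis mentions only \<open>b\<close>. Dropping the term with
      \<open>a\<close> and replacing one factor \<open>t'\<close> by \<open>b\<close> enlarges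
      \<open>flat_base\<close>, so \<open>t' powr \<beta> * Y t' powr (p - 1)\<close> is at least
      \<open>(1 + \<beta>) / ((p - 1) * b)\<close>.\<close>
    have condt: "C1 * R powr (- (2 * s)) < (\<Lambda> powr (p - 1) - 1) * (t' powr \<beta> * Y t' powr (p - 1))"
    proof -
      have L2: "\<Lambda> powr (p - 1) \<ge> 1" using L1 p by (intro ge_one_powr_ge_zero) auto
      have "(1 + \<beta>) / ((p - 1) * b) \<le> t' powr \<beta> * Y t' powr (p - 1)"
      proof -
        have X: "flat_base p \<beta> a t' > 0" by (rule flat_base_pos[OF p \<beta> less_imp_le[OF a] t'0(2)])
        have "flat_base p \<beta> a t' \<le> (p - 1) / (1 + \<beta>) * (t' powr \<beta> * b)"
          unfolding flat_base_def
        proof (rule mult_left_mono)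
          have "t' powr (1 + \<beta>) - a powr (1 + \<beta>) \<le> t' powr \<beta> * t'" using t'0 by (simp add: powr_add)
          also have "\<dots> \<le> t' powr \<beta> * b" using t'0 by (intro mult_left_mono) auto
          finally show "t' powr (1 + \<beta>) - a powr (1 + \<beta>) \<le> t' powr \<beta> * b" .
        qed (use p \<beta> in auto)
        then have "1 / ((p - 1) / (1 + \<beta>) * (t' powr \<beta> * b)) \<le> 1 / flat_base p \<beta> a t'"
          using X p \<beta> t'0 ab a by (intro divide_left_mono mult_pos_pos divide_pos_pos) auto
        then have "t' powr \<beta> * (1 / ((p - 1) / (1 + \<beta>) * (t' powr \<beta> * b))) \<le> t' powr \<beta> * (1 / flat_base p \<beta> a t')"
          by (intro mult_left_mono) auto
        moreover have "t' powr \<beta> * (1 / ((p - 1) / (1 + \<beta>) * (t' powr \<beta> * b))) = (1 + \<beta>) / ((p - 1) * b)"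
          using t'0 by simp
        ultimately show ?thesis by (simp add: Y_def flat_sol_powr[OF p \<beta> less_imp_le[OF a] t'0(2)])
      qed
      then have "(\<Lambda> powr (p - 1) - 1) * ((1 + \<beta>) / ((p - 1) * b)) \<le> (\<Lambda> powr (p - 1) - 1) * (t' powr \<beta> * Y t' powr (p - 1))"
        using L2 by (intro mult_left_mono) auto
      then show ?thesis using cond by linarith
    qed
    have Wpow: "W t' powr p = W t' * W t' powr (p - 1)" using Wt powr_add[of "W t'" 1 "p - 1"] by simp
    have Ypow: "Y t' powr p = Y t' * Y t' powr (p - 1)" using Yt powr_add[of "Y t'" 1 "p - 1"] by simp
    have "W t' powr (p - 1) \<ge> (\<Lambda> * Y t') powr (p - 1)" using YW Yt L1 p by (intro powr_mono2) auto
    then have W1: "W t' powr (p - 1) \<ge> \<Lambda> powr (p - 1) * Y t' powr (p - 1)" using Yt L1 by (simp add: powr_mult)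
    have "C1 * R powr (- (2 * s)) * W t' * D < (\<Lambda> powr (p - 1) - 1) * (t' powr \<beta> * Y t' powr (p - 1)) * W t' * D"
      using condt Wt D1 by (intro mult_strict_right_mono) auto
    moreover have "\<Lambda> * (t' powr \<beta> * Y t' powr p) \<le> (t' powr \<beta> * Y t' powr (p - 1)) * W t' * D"
    proof -
      have "\<Lambda> * (t' powr \<beta> * Y t' powr p) = (t' powr \<beta> * Y t' powr (p - 1)) * (\<Lambda> * Y t')" by (simp add: Ypow)
      also have "\<dots> \<le> (t' powr \<beta> * Y t' powr (p - 1)) * W t'" by (intro mult_left_mono YW) auto
      also have "\<dots> \<le> (t' powr \<beta> * Y t' powr (p - 1)) * W t' * D"
        using mult_left_mono[OF D1, of "t' powr \<beta> * Y t' powr (p - 1) * W t'"] Wt by simp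
      finally show ?thesis .
    qed
    moreover have "t' powr \<beta> * (W t' powr p * D) \<ge> \<Lambda> powr (p - 1) * (t' powr \<beta> * Y t' powr (p - 1)) * W t' * D"
    proof -
      have "t' powr \<beta> * W t' * D * (\<Lambda> powr (p - 1) * Y t' powr (p - 1)) \<le> t' powr \<beta> * W t' * D * W t' powr (p - 1)"
        using Wt D1 by (intro mult_left_mono W1) auto
      then show ?thesis by (simp add: Wpow mult_ac)
    qed
    moreover have "\<Lambda> powr (p - 1) * (t' powr \<beta> * Y t' powr (p - 1)) * W t' * D = (\<Lambda> powr (p - 1) - 1) * (t' powr \<beta> * Y t' powr (p - 1)) * W t' * D + (t' powr \<beta> * Y t' powr (p - 1)) * W t' * D"
      by (simp add: algebra_simps)
    ultimately show False using main' by linarith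
  qed
qed

section \<open>A Harnack dichotomy\<close>

text \<open>If \<open>u 1 0\<close> exceeds the bound of the upper barrier, then the tail of \<open>u\<close> over \<open>[1/2, 1]\<close> is not small, and
  the lower barrier turns this tail into a lower bound on the unit ball.\<close>

lemma harnack_unit:
  assumes s: "0 < s" "s < 1" and p: "p > 1" and \<beta>: "\<beta> > -1"
  shows "\<exists>c>0. \<exists>C>0. \<forall>(u :: real \<Rightarrow> 'a::euclidean_space \<Rightarrow> real).
    absorption_sol s \<beta> p u \<longrightarrow> u 1 0 > C \<longrightarrow> (\<forall>x. norm x \<le> 1 \<longrightarrow> c \<le> u 1 x)"
proof (rule lower_barrier[OF s p, where 'a='a and \<beta>=\<beta>], rule upper_barrier[OF s p \<beta>, where 'a='a])
  let ?e = "real DIM('a) + 2 * s" and ?A = "frac_const DIM('a) s"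
  have A: "?A > 0" by (rule frac_const_pos[OF s])
  fix CL C1 C2 assume CL: "CL \<ge> 0" and LB: "\<And>(u :: real \<Rightarrow> 'a \<Rightarrow> real) x0 R t1 t2 h h' k.
    \<lbrakk>absorption_sol s \<beta> p u; R > 0; 0 < t1;
    \<And>t. t \<in> {t1..t2} \<Longrightarrow> h t \<ge> 0;
    \<And>t. t \<in> {t1..t2} \<Longrightarrow> (h has_real_derivative h' t) (at t within {t1..t2});
    \<And>x. h t1 * bump ((x - x0) /\<^sub>R R) \<le> u t1 x;
    \<And>t. t \<in> {t1<..t2} \<Longrightarrow> k t \<in> borel_measurable borel;
    \<And>t x z. t \<in> {t1<..t2} \<Longrightarrow> norm (x - x0) < R \<Longrightarrow> z \<noteq> x \<Longrightarrow> k t z \<le> jump_kernel s (z - x);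
    \<And>t z. t \<in> {t1<..t2} \<Longrightarrow> 0 \<le> k t z;
    \<And>t. t \<in> {t1<..t2} \<Longrightarrow> integrable lborel (\<lambda>z. max 0 (u t z - h t * bump ((z - x0) /\<^sub>R R)) * k t z);
    \<And>t. t \<in> {t1<..t2} \<Longrightarrow> h' t + CL * R powr (- (2 * s)) * h t + t powr \<beta> * h t powr p
      \<le> ?A * (LBINT z. max 0 (u t z - h t * bump ((z - x0) /\<^sub>R R)) * k t z)\<rbrakk>
    \<Longrightarrow> \<forall>t\<in>{t1..t2}. \<forall>x. h t * bump ((x - x0) /\<^sub>R R) \<le> u t x"
  assume C12: "C1 \<ge> 0" "C2 \<ge> 0" and UB: "\<And>(u :: real \<Rightarrow> 'a \<Rightarrow> real) x0 R a b \<Lambda> B.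
    \<lbrakk>absorption_sol s \<beta> p u; R > 0; 0 < a; a < b; \<Lambda> > 1;
    C1 * R powr (- (2 * s)) < (\<Lambda> powr (p - 1) - 1) * ((1 + \<beta>) / ((p - 1) * b));
    \<And>n. integral {a..b} (tail_cbox s R x0 u n) \<le> B\<rbrakk> \<Longrightarrow>
    u b x0 \<le> \<Lambda> * flat_sol p \<beta> a b + C2 * B"
  let ?w = "\<lambda>z::'a. 1 / (1 + norm (z - 0)) powr ?e"
  have iw: "integrable lborel ?w" using integrable_weight[of "2 * s", where 'a='a] s by simp
  define c1 where "c1 = integral\<^sup>L lborel ?w"
  have c1: "c1 \<ge> 0" unfolding c1_def by (intro integral_nonneg_AE AE_I2) auto
  define a' where "a' = ?A * (1 / 2 powr ?e)"
  have a': "a' > 0" unfolding a'_def using A by simp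
  define b0 where "b0 = max 1 ((1/2) powr \<beta>)"
  \<comment> \<open>The decay rate of the barrier height \<open>h\<close> has to cover the linear
    cost of the bump, the absorption, which is at most \<open>b0 * h\<close> while
    \<open>h <= 1\<close>, and the mass of the barrier itself, subtracted from that of
    \<open>u\<close>.\<close>
  define K where "K = CL * 2 powr (- (2 * s)) + b0 + a' * c1"
  have K: "K \<ge> 0" unfolding K_def b0_def using CL a' c1 by (intro add_nonneg_nonneg mult_nonneg_nonneg) auto
  \<comment> \<open>The height of the lower barrier on the unit ball at time 1 when
    \<open>a' * J 1 >= 1\<close>: then \<open>\<theta> * J 1 >= 1/2\<close>, the damping is
    \<open>exp (- K / 2)\<close>, and the bump of radius 2 is at least \<open>9/16\<close>.\<close>
  define c where "c = exp (- K / 2) * (9/16) / 2"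
  have c: "c > 0" by (simp add: c_def)
  \<comment> \<open>Chosen so that the right side of the condition in \<open>UB\<close> equals
    \<open>C1 + 1\<close> at \<open>R = b = 1\<close>.\<close>
  define \<Lambda> where "\<Lambda> = (1 + (C1 + 1) * (p - 1) / (1 + \<beta>)) powr (1 / (p - 1))"
  have base: "(C1 + 1) * (p - 1) / (1 + \<beta>) > 0" using C12 p \<beta> by (intro divide_pos_pos mult_pos_pos) auto
  have L1: "\<Lambda> > 1" unfolding \<Lambda>_def using base p by (intro gr_one_powr) auto
  have Lp: "\<Lambda> powr (p - 1) = 1 + (C1 + 1) * (p - 1) / (1 + \<beta>)"
    unfolding \<Lambda>_def using base p by (simp add: powr_powr)
  define C where "C = \<Lambda> * flat_sol p \<beta> (1/2) 1 + C2 * (1 / a')"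
  have C: "C > 0" unfolding C_def
    using L1 flat_sol_pos[OF p \<beta>, of "1/2" 1] C12 a' by (intro add_pos_nonneg mult_pos_pos mult_nonneg_nonneg) auto
  show ?thesis
  proof (rule exI[of _ c], rule conjI[OF c], rule exI[of _ C], rule conjI[OF C], intro allI impI, rule ccontr)
    fix u :: "real \<Rightarrow> 'a \<Rightarrow> real" and x :: 'a
    assume u: "absorption_sol s \<beta> p u" and big: "u 1 0 > C" and x: "norm x \<le> 1" and neg: "\<not> c \<le> u 1 x"
    have In: "integral {1/2..1} (tail_cbox s 1 0 u n) \<le> 1 / a'" for n
    proof -
      let ?Tn = "tail_cbox s 1 0 u n"
      define J where "J t = integral {1/2..t} ?Tn" for t
      have cT: "continuous_on {1/2..1} ?Tn"
        by (rule continuous_on_subset[OF tail_cbox_continuous[OF s u]]) auto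
      have J0: "J t \<ge> 0" if "t \<in> {1/2..1}" for t
        unfolding J_def
        by (rule Henstock_Kurzweil_Integration.integral_nonneg)
          (use that tail_cbox_nonneg[OF s u] in \<open>auto intro!: integrable_continuous_interval continuous_on_subset[OF cT]\<close>)
      have Jm: "J t \<le> J 1" if "t \<in> {1/2..1}" for t
      proof -
        have "J t + integral {t..1} ?Tn = J 1" unfolding J_def
          using that by (intro Henstock_Kurzweil_Integration.integral_combine integrable_continuous_interval cT) auto
        moreover have "integral {t..1} ?Tn \<ge> 0"
          by (rule Henstock_Kurzweil_Integration.integral_nonneg)
            (use that tail_cbox_nonneg[OF s u] in \<open>auto intro!: integrable_continuous_interval continuous_on_subset[OF cT]\<close>)
        ultimately show ?thesis by linarith
      qed
      \<comment> \<open>This amplitude is below both \<open>a'\<close> and \<open>1 / J 1\<close>: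
        the first lets the tail drive \<open>h\<close>, the second keeps \<open>h <= 1\<close>, so
        that \<open>h powr p <= h\<close>. It is also at least half of the smaller of the
        two.\<close>
      define \<theta> where "\<theta> = a' / (1 + a' * J 1)"
      have J1: "J 1 \<ge> 0" by (rule J0) auto
      have den: "1 + a' * J 1 > 0" using J1 a' by (intro add_pos_nonneg) auto
      have th: "0 < \<theta>" "\<theta> \<le> a'" "\<theta> * J 1 \<le> 1"
        using den a' J1 by (auto simp: \<theta>_def divide_le_eq mult_le_cancel_left1)
      define h where "h t = \<theta> * exp (- K * (t - 1/2)) * J t" for t
      define h' where "h' t = \<theta> * exp (- K * (t - 1/2)) * ?Tn t - K * h t" for t
      let ?cb = "cbox (- real n *\<^sub>R One) (real n *\<^sub>R (One::'a))"
      \<comment> \<open>From the ball of radius 2 a jump to \<open>z\<close> has length at most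
        \<open>2 * (1 + norm z)\<close>, which bounds the kernel below by a function of
        \<open>z\<close> alone. The box makes the collected mass continuous in time.\<close>
      define k where "k = (\<lambda>(t::real) z::'a. indicator ?cb z * (?w z * (1 / 2 powr ?e)))"
      have hh: "0 \<le> h t \<and> h t \<le> 1" if "t \<in> {1/2..1}" for t
      proof
        show "0 \<le> h t" unfolding h_def using th J0[OF that] by (intro mult_nonneg_nonneg) auto
        have "exp (- K * (t - 1/2)) \<le> 1" using K that by (auto intro!: mult_nonneg_nonneg)
        then have "\<theta> * exp (- K * (t - 1/2)) * J t \<le> \<theta> * 1 * J 1"
          using th J0[OF that] Jm[OF that] by (intro mult_mono) auto
        then show "h t \<le> 1" unfolding h_def mult_1_right using th(3) by linarith
      qed
      have "\<forall>t\<in>{1/2..1}. \<forall>x. h t * bump ((x - 0) /\<^sub>R 2) \<le> u t x"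
      proof (rule LB[OF u, of 2 "1/2" 1 h h' 0 k])
        fix t :: real assume t: "t \<in> {1/2..1}"
        have "(J has_real_derivative ?Tn t) (at t within {1/2..1})"
          unfolding J_def by (rule integral_has_real_derivative[OF cT t])
        then show "(h has_real_derivative h' t) (at t within {1/2..1})"
          unfolding h_def[abs_def] h'_def by (auto intro!: derivative_eq_intros simp: h_def)
        show "0 \<le> h t" using hh[OF t] by simp
      next
        fix x
        have "h (1/2) = 0" by (simp add: h_def J_def)
        then show "h (1/2) * bump ((x - 0) /\<^sub>R 2) \<le> u (1/2) x" using sol_pos[OF u, of "1/2" x] by simp
      next
        fix t :: real assume t': "t \<in> {1/2<..1}"
        then have t: "t \<in> {1/2..1}" and t0: "t > 0" by auto
        have mcb: "(\<lambda>z::'a. indicator ?cb z :: real) \<in> borel_measurable borel" by simp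
        have mw: "?w \<in> borel_measurable borel" by measurable
        show mk: "k t \<in> borel_measurable borel" unfolding k_def
          by (intro borel_measurable_times mcb mw) auto
        show "0 \<le> k t z" for z by (simp add: k_def)
        show "k t z \<le> jump_kernel s (z - x)" if "norm (x - 0) < 2" "z \<noteq> x" for x z
        proof -
          have "norm (z - x) \<le> norm z + norm x" by (rule norm_triangle_ineq4)
          also have "\<dots> \<le> norm z + 2" using that(1) by simp
          also have "\<dots> \<le> 2 * (1 + norm z)" by simp
          finally have "norm (z - x) \<le> 2 * (1 + norm z)" .
          then have "1 / (2 * (1 + norm z)) powr ?e \<le> jump_kernel s (z - x)" using that by (intro jump_kernel_ge s) auto
          moreover have "(2 * (1 + norm z)) powr ?e = 2 powr ?e * (1 + norm z) powr ?e" by (rule powr_mult; simp)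
          moreover have "k t z \<le> 1 / (2 powr ?e * (1 + norm z) powr ?e)" by (auto simp: k_def mult.commute split: split_indicator)
          ultimately show ?thesis by simp
        qed
        have iu: "integrable lborel (\<lambda>z. indicator ?cb z * (u t z * ?w z))"
          using integrable_mult_indicator[OF _ tail_integrable[OF s u t0, of 1 0], of ?cb] by simp
        let ?m = "\<lambda>z. max 0 (u t z - h t * bump ((z - 0) /\<^sub>R 2)) * k t z"
        have mm: "?m \<in> borel_measurable lborel"
          using sol_measurable[OF u t0] mk by measurable
        have le_u: "max 0 (u t z - h t * bump ((z - 0) /\<^sub>R 2)) \<le> u t z" for z
          using sol_pos[OF u t0, of z] hh[OF t] by (auto simp: max_def)
        show im: "integrable lborel ?m"
        proof (rule Bochner_Integration.integrable_bound[OF integrable_mult_right[OF iu, of "1 / 2 powr ?e"] mm], rule AE_I2)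
          fix z
          have "?m z \<le> u t z * k t z" using le_u by (intro mult_right_mono) (auto simp: k_def)
          also have "\<dots> = (1 / 2 powr ?e) * (indicator ?cb z * (u t z * ?w z))" by (simp only: k_def mult_ac)
          finally show "norm (?m z) \<le> norm ((1 / 2 powr ?e) * (indicator ?cb z * (u t z * ?w z)))"
            using sol_pos[OF u t0, of z] by (simp add: k_def abs_mult)
        qed
        have "(1 / 2 powr ?e) * (?Tn t - h t * c1) = (LBINT z. (1 / 2 powr ?e) * (indicator ?cb z * (u t z * ?w z) - h t * ?w z))"
          by (simp only: integral_mult_right_zero Bochner_Integration.integral_diff[OF iu integrable_mult_right[OF iw]] tail_cbox_eq[OF s u t0 zero_less_one] c1_def)
        also have "\<dots> \<le> integral\<^sup>L lborel ?m"
        proof (rule integral_mono[OF _ im])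
          show "integrable lborel (\<lambda>z. (1 / 2 powr ?e) * (indicator ?cb z * (u t z * ?w z) - h t * ?w z))"
            by (intro integrable_mult_right Bochner_Integration.integrable_diff iu iw)
          fix z :: 'a
          have "h t * bump ((z - 0) /\<^sub>R 2) \<le> h t * 1" using hh[OF t] by (intro mult_left_mono) auto
          then have "(u t z - h t) * k t z \<le> ?m z" by (intro mult_right_mono) (auto simp: k_def)
          moreover have "(1 / 2 powr ?e) * (indicator ?cb z * (u t z * ?w z) - h t * ?w z) \<le> (u t z - h t) * k t z"
          proof (cases "z \<in> ?cb")
            case True
            then have i1: "indicator ?cb z = (1::real)" by simp
            show ?thesis unfolding k_def i1 by (simp only: mult_1_left left_diff_distrib right_diff_distrib mult_ac order_refl)
          next
            case False
            then have i0: "indicator ?cb z = (0::real)" by simp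
            have "0 \<le> (1 / 2 powr ?e) * (h t * ?w z)" using hh[OF t] by (intro mult_nonneg_nonneg) auto
            then show ?thesis unfolding k_def i0 by (simp only: mult_zero_left mult_zero_right right_diff_distrib)
          qed
          ultimately show "(1 / 2 powr ?e) * (indicator ?cb z * (u t z * ?w z) - h t * ?w z) \<le> ?m z" by linarith
        qed
        finally have "?A * ((1 / 2 powr ?e) * (?Tn t - h t * c1)) \<le> ?A * integral\<^sup>L lborel ?m"
          by (rule mult_left_mono) (use A in simp)
        then have "a' * (?Tn t - h t * c1) \<le> ?A * integral\<^sup>L lborel ?m"
          by (simp only: a'_def mult.assoc)
        moreover have "h' t + CL * 2 powr (- (2 * s)) * h t + t powr \<beta> * h t powr p \<le> a' * (?Tn t - h t * c1)"
        proof -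
          have T0: "?Tn t \<ge> 0" by (rule tail_cbox_nonneg[OF s u t0]) simp
          have "\<theta> * exp (- K * (t - 1/2)) \<le> a' * 1"
            using th K t by (intro mult_mono) auto
          then have 1: "\<theta> * exp (- K * (t - 1/2)) * ?Tn t \<le> a' * ?Tn t" using T0 by (intro mult_right_mono) auto
          have 2: "t powr \<beta> * h t powr p \<le> b0 * h t"
          proof (rule mult_mono)
            show "t powr \<beta> \<le> b0"
            proof (cases "\<beta> \<ge> 0")
              case True
              then have "t powr \<beta> \<le> 1 powr \<beta>" using t by (intro powr_mono2) auto
              then show ?thesis by (simp add: b0_def)
            next
              case False
              then have "t powr \<beta> \<le> (1/2) powr \<beta>" using t by (intro powr_mono2') auto
              then show ?thesis by (simp add: b0_def)
            qed
            show "h t powr p \<le> h t"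
            proof (cases "h t = 0")
              case False
              then have "h t powr p \<le> h t powr 1" using hh[OF t] p by (intro powr_mono') auto
              then show ?thesis using hh[OF t] by simp
            qed simp
          qed (use hh[OF t] in \<open>auto simp: b0_def\<close>)
          have "K * h t = CL * 2 powr (- (2 * s)) * h t + b0 * h t + a' * (h t * c1)"
            by (simp add: K_def algebra_simps)
          then show ?thesis unfolding h'_def using 1 2 by (simp add: right_diff_distrib)
        qed
        ultimately show "h' t + CL * 2 powr (- (2 * s)) * h t + t powr \<beta> * h t powr p \<le> ?A * integral\<^sup>L lborel ?m" by linarith
      qed auto
      then have "h 1 * bump (x /\<^sub>R 2) \<le> u 1 x" by simp
      moreover have "bump (x /\<^sub>R 2) \<ge> (1 - (1/2)\<^sup>2)\<^sup>2" using x by (intro bump_ge_scaled) auto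
      then have "h 1 * (9/16) \<le> h 1 * bump (x /\<^sub>R 2)" using hh[of 1] by (intro mult_left_mono) (auto simp: power2_eq_square)
      ultimately have "h 1 * (9/16) < c" using neg by linarith
      then have "\<theta> * J 1 * (exp (- K / 2) * (9/16)) < (1/2) * (exp (- K / 2) * (9/16))"
        by (simp add: h_def c_def mult_ac)
      then have "\<theta> * J 1 < 1/2" by (simp only: mult_less_cancel_right) auto
      then have "2 * (a' * J 1) < 1 + a' * J 1" using den by (simp add: \<theta>_def field_simps)
      then have "a' * J 1 < 1" by simp
      then show ?thesis using a' by (simp add: J_def field_simps)
    qed
    have "u 1 0 \<le> \<Lambda> * flat_sol p \<beta> (1/2) 1 + C2 * (1 / a')"
    proof (rule UB[OF u, of 1 "1/2" 1 \<Lambda>])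
      have "(\<Lambda> powr (p - 1) - 1) * ((1 + \<beta>) / ((p - 1) * 1)) = C1 + 1"
        unfolding Lp using p \<beta> by simp
      then show "C1 * 1 powr (- (2 * s)) < (\<Lambda> powr (p - 1) - 1) * ((1 + \<beta>) / ((p - 1) * 1))" by simp
    qed (use L1 In in auto)
    then show False using big by (simp add: C_def)
  qed
qed

section \<open>Parabolic scaling\<close>

lemma frac_lap_affine:
  fixes \<phi> :: "'a::euclidean_space \<Rightarrow> real"
  assumes f: "frac_lap s \<phi> (z + r *\<^sub>R x) L" and r: "r > 0"
  shows "frac_lap s (\<lambda>y. \<phi> (z + r *\<^sub>R y)) x (r powr (2 * s) * L)"
proof -
  let ?e = "real DIM('a) + 2 * s" and ?X = "z + r *\<^sub>R x"
  let ?F = "\<lambda>\<epsilon> w. indicator {w. norm w > \<epsilon>} w * ((\<phi> ?X - \<phi> (?X + w)) * jump_kernel s w)"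
  let ?G = "\<lambda>\<epsilon> y. indicator {y. norm y > \<epsilon>} y * ((\<phi> ?X - \<phi> (z + r *\<^sub>R (x + y))) * jump_kernel s y)"
  have eq: "?G \<epsilon> y = r powr ?e * ?F (r * \<epsilon>) (0 + r *\<^sub>R y)" for \<epsilon> y
  proof -
    have i: "indicator {y. norm y > \<epsilon>} y = (indicator {w. norm w > r * \<epsilon>} (r *\<^sub>R y) :: real)"
      using r by (simp add: indicator_def)
    have j: "jump_kernel s y = r powr ?e * jump_kernel s (r *\<^sub>R y)" using r by (simp add: jump_kernel_scale)
    have "?X + r *\<^sub>R y = z + r *\<^sub>R (x + y)" by (simp add: scaleR_add_right)
    then show ?thesis unfolding add_0_left i j by (simp only: mult_ac)
  qed
  have iF: "integrable lborel (?F \<epsilon>)" if "\<epsilon> > 0" for \<epsilon> using f that by (simp add: frac_lap_def)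
  have mF: "?F \<epsilon> \<in> borel_measurable borel" if "\<epsilon> > 0" for \<epsilon>
    using borel_measurable_integrable[OF iF[OF that]] by simp
  have G: "integrable lborel (?G \<epsilon>) \<and> integral\<^sup>L lborel (?G \<epsilon>) = r powr (2 * s) * integral\<^sup>L lborel (?F (r * \<epsilon>))" if "\<epsilon> > 0" for \<epsilon>
  proof -
    have re: "r * \<epsilon> > 0" using r that by simp
    have i: "integrable lborel (\<lambda>y. ?F (r * \<epsilon>) (0 + r *\<^sub>R y))"
      using lborel_integrable_affine[OF mF[OF re], of r 0] r iF[OF re] by blast
    have "integral\<^sup>L lborel (?G \<epsilon>) = r powr ?e * (integral\<^sup>L lborel (?F (r * \<epsilon>)) / \<bar>r\<bar> ^ DIM('a))"
      unfolding eq integral_mult_right_zero using r by (subst lborel_integral_affine[OF mF[OF re]]) auto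
    also have "\<dots> = r powr (2 * s) * integral\<^sup>L lborel (?F (r * \<epsilon>))"
      using r by (simp add: powr_add powr_realpow)
    finally show ?thesis unfolding eq using i by (simp add: integrable_mult_right)
  qed
  have "filterlim (\<lambda>\<epsilon>. r * \<epsilon>) (at_right 0) (at_right 0)"
    unfolding filterlim_at using r
    by (auto intro!: tendsto_eq_intros eventually_mono[OF eventually_at_right_less[of "0::real"]])
  then have "((\<lambda>\<epsilon>. frac_const DIM('a) s * integral\<^sup>L lborel (?F (r * \<epsilon>))) \<longlongrightarrow> L) (at_right 0)"
    using filterlim_compose[of "\<lambda>\<epsilon>. frac_const DIM('a) s * integral\<^sup>L lborel (?F \<epsilon>)" "nhds L" "at_right 0"] f
    by (simp add: frac_lap_def)
  then have "((\<lambda>\<epsilon>. r powr (2 * s) * (frac_const DIM('a) s * integral\<^sup>L lborel (?F (r * \<epsilon>)))) \<longlongrightarrow> r powr (2 * s) * L) (at_right 0)"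
    by (intro tendsto_intros)
  moreover have "\<forall>\<^sub>F \<epsilon> in at_right 0. r powr (2 * s) * (frac_const DIM('a) s * integral\<^sup>L lborel (?F (r * \<epsilon>))) = frac_const DIM('a) s * integral\<^sup>L lborel (?G \<epsilon>)"
    using eventually_at_right_less[of "0::real"]
  proof eventually_elim
    case (elim \<epsilon>)
    then show ?case using G[of \<epsilon>] by (simp only: mult.left_commute)
  qed
  ultimately have "((\<lambda>\<epsilon>. frac_const DIM('a) s * integral\<^sup>L lborel (?G \<epsilon>)) \<longlongrightarrow> r powr (2 * s) * L) (at_right 0)"
    by (rule Lim_transform_eventually)
  then show ?thesis unfolding frac_lap_def using G by blast
qed

text \<open>The scaling that leaves the equation invariant: the amplitude exponent balances the
  weight \<open>t^\<beta>\<close> against the power \<open>p\<close>, the space exponent reflects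
  the order \<open>2 s\<close>. It moves the point \<open>(\<mu>, z)\<close> to
  \<open>(1, 0)\<close>.\<close>

definition rescale :: "real \<Rightarrow> real \<Rightarrow> real \<Rightarrow> real \<Rightarrow> 'a \<Rightarrow> (real \<Rightarrow> 'a::euclidean_space \<Rightarrow> real) \<Rightarrow> real \<Rightarrow> 'a \<Rightarrow> real" where
  "rescale s \<beta> p \<mu> z u t x = \<mu> powr ((1 + \<beta>) / (p - 1)) * u (\<mu> * t) (z + \<mu> powr (1 / (2 * s)) *\<^sub>R x)"

lemma absorption_sol_rescale:
  fixes u :: "real \<Rightarrow> 'a::euclidean_space \<Rightarrow> real"
  assumes s: "0 < s" "s < 1" and p: "p > 1" and u: "absorption_sol s \<beta> p u" and l: "\<mu> > 0"
  shows "absorption_sol s \<beta> p (rescale s \<beta> p \<mu> z u)"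
proof -
  define cc where "cc = \<mu> powr ((1 + \<beta>) / (p - 1))"
  define rr where "rr = \<mu> powr (1 / (2 * s))"
  let ?e = "real DIM('a) + 2 * s"
  have c: "cc > 0" and r: "rr > 0" using l by (auto simp: cc_def rr_def)
  have r2: "rr powr (2 * s) = \<mu>" using s l by (simp add: powr_powr rr_def)
  have resc: "rescale s \<beta> p \<mu> z u = (\<lambda>t x. cc * u (\<mu> * t) (z + rr *\<^sub>R x))"
    by (simp add: rescale_def[abs_def] cc_def rr_def)
  \<comment> \<open>This forces the amplitude exponent: the time derivative and the operator each
    produce one factor \<open>\<mu>\<close>, and the weight contributes
    \<open>\<mu> powr \<beta>\<close>.\<close>
  have cp: "cc powr p = cc * (\<mu> * \<mu> powr \<beta>)"
  proof -
    have "cc powr p = cc powr (1 + (p - 1))" by simp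
    also have "\<dots> = cc * cc powr (p - 1)" using c by (simp only: powr_add powr_one)
    also have "cc powr (p - 1) = \<mu> powr (1 + \<beta>)" using p by (simp add: powr_powr cc_def)
    also have "\<dots> = \<mu> * \<mu> powr \<beta>" using l by (simp add: powr_add)
    finally show ?thesis .
  qed
  show ?thesis unfolding absorption_sol_def
  proof (intro conjI allI impI)
    have "continuous_on ({0<..} \<times> UNIV) (\<lambda>q. (\<lambda>(t, x). u t x) (\<mu> * fst q, z + rr *\<^sub>R snd q))"
      by (rule continuous_on_compose2[OF sol_cont[OF u, of "{0<..}" UNIV]])
         (use l in \<open>auto intro!: continuous_intros\<close>)
    then show "continuous_on ({0<..} \<times> UNIV) (\<lambda>(t, x). rescale s \<beta> p \<mu> z u t x)"
      unfolding resc split_def by (auto intro!: continuous_on_mult)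
  next
    fix t :: real assume t: "t > 0"
    then have lt: "\<mu> * t > 0" using l by simp
    let ?g = "\<lambda>x. u (\<mu> * t) x * (1 / (rr + norm (x - z)) powr ?e)"
    have ig: "integrable lborel ?g" by (rule tail_integrable[OF s u lt r])
    have mg: "?g \<in> borel_measurable borel" using borel_measurable_integrable[OF ig] by simp
    have "rescale s \<beta> p \<mu> z u t y * (1 / (1 + norm y) powr ?e) = cc * rr powr ?e * ?g (z + rr *\<^sub>R y)" for y
    proof -
      have "rr + norm (z + rr *\<^sub>R y - z) = rr * (1 + norm y)" using r by (simp add: algebra_simps)
      then have "(rr + norm (z + rr *\<^sub>R y - z)) powr ?e = rr powr ?e * (1 + norm y) powr ?e"
        using powr_mult[of rr "1 + norm y" ?e] by simp
      then show ?thesis using r by (simp add: resc)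
    qed
    moreover have "integrable lborel (\<lambda>y. cc * rr powr ?e * ?g (z + rr *\<^sub>R y))"
      using lborel_integrable_affine[OF mg, where c="rr" and t=z] r ig by (intro integrable_mult_right) blast
    ultimately show "integrable lborel (\<lambda>y. rescale s \<beta> p \<mu> z u t y * (1 / (1 + norm y) powr ?e))" by simp
  next
    fix t :: real and x assume "t > 0"
    then show "rescale s \<beta> p \<mu> z u t x > 0"
      unfolding resc using c l by (intro mult_pos_pos sol_pos[OF u]) auto
  next
    fix t :: real and x assume t: "t > 0"
    then have lt: "\<mu> * t > 0" using l by simp
    let ?X = "z + rr *\<^sub>R x"
    obtain ut L where d: "((\<lambda>\<tau>. u \<tau> ?X) has_real_derivative ut) (at (\<mu> * t))" "frac_lap s (u (\<mu> * t)) ?X L"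
        "ut + L + (\<mu> * t) powr \<beta> * u (\<mu> * t) ?X powr p = 0"
      using u lt unfolding absorption_sol_def by blast
    show "\<exists>ut L. ((\<lambda>\<tau>. rescale s \<beta> p \<mu> z u \<tau> x) has_real_derivative ut) (at t) \<and>
        frac_lap s (rescale s \<beta> p \<mu> z u t) x L \<and> ut + L + t powr \<beta> * rescale s \<beta> p \<mu> z u t x powr p = 0"
    proof (rule exI[of _ "cc * (ut * \<mu>)"], rule exI[of _ "cc * (\<mu> * L)"], intro conjI)
      have "((\<lambda>\<tau>. u (\<mu> * \<tau>) ?X) has_real_derivative ut * \<mu>) (at t)"
        by (rule DERIV_chain2[where f="\<lambda>\<tau>. u \<tau> ?X" and g="\<lambda>\<tau>. \<mu> * \<tau>", OF d(1)]) (auto intro!: derivative_eq_intros)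
      then show "((\<lambda>\<tau>. rescale s \<beta> p \<mu> z u \<tau> x) has_real_derivative cc * (ut * \<mu>)) (at t)"
        unfolding resc by (rule DERIV_cmult)
      show "frac_lap s (rescale s \<beta> p \<mu> z u t) x (cc * (\<mu> * L))"
        unfolding resc using frac_lap_cmult[OF frac_lap_affine[OF d(2) r], of cc] by (simp add: r2)
      have "t powr \<beta> * rescale s \<beta> p \<mu> z u t x powr p = t powr \<beta> * (cc powr p * u (\<mu> * t) ?X powr p)"
        using sol_pos[OF u lt, of ?X] c by (simp add: resc powr_mult)
      also have "\<dots> = cc * \<mu> * ((\<mu> * t) powr \<beta> * u (\<mu> * t) ?X powr p)"
        using l t by (simp add: cp powr_mult)
      finally have e: "t powr \<beta> * rescale s \<beta> p \<mu> z u t x powr p = cc * \<mu> * ((\<mu> * t) powr \<beta> * u (\<mu> * t) ?X powr p)" .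
      have "cc * (ut * \<mu>) + cc * (\<mu> * L) + t powr \<beta> * rescale s \<beta> p \<mu> z u t x powr p
        = cc * \<mu> * (ut + L + (\<mu> * t) powr \<beta> * u (\<mu> * t) ?X powr p)"
        unfolding e by (simp only: distrib_left mult_ac)
      then show "cc * (ut * \<mu>) + cc * (\<mu> * L) + t powr \<beta> * rescale s \<beta> p \<mu> z u t x powr p = 0"
        using d(3) by simp
    qed
  qed
qed

text \<open>\<open>harnack_unit\<close> for the solution rescaled about \<open>(t, y)\<close>. Its
  constants serve all solutions at once, so both thresholds merely acquire the same power of
  \<open>t\<close>.\<close>

lemma harnack_dichotomy:
  assumes s: "0 < s" "s < 1" and p: "p > 1" and \<beta>: "\<beta> > -1"
  shows "\<exists>c>0. \<exists>C>0. \<forall>(u :: real \<Rightarrow> 'a::euclidean_space \<Rightarrow> real) t y.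
    absorption_sol s \<beta> p u \<longrightarrow> t > 0 \<longrightarrow> u t y > C * t powr (- ((1 + \<beta>) / (p - 1))) \<longrightarrow>
    (\<forall>x. norm (x - y) \<le> t powr (1 / (2 * s)) \<longrightarrow> c * t powr (- ((1 + \<beta>) / (p - 1))) \<le> u t x)"
proof -
  obtain c C where c: "c > 0" and C: "C > 0" and H: "\<And>u :: real \<Rightarrow> 'a \<Rightarrow> real. absorption_sol s \<beta> p u \<Longrightarrow> u 1 0 > C \<Longrightarrow> (\<forall>x. norm x \<le> 1 \<longrightarrow> c \<le> u 1 x)"
    using harnack_unit[OF s p \<beta>, where 'a='a] by blast
  show ?thesis
  proof (rule exI[of _ c], rule conjI[OF c], rule exI[of _ C], rule conjI[OF C], intro allI impI)
    fix u :: "real \<Rightarrow> 'a \<Rightarrow> real" and t y x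
    let ?al = "(1 + \<beta>) / (p - 1)" and ?r = "t powr (1 / (2 * s))"
    assume u: "absorption_sol s \<beta> p u" and t: "t > 0" and big: "u t y > C * t powr (- ?al)" and x: "norm (x - y) \<le> ?r"
    have r: "?r > 0" using t by simp
    let ?v = "rescale s \<beta> p t y u"
    have "?v 1 0 = t powr ?al * u t y" by (simp add: rescale_def)
    moreover have "t powr ?al * u t y > t powr ?al * (C * t powr (- ?al))" using big t by (intro mult_strict_left_mono) auto
    moreover have "t powr ?al * (C * t powr (- ?al)) = C" using t by (simp add: powr_minus)
    ultimately have "?v 1 0 > C" by simp
    moreover have "norm ((x - y) /\<^sub>R ?r) \<le> 1" unfolding norm_divideR[OF r] using x r by simp
    ultimately have "c \<le> ?v 1 ((x - y) /\<^sub>R ?r)" using H[OF absorption_sol_rescale[OF s p u t, of y]] by blast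
    also have "\<dots> = t powr ?al * u t x" using r by (simp add: rescale_def)
    finally show "c * t powr (- ?al) \<le> u t x" using t by (simp add: powr_minus field_simps)
  qed
qed

section \<open>The linear flow\<close>

lemma exp_weight_bounded:
  assumes "c > 0" "a > (0::real)"
  shows "\<exists>K. \<forall>r\<ge>0. (1 + r) powr M * exp (- (c * r powr a)) \<le> K"
proof -
  let ?f = "\<lambda>r::real. (1 + r) powr M * exp (- (c * r powr a))"
  have "(?f \<longlongrightarrow> 0) at_top" using assms by real_asymp
  then have "\<forall>\<^sub>F r in at_top. ?f r < 1" by (rule order_tendstoD(2)) simp
  then obtain R where R: "\<And>r. r \<ge> R \<Longrightarrow> ?f r < 1" by (auto simp: eventually_at_top_linorder)
  have "continuous_on {0..max 0 R} ?f"
    using assms by (intro continuous_intros continuous_on_powr') auto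
  then have "\<exists>x\<in>{0..max 0 R}. \<forall>y\<in>{0..max 0 R}. ?f y \<le> ?f x"
    by (intro continuous_attains_sup) auto
  then obtain x where x: "\<forall>y\<in>{0..max 0 R}. ?f y \<le> ?f x" by blast
  have "?f r \<le> max 1 (?f x)" if "r \<ge> 0" for r
  proof (cases "r \<ge> R")
    case True
    then show ?thesis using R[of r] by linarith
  next
    case False
    then have "?f r \<le> ?f x" using that by (intro x[rule_format]) auto
    then show ?thesis by linarith
  qed
  then show ?thesis by blast
qed

text \<open>Covers the decay coming from the symbol (\<open>a = 2 * s\<close>) and the Gaussian
  factor (\<open>a = 2\<close>) alike; the power \<open>m\<close> leaves room for the growth of the
  symbol.\<close>

lemma integrable_exp_weight:
  assumes "c > 0" "a > (0::real)"
  shows "integrable lborel (\<lambda>\<xi>::'a::euclidean_space. (1 + norm \<xi>) powr m * exp (- (c * norm \<xi> powr a)))"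
proof -
  let ?N = "real DIM('a)"
  obtain K where K: "\<And>r. r \<ge> 0 \<Longrightarrow> (1 + r) powr (m + ?N + 1) * exp (- (c * r powr a)) \<le> K"
    using exp_weight_bounded[OF assms] by blast
  show ?thesis
  proof (rule Bochner_Integration.integrable_bound)
    show "integrable lborel (\<lambda>\<xi>::'a. K * (1 / (1 + norm \<xi>) powr (?N + 1)))"
      by (intro integrable_mult_right integrable_weight) simp
    show "AE \<xi>::'a in lborel. norm ((1 + norm \<xi>) powr m * exp (- (c * norm \<xi> powr a))) \<le> norm (K * (1 / (1 + norm \<xi>) powr (?N + 1)))"
    proof (rule AE_I2)
      fix \<xi> :: 'a
      let ?r = "norm \<xi>"
      have p: "1 + ?r > 0" by (simp add: add_pos_nonneg)
      have "1 \<le> K" using K[of 0] by simp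
      have "(1 + ?r) powr m * exp (- (c * ?r powr a)) * (1 + ?r) powr (?N + 1) \<le> K"
        using K[of ?r] by (simp add: powr_add mult_ac)
      moreover have "(1 + ?r) powr (?N + 1) > 0" using p by simp
      ultimately have "(1 + ?r) powr m * exp (- (c * ?r powr a)) \<le> K * (1 / (1 + ?r) powr (?N + 1))"
        by (simp only: pos_le_divide_eq mult_1_right times_divide_eq_right)
      then show "norm ((1 + ?r) powr m * exp (- (c * ?r powr a))) \<le> norm (K * (1 / (1 + ?r) powr (?N + 1)))"
        using \<open>1 \<le> K\<close> by simp
    qed
  qed measurable
qed

lemma one_minus_cos_le: "1 - cos x \<le> x\<^sup>2 / 2" for x :: real
proof -
  have "1 - cos x = 2 * (sin (x / 2))\<^sup>2" using cos_double_sin[of "x / 2"] by simp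
  also have "(sin (x / 2))\<^sup>2 \<le> (x / 2)\<^sup>2" using abs_sin_x_le_abs_x[of "x / 2"] by (simp add: abs_le_square_iff[symmetric])
  finally show ?thesis by (simp add: power2_eq_square)
qed

section \<open>The Fourier multiplier and the mollified flow\<close>

text \<open>The Fourier multiplier in Levy-Khintchine form. By scaling and rotation it is a constant
  multiple of \<open>|\<xi>|^(2 s)\<close>; nonnegativity, measurability and crude bounds from both
  sides are enough here.\<close>

definition lap_symbol :: "real \<Rightarrow> 'a::euclidean_space \<Rightarrow> real" where
  "lap_symbol s \<xi> = frac_const DIM('a) s * (LBINT z. (1 - cos (z \<bullet> \<xi>)) * jump_kernel s z)"

context
  fixes s :: real
  assumes s: "0 < s" "s < 1"
begin

lemma lap_symbol_dominated:
  fixes z \<xi> :: "'a::euclidean_space"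
  shows "(1 - cos (z \<bullet> \<xi>)) * jump_kernel s z \<le>
    (norm \<xi>)\<^sup>2 * (indicator (ball 0 1) z * ((norm z)\<^sup>2 * jump_kernel s z)) + 2 * (indicator {z. 1 \<le> norm z} z * jump_kernel s z)"
proof (cases "norm z < 1")
  case True
  have "1 - cos (z \<bullet> \<xi>) \<le> (z \<bullet> \<xi>)\<^sup>2 / 2" by (rule one_minus_cos_le)
  also have "\<dots> \<le> (z \<bullet> \<xi>)\<^sup>2" by simp
  also have "\<dots> \<le> (norm z * norm \<xi>)\<^sup>2"
    using Cauchy_Schwarz_ineq2[of z \<xi>] by (simp add: abs_le_square_iff[symmetric])
  finally have "(1 - cos (z \<bullet> \<xi>)) * jump_kernel s z \<le> (norm z * norm \<xi>)\<^sup>2 * jump_kernel s z" by (intro mult_right_mono) auto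
  then show ?thesis using True by (simp add: power_mult_distrib mult_ac)
next
  case False
  have "1 - cos (z \<bullet> \<xi>) \<le> 2" using cos_ge_minus_one[of "z \<bullet> \<xi>"] by linarith
  then have "(1 - cos (z \<bullet> \<xi>)) * jump_kernel s z \<le> 2 * jump_kernel s z" by (intro mult_right_mono) auto
  then show ?thesis using False by simp
qed

lemma lap_symbol_dominator_integrable:
  "integrable lborel (\<lambda>z::'a::euclidean_space. c * (indicator (ball 0 1) z * ((norm z)\<^sup>2 * jump_kernel s z)) + 2 * (indicator {z. 1 \<le> norm z} z * jump_kernel s z))"
  using s by (intro Bochner_Integration.integrable_add integrable_mult_right jump_kernel_inner_integrable jump_kernel_outer_integrable) auto

lemma lap_symbol_integrable: "integrable lborel (\<lambda>z::'a::euclidean_space. (1 - cos (z \<bullet> \<xi>)) * jump_kernel s z)"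
proof (rule Bochner_Integration.integrable_bound[OF lap_symbol_dominator_integrable])
  show "(\<lambda>z::'a. (1 - cos (z \<bullet> \<xi>)) * jump_kernel s z) \<in> borel_measurable lborel"
    by (intro borel_measurable_times) auto
  show "AE z in lborel. norm ((1 - cos (z \<bullet> \<xi>)) * jump_kernel s z) \<le>
    norm ((norm \<xi>)\<^sup>2 * (indicator (ball 0 1) z * ((norm z)\<^sup>2 * jump_kernel s z)) + 2 * (indicator {z. 1 \<le> norm z} z * jump_kernel s z))"
    using lap_symbol_dominated[of _ \<xi>] by (intro AE_I2) (simp add: abs_mult)
qed

lemma lap_symbol_nonneg: "lap_symbol s (\<xi>::'a::euclidean_space) \<ge> 0"
  unfolding lap_symbol_def using frac_const_pos[OF s] by (intro mult_nonneg_nonneg integral_nonneg_AE AE_I2) (auto simp: less_imp_le)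

text \<open>Splitting the jumps at length 1 gives only quadratic growth, which suffices because the
  Gaussian factor in \<open>heat_weight\<close> makes every power integrable.\<close>

lemma lap_symbol_upper: "\<exists>C\<ge>0. \<forall>\<xi>::'a::euclidean_space. lap_symbol s \<xi> \<le> C * (1 + norm \<xi>) powr 2"
proof -
  let ?A = "frac_const DIM('a) s"
  have A: "?A > 0" by (rule frac_const_pos[OF s])
  let ?C = "?A * (inner_moment TYPE('a) s + 2 * outer_mass TYPE('a) s)"
  show ?thesis
  proof (intro exI[of _ ?C] conjI allI)
    show "?C \<ge> 0" using A by (intro mult_nonneg_nonneg add_nonneg_nonneg) auto
    fix \<xi> :: 'a
    have "(LBINT z. (1 - cos (z \<bullet> \<xi>)) * jump_kernel s z) \<le> integral\<^sup>L lborel (\<lambda>z::'a.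
      (norm \<xi>)\<^sup>2 * (indicator (ball 0 1) z * ((norm z)\<^sup>2 * jump_kernel s z)) + 2 * (indicator {z. 1 \<le> norm z} z * jump_kernel s z))"
      by (intro integral_mono lap_symbol_integrable lap_symbol_dominator_integrable lap_symbol_dominated)
    also have "\<dots> = (norm \<xi>)\<^sup>2 * inner_moment TYPE('a) s + 2 * outer_mass TYPE('a) s"
      using Bochner_Integration.integral_add[OF integrable_mult_right[OF jump_kernel_inner_integrable[OF s zero_less_one]] integrable_mult_right[OF jump_kernel_outer_integrable[OF s(1) zero_less_one]]]
      by (simp only: integral_mult_right_zero inner_moment_def outer_mass_def)
    also have "\<dots> \<le> (inner_moment TYPE('a) s + 2 * outer_mass TYPE('a) s) * (1 + norm \<xi>)\<^sup>2"
    proof -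
      have "(norm \<xi>)\<^sup>2 * inner_moment TYPE('a) s \<le> (1 + norm \<xi>)\<^sup>2 * inner_moment TYPE('a) s" by (intro mult_right_mono power_mono) auto
      moreover have "1 * (2 * outer_mass TYPE('a) s) \<le> (1 + norm \<xi>)\<^sup>2 * (2 * outer_mass TYPE('a) s)" by (intro mult_right_mono) auto
        moreover have "(inner_moment TYPE('a) s + 2 * outer_mass TYPE('a) s) * (1 + norm \<xi>)\<^sup>2 = (1 + norm \<xi>)\<^sup>2 * inner_moment TYPE('a) s + (1 + norm \<xi>)\<^sup>2 * (2 * outer_mass TYPE('a) s)"
        by (simp add: algebra_simps)
      ultimately show ?thesis by linarith
    qed
    also have "(1 + norm \<xi>)\<^sup>2 = (1 + norm \<xi>) powr 2" using powr_realpow[of "1 + norm \<xi>" 2] by (simp add: add_pos_nonneg)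
    finally show "lap_symbol s \<xi> \<le> ?C * (1 + norm \<xi>) powr 2" unfolding lap_symbol_def using A by (simp add: mult.assoc)
  qed
qed

text \<open>The ball of radius \<open>1 / (2 |\<xi>|)\<close> about \<open>\<xi> / |\<xi>|^2\<close>
  consists of jumps with \<open>z \<bullet> \<xi>\<close> in \<open>[1/2, 3/2]\<close>, where
  \<open>1 - cos\<close> is at least \<open>1 - cos (1/2)\<close>. Its volume and its distance from
  the origin combine to the power \<open>2 s\<close>.\<close>

lemma lap_symbol_lower: "\<exists>c>0. \<forall>\<xi>::'a::euclidean_space. c * norm \<xi> powr (2 * s) \<le> lap_symbol s \<xi>"
proof -
  let ?A = "frac_const DIM('a) s" and ?e = "real DIM('a) + 2 * s" and ?V = "unit_ball_vol (real DIM('a))"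
  have A: "?A > 0" by (rule frac_const_pos[OF s])
  define \<kappa> where "\<kappa> = 1 - cos (1/2 :: real)"
  have kap: "\<kappa> > 0" using cos_monotone_0_pi[of 0 "1/2"] pi_gt3 by (simp add: \<kappa>_def)
  define c where "c = ?A * (\<kappa> * (2/3) powr ?e * (?V * (1/2) ^ DIM('a)))"
  have c: "c > 0" unfolding c_def using A kap by (intro mult_pos_pos) auto
  show ?thesis
  proof (intro exI[of _ c] conjI c allI)
    fix \<xi> :: 'a
    show "c * norm \<xi> powr (2 * s) \<le> lap_symbol s \<xi>"
    proof (cases "\<xi> = 0")
      case True
      then show ?thesis using lap_symbol_nonneg[of \<xi>] by simp
    next
      case False
      define n where "n = norm \<xi>"
      have n: "n > 0" using False by (simp add: n_def)
      let ?B = "ball (\<xi> /\<^sub>R n\<^sup>2) (1 / (2 * n))"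
      have vol: "measure lborel ?B = ?V * (1/2) ^ DIM('a) / n ^ DIM('a)"
        using n by (simp add: content_ball power_divide power_mult_distrib)
      have "\<kappa> * (1 / (3 / (2 * n)) powr ?e) * measure lborel ?B
        = (LBINT z. \<kappa> * (1 / (3 / (2 * n)) powr ?e) * indicator ?B z)" by simp
      also have "\<dots> \<le> (LBINT z. (1 - cos (z \<bullet> \<xi>)) * jump_kernel s z)"
      proof (rule integral_mono[OF _ lap_symbol_integrable])
        show "integrable lborel (\<lambda>z. \<kappa> * (1 / (3 / (2 * n)) powr ?e) * indicator ?B z)"
          using emeasure_lborel_ball_finite by (intro integrable_mult_right integrable_real_indicator) auto
        fix z
        show "\<kappa> * (1 / (3 / (2 * n)) powr ?e) * indicator ?B z \<le> (1 - cos (z \<bullet> \<xi>)) * jump_kernel s z"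
        proof (cases "z \<in> ?B")
          case True
          define w where "w = z - \<xi> /\<^sub>R n\<^sup>2"
          have w: "norm w < 1 / (2 * n)" using True by (simp add: w_def dist_norm norm_minus_commute)
          have zw: "z = \<xi> /\<^sub>R n\<^sup>2 + w" by (simp add: w_def)
          have "z \<bullet> \<xi> = 1 + w \<bullet> \<xi>"
            using n by (simp add: zw inner_add_left n_def power2_norm_eq_inner)
          moreover have "\<bar>w \<bullet> \<xi>\<bar> \<le> 1/2"
          proof -
            have "\<bar>w \<bullet> \<xi>\<bar> \<le> norm w * n" unfolding n_def by (rule Cauchy_Schwarz_ineq2)
            also have "\<dots> \<le> 1 / (2 * n) * n" using w n by (intro mult_right_mono) auto
            finally show ?thesis using n by simp
          qed
          ultimately have zx: "1/2 \<le> z \<bullet> \<xi>" "z \<bullet> \<xi> \<le> 3/2" by linarith+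
          then have "cos (z \<bullet> \<xi>) \<le> cos (1/2)" using pi_gt3 by (intro cos_monotone_0_pi_le) auto
          then have 1: "\<kappa> \<le> 1 - cos (z \<bullet> \<xi>)" by (simp add: \<kappa>_def)
          have z0: "z \<noteq> 0" using zx by auto
          have "norm z \<le> norm (\<xi> /\<^sub>R n\<^sup>2) + norm w" unfolding zw by (rule norm_triangle_ineq)
          also have "norm (\<xi> /\<^sub>R n\<^sup>2) = 1 / n" using n by (simp add: n_def power2_eq_square field_simps)
          finally have "norm z \<le> 1 / n + 1 / (2 * n)" using w by simp
          also have "\<dots> = 3 / (2 * n)" using n by (simp add: field_simps)
          finally have 2: "1 / (3 / (2 * n)) powr ?e \<le> jump_kernel s z" by (intro jump_kernel_ge s z0)
          have "\<kappa> * (1 / (3 / (2 * n)) powr ?e) \<le> (1 - cos (z \<bullet> \<xi>)) * jump_kernel s z"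
            using kap by (intro mult_mono 1 2) auto
          then show ?thesis using True by simp
        qed simp
      qed
      finally have "?A * (\<kappa> * (1 / (3 / (2 * n)) powr ?e) * measure lborel ?B) \<le> lap_symbol s \<xi>"
        unfolding lap_symbol_def using A by (intro mult_left_mono) auto
      moreover have "?A * (\<kappa> * (1 / (3 / (2 * n)) powr ?e) * measure lborel ?B) = c * n powr (2 * s)"
      proof -
        have "1 / (3 / (2 * n)) powr ?e = (2/3) powr ?e * n powr ?e"
        proof -
          have "1 / (3 / (2 * n)) powr ?e = (1 / (3 / (2 * n))) powr ?e" using n by (subst powr_divide) simp_all
          also have "1 / (3 / (2 * n)) = (2/3) * n" by simp
          also have "((2/3) * n) powr ?e = (2/3) powr ?e * n powr ?e" by (rule powr_mult)
          finally show ?thesis .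
        qed
        moreover have "n powr ?e = n ^ DIM('a) * n powr (2 * s)" using n by (simp add: powr_add powr_realpow)
        ultimately show ?thesis using n by (simp add: vol c_def)
      qed
      ultimately show ?thesis by (simp add: n_def)
    qed
  qed
qed

lemma lap_symbol_measurable [measurable]: "lap_symbol s \<in> borel_measurable borel"
proof -
  have "(\<lambda>\<xi>::'a. (LBINT z. (1 - cos (z \<bullet> \<xi>)) * jump_kernel s z)) \<in> borel_measurable borel"
    by (rule lborel.borel_measurable_lebesgue_integral) measurable
  then show ?thesis unfolding lap_symbol_def[abs_def] by measurable
qed

end

lemma integrable_pair_product:
  fixes f :: "'a::euclidean_space \<Rightarrow> real" and g :: "'b::euclidean_space \<Rightarrow> real"
  assumes f: "integrable lborel f" and g: "integrable lborel g"
  shows "integrable (lborel \<Otimes>\<^sub>M lborel) (\<lambda>(x, y). f x * g y)"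
proof (rule lborel_pair.Fubini_integrable)
  have [measurable]: "f \<in> borel_measurable borel" "g \<in> borel_measurable borel" using f g by auto
  show "(\<lambda>(x, y). f x * g y) \<in> borel_measurable (lborel \<Otimes>\<^sub>M lborel)" by measurable
  have "integrable lborel (\<lambda>x. \<bar>f x\<bar> * (LBINT y. \<bar>g y\<bar>))"
    using f by (intro integrable_mult_left) auto
  then show "integrable lborel (\<lambda>x. \<integral>y. norm (case (x, y) of (x, y) \<Rightarrow> f x * g y) \<partial>lborel)"
    by (simp add: abs_mult)
  show "AE x in lborel. integrable lborel (\<lambda>y. case (x, y) of (x, y) \<Rightarrow> f x * g y)"
    using g by auto
qed

lemma exp_minus_lipschitz:
  fixes a b :: real
  assumes "a \<ge> 0" "b \<ge> 0" shows "\<bar>exp (- a) - exp (- b)\<bar> \<le> \<bar>a - b\<bar>"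
proof -
  have *: "exp (- a) - exp (- b) \<le> b - a" if "a \<ge> 0" "a \<le> b" for a b :: real
  proof -
    have "1 - exp (- (b - a)) \<le> b - a" using exp_ge_add_one_self[of "- (b - a)"] by linarith
    moreover have "1 - exp (- (b - a)) \<ge> 0" using that by simp
    ultimately have "exp (- a) * (1 - exp (- (b - a))) \<le> 1 * (b - a)" using that by (intro mult_mono) auto
    moreover have "exp (- a) * exp (- (b - a)) = exp (- b)" by (simp add: exp_add[symmetric])
    ultimately show ?thesis by (simp add: algebra_simps)
  qed
  show ?thesis
  proof (cases "a \<le> b")
    case True
    then have "exp (- b) \<le> exp (- a)" by simp
    then show ?thesis using *[of a b] True assms by simp
  next
    case False
    then have "exp (- a) \<le> exp (- b)" by simp
    then show ?thesis using *[of b a] False assms by simp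
  qed
qed

text \<open>The factor \<open>exp (- h\<^sup>2 |\<xi>|\<^sup>2 / 2)\<close> mollifies the initial datum at scale \<open>h\<close>, so that the flow is smooth up
  to \<open>\<tau> = 0\<close>.\<close>

definition heat_weight :: "real \<Rightarrow> real \<Rightarrow> real \<Rightarrow> 'a::euclidean_space \<Rightarrow> real" where
  "heat_weight s h \<tau> \<xi> = exp (- (\<tau> * lap_symbol s \<xi> + h\<^sup>2 / 2 * norm \<xi> powr 2))"

text \<open>A real form of the Fourier integrand: if \<open>A\<close> and \<open>B\<close> are the
  cosine and sine transforms of \<open>f\<close>, it is the integral of
  \<open>cos ((x - y) \<bullet> \<xi>) * f y\<close> over \<open>y\<close>
  (\<open>wave_eq\<close>).\<close>

definition wave :: "('a::euclidean_space \<Rightarrow> real) \<Rightarrow> ('a \<Rightarrow> real) \<Rightarrow> 'a \<Rightarrow> 'a \<Rightarrow> real" where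
  "wave A B x \<xi> = cos (x \<bullet> \<xi>) * A \<xi> + sin (x \<bullet> \<xi>) * B \<xi>"

definition spectral :: "real \<Rightarrow> real \<Rightarrow> ('a::euclidean_space \<Rightarrow> real) \<Rightarrow> ('a \<Rightarrow> real) \<Rightarrow> real \<Rightarrow> 'a \<Rightarrow> real" where
  "spectral s h A B \<tau> x = (LBINT \<xi>. wave A B x \<xi> * heat_weight s h \<tau> \<xi>)"

definition spectral_lap :: "real \<Rightarrow> real \<Rightarrow> ('a::euclidean_space \<Rightarrow> real) \<Rightarrow> ('a \<Rightarrow> real) \<Rightarrow> real \<Rightarrow> 'a \<Rightarrow> real" where
  "spectral_lap s h A B \<tau> x = (LBINT \<xi>. wave A B x \<xi> * (lap_symbol s \<xi> * heat_weight s h \<tau> \<xi>))"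

context
  fixes s h k :: real and A B :: "'a::euclidean_space \<Rightarrow> real"
  assumes s: "0 < s" "s < 1" and h: "h > 0"
    and mA [measurable]: "A \<in> borel_measurable borel" and mB [measurable]: "B \<in> borel_measurable borel"
    and wk: "\<And>x \<xi>. \<bar>wave A B x \<xi>\<bar> \<le> k"
begin

lemmas [measurable] = lap_symbol_measurable[OF s]

lemma heat_weight_measurable [measurable]: "(\<lambda>\<xi>::'a. heat_weight s h \<tau> \<xi>) \<in> borel_measurable borel"
  unfolding heat_weight_def by measurable

lemma wave_measurable [measurable]: "wave A B x \<in> borel_measurable borel"
  unfolding wave_def[abs_def] by measurable

lemma wave_bound_nonneg: "k \<ge> 0" using wk[of 0 0] by linarith

lemma heat_weight_pos: "heat_weight s h \<tau> (\<xi>::'a) > 0" by (simp add: heat_weight_def)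

lemma heat_weight_le: "\<tau> \<ge> 0 \<Longrightarrow> heat_weight s h \<tau> (\<xi>::'a) \<le> heat_weight s h 0 \<xi>"
  unfolding heat_weight_def using lap_symbol_nonneg[OF s, of \<xi>] by simp

lemma heat_weight0_moment_integrable: "integrable lborel (\<lambda>\<xi>::'a. (1 + norm \<xi>) powr m * heat_weight s h 0 \<xi>)"
  using integrable_exp_weight[of "h\<^sup>2 / 2" 2 m, where 'a='a] h by (simp add: heat_weight_def)

lemma heat_weight0_integrable: "integrable lborel (\<lambda>\<xi>::'a. heat_weight s h 0 \<xi>)"
proof -
  have "1 + norm x \<noteq> 0" for x :: 'a using norm_ge_zero[of x] by linarith
  then show ?thesis using heat_weight0_moment_integrable[of 0] by simp
qed

lemma heat_weight_integrable: "\<tau> \<ge> 0 \<Longrightarrow> integrable lborel (\<lambda>\<xi>::'a. heat_weight s h \<tau> \<xi>)"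
  by (rule Bochner_Integration.integrable_bound[OF heat_weight0_integrable])
    (auto intro!: AE_I2 heat_weight_le simp: heat_weight_pos less_imp_le)

lemma symbol_heat_weight0_integrable: "integrable lborel (\<lambda>\<xi>::'a. lap_symbol s \<xi> * heat_weight s h 0 \<xi>)"
proof -
  obtain C where C: "C \<ge> 0" "\<And>\<xi>::'a. lap_symbol s \<xi> \<le> C * (1 + norm \<xi>) powr 2" using lap_symbol_upper[OF s] by blast
  show ?thesis
  proof (rule Bochner_Integration.integrable_bound[OF integrable_mult_right[OF heat_weight0_moment_integrable[of 2], of C]])
    show "AE \<xi>::'a in lborel. norm (lap_symbol s \<xi> * heat_weight s h 0 \<xi>) \<le> norm (C * ((1 + norm \<xi>) powr 2 * heat_weight s h 0 \<xi>))"
    proof (rule AE_I2)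
      fix \<xi> :: 'a
      have "lap_symbol s \<xi> * heat_weight s h 0 \<xi> \<le> C * (1 + norm \<xi>) powr 2 * heat_weight s h 0 \<xi>"
        using heat_weight_pos[of 0 \<xi>] by (intro mult_right_mono C) auto
      then show "norm (lap_symbol s \<xi> * heat_weight s h 0 \<xi>) \<le> norm (C * ((1 + norm \<xi>) powr 2 * heat_weight s h 0 \<xi>))"
        using lap_symbol_nonneg[OF s, of \<xi>] heat_weight_pos[of 0 \<xi>] C(1) by (simp add: abs_mult mult_ac)
    qed
  qed measurable
qed

lemma wave_mult_integrable:
  assumes "integrable lborel g" shows "integrable lborel (\<lambda>\<xi>. wave A B x \<xi> * g \<xi>)"
proof (rule Bochner_Integration.integrable_bound[OF integrable_mult_right[OF integrable_norm[OF assms], of k]])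
  have [measurable]: "g \<in> borel_measurable borel" using assms by auto
  show "(\<lambda>\<xi>. wave A B x \<xi> * g \<xi>) \<in> borel_measurable lborel" by measurable
  show "AE \<xi> in lborel. norm (wave A B x \<xi> * g \<xi>) \<le> norm (k * norm (g \<xi>))"
    using wk wave_bound_nonneg by (intro AE_I2) (auto simp: abs_mult intro!: mult_right_mono)
qed

lemma spectral_bound:
  assumes "\<tau> \<ge> 0" shows "\<bar>spectral s h A B \<tau> x\<bar> \<le> k * (LBINT \<xi>::'a. heat_weight s h \<tau> \<xi>)"
proof -
  have "\<bar>spectral s h A B \<tau> x\<bar> \<le> (LBINT \<xi>. \<bar>wave A B x \<xi> * heat_weight s h \<tau> \<xi>\<bar>)"
    unfolding spectral_def using integral_norm_bound[of lborel "\<lambda>\<xi>. wave A B x \<xi> * heat_weight s h \<tau> \<xi>"] by simp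
  also have "\<dots> \<le> (LBINT \<xi>::'a. k * heat_weight s h \<tau> \<xi>)"
  proof (rule integral_mono)
    show "integrable lborel (\<lambda>\<xi>. \<bar>wave A B x \<xi> * heat_weight s h \<tau> \<xi>\<bar>)"
      by (intro integrable_abs wave_mult_integrable heat_weight_integrable assms)
    show "integrable lborel (\<lambda>\<xi>::'a. k * heat_weight s h \<tau> \<xi>)" by (intro integrable_mult_right heat_weight_integrable assms)
    show "\<bar>wave A B x \<xi> * heat_weight s h \<tau> \<xi>\<bar> \<le> k * heat_weight s h \<tau> \<xi>" for \<xi>
      using wk[of x \<xi>] heat_weight_pos[of \<tau> \<xi>] by (simp add: abs_mult)
  qed
  finally show ?thesis by simp
qed

lemma spectral_continuous: "continuous_on ({0..} \<times> UNIV) (\<lambda>q. spectral s h A B (fst q) (snd q))"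
proof (rule continuous_on_sequentiallyI)
  fix q :: "nat \<Rightarrow> real \<times> 'a" and a assume q: "\<forall>n. q n \<in> {0..} \<times> UNIV" and a: "a \<in> {0..} \<times> (UNIV :: 'a set)" and lim: "q \<longlonglongrightarrow> a"
  have l1: "(\<lambda>n. fst (q n)) \<longlonglongrightarrow> fst a" and l2: "(\<lambda>n. snd (q n)) \<longlonglongrightarrow> snd a"
    using lim by (auto intro: tendsto_fst tendsto_snd)
  show "(\<lambda>n. spectral s h A B (fst (q n)) (snd (q n))) \<longlonglongrightarrow> spectral s h A B (fst a) (snd a)"
    unfolding spectral_def
  proof (rule integral_dominated_convergence[where w="\<lambda>\<xi>. k * heat_weight s h 0 \<xi>"])
    show "integrable lborel (\<lambda>\<xi>::'a. k * heat_weight s h 0 \<xi>)" by (intro integrable_mult_right heat_weight0_integrable)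
    show "AE \<xi> in lborel. (\<lambda>n. wave A B (snd (q n)) \<xi> * heat_weight s h (fst (q n)) \<xi>) \<longlonglongrightarrow> wave A B (snd a) \<xi> * heat_weight s h (fst a) \<xi>"
      unfolding wave_def heat_weight_def by (intro AE_I2 tendsto_intros l1 l2)
    show "AE \<xi> in lborel. norm (wave A B (snd (q n)) \<xi> * heat_weight s h (fst (q n)) \<xi>) \<le> k * heat_weight s h 0 \<xi>" for n
    proof (rule AE_I2)
      fix \<xi>
      have "fst (q n) \<ge> 0" using q[rule_format, of n] by (cases "q n") auto
      then have "\<bar>wave A B (snd (q n)) \<xi>\<bar> * heat_weight s h (fst (q n)) \<xi> \<le> k * heat_weight s h 0 \<xi>"
        using wk heat_weight_le heat_weight_pos[of "fst (q n)" \<xi>] wave_bound_nonneg by (intro mult_mono) auto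
      then show "norm (wave A B (snd (q n)) \<xi> * heat_weight s h (fst (q n)) \<xi>) \<le> k * heat_weight s h 0 \<xi>"
        using heat_weight_pos[of "fst (q n)" \<xi>] by (simp add: abs_mult)
    qed
  qed measurable
qed

text \<open>Dominated convergence under the integral: by \<open>exp_minus_lipschitz\<close> the
  difference quotients of \<open>heat_weight\<close> in time are bounded by the symbol times the
  weight at time 0.\<close>

lemma spectral_deriv:
  assumes t: "\<tau> > 0"
  shows "((\<lambda>\<tau>. spectral s h A B \<tau> x) has_real_derivative - spectral_lap s h A B \<tau> x) (at \<tau>)"
proof -
  let ?q = "\<lambda>d. (spectral s h A B (\<tau> + d) x - spectral s h A B \<tau> x) / d"
  have "?q \<midarrow>0\<rightarrow> - spectral_lap s h A B \<tau> x"
    unfolding tendsto_at_iff_sequentially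
  proof (intro allI impI)
    fix X :: "nat \<Rightarrow> real" assume X: "\<forall>i. X i \<in> UNIV - {0}" "X \<longlonglongrightarrow> 0"
    have "\<forall>\<^sub>F n in sequentially. norm (X n) < \<tau>"
      using tendsto_norm_zero[OF X(2)] t by (rule order_tendstoD(2))
    then obtain n0 where n0: "\<And>n. n \<ge> n0 \<Longrightarrow> \<bar>X n\<bar> < \<tau>" by (auto simp: eventually_sequentially)
    \<comment> \<open>Finitely many terms are dropped so that \<open>\<tau> + Y n\<close> stays
      nonnegative and the weight at that time is dominated by the one at time 0.\<close>
    define Y where "Y n = X (n + n0)" for n
    have Y: "Y n \<noteq> 0" "\<bar>Y n\<bar> < \<tau>" for n using X(1) n0[of "n + n0"] by (auto simp: Y_def)
    have Y0: "Y \<longlonglongrightarrow> 0" unfolding Y_def using LIMSEQ_ignore_initial_segment[OF X(2)] .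
    let ?w = "wave A B x"
    have Yt: "\<tau> + Y n \<ge> 0" for n using Y(2)[of n] by linarith
    have q: "?q (Y n) = (LBINT \<xi>. ?w \<xi> * ((heat_weight s h (\<tau> + Y n) \<xi> - heat_weight s h \<tau> \<xi>) / Y n))" for n
    proof -
      have i: "integrable lborel (\<lambda>\<xi>. ?w \<xi> * heat_weight s h (\<tau> + Y n) \<xi>)" "integrable lborel (\<lambda>\<xi>. ?w \<xi> * heat_weight s h \<tau> \<xi>)"
        using Yt t by (auto intro!: wave_mult_integrable heat_weight_integrable)
      have "spectral s h A B (\<tau> + Y n) x - spectral s h A B \<tau> x = (LBINT \<xi>. ?w \<xi> * heat_weight s h (\<tau> + Y n) \<xi> - ?w \<xi> * heat_weight s h \<tau> \<xi>)"
        unfolding spectral_def by (rule Bochner_Integration.integral_diff[OF i, symmetric])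
      then have "?q (Y n) = (LBINT \<xi>. (?w \<xi> * heat_weight s h (\<tau> + Y n) \<xi> - ?w \<xi> * heat_weight s h \<tau> \<xi>) / Y n)"
        by (simp only: integral_divide_zero)
      then show ?thesis by (simp only: right_diff_distrib[symmetric] times_divide_eq_right)
    qed
    have "(\<lambda>n. ?q (Y n)) \<longlonglongrightarrow> (LBINT \<xi>. ?w \<xi> * (- (lap_symbol s \<xi> * heat_weight s h \<tau> \<xi>)))"
      unfolding q
    proof (rule integral_dominated_convergence[where w="\<lambda>\<xi>. k * (lap_symbol s \<xi> * heat_weight s h 0 \<xi>)"])
      show "integrable lborel (\<lambda>\<xi>::'a. k * (lap_symbol s \<xi> * heat_weight s h 0 \<xi>))"
        by (intro integrable_mult_right symbol_heat_weight0_integrable)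
      show "AE \<xi> in lborel. (\<lambda>n. ?w \<xi> * ((heat_weight s h (\<tau> + Y n) \<xi> - heat_weight s h \<tau> \<xi>) / Y n)) \<longlonglongrightarrow> ?w \<xi> * (- (lap_symbol s \<xi> * heat_weight s h \<tau> \<xi>))"
      proof (rule AE_I2, rule tendsto_mult[OF tendsto_const])
        fix \<xi> :: 'a
        have "((\<lambda>\<tau>. heat_weight s h \<tau> \<xi>) has_real_derivative - (lap_symbol s \<xi> * heat_weight s h \<tau> \<xi>)) (at \<tau>)"
          unfolding heat_weight_def by (auto intro!: derivative_eq_intros)
        then have "(\<lambda>d. (heat_weight s h (\<tau> + d) \<xi> - heat_weight s h \<tau> \<xi>) / d) \<midarrow>0\<rightarrow> - (lap_symbol s \<xi> * heat_weight s h \<tau> \<xi>)"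
          by (simp add: DERIV_def)
        then show "(\<lambda>n. (heat_weight s h (\<tau> + Y n) \<xi> - heat_weight s h \<tau> \<xi>) / Y n) \<longlonglongrightarrow> - (lap_symbol s \<xi> * heat_weight s h \<tau> \<xi>)"
          unfolding tendsto_at_iff_sequentially comp_def using Y Y0 by auto
      qed
      show "AE \<xi> in lborel. norm (?w \<xi> * ((heat_weight s h (\<tau> + Y n) \<xi> - heat_weight s h \<tau> \<xi>) / Y n)) \<le> k * (lap_symbol s \<xi> * heat_weight s h 0 \<xi>)" for n
      proof (rule AE_I2)
        fix \<xi> :: 'a
        let ?m = "lap_symbol s \<xi>"
        have m: "?m \<ge> 0" by (rule lap_symbol_nonneg[OF s])
        have E: "heat_weight s h c \<xi> = exp (- (c * ?m)) * heat_weight s h 0 \<xi>" for c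
          by (simp add: heat_weight_def exp_add[symmetric] algebra_simps)
        have "\<bar>exp (- ((\<tau> + Y n) * ?m)) - exp (- (\<tau> * ?m))\<bar> \<le> \<bar>(\<tau> + Y n) * ?m - \<tau> * ?m\<bar>"
          using m t Yt by (intro exp_minus_lipschitz mult_nonneg_nonneg) auto
        also have "\<dots> = \<bar>Y n\<bar> * ?m" using m by (simp add: distrib_right abs_mult)
        finally have "\<bar>exp (- ((\<tau> + Y n) * ?m)) - exp (- (\<tau> * ?m))\<bar> * heat_weight s h 0 \<xi> \<le> \<bar>Y n\<bar> * ?m * heat_weight s h 0 \<xi>"
          using heat_weight_pos[of 0 \<xi>] by (intro mult_right_mono) auto
        moreover have "\<bar>heat_weight s h (\<tau> + Y n) \<xi> - heat_weight s h \<tau> \<xi>\<bar> = \<bar>exp (- ((\<tau> + Y n) * ?m)) - exp (- (\<tau> * ?m))\<bar> * heat_weight s h 0 \<xi>"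
          using heat_weight_pos[of 0 \<xi>] unfolding E[of "\<tau> + Y n"] E[of \<tau>] left_diff_distrib[symmetric] by (simp add: abs_mult)
        ultimately have "\<bar>heat_weight s h (\<tau> + Y n) \<xi> - heat_weight s h \<tau> \<xi>\<bar> / \<bar>Y n\<bar> \<le> ?m * heat_weight s h 0 \<xi>"
          using Y(1)[of n] by (simp add: divide_le_eq mult_ac)
        then have "\<bar>?w \<xi>\<bar> * (\<bar>heat_weight s h (\<tau> + Y n) \<xi> - heat_weight s h \<tau> \<xi>\<bar> / \<bar>Y n\<bar>) \<le> k * (?m * heat_weight s h 0 \<xi>)"
          using wk wave_bound_nonneg by (intro mult_mono) auto
        then show "norm (?w \<xi> * ((heat_weight s h (\<tau> + Y n) \<xi> - heat_weight s h \<tau> \<xi>) / Y n)) \<le> k * (?m * heat_weight s h 0 \<xi>)"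
          by (simp add: abs_mult abs_divide)
      qed
    qed measurable
    then have "(\<lambda>n. ?q (Y n)) \<longlonglongrightarrow> - spectral_lap s h A B \<tau> x" by (simp add: spectral_lap_def)
    then show "(?q \<circ> X) \<longlonglongrightarrow> - spectral_lap s h A B \<tau> x"
      unfolding comp_def Y_def by (rule LIMSEQ_offset)
  qed
  then show ?thesis by (simp add: DERIV_def)
qed

text \<open>By Fubini the operator truncated at \<open>\<epsilon>\<close> multiplies each frequency
  by the truncated symbol \<open>m \<epsilon>\<close>, up to \<open>frac_const\<close>; the terms
  odd in the jump vanish. As \<open>\<epsilon>\<close> tends to 0 the truncated symbols converge and
  stay below \<open>lap_symbol\<close>, which is integrable against the weight at time 0.\<close>

lemma spectral_frac_lap:
  assumes t: "\<tau> > 0"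
  shows "frac_lap s (spectral s h A B \<tau>) x (spectral_lap s h A B \<tau> x)"
proof -
  let ?A = "frac_const DIM('a) s" and ?v = "spectral s h A B \<tau>"
  let ?I = "\<lambda>\<epsilon> z. indicator {z. norm z > \<epsilon>} z :: real"
  define m where "m \<epsilon> \<xi> = (LBINT z. ?I \<epsilon> z * ((1 - cos (z \<bullet> \<xi>)) * jump_kernel s z))" for \<epsilon> and \<xi> :: 'a
  have Ei: "integrable lborel (\<lambda>\<xi>::'a. heat_weight s h \<tau> \<xi>)" using t by (intro heat_weight_integrable) auto
  have main: "integrable lborel (\<lambda>z. ?I \<epsilon> z * ((?v x - ?v (x + z)) * jump_kernel s z)) \<and>
    (LBINT z. ?I \<epsilon> z * ((?v x - ?v (x + z)) * jump_kernel s z)) = (LBINT \<xi>. wave A B x \<xi> * (m \<epsilon> \<xi> * heat_weight s h \<tau> \<xi>))"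
    if e: "\<epsilon> > 0" for \<epsilon>
  proof -
    let ?J = "\<lambda>z::'a. ?I \<epsilon> z * jump_kernel s z"
    have mI: "(\<lambda>z::'a. ?I \<epsilon> z) \<in> borel_measurable borel" by simp
    have [measurable]: "?J \<in> borel_measurable borel" by (intro borel_measurable_times mI) auto
    have iJ: "integrable lborel ?J"
      by (rule Bochner_Integration.integrable_bound[OF jump_kernel_outer_integrable[OF s(1) e]]) (auto split: split_indicator)
    let ?F = "\<lambda>z \<xi>. ?J z * ((wave A B x \<xi> - wave A B (x + z) \<xi>) * heat_weight s h \<tau> \<xi>)"
    have mF: "case_prod ?F \<in> borel_measurable (lborel \<Otimes>\<^sub>M lborel)"
      unfolding wave_def split_def by measurable
    have iF: "integrable (lborel \<Otimes>\<^sub>M lborel) (case_prod ?F)"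
    proof (rule Bochner_Integration.integrable_bound[OF integrable_mult_right[OF integrable_pair_product[OF iJ Ei], of "2 * k"] mF], rule AE_I2)
      fix zx :: "'a \<times> 'a"
      obtain z \<xi> where zx: "zx = (z, \<xi>)" by (cases zx)
      have "\<bar>wave A B x \<xi> - wave A B (x + z) \<xi>\<bar> \<le> 2 * k" using wk[of x \<xi>] wk[of "x + z" \<xi>] by linarith
      then have "?J z * (\<bar>wave A B x \<xi> - wave A B (x + z) \<xi>\<bar> * heat_weight s h \<tau> \<xi>) \<le> ?J z * (2 * k * heat_weight s h \<tau> \<xi>)"
        using heat_weight_pos[of \<tau> \<xi>] by (intro mult_left_mono mult_right_mono) auto
      then show "norm (case_prod ?F zx) \<le> norm (2 * k * (case zx of (z, \<xi>) \<Rightarrow> ?J z * heat_weight s h \<tau> \<xi>))"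
        using heat_weight_pos[of \<tau> \<xi>] wave_bound_nonneg by (simp add: zx abs_mult mult_ac)
    qed
    have inner: "(LBINT \<xi>. ?F z \<xi>) = ?I \<epsilon> z * ((?v x - ?v (x + z)) * jump_kernel s z)" for z
    proof -
      have "?v x - ?v (x + z) = (LBINT \<xi>. wave A B x \<xi> * heat_weight s h \<tau> \<xi> - wave A B (x + z) \<xi> * heat_weight s h \<tau> \<xi>)"
        unfolding spectral_def by (rule Bochner_Integration.integral_diff[symmetric]) (intro wave_mult_integrable Ei)+
      then have "(LBINT \<xi>. (wave A B x \<xi> - wave A B (x + z) \<xi>) * heat_weight s h \<tau> \<xi>) = ?v x - ?v (x + z)"
        by (simp only: left_diff_distrib)
      then have "(LBINT \<xi>. ?F z \<xi>) = ?J z * (?v x - ?v (x + z))"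
        by (simp only: integral_mult_right_zero)
      then show ?thesis by (simp only: mult_ac)
    qed
    have inner2: "(LBINT z. ?F z \<xi>) = wave A B x \<xi> * (m \<epsilon> \<xi> * heat_weight s h \<tau> \<xi>)" for \<xi>
    proof -
      \<comment> \<open>The conjugate wave. The addition formulas split the increment into a cosine
        part proportional to the wave and a sine part proportional to \<open>?Q\<close>; the latter
        is odd in \<open>z\<close>.\<close>
      let ?Q = "cos (x \<bullet> \<xi>) * B \<xi> - sin (x \<bullet> \<xi>) * A \<xi>"
      have eq: "?F z \<xi> = (wave A B x \<xi> * heat_weight s h \<tau> \<xi>) * (?I \<epsilon> z * ((1 - cos (z \<bullet> \<xi>)) * jump_kernel s z)) - (?Q * heat_weight s h \<tau> \<xi>) * (?J z * sin (z \<bullet> \<xi>))" for z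
        unfolding wave_def inner_add_left cos_add sin_add by (simp add: algebra_simps)
      have i1: "integrable lborel (\<lambda>z. ?I \<epsilon> z * ((1 - cos (z \<bullet> \<xi>)) * jump_kernel s z))"
      proof (rule Bochner_Integration.integrable_bound[OF lap_symbol_integrable[OF s, of \<xi>]])
        show "(\<lambda>z. ?I \<epsilon> z * ((1 - cos (z \<bullet> \<xi>)) * jump_kernel s z)) \<in> borel_measurable lborel"
          using mI by (intro borel_measurable_times) auto
      qed (auto split: split_indicator)
      have ms: "(\<lambda>z. ?J z * sin (z \<bullet> \<xi>)) \<in> borel_measurable borel" by measurable
      have i2: "integrable lborel (\<lambda>z. ?J z * sin (z \<bullet> \<xi>))"
        by (rule Bochner_Integration.integrable_bound[OF iJ]) (use ms in \<open>auto simp: abs_mult intro!: mult_left_le\<close>)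
      have z0: "(LBINT z. ?J z * sin (z \<bullet> \<xi>)) = 0"
        by (rule lborel_integral_odd[OF ms]) (simp add: indicator_def)
      show ?thesis unfolding eq Bochner_Integration.integral_diff[OF integrable_mult_right[OF i1] integrable_mult_right[OF i2]]
          integral_mult_right_zero z0 m_def by (simp add: mult_ac)
    qed
    have "integrable lborel (\<lambda>z. (LBINT \<xi>. ?F z \<xi>))"
      by (rule lborel_pair.integrable_fst[OF iF])
    moreover have "(LBINT z. (LBINT \<xi>. ?F z \<xi>)) = (LBINT \<xi>. (LBINT z. ?F z \<xi>))"
      by (rule lborel_pair.Fubini_integral[OF iF, symmetric])
    ultimately show ?thesis unfolding inner inner2 by simp
  qed
  have m_le: "?A * m \<epsilon> \<xi> \<le> lap_symbol s \<xi>" "0 \<le> m \<epsilon> \<xi>" for \<epsilon> \<xi>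
  proof -
    have "m \<epsilon> \<xi> \<le> (LBINT z. (1 - cos (z \<bullet> \<xi>)) * jump_kernel s z)"
      unfolding m_def
    proof (rule integral_mono[OF _ lap_symbol_integrable[OF s]])
      show "integrable lborel (\<lambda>z. ?I \<epsilon> z * ((1 - cos (z \<bullet> \<xi>)) * jump_kernel s z))"
      proof (rule Bochner_Integration.integrable_bound[OF lap_symbol_integrable[OF s, of \<xi>]])
        have mI: "(\<lambda>z::'a. ?I \<epsilon> z) \<in> borel_measurable borel" by simp
        show "(\<lambda>z. ?I \<epsilon> z * ((1 - cos (z \<bullet> \<xi>)) * jump_kernel s z)) \<in> borel_measurable lborel"
          using mI by (intro borel_measurable_times) auto
      qed (auto split: split_indicator)
    qed (auto split: split_indicator)
    then show "?A * m \<epsilon> \<xi> \<le> lap_symbol s \<xi>" unfolding lap_symbol_def using frac_const_pos[OF s, of "DIM('a)"] by (intro mult_left_mono) auto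
    show "0 \<le> m \<epsilon> \<xi>" unfolding m_def by (intro integral_nonneg_AE AE_I2) auto
  qed
  have mm [measurable]: "m \<epsilon> \<in> borel_measurable borel" for \<epsilon>
    unfolding m_def[abs_def] by (rule lborel.borel_measurable_lebesgue_integral) measurable
  have "((\<lambda>\<epsilon>. ?A * (LBINT \<xi>. wave A B x \<xi> * (m \<epsilon> \<xi> * heat_weight s h \<tau> \<xi>))) \<longlongrightarrow> spectral_lap s h A B \<tau> x) (at_right 0)"
    unfolding tendsto_at_iff_sequentially comp_def
  proof (intro allI impI)
    fix X :: "nat \<Rightarrow> real" assume X: "\<forall>i. X i \<in> {0<..} - {0}" "X \<longlonglongrightarrow> 0"
    have ml: "(\<lambda>n. m (X n) \<xi>) \<longlonglongrightarrow> (LBINT z. (1 - cos (z \<bullet> \<xi>)) * jump_kernel s z)" for \<xi> :: 'a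
      unfolding m_def
    proof (rule integral_dominated_convergence[OF _ _ lap_symbol_integrable[OF s, of \<xi>]])
      show "AE z in lborel. (\<lambda>n. ?I (X n) z * ((1 - cos (z \<bullet> \<xi>)) * jump_kernel s z)) \<longlonglongrightarrow> (1 - cos (z \<bullet> \<xi>)) * jump_kernel s z"
      proof (rule AE_I2, rule tendsto_eventually)
        fix z :: 'a
        show "\<forall>\<^sub>F n in sequentially. ?I (X n) z * ((1 - cos (z \<bullet> \<xi>)) * jump_kernel s z) = (1 - cos (z \<bullet> \<xi>)) * jump_kernel s z"
        proof (cases "z = 0")
          case False
          then have "\<forall>\<^sub>F n in sequentially. X n < norm z" using order_tendstoD(2)[OF X(2)] by simp
          then show ?thesis by eventually_elim simp
        qed simp
      qed
      have mI: "(\<lambda>z::'a. ?I \<epsilon> z) \<in> borel_measurable borel" for \<epsilon> by simp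
      show "(\<lambda>z. ?I (X n) z * ((1 - cos (z \<bullet> \<xi>)) * jump_kernel s z)) \<in> borel_measurable lborel" for n
        using mI by (intro borel_measurable_times) auto
    qed (auto split: split_indicator)
    have "(\<lambda>n. (LBINT \<xi>. wave A B x \<xi> * (?A * m (X n) \<xi> * heat_weight s h \<tau> \<xi>))) \<longlonglongrightarrow> spectral_lap s h A B \<tau> x"
      unfolding spectral_lap_def
    proof (rule integral_dominated_convergence[where w="\<lambda>\<xi>. k * (lap_symbol s \<xi> * heat_weight s h 0 \<xi>)"])
      show "integrable lborel (\<lambda>\<xi>::'a. k * (lap_symbol s \<xi> * heat_weight s h 0 \<xi>))"
        by (intro integrable_mult_right symbol_heat_weight0_integrable)
      show "AE \<xi> in lborel. (\<lambda>n. wave A B x \<xi> * (?A * m (X n) \<xi> * heat_weight s h \<tau> \<xi>)) \<longlonglongrightarrow> wave A B x \<xi> * (lap_symbol s \<xi> * heat_weight s h \<tau> \<xi>)"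
        unfolding lap_symbol_def by (intro AE_I2 tendsto_intros ml)
      show "AE \<xi> in lborel. norm (wave A B x \<xi> * (?A * m (X n) \<xi> * heat_weight s h \<tau> \<xi>)) \<le> k * (lap_symbol s \<xi> * heat_weight s h 0 \<xi>)" for n
      proof (rule AE_I2)
        fix \<xi> :: 'a
        have "0 \<le> ?A * m (X n) \<xi>" using m_le(2)[of "X n" \<xi>] frac_const_pos[OF s, of "DIM('a)"] by (intro mult_nonneg_nonneg) auto
        moreover from this have "\<bar>wave A B x \<xi>\<bar> * (?A * m (X n) \<xi> * heat_weight s h \<tau> \<xi>) \<le> k * (lap_symbol s \<xi> * heat_weight s h 0 \<xi>)"
          using wk m_le(1) heat_weight_le[of \<tau> \<xi>] t heat_weight_pos[of \<tau> \<xi>] wave_bound_nonneg lap_symbol_nonneg[OF s, of \<xi>]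
          by (intro mult_mono) (auto intro: mult_nonneg_nonneg)
        ultimately show "norm (wave A B x \<xi> * (?A * m (X n) \<xi> * heat_weight s h \<tau> \<xi>)) \<le> k * (lap_symbol s \<xi> * heat_weight s h 0 \<xi>)"
          using heat_weight_pos[of \<tau> \<xi>] m_le(2)[of "X n" \<xi>] frac_const_pos[OF s, of "DIM('a)"] by (simp add: abs_mult)
      qed
    qed measurable
    moreover have "(LBINT \<xi>. wave A B x \<xi> * (?A * m (X n) \<xi> * heat_weight s h \<tau> \<xi>)) = ?A * (LBINT \<xi>. wave A B x \<xi> * (m (X n) \<xi> * heat_weight s h \<tau> \<xi>))" for n
      by (simp only: integral_mult_right_zero[symmetric] mult_ac)
    ultimately show "(\<lambda>n. ?A * (LBINT \<xi>. wave A B x \<xi> * (m (X n) \<xi> * heat_weight s h \<tau> \<xi>))) \<longlonglongrightarrow> spectral_lap s h A B \<tau> x" by simp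
  qed
  moreover have "\<forall>\<^sub>F \<epsilon> in at_right 0. ?A * (LBINT \<xi>. wave A B x \<xi> * (m \<epsilon> \<xi> * heat_weight s h \<tau> \<xi>)) =
    ?A * (LBINT z. ?I \<epsilon> z * ((?v x - ?v (x + z)) * jump_kernel s z))"
    using eventually_at_right_less[of "0::real"] by eventually_elim (use main in simp)
  ultimately have "((\<lambda>\<epsilon>. ?A * (LBINT z. ?I \<epsilon> z * ((?v x - ?v (x + z)) * jump_kernel s z))) \<longlongrightarrow> spectral_lap s h A B \<tau> x) (at_right 0)"
    by (rule Lim_transform_eventually)
  then show ?thesis unfolding frac_lap_def using main by blast
qed

end

section \<open>Gaussian transforms\<close>

text \<open>The characteristic function of the standard normal law, freed from the normalisation
  \<open>1 / sqrt (2 * pi)\<close>.\<close>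

lemma gauss_char_1d:
  fixes t :: real
  shows "(CLINT x|lborel. iexp (t * x) * complex_of_real (exp (- (x\<^sup>2) / 2))) = complex_of_real (sqrt (2 * pi) * exp (- (t\<^sup>2) / 2))"
proof -
  have "complex_of_real (exp (- (t\<^sup>2) / 2)) = (CLINT x|std_normal_distribution. iexp (t * x))"
    using char_std_normal_distribution by (simp add: char_def fun_eq_iff)
  also have "\<dots> = (CLINT x|lborel. std_normal_density x *\<^sub>R iexp (t * x))"
    by (subst integral_density) (auto simp: normal_density_nonneg)
  also have "\<dots> = (CLINT x|lborel. complex_of_real (1 / sqrt (2 * pi)) * (iexp (t * x) * complex_of_real (exp (- (x\<^sup>2) / 2))))"
    by (intro Bochner_Integration.integral_cong) (auto simp: std_normal_density_def scaleR_conv_of_real)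
  also have "\<dots> = complex_of_real (1 / sqrt (2 * pi)) * (CLINT x|lborel. iexp (t * x) * complex_of_real (exp (- (x\<^sup>2) / 2)))"
    by (rule integral_mult_right_zero)
  finally have "complex_of_real (sqrt (2 * pi)) * complex_of_real (exp (- (t\<^sup>2) / 2))
    = complex_of_real (sqrt (2 * pi)) * (complex_of_real (1 / sqrt (2 * pi)) * (CLINT x|lborel. iexp (t * x) * complex_of_real (exp (- (x\<^sup>2) / 2))))" by simp
  then show ?thesis by (simp add: mult.assoc[symmetric] of_real_mult[symmetric] del: of_real_mult)
qed

lemma gauss_integrable_1d: "integrable lborel (\<lambda>x::real. iexp (t * x) * complex_of_real (exp (- (x\<^sup>2) / 2)))"
proof (rule Bochner_Integration.integrable_bound)
  show "integrable lborel (\<lambda>x::real. exp (- (1/2 * norm x powr 2)) * (1 + norm x) powr 0)"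
    using integrable_exp_weight[of "1/2" 2 0, where 'a=real] by (simp add: mult.commute)
  have "1 + \<bar>x\<bar> \<noteq> 0" for x :: real by linarith
  then show "AE x::real in lborel. norm (iexp (t * x) * complex_of_real (exp (- (x\<^sup>2) / 2))) \<le> norm (exp (- (1/2 * norm x powr 2)) * (1 + norm x) powr 0)"
    by (intro AE_I2) (simp add: norm_mult powr_numeral)
qed measurable

lemma gauss_prod: "(\<Prod>b\<in>Basis. exp (- ((\<xi> \<bullet> b)\<^sup>2) / 2)) = exp (- ((norm \<xi>)\<^sup>2) / 2)" for \<xi> :: "'a::euclidean_space"
proof -
  have "(norm \<xi>)\<^sup>2 = (\<Sum>b\<in>Basis. (\<xi> \<bullet> b)\<^sup>2)"
    by (subst power2_norm_eq_inner, subst euclidean_inner) (simp add: power2_eq_square)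
  then have "- ((norm \<xi>)\<^sup>2) / 2 = (\<Sum>b\<in>Basis. - ((\<xi> \<bullet> b)\<^sup>2) / 2)"
    by (simp only: sum_divide_distrib sum_negf[symmetric])
  then show ?thesis by (simp only: exp_sum[OF finite_Basis])
qed

text \<open>The integrand factors over the coordinates, and \<open>lborel\<close> is the image of a
  product of one-dimensional measures.\<close>

lemma gauss_char:
  fixes w :: "'a::euclidean_space"
  shows "(CLINT \<xi>|lborel. iexp (w \<bullet> \<xi>) * complex_of_real (exp (- ((norm \<xi>)\<^sup>2) / 2)))
    = complex_of_real (sqrt (2 * pi) ^ DIM('a) * exp (- ((norm w)\<^sup>2) / 2))"
proof -
  interpret P: product_sigma_finite "\<lambda>_::'a. lborel :: real measure" ..
  let ?g = "\<lambda>t x::real. iexp (t * x) * complex_of_real (exp (- (x\<^sup>2) / 2))"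
  have prod: "iexp (w \<bullet> \<xi>) * complex_of_real (exp (- ((norm \<xi>)\<^sup>2) / 2)) = (\<Prod>b\<in>Basis. ?g (w \<bullet> b) (\<xi> \<bullet> b))" for \<xi>
  proof -
    have "(\<Prod>b\<in>Basis. ?g (w \<bullet> b) (\<xi> \<bullet> b)) = (\<Prod>b\<in>Basis. iexp ((w \<bullet> b) * (\<xi> \<bullet> b))) * complex_of_real (\<Prod>b\<in>Basis. exp (- ((\<xi> \<bullet> b)\<^sup>2) / 2))"
      by (simp add: prod.distrib)
    also have "(\<Prod>b\<in>Basis. iexp ((w \<bullet> b) * (\<xi> \<bullet> b))) = iexp (w \<bullet> \<xi>)"
      by (simp add: exp_sum[symmetric] sum_distrib_left[symmetric] euclidean_inner[of w \<xi>])
    also have "(\<Prod>b\<in>Basis. exp (- ((\<xi> \<bullet> b)\<^sup>2) / 2)) = exp (- ((norm \<xi>)\<^sup>2) / 2)"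
      by (rule gauss_prod)
    finally show ?thesis by simp
  qed
  have "(CLINT \<xi>|lborel. iexp (w \<bullet> \<xi>) * complex_of_real (exp (- ((norm \<xi>)\<^sup>2) / 2)))
     = integral\<^sup>L (distr (\<Pi>\<^sub>M b\<in>Basis. lborel) borel (\<lambda>f. \<Sum>b\<in>Basis. f b *\<^sub>R b)) (\<lambda>\<xi>::'a. \<Prod>b\<in>Basis. ?g (w \<bullet> b) (\<xi> \<bullet> b))"
    unfolding prod lborel_eq[symmetric] ..
  also have "\<dots> = integral\<^sup>L (\<Pi>\<^sub>M b\<in>Basis. lborel) (\<lambda>f. \<Prod>b\<in>Basis. ?g (w \<bullet> b) ((\<Sum>b\<in>Basis. f b *\<^sub>R b) \<bullet> b))"
    by (rule integral_distr) measurable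
  also have "\<dots> = integral\<^sup>L (\<Pi>\<^sub>M b\<in>Basis. lborel) (\<lambda>f. \<Prod>b\<in>Basis. ?g (w \<bullet> b) (f b))"
    by (intro Bochner_Integration.integral_cong refl prod.cong) simp
  also have "\<dots> = (\<Prod>b\<in>Basis. integral\<^sup>L lborel (?g (w \<bullet> b)))"
    by (rule P.product_integral_prod[OF finite_Basis gauss_integrable_1d])
  also have "\<dots> = (\<Prod>b\<in>Basis. complex_of_real (sqrt (2 * pi) * exp (- ((w \<bullet> b)\<^sup>2) / 2)))"
    by (simp only: gauss_char_1d)
  also have "\<dots> = complex_of_real (sqrt (2 * pi) ^ DIM('a) * exp (- ((norm w)\<^sup>2) / 2))"
  proof -
    have "(\<Prod>b\<in>Basis. sqrt (2 * pi) * exp (- ((w \<bullet> b)\<^sup>2) / 2)) = sqrt (2 * pi) ^ DIM('a) * exp (- ((norm w)\<^sup>2) / 2)"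
      by (simp only: prod.distrib prod_constant gauss_prod)
    then show ?thesis by (simp only: of_real_prod[symmetric])
  qed
  finally show ?thesis .
qed

lemma gauss_integrable: "integrable lborel (\<lambda>\<xi>::'a::euclidean_space. exp (- ((norm \<xi>)\<^sup>2) / 2))"
proof -
  have "1 + norm x \<noteq> 0" for x :: 'a using norm_ge_zero[of x] by linarith
  then show ?thesis using integrable_exp_weight[of "1/2" 2 0, where 'a='a] by (simp add: powr_numeral)
qed

lemma gauss_cos:
  fixes w :: "'a::euclidean_space"
  shows "(LBINT \<xi>. cos (w \<bullet> \<xi>) * exp (- ((norm \<xi>)\<^sup>2) / 2)) = sqrt (2 * pi) ^ DIM('a) * exp (- ((norm w)\<^sup>2) / 2)"
proof -
  let ?F = "\<lambda>\<xi>. iexp (w \<bullet> \<xi>) * complex_of_real (exp (- ((norm \<xi>)\<^sup>2) / 2))"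
  have "integrable lborel ?F"
    by (rule Bochner_Integration.integrable_bound[OF gauss_integrable[where 'a='a]]) (auto simp: norm_mult)
  then have "Re (integral\<^sup>L lborel ?F) = (LBINT \<xi>. Re (?F \<xi>))" by (rule integral_Re[symmetric])
  moreover have "Re (?F \<xi>) = cos (w \<bullet> \<xi>) * exp (- ((norm \<xi>)\<^sup>2) / 2)" for \<xi>
    by (simp add: Re_exp)
  ultimately show ?thesis unfolding gauss_char by simp
qed

lemma gauss_cos_scaled:
  fixes w :: "'a::euclidean_space"
  assumes h: "h > 0"
  shows "(LBINT \<xi>. cos (w \<bullet> \<xi>) * heat_weight s h 0 \<xi>) = sqrt (2 * pi) ^ DIM('a) / h ^ DIM('a) * exp (- ((norm (w /\<^sub>R h))\<^sup>2) / 2)"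
proof -
  let ?f = "\<lambda>\<xi>::'a. cos ((w /\<^sub>R h) \<bullet> \<xi>) * exp (- ((norm \<xi>)\<^sup>2) / 2)"
  have "?f (0 + h *\<^sub>R \<xi>) = cos (w \<bullet> \<xi>) * heat_weight s h 0 \<xi>" for \<xi>
    using h by (simp add: heat_weight_def powr_numeral power_mult_distrib mult.assoc[symmetric])
  then have "(LBINT \<xi>. cos (w \<bullet> \<xi>) * heat_weight s h 0 \<xi>) = (LBINT \<xi>. ?f (0 + h *\<^sub>R \<xi>))" by simp
  also have "\<dots> = integral\<^sup>L lborel ?f / \<bar>h\<bar> ^ DIM('a)"
    by (rule lborel_integral_affine) (use h in auto)
  also have "\<dots> = sqrt (2 * pi) ^ DIM('a) / h ^ DIM('a) * exp (- ((norm (w /\<^sub>R h))\<^sup>2) / 2)"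
    unfolding gauss_cos using h by simp
  finally show ?thesis .
qed

lemma one_minus_abs_le_cos: "1 - \<bar>x\<bar> \<le> cos x" for x :: real
proof (cases "\<bar>x\<bar> \<le> 2")
  case True
  have "x\<^sup>2 / 2 = \<bar>x\<bar> * \<bar>x\<bar> / 2" by (simp add: power2_eq_square)
  also have "\<dots> \<le> \<bar>x\<bar> * 2 / 2" using True by (intro divide_right_mono mult_left_mono) auto
  finally show ?thesis using one_minus_cos_le[of x] by linarith
next
  case False
  then show ?thesis using cos_ge_minus_one[of x] by linarith
qed

section \<open>The flow of an integrable datum\<close>

context
  fixes f :: "'a::euclidean_space \<Rightarrow> real" and s h :: real
  assumes s: "0 < s" "s < 1" and h: "h > 0" and f0: "\<And>y. f y \<ge> 0" and fi: "integrable lborel f"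
begin

definition cos_transform :: "'a \<Rightarrow> real" where "cos_transform \<xi> = (LBINT y. cos (y \<bullet> \<xi>) * f y)"
definition sin_transform :: "'a \<Rightarrow> real" where "sin_transform \<xi> = (LBINT y. sin (y \<bullet> \<xi>) * f y)"

lemma datum_measurable [measurable]: "f \<in> borel_measurable borel" using borel_measurable_integrable[OF fi] by simp

lemma trig_integrable:
  assumes "g \<in> borel_measurable borel" "\<And>y. \<bar>g y\<bar> \<le> 1"
  shows "integrable lborel (\<lambda>y. g y * f y)"
  by (rule Bochner_Integration.integrable_bound[OF fi])
    (use assms f0 in \<open>auto simp: abs_mult intro!: mult_left_le_one_le\<close>)

lemma wave_eq: "wave cos_transform sin_transform x \<xi> = (LBINT y. cos ((x - y) \<bullet> \<xi>) * f y)"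
proof -
  have "(LBINT y. cos ((x - y) \<bullet> \<xi>) * f y)
     = (LBINT y. cos (x \<bullet> \<xi>) * (cos (y \<bullet> \<xi>) * f y) + sin (x \<bullet> \<xi>) * (sin (y \<bullet> \<xi>) * f y))"
    by (simp only: inner_diff_left cos_diff distrib_right mult.assoc)
  also have "\<dots> = wave cos_transform sin_transform x \<xi>"
    unfolding wave_def cos_transform_def sin_transform_def
    by (subst Bochner_Integration.integral_add) (auto intro!: integrable_mult_right trig_integrable)
  finally show ?thesis by simp
qed

lemma transforms_measurable [measurable]: "cos_transform \<in> borel_measurable borel" "sin_transform \<in> borel_measurable borel"
  unfolding cos_transform_def[abs_def] sin_transform_def[abs_def]
  by (rule lborel.borel_measurable_lebesgue_integral, measurable)+

lemma wave_abs_le: "\<bar>wave cos_transform sin_transform x \<xi>\<bar> \<le> integral\<^sup>L lborel f"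
proof -
  have "\<bar>wave cos_transform sin_transform x \<xi>\<bar> \<le> (LBINT y. \<bar>cos ((x - y) \<bullet> \<xi>) * f y\<bar>)"
    unfolding wave_eq using integral_norm_bound[of lborel "\<lambda>y. cos ((x - y) \<bullet> \<xi>) * f y"] by simp
  also have "\<dots> \<le> integral\<^sup>L lborel f"
    by (rule integral_mono[OF integrable_abs[OF trig_integrable] fi])
      (use f0 in \<open>auto simp: abs_mult intro!: mult_left_le_one_le\<close>)
  finally show ?thesis .
qed

text \<open>Since \<open>cos \<ge> 1 - |\<cdot>|\<close>, the flow of a datum concentrated near \<open>x\<close> is bounded below without knowing
  that the heat kernel is positive.\<close>

lemma wave_lower:
  assumes "\<And>y. f y \<noteq> 0 \<Longrightarrow> norm (x - y) \<le> r"
  shows "integral\<^sup>L lborel f * (1 - r * norm \<xi>) \<le> wave cos_transform sin_transform x \<xi>"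
proof -
  have "integral\<^sup>L lborel f * (1 - r * norm \<xi>) = (LBINT y. (1 - r * norm \<xi>) * f y)" by simp
  also have "\<dots> \<le> wave cos_transform sin_transform x \<xi>" unfolding wave_eq
  proof (rule integral_mono[OF integrable_mult_right[OF fi] trig_integrable])
    fix y
    show "(1 - r * norm \<xi>) * f y \<le> cos ((x - y) \<bullet> \<xi>) * f y"
    proof (cases "f y = 0")
      case False
      have "\<bar>(x - y) \<bullet> \<xi>\<bar> \<le> norm (x - y) * norm \<xi>" by (rule Cauchy_Schwarz_ineq2)
      also have "\<dots> \<le> r * norm \<xi>" using assms[OF False] by (intro mult_right_mono) auto
      finally have "1 - r * norm \<xi> \<le> cos ((x - y) \<bullet> \<xi>)" using one_minus_abs_le_cos[of "(x - y) \<bullet> \<xi>"] by linarith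
      then show ?thesis using f0[of y] by (intro mult_right_mono) auto
    qed simp
  qed auto
  finally show ?thesis .
qed

text \<open>The Gaussian factor makes Fubini applicable, so Fourier inversion reduces to the
  explicit transform of a Gaussian. At time 0 the flow is thus, up to normalisation, an average of
  \<open>f\<close> with a positive kernel of scale \<open>h\<close>.\<close>

lemma spectral_initial:
  "spectral s h cos_transform sin_transform 0 x = sqrt (2 * pi) ^ DIM('a) * (LBINT z. f (x + h *\<^sub>R z) * exp (- ((norm z)\<^sup>2) / 2))"
proof -
  let ?E = "\<lambda>\<xi>::'a. heat_weight s h 0 \<xi>"
  note ctx = s h transforms_measurable wave_abs_le
  have Ei: "integrable lborel ?E" by (rule heat_weight0_integrable[OF ctx])
  have [measurable]: "?E \<in> borel_measurable borel" using borel_measurable_integrable[OF Ei] by simp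
  let ?F = "\<lambda>y \<xi>. cos ((x - y) \<bullet> \<xi>) * f y * ?E \<xi>"
  have iF: "integrable (lborel \<Otimes>\<^sub>M lborel) (case_prod ?F)"
  proof (rule Bochner_Integration.integrable_bound[OF integrable_pair_product[OF fi Ei]])
    show "case_prod ?F \<in> borel_measurable (lborel \<Otimes>\<^sub>M lborel)" unfolding split_def by measurable
    show "AE q in lborel \<Otimes>\<^sub>M lborel. norm (case_prod ?F q) \<le> norm (case q of (y, \<xi>) \<Rightarrow> f y * ?E \<xi>)"
      using f0 by (intro AE_I2) (auto simp: abs_mult split: prod.split intro!: mult_right_mono mult_left_le_one_le)
  qed
  have "spectral s h cos_transform sin_transform 0 x = (LBINT \<xi>. (LBINT y. ?F y \<xi>))"
    unfolding spectral_def wave_eq by simp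
  also have "\<dots> = (LBINT y. (LBINT \<xi>. ?F y \<xi>))"
    by (rule lborel_pair.Fubini_integral[OF iF])
  also have "\<dots> = (LBINT y. f y * (sqrt (2 * pi) ^ DIM('a) / h ^ DIM('a) * exp (- ((norm ((x - y) /\<^sub>R h))\<^sup>2) / 2)))"
  proof (rule Bochner_Integration.integral_cong[OF refl])
    fix y
    have "(LBINT \<xi>. ?F y \<xi>) = (LBINT \<xi>. f y * (cos ((x - y) \<bullet> \<xi>) * ?E \<xi>))" by (simp only: mult_ac)
    then show "(LBINT \<xi>. ?F y \<xi>) = f y * (sqrt (2 * pi) ^ DIM('a) / h ^ DIM('a) * exp (- ((norm ((x - y) /\<^sub>R h))\<^sup>2) / 2))"
      by (simp only: integral_mult_right_zero gauss_cos_scaled[OF h])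
  qed
  also have "\<dots> = sqrt (2 * pi) ^ DIM('a) * ((LBINT y. f y * exp (- ((norm ((x - y) /\<^sub>R h))\<^sup>2) / 2)) / \<bar>h\<bar> ^ DIM('a))"
  proof -
    have "(\<lambda>y. f y * (sqrt (2 * pi) ^ DIM('a) / h ^ DIM('a) * exp (- ((norm ((x - y) /\<^sub>R h))\<^sup>2) / 2)))
      = (\<lambda>y. (sqrt (2 * pi) ^ DIM('a) / h ^ DIM('a)) * (f y * exp (- ((norm ((x - y) /\<^sub>R h))\<^sup>2) / 2)))" by (simp only: mult_ac)
    then show ?thesis using h by (simp only: integral_mult_right_zero) simp
  qed
  also have "(LBINT y. f y * exp (- ((norm ((x - y) /\<^sub>R h))\<^sup>2) / 2)) / \<bar>h\<bar> ^ DIM('a)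
     = (LBINT z. f (x + h *\<^sub>R z) * exp (- ((norm ((x - (x + h *\<^sub>R z)) /\<^sub>R h))\<^sup>2) / 2))"
    by (rule lborel_integral_affine[symmetric]) (use h in auto)
  also have "\<dots> = (LBINT z. f (x + h *\<^sub>R z) * exp (- ((norm z)\<^sup>2) / 2))"
    using h by simp
  finally show ?thesis .
qed

end

lemma compact_support_uniform:
  fixes f :: "'a::euclidean_space \<Rightarrow> real"
  assumes c: "continuous_on UNIV f" and sp: "\<And>y. f y \<noteq> 0 \<Longrightarrow> norm y \<le> R" and e: "\<epsilon> > 0"
  shows "\<exists>\<delta>>0. \<forall>x y. norm (x - y) < \<delta> \<longrightarrow> \<bar>f x - f y\<bar> < \<epsilon>"
proof -
  have "uniformly_continuous_on (cball 0 (R + 1)) f"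
    by (rule compact_uniformly_continuous) (auto intro: continuous_on_subset[OF c])
  then obtain d where d: "d > 0" "\<And>x y. x \<in> cball 0 (R + 1) \<Longrightarrow> y \<in> cball 0 (R + 1) \<Longrightarrow> dist x y < d \<Longrightarrow> dist (f x) (f y) < \<epsilon>"
    unfolding uniformly_continuous_on_def using e by (metis dist_commute)
  show ?thesis
  proof (intro exI[of _ "min d 1"] conjI allI impI)
    fix x y :: 'a assume xy: "norm (x - y) < min d 1"
    show "\<bar>f x - f y\<bar> < \<epsilon>"
    proof (cases "norm x \<le> R + 1 \<and> norm y \<le> R + 1")
      case True
      then show ?thesis using d(2)[of x y] xy by (auto simp: dist_norm)
    next
      case False
      have "norm x \<le> norm y + norm (x - y)" "norm y \<le> norm x + norm (x - y)"
        using norm_triangle_sub[of x y] norm_triangle_sub[of y x] by (auto simp: norm_minus_commute)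
      then have "norm x > R" "norm y > R" using False xy by auto
      then have "f x = 0" "f y = 0" using sp[of x] sp[of y] by fastforce+
      then show ?thesis using e by simp
    qed
  qed (use d in auto)
qed

text \<open>Collects what the comparison argument asks of a linear flow. No sign of \<open>v\<close>
  is included, since positivity of the heat kernel is not proved. The parameters \<open>Ce\<close>,
  \<open>c0\<close> and \<open>\<delta>\<close> are meant to be uniform in the datum, while the
  bound \<open>M\<close> may depend on it and on \<open>\<epsilon>\<close>.\<close>

definition flow_from :: "real \<Rightarrow> real \<Rightarrow> real \<Rightarrow> real \<Rightarrow> ('a::euclidean_space \<Rightarrow> real) \<Rightarrow> real \<Rightarrow> (real \<Rightarrow> 'a \<Rightarrow> real) \<Rightarrow> bool" where
  "flow_from s Ce c0 \<delta> f \<epsilon> v \<longleftrightarrow>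
      continuous_on ({0..} \<times> UNIV) (\<lambda>q. v (fst q) (snd q)) \<and>
      (\<forall>\<tau>>0. \<forall>x. \<exists>V. ((\<lambda>\<tau>. v \<tau> x) has_real_derivative - V) (at \<tau>) \<and> frac_lap s (v \<tau>) x V) \<and>
      (\<forall>x. v 0 x \<le> f x + \<epsilon>) \<and>
      (\<forall>\<tau>>0. \<forall>x. v \<tau> x \<le> Ce * \<tau> powr (- (real DIM('a) / (2 * s)))) \<and>
      (\<exists>M. \<forall>\<tau>\<ge>0. \<forall>x. v \<tau> x \<le> M) \<and>
      (\<forall>\<tau>\<in>{1/2..1}. \<forall>x. norm x \<le> \<delta> \<longrightarrow> c0 \<le> v \<tau> x)"

text \<open>For a nonnegative datum of mass 1 supported in the ball of radius
  \<open>\<delta>\<close>, the \<open>wave\<close> factor is at most 1, and at least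
  \<open>1 - 2 \<delta> |\<xi>|\<close> when \<open>norm x <= \<delta>\<close>. The constants are
  therefore integrals of the symbol alone; only the mollification scale \<open>h\<close> depends on
  the datum.\<close>

lemma linear_flow:
  assumes s: "0 < s" "s < 1"
  shows "\<exists>Ce>0. \<exists>c0>0. \<exists>\<delta>>0. \<forall>(f :: 'a::euclidean_space \<Rightarrow> real) Bd \<epsilon>.
    continuous_on UNIV f \<and> (\<forall>y. 0 \<le> f y \<and> f y \<le> Bd) \<and> (\<forall>y. f y \<noteq> 0 \<longrightarrow> norm y \<le> \<delta>) \<and> integral\<^sup>L lborel f = 1 \<and> \<epsilon> > 0 \<longrightarrow>
    (\<exists>v. flow_from s Ce c0 \<delta> f \<epsilon> v)"
proof -
  let ?N = "DIM('a)"
  obtain c where c: "c > 0" "\<And>\<xi>::'a. c * norm \<xi> powr (2 * s) \<le> lap_symbol s \<xi>" using lap_symbol_lower[OF s] by blast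
  \<comment> \<open>The constant of Fourier inversion. It cancels one factor
    \<open>sqrt (2 * pi) ^ ?N\<close> from the transform of the Gaussian and another from its mass,
    see \<open>cNs\<close>.\<close>
  define cN :: real where "cN = 1 / (2 * pi) ^ ?N"
  have cN: "cN > 0" by (simp add: cN_def)
  have nz: "1 + norm x \<noteq> 0" for x :: 'a using norm_ge_zero[of x] by linarith
  let ?g = "\<lambda>\<xi>::'a. exp (- (c * norm \<xi> powr (2 * s)))"
  have ig: "integrable lborel ?g" using integrable_exp_weight[of c "2 * s" 0, where 'a='a] c s nz by simp
  define Ce where "Ce = cN * (integral\<^sup>L lborel ?g + 1)"
  have Ig0: "integral\<^sup>L lborel ?g \<ge> 0" by (intro integral_nonneg_AE AE_I2) auto
  have Ce: "Ce > 0" unfolding Ce_def using cN by (rule mult_pos_pos) (use Ig0 in linarith)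
  \<comment> \<open>Envelopes valid for all times in \<open>[1/2, 1]\<close> and all
    \<open>h <= 1\<close>: \<open>?l\<close> lies below \<open>heat_weight\<close>, and
    \<open>?u\<close> above \<open>norm \<xi>\<close> times it.\<close>
  let ?l = "\<lambda>\<xi>::'a. exp (- (lap_symbol s \<xi> + 1 / 2 * norm \<xi> powr 2))"
  let ?u = "\<lambda>\<xi>::'a. norm \<xi> * exp (- (c / 2 * norm \<xi> powr (2 * s)))"
  have [measurable]: "lap_symbol s \<in> borel_measurable (borel :: 'a measure)" by (rule lap_symbol_measurable[OF s])
  have iu: "integrable lborel ?u"
  proof (rule Bochner_Integration.integrable_bound)
    show "integrable lborel (\<lambda>\<xi>::'a. (1 + norm \<xi>) powr 1 * exp (- (c / 2 * norm \<xi> powr (2 * s))))"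
      using c s by (intro integrable_exp_weight) auto
    show "AE \<xi>::'a in lborel. norm (?u \<xi>) \<le> norm ((1 + norm \<xi>) powr 1 * exp (- (c / 2 * norm \<xi> powr (2 * s))))"
      using nz by (intro AE_I2) (auto simp: abs_mult intro!: mult_right_mono)
  qed measurable
  have il: "integrable lborel ?l"
  proof (rule Bochner_Integration.integrable_bound[OF gauss_integrable[where 'a='a]])
    show "AE \<xi>::'a in lborel. norm (?l \<xi>) \<le> norm (exp (- ((norm \<xi>)\<^sup>2) / 2))"
      using lap_symbol_nonneg[OF s, where 'a='a] by (intro AE_I2) (simp add: powr_numeral)
  qed measurable
  define e0 where "e0 = integral\<^sup>L lborel ?l"
  define e1 where "e1 = integral\<^sup>L lborel ?u"
  have e0: "e0 > 0"
  proof -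
    have "e0 \<noteq> 0"
    proof
      assume "e0 = 0"
      then have "AE \<xi> in lborel. ?l \<xi> = 0"
        using integral_nonneg_eq_0_iff_AE[OF il] by (simp add: e0_def)
      then have "ae_filter (lborel :: 'a measure) = bot" by (simp add: trivial_limit_def)
      then show False by (simp add: ae_filter_eq_bot_iff)
    qed
    moreover have "e0 \<ge> 0" unfolding e0_def by (intro integral_nonneg_AE AE_I2) auto
    ultimately show ?thesis by simp
  qed
  have e1: "e1 \<ge> 0" unfolding e1_def by (intro integral_nonneg_AE AE_I2) auto
  \<comment> \<open>Makes the loss \<open>2 * \<delta> * e1\<close> at most half of the main term
    \<open>e0\<close>.\<close>
  define \<delta> where "\<delta> = e0 / (4 * (e1 + 1))"
  have del: "\<delta> > 0" using e0 e1 by (simp add: \<delta>_def)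
  have del2: "2 * \<delta> * e1 \<le> e0 / 2"
  proof -
    have "2 * \<delta> * e1 = e0 / 2 * (e1 / (e1 + 1))" using e1 by (simp add: \<delta>_def divide_simps)
    also have "\<dots> \<le> e0 / 2 * 1" using e0 e1 by (intro mult_left_mono) auto
    finally show ?thesis by simp
  qed
  define c0 where "c0 = cN * (e0 / 2)"
  have c0: "c0 > 0" unfolding c0_def using cN e0 by simp
  let ?G = "\<lambda>z::'a. exp (- ((norm z)\<^sup>2) / 2)"
  have iG: "integrable lborel ?G" by (rule gauss_integrable)
  have intG: "integral\<^sup>L lborel ?G = sqrt (2 * pi) ^ ?N" using gauss_cos[of "0::'a"] by simp
  have iG1: "integrable lborel (\<lambda>z::'a. norm z * ?G z)"
  proof (rule Bochner_Integration.integrable_bound)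
    show "integrable lborel (\<lambda>\<xi>::'a. (1 + norm \<xi>) powr 1 * exp (- (1 / 2 * norm \<xi> powr 2)))"
      by (intro integrable_exp_weight) auto
    show "AE \<xi>::'a in lborel. norm (norm \<xi> * ?G \<xi>) \<le> norm ((1 + norm \<xi>) powr 1 * exp (- (1 / 2 * norm \<xi> powr 2)))"
      using nz by (intro AE_I2) (auto simp: abs_mult powr_numeral intro!: mult_right_mono)
  qed measurable
  define M1 where "M1 = (LBINT z::'a. norm z * ?G z)"
  have M1: "M1 \<ge> 0" unfolding M1_def by (intro integral_nonneg_AE AE_I2) auto
  have cNs: "cN * (sqrt (2 * pi) ^ ?N * sqrt (2 * pi) ^ ?N) = 1"
  proof -
    have "sqrt (2 * pi) ^ ?N * sqrt (2 * pi) ^ ?N = (sqrt (2 * pi) * sqrt (2 * pi)) ^ ?N" by (rule power_mult_distrib[symmetric])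
    also have "sqrt (2 * pi) * sqrt (2 * pi) = 2 * pi" by simp
    finally show ?thesis by (simp add: cN_def)
  qed
  show ?thesis
  proof (rule exI[of _ Ce], rule conjI[OF Ce], rule exI[of _ c0], rule conjI[OF c0], rule exI[of _ \<delta>], rule conjI[OF del], intro allI impI, elim conjE)
    fix f :: "'a \<Rightarrow> real" and Bd \<epsilon> :: real
    assume fc: "continuous_on UNIV f" and fb: "\<forall>y. 0 \<le> f y \<and> f y \<le> Bd" and fs: "\<forall>y. f y \<noteq> 0 \<longrightarrow> norm y \<le> \<delta>"
      and f1: "integral\<^sup>L lborel f = 1" and eps: "\<epsilon> > 0"
    have f0: "f y \<ge> 0" for y using fb by auto
    have fi: "integrable lborel f" using f1 not_integrable_integral_eq[of lborel f] by force
    have [measurable]: "f \<in> borel_measurable borel" using borel_measurable_integrable[OF fi] by simp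
    have Bd: "Bd \<ge> 0" using fb[rule_format, of 0] by linarith
    obtain d where d: "d > 0" "\<And>x y. norm (x - y) < d \<Longrightarrow> \<bar>f x - f y\<bar> < \<epsilon> / 2"
      using compact_support_uniform[OF fc, of \<delta> "\<epsilon> / 2"] fs eps by auto
    let ?q = "sqrt (2 * pi) ^ ?N"
    have q: "?q > 0" by simp
    \<comment> \<open>Within distance \<open>d\<close> the average raises the datum by at most
      \<open>\<epsilon> / 2\<close>. Beyond it the datum is at most
      \<open>Bd <= Bd / d * (h * norm z)\<close>, whose Gaussian average this choice of
      \<open>h\<close> brings down to \<open>\<epsilon> / 2\<close>.\<close>
    define h where "h = min 1 (\<epsilon> / 2 / (cN * ?q * (Bd / d) * M1 + 1))"
    have den: "cN * ?q * (Bd / d) * M1 \<ge> 0" using cN Bd d(1) M1 by (intro mult_nonneg_nonneg) auto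
    then have h: "h > 0" "h \<le> 1" using eps by (auto simp: h_def)
    have hM: "cN * ?q * (Bd / d) * M1 * h \<le> \<epsilon> / 2"
    proof -
      let ?D = "cN * ?q * (Bd / d) * M1"
      have aux: "D * (e / (D + 1)) \<le> e" if "D \<ge> 0" "e > 0" for D e :: real
        using that by (simp add: divide_simps)
      have "?D * h \<le> ?D * (\<epsilon> / 2 / (?D + 1))" using den by (intro mult_left_mono) (auto simp: h_def)
      also have "\<dots> \<le> \<epsilon> / 2" by (rule aux[OF den]) (use eps in simp)
      finally show ?thesis .
    qed
    note fctx = s h(1) f0 fi
    define A where "A = cos_transform f"
    define B where "B = sin_transform f"
    have mA: "A \<in> borel_measurable borel" and mB: "B \<in> borel_measurable borel"
      unfolding A_def B_def by (rule transforms_measurable[OF fctx])+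
    have wk: "\<bar>wave A B x \<xi>\<bar> \<le> 1" for x \<xi>
      using wave_abs_le[OF fctx, of x \<xi>] by (simp add: A_def B_def f1)
    note ctx = s h(1) mA mB wk
    define v where "v = (\<lambda>\<tau> x. cN * spectral s h A B \<tau> x)"
    show "\<exists>v. flow_from s Ce c0 \<delta> f \<epsilon> v"
      unfolding flow_from_def
    proof (rule exI[of _ v], intro conjI allI impI ballI)
      show "continuous_on ({0..} \<times> UNIV) (\<lambda>q. v (fst q) (snd q))"
        unfolding v_def by (intro continuous_on_mult continuous_on_const spectral_continuous[OF ctx])
    next
      fix \<tau> :: real and x assume t: "\<tau> > 0"
      show "\<exists>V. ((\<lambda>\<tau>. v \<tau> x) has_real_derivative - V) (at \<tau>) \<and> frac_lap s (v \<tau>) x V"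
      proof (rule exI[of _ "cN * spectral_lap s h A B \<tau> x"], rule conjI)
        show "((\<lambda>\<tau>. v \<tau> x) has_real_derivative - (cN * spectral_lap s h A B \<tau> x)) (at \<tau>)"
          unfolding v_def using DERIV_cmult[OF spectral_deriv[OF ctx t, where x=x], where c=cN] by simp
        show "frac_lap s (v \<tau>) x (cN * spectral_lap s h A B \<tau> x)"
          unfolding v_def by (rule frac_lap_cmult[OF spectral_frac_lap[OF ctx t]])
      qed
    next
      fix x
      have "v 0 x = cN * ?q * (LBINT z. f (x + h *\<^sub>R z) * ?G z)"
        unfolding v_def A_def B_def spectral_initial[OF fctx] by simp
      also have "\<dots> \<le> cN * ?q * (LBINT z. (f x + \<epsilon> / 2) * ?G z + Bd / d * h * (norm z * ?G z))"
      proof (rule mult_left_mono)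
        show "(LBINT z. f (x + h *\<^sub>R z) * ?G z) \<le> (LBINT z. (f x + \<epsilon> / 2) * ?G z + Bd / d * h * (norm z * ?G z))"
        proof (rule integral_mono)
          show "integrable lborel (\<lambda>z. f (x + h *\<^sub>R z) * ?G z)"
          proof (rule Bochner_Integration.integrable_bound[OF integrable_mult_right[OF iG, of Bd]])
            show "AE z in lborel. norm (f (x + h *\<^sub>R z) * ?G z) \<le> norm (Bd * ?G z)"
              using fb Bd by (intro AE_I2) (auto simp: abs_mult intro!: mult_right_mono)
          qed measurable
          show "integrable lborel (\<lambda>z. (f x + \<epsilon> / 2) * ?G z + Bd / d * h * (norm z * ?G z))"
            by (intro Bochner_Integration.integrable_add integrable_mult_right iG iG1)
          fix z :: 'a
          have "f (x + h *\<^sub>R z) \<le> f x + \<epsilon> / 2 + Bd / d * h * norm z"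
          proof (cases "h * norm z < d")
            case True
            then have "\<bar>f (x + h *\<^sub>R z) - f x\<bar> < \<epsilon> / 2" using h by (intro d(2)) auto
            moreover have "Bd / d * h * norm z \<ge> 0" using Bd d h by (intro mult_nonneg_nonneg) auto
            ultimately show ?thesis by linarith
          next
            case False
            then have "Bd / d * d \<le> Bd / d * (h * norm z)" using Bd d by (intro mult_left_mono) auto
            then have "Bd \<le> Bd / d * h * norm z" using d(1) by (simp add: mult.assoc)
            moreover have "f (x + h *\<^sub>R z) \<le> Bd" using fb by auto
            ultimately show ?thesis using f0[of x] eps by linarith
          qed
          then have "f (x + h *\<^sub>R z) * ?G z \<le> (f x + \<epsilon> / 2 + Bd / d * h * norm z) * ?G z" by (intro mult_right_mono) auto
          then show "f (x + h *\<^sub>R z) * ?G z \<le> (f x + \<epsilon> / 2) * ?G z + Bd / d * h * (norm z * ?G z)"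
            by (simp only: distrib_right mult.assoc)
        qed
      qed (use cN in simp)
      also have "(LBINT z. (f x + \<epsilon> / 2) * ?G z + Bd / d * h * (norm z * ?G z)) = (f x + \<epsilon> / 2) * ?q + Bd / d * h * M1"
        by (simp only: Bochner_Integration.integral_add[OF integrable_mult_right[OF iG] integrable_mult_right[OF iG1]] integral_mult_right_zero intG M1_def)
      also have "cN * ?q * ((f x + \<epsilon> / 2) * ?q + Bd / d * h * M1) = cN * (?q * ?q) * (f x + \<epsilon> / 2) + cN * ?q * (Bd / d) * M1 * h"
        by (simp only: distrib_left mult_ac)
      also have "\<dots> \<le> f x + \<epsilon>" unfolding cNs mult_1_left using hM by linarith
      finally show "v 0 x \<le> f x + \<epsilon>" .
    next
      fix \<tau> :: real and x assume t: "\<tau> > 0"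
      define r where "r = \<tau> powr (1 / (2 * s))"
      have r: "r > 0" using t by (simp add: r_def)
      have rs: "r powr (2 * s) = \<tau>" using t s by (simp add: r_def powr_powr)
      have gr: "?g (0 + r *\<^sub>R \<xi>) = exp (- (\<tau> * (c * norm \<xi> powr (2 * s))))" for \<xi>
      proof -
        have "norm (0 + r *\<^sub>R \<xi>) powr (2 * s) = \<tau> * norm \<xi> powr (2 * s)" using r by (simp add: powr_mult rs)
        then show ?thesis by (simp only: mult.left_commute)
      qed
      have mg: "?g \<in> borel_measurable borel" using borel_measurable_integrable[OF ig] by simp
      have igr: "integrable lborel (\<lambda>\<xi>. ?g (0 + r *\<^sub>R \<xi>))" using lborel_integrable_affine[OF mg, of r 0] r ig by blast
      have "spectral s h A B \<tau> x \<le> 1 * (LBINT \<xi>::'a. heat_weight s h \<tau> \<xi>)"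
        using spectral_bound[OF ctx, where \<tau>=\<tau> and x=x] t by linarith
      also have "\<dots> \<le> (LBINT \<xi>. ?g (0 + r *\<^sub>R \<xi>))"
        unfolding mult_1_left
      proof (rule integral_mono[OF heat_weight_integrable[OF ctx] igr])
        fix \<xi> :: 'a
        have "\<tau> * (c * norm \<xi> powr (2 * s)) \<le> \<tau> * lap_symbol s \<xi>" using t by (intro mult_left_mono c) auto
        moreover have "0 \<le> h\<^sup>2 / 2 * norm \<xi> powr 2" by (rule mult_nonneg_nonneg) auto
        ultimately show "heat_weight s h \<tau> \<xi> \<le> ?g (0 + r *\<^sub>R \<xi>)" unfolding gr heat_weight_def exp_le_cancel_iff by linarith
      qed (use t in simp)
      also have "\<dots> = integral\<^sup>L lborel ?g / \<bar>r\<bar> ^ ?N" by (rule lborel_integral_affine[OF mg]) (use r in simp)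
      also have "\<dots> = integral\<^sup>L lborel ?g * \<tau> powr (- (real ?N / (2 * s)))"
      proof -
        have rN: "r ^ ?N = \<tau> powr (real ?N / (2 * s))"
        proof -
          have "r ^ ?N = r powr real ?N" using r by (simp add: powr_realpow)
          also have "\<dots> = \<tau> powr (real ?N / (2 * s))" unfolding r_def powr_powr by simp
          finally show ?thesis .
        qed
        show ?thesis unfolding abs_of_pos[OF r] rN powr_minus by (rule divide_inverse)
      qed
      also have "\<dots> \<le> (integral\<^sup>L lborel ?g + 1) * \<tau> powr (- (real ?N / (2 * s)))" by (intro mult_right_mono) auto
      finally have "cN * spectral s h A B \<tau> x \<le> cN * ((integral\<^sup>L lborel ?g + 1) * \<tau> powr (- (real ?N / (2 * s))))"
        using cN by (intro mult_left_mono) auto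
      then show "v \<tau> x \<le> Ce * \<tau> powr (- (real ?N / (2 * s)))" by (simp only: v_def Ce_def mult.assoc)
    next
      show "\<exists>M. \<forall>\<tau>\<ge>0. \<forall>x. v \<tau> x \<le> M"
      proof (intro exI[of _ "cN * (LBINT \<xi>::'a. heat_weight s h 0 \<xi>)"] allI impI)
        fix \<tau> :: real and x assume t: "0 \<le> \<tau>"
        have "spectral s h A B \<tau> x \<le> 1 * (LBINT \<xi>::'a. heat_weight s h \<tau> \<xi>)"
          using spectral_bound[OF ctx t, where x=x] by linarith
        also have "\<dots> \<le> (LBINT \<xi>::'a. heat_weight s h 0 \<xi>)"
          unfolding mult_1_left by (intro integral_mono heat_weight_integrable[OF ctx] heat_weight0_integrable[OF ctx] heat_weight_le[OF ctx] t)
        finally show "v \<tau> x \<le> cN * (LBINT \<xi>::'a. heat_weight s h 0 \<xi>)"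
          unfolding v_def using cN by (intro mult_left_mono) auto
      qed
    next
      fix \<tau> :: real and x :: 'a assume t: "\<tau> \<in> {1/2..1}" and x: "norm x \<le> \<delta>"
      have lw: "1 - 2 * \<delta> * norm \<xi> \<le> wave A B x \<xi>" for \<xi>
      proof -
        have "integral\<^sup>L lborel f * (1 - 2 * \<delta> * norm \<xi>) \<le> wave (cos_transform f) (sin_transform f) x \<xi>"
        proof (rule wave_lower[OF fctx])
          fix y assume "f y \<noteq> 0"
          then have "norm y \<le> \<delta>" using fs by auto
          then show "norm (x - y) \<le> 2 * \<delta>" using norm_triangle_ineq4[of x y] x by linarith
        qed
        then show ?thesis by (simp add: f1 A_def B_def)
      qed
      have "e0 - 2 * \<delta> * e1 = (LBINT \<xi>. ?l \<xi> - 2 * \<delta> * ?u \<xi>)"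
        by (simp only: Bochner_Integration.integral_diff[OF il integrable_mult_right[OF iu]] integral_mult_right_zero e0_def e1_def)
      also have "\<dots> \<le> spectral s h A B \<tau> x" unfolding spectral_def
      proof (rule integral_mono)
        show "integrable lborel (\<lambda>\<xi>. ?l \<xi> - 2 * \<delta> * ?u \<xi>)" by (intro Bochner_Integration.integrable_diff integrable_mult_right il iu)
        show "integrable lborel (\<lambda>\<xi>. wave A B x \<xi> * heat_weight s h \<tau> \<xi>)"
          using t by (intro wave_mult_integrable[OF ctx] heat_weight_integrable[OF ctx]) auto
        fix \<xi> :: 'a
        have sn: "lap_symbol s \<xi> \<ge> 0" by (rule lap_symbol_nonneg[OF s])
        have "\<tau> * lap_symbol s \<xi> + h\<^sup>2 / 2 * norm \<xi> powr 2 \<le> lap_symbol s \<xi> + 1 / 2 * norm \<xi> powr 2"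
        proof (rule add_mono)
          show "\<tau> * lap_symbol s \<xi> \<le> lap_symbol s \<xi>" using t sn by (intro mult_left_le_one_le) auto
          have "h\<^sup>2 \<le> 1" using h by (simp add: power_le_one)
          then show "h\<^sup>2 / 2 * norm \<xi> powr 2 \<le> 1 / 2 * norm \<xi> powr 2" by (intro mult_right_mono) auto
        qed
        then have 1: "?l \<xi> \<le> heat_weight s h \<tau> \<xi>" unfolding heat_weight_def by simp
        have "c / 2 * norm \<xi> powr (2 * s) \<le> \<tau> * lap_symbol s \<xi>"
        proof -
          have "(1/2) * (c * norm \<xi> powr (2 * s)) \<le> \<tau> * lap_symbol s \<xi>" using t c by (intro mult_mono) auto
          then show ?thesis by simp
        qed
        moreover have "0 \<le> h\<^sup>2 / 2 * norm \<xi> powr 2" by (intro mult_nonneg_nonneg) auto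
        ultimately have 2: "heat_weight s h \<tau> \<xi> \<le> exp (- (c / 2 * norm \<xi> powr (2 * s)))" unfolding heat_weight_def exp_le_cancel_iff by linarith
        have "?l \<xi> - 2 * \<delta> * ?u \<xi> \<le> heat_weight s h \<tau> \<xi> - 2 * \<delta> * (norm \<xi> * heat_weight s h \<tau> \<xi>)"
          using 1 2 del by (intro diff_mono mult_left_mono) auto
        also have "\<dots> = (1 - 2 * \<delta> * norm \<xi>) * heat_weight s h \<tau> \<xi>" by (simp add: algebra_simps)
        also have "\<dots> \<le> wave A B x \<xi> * heat_weight s h \<tau> \<xi>"
          using heat_weight_pos[OF ctx, of \<tau> \<xi>] by (intro mult_right_mono lw) auto
        finally show "?l \<xi> - 2 * \<delta> * ?u \<xi> \<le> wave A B x \<xi> * heat_weight s h \<tau> \<xi>" .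
      qed
      finally have "e0 / 2 \<le> spectral s h A B \<tau> x" using del2 by linarith
      then show "c0 \<le> v \<tau> x" unfolding c0_def v_def using cN by (intro mult_left_mono) auto
    qed
  qed
qed

section \<open>Points of concentration\<close>

text \<open>The condition of \<open>singular_set\<close> stated without \<open>Limsup\<close> and
  for Borel integrals, a form that passes directly to rescaled solutions.\<close>

definition concentrates :: "(real \<Rightarrow> 'a::euclidean_space \<Rightarrow> real) \<Rightarrow> 'a \<Rightarrow> bool" where
  "concentrates u z \<longleftrightarrow> (\<forall>\<rho>>0. \<forall>M. \<forall>\<tau>>0. \<exists>t. 0 < t \<and> t < \<tau> \<and> M < (LBINT x. indicator (ball z \<rho>) x * u t x))"

lemma sol_ball_integrable:
  assumes u: "absorption_sol s \<beta> p u" and t: "t > 0"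
  shows "integrable lborel (\<lambda>x. indicator (ball z r) x * u t x)"
proof -
  have "set_integrable lborel (cball z r) (u t)"
    unfolding set_integrable_def by (rule borel_integrable_compact) (auto intro: sol_cont_x[OF u t])
  then have "set_integrable lborel (ball z r) (u t)" by (rule set_integrable_subset) auto
  then show ?thesis by (simp add: set_integrable_def)
qed

text \<open>If \<open>u\<close> stays below the threshold near 0, the truncation loses nothing and
  keeps the mass. Otherwise \<open>harnack_dichotomy\<close> supplies a mass of order
  \<open>t0 powr (N / (2 s) - \<alpha>)\<close>, large for small \<open>t0\<close> because
  \<open>sub\<close> makes the exponent negative. Division by the mass, which is at least 1, leaves
  the function below \<open>u\<close>.\<close>

lemma compact_seed:
  assumes s: "0 < s" "s < 1" and p: "p > 1" and \<beta>: "\<beta> > -1"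
    and sub: "real DIM('a) / (2 * s) < (1 + \<beta>) / (p - 1)" and del: "\<delta> > 0"
  shows "\<exists>C>0. \<forall>(u :: real \<Rightarrow> 'a::euclidean_space \<Rightarrow> real). absorption_sol s \<beta> p u \<longrightarrow> concentrates u 0 \<longrightarrow>
    (\<exists>t0>0. t0 \<le> 1/2 \<and> (\<exists>f. continuous_on UNIV f \<and> (\<forall>y. 0 \<le> f y \<and> f y \<le> C * t0 powr (- ((1 + \<beta>) / (p - 1)))) \<and>
      (\<forall>y. f y \<le> u t0 y) \<and> (\<forall>y. f y \<noteq> 0 \<longrightarrow> norm y \<le> \<delta>) \<and> integral\<^sup>L lborel f = 1))"
proof -
  let ?al = "(1 + \<beta>) / (p - 1)" and ?N = "real DIM('a)"
  obtain cH C where cH: "cH > 0" and C: "C > 0" and H: "\<And>(u :: real \<Rightarrow> 'a \<Rightarrow> real) t y x.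
    absorption_sol s \<beta> p u \<Longrightarrow> t > 0 \<Longrightarrow> u t y > C * t powr (- ?al) \<Longrightarrow> norm (x - y) \<le> t powr (1 / (2 * s)) \<Longrightarrow> cH * t powr (- ?al) \<le> u t x"
    using harnack_dichotomy[OF s p \<beta>, where 'a='a] by blast
  let ?V = "unit_ball_vol ?N"
  \<comment> \<open>The minimum lets the lower bound of the dichotomy survive the truncation at
    height \<open>C * t0 powr (- ?al)\<close>.\<close>
  define c where "c = min cH C"
  have c: "c > 0" using cH C by (simp add: c_def)
  have ev1: "\<forall>\<^sub>F t in at_right 0. t powr (1 / (2 * s)) < \<delta> / 4"
  proof -
    have "((\<lambda>t::real. t powr (1 / (2 * s))) \<longlongrightarrow> 0) (at_right 0)" using s by real_asymp
    then show ?thesis using del by (intro order_tendstoD(2)) auto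
  qed
  have ev2: "\<forall>\<^sub>F t in at_right 0. 9/16 * c * ?V * t powr (?N / (2 * s) - ?al) > 1"
  proof -
    have "filterlim (\<lambda>t::real. t powr (?N / (2 * s) - ?al)) at_top (at_right 0)"
      using sub by real_asymp
    then have "filterlim (\<lambda>t::real. (9/16 * c * ?V) * t powr (?N / (2 * s) - ?al)) at_top (at_right 0)"
      using c by (intro filterlim_tendsto_pos_mult_at_top[OF tendsto_const]) auto
    then show ?thesis unfolding filterlim_at_top_dense by blast
  qed
  have "\<forall>\<^sub>F t in at_right 0. t powr (1 / (2 * s)) < \<delta> / 4 \<and> 9/16 * c * ?V * t powr (?N / (2 * s) - ?al) > 1"
    by (rule eventually_conj[OF ev1 ev2])
  then obtain b where b: "b > 0" "\<And>t. 0 < t \<Longrightarrow> t < b \<Longrightarrow> t powr (1 / (2 * s)) < \<delta> / 4 \<and> 9/16 * c * ?V * t powr (?N / (2 * s) - ?al) > 1"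
    unfolding eventually_at_right_field by auto
  show ?thesis
  proof (rule exI[of _ C], rule conjI[OF C], intro allI impI)
    fix u :: "real \<Rightarrow> 'a \<Rightarrow> real" assume u: "absorption_sol s \<beta> p u" and conc: "concentrates u 0"
    \<comment> \<open>Mass 2 suffices, since the bump of radius \<open>\<delta>\<close> is at least
      \<open>9/16\<close> on the smaller ball and \<open>2 * 9/16 > 1\<close>.\<close>
    obtain t0 where t0: "0 < t0" "t0 < min b (1/2)" and mass: "2 < (LBINT x. indicator (ball 0 (\<delta>/4)) x * u t0 x)"
      using conc[unfolded concentrates_def, rule_format, of "\<delta>/4" "min b (1/2)" 2] b(1) del by auto
    let ?B = "C * t0 powr (- ?al)"
    have B: "?B > 0" using C t0 by simp
    define g where "g y = bump (y /\<^sub>R \<delta>) * min (u t0 y) ?B" for y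
    have up: "u t0 y > 0" for y by (rule sol_pos[OF u t0(1)])
    have g0: "0 \<le> g y" "g y \<le> ?B" "g y \<le> u t0 y" for y
    proof -
      have m: "0 \<le> min (u t0 y) ?B" using up[of y] B by simp
      show "0 \<le> g y" unfolding g_def by (rule mult_nonneg_nonneg[OF _ m]) simp
      have "g y \<le> min (u t0 y) ?B" unfolding g_def using m by (intro mult_left_le_one_le) auto
      then show "g y \<le> ?B" "g y \<le> u t0 y" by auto
    qed
    have gc: "continuous_on UNIV g" unfolding g_def
      by (intro continuous_on_mult bump_cont' continuous_on_scaleR continuous_on_const continuous_on_id continuous_on_min sol_cont_x[OF u t0(1)])
    have gs: "norm y \<le> \<delta>" if "g y \<noteq> 0" for y
      using that bump_outside[OF del, of y] unfolding g_def by force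
    have mg: "g \<in> borel_measurable borel" by (rule borel_measurable_continuous_onI[OF gc])
    have gi: "integrable lborel g"
    proof (rule Bochner_Integration.integrable_bound[OF sol_ball_integrable[OF u t0(1), of 0 "2 * \<delta>"]])
      show "g \<in> borel_measurable lborel" using mg by simp
      show "AE y in lborel. norm (g y) \<le> norm (indicator (ball 0 (2 * \<delta>)) y * u t0 y)"
      proof (rule AE_I2)
        fix y
        show "norm (g y) \<le> norm (indicator (ball 0 (2 * \<delta>)) y * u t0 y)"
        proof (cases "g y = 0")
          case False
          then have "norm y < 2 * \<delta>" using gs[of y] del by linarith
          then show ?thesis using g0[of y] by simp
        qed simp
      qed
    qed
    have bmp: "9/16 \<le> bump (y /\<^sub>R \<delta>)" if "norm y \<le> \<delta> / 2" for y :: 'a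
      using bump_ge_scaled[OF del, of y "1/2"] that by (simp add: power2_eq_square)
    define m where "m = integral\<^sup>L lborel g"
    have m: "m \<ge> 1"
    proof (cases "\<forall>y\<in>ball 0 (\<delta>/4). u t0 y \<le> ?B")
      case True
      have "9/16 * (LBINT x. indicator (ball 0 (\<delta>/4)) x * u t0 x) \<le> m"
        unfolding m_def integral_mult_right_zero[symmetric]
      proof (rule integral_mono[OF integrable_mult_right[OF sol_ball_integrable[OF u t0(1)]] gi])
        fix y
        show "9/16 * (indicator (ball 0 (\<delta>/4)) y * u t0 y) \<le> g y"
        proof (cases "y \<in> ball 0 (\<delta>/4)")
          case y: True
          then have "g y = bump (y /\<^sub>R \<delta>) * u t0 y" using True by (simp add: g_def)
          moreover have "9/16 \<le> bump (y /\<^sub>R \<delta>)" using y del by (intro bmp) auto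
          ultimately show ?thesis using y up[of y] by simp
        qed (use g0 in simp)
      qed
      then show ?thesis using mass by linarith
    next
      case False
      then obtain y0 where y0: "norm y0 < \<delta> / 4" "u t0 y0 > ?B" by (auto simp: not_le)
      let ?r = "t0 powr (1 / (2 * s))"
      have r: "0 < ?r" "?r < \<delta> / 4" and big: "9/16 * c * ?V * t0 powr (?N / (2 * s) - ?al) > 1" using b(2)[of t0] t0 by auto
      have "9/16 * (c * t0 powr (- ?al)) * measure lborel (ball y0 ?r) = (LBINT y. 9/16 * (c * t0 powr (- ?al)) * indicator (ball y0 ?r) y)" by simp
      also have "\<dots> \<le> m" unfolding m_def
      proof (rule integral_mono[OF _ gi])
        show "integrable lborel (\<lambda>y. 9/16 * (c * t0 powr (- ?al)) * indicator (ball y0 ?r) y)"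
          using emeasure_lborel_ball_finite by (intro integrable_mult_right integrable_real_indicator) auto
        fix y
        show "9/16 * (c * t0 powr (- ?al)) * indicator (ball y0 ?r) y \<le> g y"
        proof (cases "y \<in> ball y0 ?r")
          case True
          then have yy: "norm (y - y0) < ?r" by (simp add: dist_norm norm_minus_commute)
          then have "cH * t0 powr (- ?al) \<le> u t0 y" using H[OF u t0(1) y0(2), of y] by simp
          moreover have "c * t0 powr (- ?al) \<le> cH * t0 powr (- ?al)" "c * t0 powr (- ?al) \<le> ?B"
            by (auto simp: c_def intro!: mult_right_mono)
          ultimately have 1: "c * t0 powr (- ?al) \<le> min (u t0 y) ?B" by simp
          have "norm y \<le> norm y0 + norm (y - y0)" using norm_triangle_sub[of y y0] by simp
          then have 2: "9/16 \<le> bump (y /\<^sub>R \<delta>)" using yy r y0 by (intro bmp) linarith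
          have "9/16 * (c * t0 powr (- ?al)) \<le> g y" unfolding g_def using c by (intro mult_mono 1 2) auto
          then show ?thesis using True by simp
        qed (use g0 in simp)
      qed
      finally have "9/16 * (c * t0 powr (- ?al)) * measure lborel (ball y0 ?r) \<le> m" .
      moreover have "measure lborel (ball y0 ?r) = ?V * t0 powr (?N / (2 * s))"
      proof -
        have "?r ^ DIM('a) = ?r powr ?N" using r by (simp add: powr_realpow)
        also have "\<dots> = t0 powr (?N / (2 * s))" unfolding powr_powr by simp
        finally show ?thesis using r by (simp add: content_ball)
      qed
      moreover have "t0 powr (- ?al) * t0 powr (?N / (2 * s)) = t0 powr (?N / (2 * s) - ?al)"
        by (simp add: powr_add[symmetric])
      ultimately show ?thesis using big by (simp add: mult_ac)
    qed
    show "\<exists>t0>0. t0 \<le> 1/2 \<and> (\<exists>f. continuous_on UNIV f \<and> (\<forall>y. 0 \<le> f y \<and> f y \<le> C * t0 powr (- ?al)) \<and>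
      (\<forall>y. f y \<le> u t0 y) \<and> (\<forall>y. f y \<noteq> 0 \<longrightarrow> norm y \<le> \<delta>) \<and> integral\<^sup>L lborel f = 1)"
    proof (rule exI[of _ t0], intro conjI)
      have le: "g y / m \<le> g y" for y using m g0(1)[of y] by (simp add: divide_le_eq mult_le_cancel_left1)
      show "\<exists>f. continuous_on UNIV f \<and> (\<forall>y. 0 \<le> f y \<and> f y \<le> C * t0 powr (- ?al)) \<and>
        (\<forall>y. f y \<le> u t0 y) \<and> (\<forall>y. f y \<noteq> 0 \<longrightarrow> norm y \<le> \<delta>) \<and> integral\<^sup>L lborel f = 1"
      proof (rule exI[of _ "\<lambda>y. g y / m"], intro conjI allI impI)
        show "continuous_on UNIV (\<lambda>y. g y / m)" using m by (intro continuous_on_divide gc continuous_on_const) auto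
        show "0 \<le> g y / m" for y using g0 m by simp
        show "g y / m \<le> C * t0 powr (- ?al)" "g y / m \<le> u t0 y" for y using le[of y] g0[of y] by linarith+
        show "norm y \<le> \<delta>" if "g y / m \<noteq> 0" for y using that by (intro gs) auto
        show "(LBINT y. g y / m) = 1" using m by (simp add: m_def)
      qed
    qed (use t0 in auto)
  qed
qed

text \<open>The constant must not degenerate with the unknown seed time \<open>t0\<close>. The total
  damping is the exponential of a bound for the integral of \<open>t^\<beta> v^(p - 1)\<close>: on
  \<open>[t0, 2 t0]\<close> it is bounded because \<open>\<alpha> (p - 1) = 1 + \<beta>\<close>, on
  \<open>[2 t0, 1]\<close> because \<open>\<theta> > 0\<close>.\<close>

lemma singular_lower_unit:
  assumes s: "0 < s" "s < 1" and p: "p > 1" and \<beta>: "\<beta> > -1"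
    and sub: "real DIM('a) / (2 * s) < (1 + \<beta>) / (p - 1)"
  shows "\<exists>c>0. \<exists>\<delta>>0. \<forall>(u :: real \<Rightarrow> 'a::euclidean_space \<Rightarrow> real). absorption_sol s \<beta> p u \<longrightarrow> concentrates u 0 \<longrightarrow>
    (\<forall>x. norm x \<le> \<delta> \<longrightarrow> c \<le> u 1 x)"
proof -
  let ?al = "(1 + \<beta>) / (p - 1)" and ?N = "real DIM('a)"
  obtain Ce c0 \<delta> where Ce: "Ce > 0" and c0: "c0 > 0" and del: "\<delta> > 0" and flow: "\<And>(f :: 'a \<Rightarrow> real) Bd \<epsilon>.
    continuous_on UNIV f \<and> (\<forall>y. 0 \<le> f y \<and> f y \<le> Bd) \<and> (\<forall>y. f y \<noteq> 0 \<longrightarrow> norm y \<le> \<delta>) \<and> integral\<^sup>L lborel f = 1 \<and> \<epsilon> > 0 \<Longrightarrow>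
    (\<exists>v. flow_from s Ce c0 \<delta> f \<epsilon> v)"
    using linear_flow[OF s, where 'a='a] by blast
  obtain CH where CH: "CH > 0" and sd: "\<And>u :: real \<Rightarrow> 'a \<Rightarrow> real. absorption_sol s \<beta> p u \<Longrightarrow> concentrates u 0 \<Longrightarrow>
    (\<exists>t0>0. t0 \<le> 1/2 \<and> (\<exists>f. continuous_on UNIV f \<and> (\<forall>y. 0 \<le> f y \<and> f y \<le> CH * t0 powr (- ?al)) \<and>
      (\<forall>y. f y \<le> u t0 y) \<and> (\<forall>y. f y \<noteq> 0 \<longrightarrow> norm y \<le> \<delta>) \<and> integral\<^sup>L lborel f = 1))"
    using compact_seed[OF s p \<beta> sub del] by blast
  define \<gamma> where "\<gamma> = ?N / (2 * s) * (p - 1)"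
  \<comment> \<open>The decay of the flow turns \<open>t^\<beta> v^(p - 1)\<close> into a multiple
    of \<open>t powr (\<theta> - 1)\<close>, integrable at 0 exactly when
    \<open>\<theta> > 0\<close>, which is the subcriticality \<open>sub\<close>.\<close>
  define \<theta> where "\<theta> = 1 + \<beta> - \<gamma>"
  have th: "\<theta> > 0" unfolding \<theta>_def \<gamma>_def using sub p by (simp add: less_divide_eq)
  \<comment> \<open>The factor \<open>2 powr (\<beta> + 2)\<close> comes from
    \<open>t <= 2 * t0\<close>, the factor \<open>(2 * CH) powr (p - 1)\<close> from the height
    \<open>2 * CH * t0 powr (- ?al)\<close> of the flow up to that time.\<close>
  define C1 where "C1 = 2 powr (\<beta> + 2) * (2 * CH) powr (p - 1)"
  define C2 where "C2 = Ce powr (p - 1) * 2 powr \<gamma> / \<theta>"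
  have C12: "C1 > 0" "C2 > 0" unfolding C1_def C2_def using CH Ce th by auto
  define c where "c = exp (- C1 - C2) * c0 / 2"
  have c: "c > 0" unfolding c_def using c0 by simp
  show ?thesis
  proof (rule exI[of _ c], rule conjI[OF c], rule exI[of _ \<delta>], rule conjI[OF del], intro allI impI)
    fix u :: "real \<Rightarrow> 'a \<Rightarrow> real" and x :: 'a
    assume u: "absorption_sol s \<beta> p u" and conc: "concentrates u 0" and x: "norm x \<le> \<delta>"
    obtain t0 f where t0: "t0 > 0" "t0 \<le> 1/2" and f: "continuous_on UNIV f" "\<And>y. 0 \<le> f y" "\<And>y. f y \<le> CH * t0 powr (- ?al)"
      "\<And>y. f y \<le> u t0 y" "\<And>y. f y \<noteq> 0 \<Longrightarrow> norm y \<le> \<delta>" "integral\<^sup>L lborel f = 1"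
      using sd[OF u conc] by blast
    let ?B = "CH * t0 powr (- ?al)"
    have B: "?B > 0" using CH t0 by simp
    \<comment> \<open>The final comparison gives the bound \<open>2 * c\<close> minus
      \<open>\<epsilon>\<close>, hence the minimum with \<open>c\<close>; the minimum with
      \<open>?B\<close> yields \<open>v \<le> 2 * ?B\<close>.\<close>
    define \<epsilon> where "\<epsilon> = min ?B c"
    have eps: "\<epsilon> > 0" "\<epsilon> \<le> ?B" "\<epsilon> \<le> c" using B c by (auto simp: \<epsilon>_def)
    obtain v where v: "flow_from s Ce c0 \<delta> f \<epsilon> v"
      using flow[of f ?B \<epsilon>] f eps(1) by blast
    obtain M where vc: "continuous_on ({0..} \<times> UNIV) (\<lambda>q. v (fst q) (snd q))"
      and vd: "\<And>\<tau> x. \<tau> > 0 \<Longrightarrow> \<exists>V. ((\<lambda>\<tau>. v \<tau> x) has_real_derivative - V) (at \<tau>) \<and> frac_lap s (v \<tau>) x V"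
      and v0: "\<And>x. v 0 x \<le> f x + \<epsilon>" and vu: "\<And>\<tau> x. \<tau> > 0 \<Longrightarrow> v \<tau> x \<le> Ce * \<tau> powr (- (?N / (2 * s)))"
      and vM: "\<And>\<tau> x. \<tau> \<ge> 0 \<Longrightarrow> v \<tau> x \<le> M" and vl: "\<And>\<tau> x. \<tau> \<in> {1/2..1} \<Longrightarrow> norm x \<le> \<delta> \<Longrightarrow> c0 \<le> v \<tau> x"
      using v unfolding flow_from_def by blast
    \<comment> \<open>The maximum principle for the linear flow, by comparison with the constant
      solution \<open>?B\<close>.\<close>
    have vB: "v \<tau> x \<le> ?B + \<epsilon>" if tau: "\<tau> \<in> {0..1}" for \<tau> x
    proof (rule comparison[OF s, where ?t0.0=0 and ?t2.0=1 and V=v and U="\<lambda>_ _. ?B" and M=M])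
      show "continuous_on ({0..1} \<times> UNIV) (\<lambda>(t, x). v t x)"
      proof -
        have "{0..1::real} \<times> (UNIV :: 'a set) \<subseteq> {0..} \<times> UNIV" by auto
        from continuous_on_subset[OF vc this] show ?thesis by (simp only: split_def)
      qed
      show "continuous_on ({0..1} \<times> UNIV) (\<lambda>(t, x). ?B)" by (simp add: split_def)
      show "v 0 x \<le> ?B + \<epsilon>" for x using v0[of x] f(3)[of x] by linarith
      fix t :: real and x assume t: "t \<in> {0<..1}"
      then obtain V where V: "((\<lambda>\<tau>. v \<tau> x) has_real_derivative - V) (at t)" "frac_lap s (v t) x V" using vd[of t x] by auto
      show "\<exists>Vt LV Ut LU. ((\<lambda>\<tau>. v \<tau> x) has_real_derivative Vt) (at t) \<and> ((\<lambda>\<tau>. ?B) has_real_derivative Ut) (at t) \<and>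
         frac_lap s (v t) x LV \<and> frac_lap s (\<lambda>_. ?B) x LU \<and> (v t x > ?B \<longrightarrow> Vt + LV \<le> Ut + LU)"
        by (rule exI[of _ "- V"], rule exI[of _ V], rule exI[of _ 0], rule exI[of _ 0]) (use V in \<open>auto intro: frac_lap_const\<close>)
    qed (use vM B eps tau in auto)
    \<comment> \<open>Chosen so that \<open>\<phi> v\<close> is a subsolution: for \<open>t \<ge> 2 t0\<close> the term with \<open>C2\<close> beats the absorption by means of
      the decay \<open>v \<le> Ce (t - t0)\<^bsup>-N/2s\<^esup>\<close>; up to \<open>2 t0\<close>, where only \<open>v \<le> 2 CH t0\<^sup>-\<^sup>\<alpha>\<close> is available, the term with
      \<open>C1\<close> does.\<close>
    define \<phi> where "\<phi> t = exp (C1 * (t0 / t - 1) - C2 * (t powr \<theta> - t0 powr \<theta>))" for t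
    define b where "b t = C1 * (t0 / t\<^sup>2) + C2 * (\<theta> * t powr (\<theta> - 1))" for t
    have phi: "0 < \<phi> t" "t \<ge> t0 \<Longrightarrow> \<phi> t \<le> 1" for t
    proof -
      show "0 < \<phi> t" by (simp add: \<phi>_def)
      assume t: "t \<ge> t0"
      have "t0 / t - 1 \<le> 0" using t t0 by simp
      then have "C1 * (t0 / t - 1) \<le> 0" using C12 by (intro mult_nonneg_nonpos) auto
      moreover have "t0 powr \<theta> \<le> t powr \<theta>" using t t0 th by (intro powr_mono2) auto
      then have "0 \<le> C2 * (t powr \<theta> - t0 powr \<theta>)" using C12 by (intro mult_nonneg_nonneg) auto
      ultimately show "\<phi> t \<le> 1" unfolding \<phi>_def by simp
    qed
    have dphi: "(\<phi> has_real_derivative - (b t * \<phi> t)) (at t)" if "t > 0" for t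
      unfolding \<phi>_def b_def using that
      by (auto intro!: derivative_eq_intros simp: power2_eq_square field_simps)
    have bb: "t powr \<beta> * v (t - t0) x powr (p - 1) \<le> b t" if t: "t \<in> {t0<..1}" and vp: "v (t - t0) x > 0" for t x
    proof (cases "t \<le> 2 * t0")
      case True
      have "v (t - t0) x \<le> 2 * CH * t0 powr (- ?al)" using vB[of "t - t0" x] t t0 eps by auto
      then have "v (t - t0) x powr (p - 1) \<le> (2 * CH * t0 powr (- ?al)) powr (p - 1)" using vp p by (intro powr_mono2) auto
      also have "\<dots> = (2 * CH) powr (p - 1) * t0 powr (- (1 + \<beta>))"
      proof -
        have "- ?al * (p - 1) = - (1 + \<beta>)" using p by simp
        then have "(t0 powr (- ?al)) powr (p - 1) = t0 powr (- (1 + \<beta>))" by (simp only: powr_powr)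
        moreover have "(2 * CH * t0 powr (- ?al)) powr (p - 1) = (2 * CH) powr (p - 1) * (t0 powr (- ?al)) powr (p - 1)"
          by (rule powr_mult)
        ultimately show ?thesis by simp
      qed
      finally have 1: "t powr \<beta> * v (t - t0) x powr (p - 1) \<le> t powr \<beta> * ((2 * CH) powr (p - 1) * t0 powr (- (1 + \<beta>)))"
        by (intro mult_left_mono) auto
      have "t powr (\<beta> + 2) \<le> (2 * t0) powr (\<beta> + 2)" using True t t0 \<beta> by (intro powr_mono2) auto
      then have "t powr \<beta> * t\<^sup>2 \<le> 2 powr (\<beta> + 2) * (t0 powr (1 + \<beta>) * t0)"
        using t t0 by (simp add: powr_mult powr_add power2_eq_square mult_ac)
      moreover have "X * (1 / a) \<le> K * (y / q)" if "X * q \<le> K * (a * y)" "a > 0" "q > 0" for X a K y q :: real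
        using that by (simp add: divide_simps mult_ac)
      ultimately have "t powr \<beta> * (1 / t0 powr (1 + \<beta>)) \<le> 2 powr (\<beta> + 2) * (t0 / t\<^sup>2)"
        using t t0 by auto
      then have "t powr \<beta> * t0 powr (- (1 + \<beta>)) \<le> 2 powr (\<beta> + 2) * (t0 / t\<^sup>2)"
        by (simp only: powr_minus_divide)
      then have "(2 * CH) powr (p - 1) * (t powr \<beta> * t0 powr (- (1 + \<beta>))) \<le> (2 * CH) powr (p - 1) * (2 powr (\<beta> + 2) * (t0 / t\<^sup>2))"
        by (intro mult_left_mono) auto
      then have "t powr \<beta> * ((2 * CH) powr (p - 1) * t0 powr (- (1 + \<beta>))) \<le> C1 * (t0 / t\<^sup>2)"
        by (simp only: C1_def mult_ac)
      moreover have "0 \<le> C2 * (\<theta> * t powr (\<theta> - 1))" using C12 th by (intro mult_nonneg_nonneg) auto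
      ultimately show ?thesis unfolding b_def using 1 by linarith
    next
      case False
      then have tt: "t / 2 \<le> t - t0" "0 < t" using t t0 by auto
      have "v (t - t0) x \<le> Ce * (t - t0) powr (- (?N / (2 * s)))" using vu[of "t - t0" x] t by auto
      also have "\<dots> \<le> Ce * (t / 2) powr (- (?N / (2 * s)))"
        using Ce tt s by (intro mult_left_mono powr_mono2') auto
      finally have "v (t - t0) x powr (p - 1) \<le> (Ce * (t / 2) powr (- (?N / (2 * s)))) powr (p - 1)"
        using vp p by (intro powr_mono2) auto
      also have "\<dots> = Ce powr (p - 1) * ((t / 2) powr (- (?N / (2 * s)))) powr (p - 1)"
        by (rule powr_mult)
      also have "((t / 2) powr (- (?N / (2 * s)))) powr (p - 1) = (t / 2) powr (- \<gamma>)"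
        by (simp only: powr_powr \<gamma>_def mult_minus_left)
      also have "(t / 2) powr (- \<gamma>) = 2 powr \<gamma> * t powr (- \<gamma>)"
        using tt by (simp add: powr_divide powr_minus divide_simps)
      finally have "t powr \<beta> * v (t - t0) x powr (p - 1) \<le> t powr \<beta> * (Ce powr (p - 1) * (2 powr \<gamma> * t powr (- \<gamma>)))"
        by (intro mult_left_mono) auto
      also have "\<dots> = Ce powr (p - 1) * 2 powr \<gamma> * (t powr \<beta> * t powr (- \<gamma>))" by (simp only: mult_ac)
      also have "t powr \<beta> * t powr (- \<gamma>) = t powr (\<theta> - 1)" by (simp add: powr_add[symmetric] \<theta>_def)
      also have "Ce powr (p - 1) * 2 powr \<gamma> * t powr (\<theta> - 1) = C2 * (\<theta> * t powr (\<theta> - 1))" using th by (simp add: C2_def)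
      finally show ?thesis unfolding b_def using C12 t0 by (simp add: add_increasing)
    qed
    have cmp: "\<phi> 1 * v (1 - t0) x \<le> u 1 x + \<epsilon>"
    proof (rule comparison[OF s, where ?t0.0=t0 and ?t2.0=1 and V="\<lambda>t x. \<phi> t * v (t - t0) x" and U=u and M="max M 0"])
      have "continuous_on {t0..1} \<phi>"
        using t0 by (intro continuous_at_imp_continuous_on ballI DERIV_isCont[OF dphi]) auto
      then have "continuous_on ({t0..1} \<times> (UNIV::'a set)) (\<lambda>q. \<phi> (fst q))"
        by (rule continuous_on_compose2) (auto intro!: continuous_intros)
      moreover have "continuous_on ({t0..1} \<times> (UNIV::'a set)) (\<lambda>q. (\<lambda>q. v (fst q) (snd q)) (fst q - t0, snd q))"
        by (rule continuous_on_compose2[OF vc]) (auto intro!: continuous_intros)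
      ultimately show "continuous_on ({t0..1} \<times> UNIV) (\<lambda>(t, x). \<phi> t * v (t - t0) x)"
        unfolding split_def by (intro continuous_on_mult) auto
      show "continuous_on ({t0..1} \<times> UNIV) (\<lambda>(t, x). u t x)"
        by (rule sol_cont[OF u]) (use t0 in auto)
      show "\<phi> t * v (t - t0) x \<le> max M 0" if "t \<in> {t0..1}" for t x
      proof (cases "v (t - t0) x \<le> 0")
        case True
        then show ?thesis using phi(1)[of t] mult_nonneg_nonpos[of "\<phi> t" "v (t - t0) x"] by linarith
      next
        case False
        then have "\<phi> t * v (t - t0) x \<le> v (t - t0) x" using phi[of t] that by (intro mult_left_le_one_le) auto
        then show ?thesis using vM[of "t - t0" x] that by auto
      qed
      show "0 \<le> u t x" if "t \<in> {t0..1}" for t x using sol_pos[OF u, of t x] that t0 by auto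
      show "\<phi> t0 * v (t0 - t0) x \<le> u t0 x + \<epsilon>" for x
        using v0[of x] f(4)[of x] t0 by (simp add: \<phi>_def)
      fix t x assume t: "t \<in> {t0<..1}"
      then have tp: "t > 0" "t - t0 > 0" using t0 by auto
      obtain V where V: "((\<lambda>\<tau>. v \<tau> x) has_real_derivative - V) (at (t - t0))" "frac_lap s (v (t - t0)) x V" using vd[OF tp(2)] by blast
      obtain ut L where ul: "((\<lambda>\<tau>. u \<tau> x) has_real_derivative ut) (at t)" "frac_lap s (u t) x L" "ut + L + t powr \<beta> * u t x powr p = 0"
        using u tp(1) unfolding absorption_sol_def by blast
      have dv: "((\<lambda>\<tau>. v (\<tau> - t0) x) has_real_derivative - V) (at t)"
      proof -
        have "((\<lambda>\<tau>. \<tau> - t0) has_real_derivative 1) (at t)" by (auto intro!: derivative_eq_intros)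
        from DERIV_chain2[where f="\<lambda>\<tau>. v \<tau> x" and g="\<lambda>\<tau>. \<tau> - t0", OF V(1) this] show ?thesis by simp
      qed
      have dV: "((\<lambda>\<tau>. \<phi> \<tau> * v (\<tau> - t0) x) has_real_derivative - (b t * \<phi> t) * v (t - t0) x + \<phi> t * (- V)) (at t)"
        using DERIV_mult[OF dphi[OF tp(1)] dv] by (simp add: mult_ac)
      \<comment> \<open>Only points with \<open>\<phi> t * v (t - t0) x > u t x\<close> matter.
        There \<open>v\<close> is positive, as \<open>u\<close> is, and
        \<open>\<phi> t \<le> 1\<close> allows its power \<open>p\<close> to be replaced by its
        first power.\<close>
      have main: "- (b t * \<phi> t) * v (t - t0) x + \<phi> t * (- V) + \<phi> t * V \<le> ut + L" if gt: "\<phi> t * v (t - t0) x > u t x"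
      proof -
        have u0: "u t x > 0" by (rule sol_pos[OF u tp(1)])
        then have vp: "v (t - t0) x > 0" using gt phi(1)[of t] by (metis less_trans zero_less_mult_pos)
        have "u t x powr p \<le> (\<phi> t * v (t - t0) x) powr p" using gt u0 p by (intro powr_mono2) auto
        also have "\<dots> = \<phi> t powr p * v (t - t0) x powr p" by (rule powr_mult)
        also have "\<dots> \<le> \<phi> t powr 1 * v (t - t0) x powr p"
          using phi[of t] t p by (intro mult_right_mono powr_mono') auto
        also have "v (t - t0) x powr p = v (t - t0) x * v (t - t0) x powr (p - 1)"
          using vp powr_add[of "v (t - t0) x" 1 "p - 1"] by simp
        finally have "u t x powr p \<le> \<phi> t * (v (t - t0) x * v (t - t0) x powr (p - 1))" using phi(1)[of t] by simp
        then have "t powr \<beta> * u t x powr p \<le> t powr \<beta> * (\<phi> t * (v (t - t0) x * v (t - t0) x powr (p - 1)))" by (intro mult_left_mono) auto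
        also have "\<dots> = \<phi> t * v (t - t0) x * (t powr \<beta> * v (t - t0) x powr (p - 1))" by (simp only: mult_ac)
        also have "\<dots> \<le> \<phi> t * v (t - t0) x * b t" using phi(1)[of t] vp by (intro mult_left_mono bb t vp) auto
        finally have "t powr \<beta> * u t x powr p \<le> b t * \<phi> t * v (t - t0) x" by (simp only: mult_ac)
        then show ?thesis using ul(3) by simp
      qed
      show "\<exists>Vt LV Ut LU. ((\<lambda>\<tau>. \<phi> \<tau> * v (\<tau> - t0) x) has_real_derivative Vt) (at t) \<and> ((\<lambda>\<tau>. u \<tau> x) has_real_derivative Ut) (at t) \<and>
         frac_lap s (\<lambda>x. \<phi> t * v (t - t0) x) x LV \<and> frac_lap s (u t) x LU \<and> (\<phi> t * v (t - t0) x > u t x \<longrightarrow> Vt + LV \<le> Ut + LU)"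
        using dV ul(1) frac_lap_cmult[OF V(2), of "\<phi> t"] ul(2) main by blast
    qed (use eps t0 in auto)
    have "exp (- C1 - C2) \<le> \<phi> 1"
    proof -
      have "- C1 \<le> C1 * (t0 / 1 - 1)" using C12 t0 by (simp add: algebra_simps)
      moreover have "C2 * (1 powr \<theta> - t0 powr \<theta>) \<le> C2 * 1" using C12 by (intro mult_left_mono) auto
      ultimately show ?thesis unfolding \<phi>_def exp_le_cancel_iff by linarith
    qed
    then have "exp (- C1 - C2) * c0 \<le> \<phi> 1 * v (1 - t0) x"
      using vl[of "1 - t0" x] x t0 c0 phi(1)[of 1] by (intro mult_mono) auto
    then show "c \<le> u 1 x" using cmp eps(3) by (simp add: c_def)
  qed
qed

lemma concentrates_rescale:
  fixes u :: "real \<Rightarrow> 'a::euclidean_space \<Rightarrow> real"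
  assumes s: "0 < s" and u: "absorption_sol s \<beta> p u" and m: "\<mu> > 0" and conc: "concentrates u z"
  shows "concentrates (rescale s \<beta> p \<mu> z u) 0"
  unfolding concentrates_def
proof (intro allI impI)
  fix \<rho> M \<tau> :: real assume rho: "\<rho> > 0" and tau: "\<tau> > 0"
  define a where "a = \<mu> powr ((1 + \<beta>) / (p - 1))"
  define r where "r = \<mu> powr (1 / (2 * s))"
  have a: "a > 0" and r: "r > 0" using m by (auto simp: a_def r_def)
  obtain t where t: "0 < t" "t < \<mu> * \<tau>" and big: "M / a * r ^ DIM('a) < (LBINT x. indicator (ball z (r * \<rho>)) x * u t x)"
    using conc[unfolded concentrates_def, rule_format, of "r * \<rho>" "\<mu> * \<tau>"] r rho m tau by auto
  let ?g = "\<lambda>x. indicator (ball z (r * \<rho>)) x * u t x"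
  have mg: "?g \<in> borel_measurable borel" using borel_measurable_integrable[OF sol_ball_integrable[OF u t(1)]] by simp
  have ind: "indicator (ball z (r * \<rho>)) (z + r *\<^sub>R x) = (indicator (ball 0 \<rho>) x :: real)" for x
    using r by (simp add: indicator_def dist_norm)
  have "(LBINT x. indicator (ball 0 \<rho>) x * rescale s \<beta> p \<mu> z u (t / \<mu>) x) = (LBINT x. a * ?g (z + r *\<^sub>R x))"
    unfolding ind rescale_def a_def[symmetric] r_def[symmetric] using m by (simp add: mult_ac)
  also have "\<dots> = a * (integral\<^sup>L lborel ?g / \<bar>r\<bar> ^ DIM('a))"
    unfolding integral_mult_right_zero using r by (subst lborel_integral_affine[OF mg]) auto
  also have "\<dots> > M"
  proof -
    have "M / a * r ^ DIM('a) / r ^ DIM('a) < integral\<^sup>L lborel ?g / r ^ DIM('a)" using big r by (intro divide_strict_right_mono) auto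
    then have "a * (M / a) < a * (integral\<^sup>L lborel ?g / r ^ DIM('a))" using a r by (intro mult_strict_left_mono) auto
    then show ?thesis using a r by simp
  qed
  finally show "\<exists>t. 0 < t \<and> t < \<tau> \<and> M < (LBINT x. indicator (ball 0 \<rho>) x * rescale s \<beta> p \<mu> z u t x)"
    using t m by (intro exI[of _ "t / \<mu>"]) (auto simp: divide_less_eq mult.commute)
qed

text \<open>The bound at time 1 for the solution rescaled by \<open>\<mu> = t\<close> about
  \<open>z\<close>, whose concentration point is 0.\<close>

lemma singular_lower:
  assumes s: "0 < s" "s < 1" and p: "p > 1" and \<beta>: "\<beta> > -1"
    and sub: "real DIM('a) / (2 * s) < (1 + \<beta>) / (p - 1)"
  shows "\<exists>c>0. \<exists>\<delta>>0. \<forall>(u :: real \<Rightarrow> 'a::euclidean_space \<Rightarrow> real) z t x. absorption_sol s \<beta> p u \<longrightarrow> concentrates u z \<longrightarrow> t > 0 \<longrightarrow>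
    norm (x - z) \<le> \<delta> * t powr (1 / (2 * s)) \<longrightarrow> c * t powr (- ((1 + \<beta>) / (p - 1))) \<le> u t x"
proof -
  obtain c \<delta> where c: "c > 0" and del: "\<delta> > 0" and H: "\<And>(u :: real \<Rightarrow> 'a \<Rightarrow> real) x.
    absorption_sol s \<beta> p u \<Longrightarrow> concentrates u 0 \<Longrightarrow> norm x \<le> \<delta> \<Longrightarrow> c \<le> u 1 x"
    using singular_lower_unit[OF s p \<beta> sub] by blast
  show ?thesis
  proof (rule exI[of _ c], rule conjI[OF c], rule exI[of _ \<delta>], rule conjI[OF del], intro allI impI)
    fix u :: "real \<Rightarrow> 'a \<Rightarrow> real" and z x t
    let ?al = "(1 + \<beta>) / (p - 1)" and ?r = "t powr (1 / (2 * s))"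
    assume u: "absorption_sol s \<beta> p u" and conc: "concentrates u z" and t: "t > 0" and x: "norm (x - z) \<le> \<delta> * ?r"
    have r: "?r > 0" using t by simp
    let ?v = "rescale s \<beta> p t z u"
    have "norm ((x - z) /\<^sub>R ?r) \<le> \<delta>" unfolding norm_divideR[OF r] using x r by (simp add: divide_le_eq)
    then have "c \<le> ?v 1 ((x - z) /\<^sub>R ?r)"
      by (rule H[OF absorption_sol_rescale[OF s p u t] concentrates_rescale[OF s(1) u t conc]])
    also have "\<dots> = t powr ?al * u t x" using r by (simp add: rescale_def)
    finally show "c * t powr (- ?al) \<le> u t x" using t by (simp add: powr_minus field_simps)
  qed
qed

section \<open>Blow-up near a singular plane\<close>

text \<open>The measure near the plane is needed only inside a bounded set and only from below, so
  packing by balls replaces adapted coordinates and a product decomposition of the measure.\<close>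

lemma tube_volume:
  fixes A :: "'a::euclidean_space set"
  assumes A: "affine A" and dim: "aff_dim A = int DIM('a) - int \<kappa>" and k: "\<kappa> \<le> DIM('a)" and z0: "z0 \<in> A"
  shows "\<exists>c>0. \<exists>R>0. \<forall>r. 0 < r \<and> r \<le> 1 \<longrightarrow>
    (\<exists>S. S \<in> sets borel \<and> S \<subseteq> ball z0 R \<and> (\<forall>y\<in>S. \<exists>a\<in>A. norm (y - a) \<le> r) \<and> c * r ^ \<kappa> \<le> measure lborel S)"
proof -
  define V where "V = (\<lambda>x. - z0 + x) ` A"
  have V: "subspace V" unfolding V_def using affine_diffs_subspace[OF A z0] .
  define n where "n = DIM('a) - \<kappa>"
  have "aff_dim V = aff_dim A" unfolding V_def by (rule aff_dim_translation_eq)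
  then have "int (dim V) = int n" using dim k aff_dim_subspace[OF V] by (simp add: n_def)
  then have dV: "dim V = n" by simp
  obtain B where B: "B \<subseteq> V" "pairwise orthogonal B" "\<And>x. x \<in> B \<Longrightarrow> norm x = 1" "independent B" "card B = dim V"
    using orthonormal_basis_subspace[OF V] by metis
  have fB: "finite B" using B(4) independent_imp_finite by blast
  let ?W = "unit_ball_vol (real DIM('a))"
  define c where "c = ?W * (1/2) ^ n"
  have c: "c > 0" by (simp add: c_def)
  define R where "R = real n + 2"
  show ?thesis
  proof (rule exI[of _ c], rule conjI[OF c], rule exI[of _ R], rule conjI, simp add: R_def, intro allI impI)
    fix r :: real assume r: "0 < r \<and> r \<le> 1"
    \<comment> \<open>Lattice steps of length \<open>2 * r\<close> up to distance 1 in each of the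
      \<open>n\<close> directions: the centres stay within \<open>n\<close> of \<open>z0\<close>,
      and each direction carries \<open>M + 1 >= 1 / (2 * r)\<close> points.\<close>
    define M where "M = nat \<lfloor>1 / (2 * r)\<rfloor>"
    have M: "real M \<le> 1 / (2 * r)" "1 / (2 * r) \<le> real M + 1"
    proof -
      have "1 / (2 * r) \<ge> 0" using r by simp
      then have "real M = of_int \<lfloor>1 / (2 * r)\<rfloor>" unfolding M_def by simp
      then show "real M \<le> 1 / (2 * r)" "1 / (2 * r) \<le> real M + 1" by linarith+
    qed
    define F where "F = B \<rightarrow>\<^sub>E {..M}"
    define P where "P j = z0 + (\<Sum>b\<in>B. (2 * r * real (j b)) *\<^sub>R b)" for j :: "'a \<Rightarrow> nat"
    \<comment> \<open>About \<open>r\<^bsup>\<kappa> - N\<^esup>\<close> disjoint balls centred at lattice points of the plane.\<close>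
    define S where "S = (\<Union>j\<in>F. ball (P j) r)"
    have fF: "finite F" unfolding F_def using fB by (intro finite_PiE) auto
    have PA: "P j \<in> A" for j
    proof -
      have "(\<Sum>b\<in>B. (2 * r * real (j b)) *\<^sub>R b) \<in> V"
        using B(1) by (intro subspace_sum[OF V] subspace_scale[OF V]) auto
      then obtain x where "x \<in> A" "(\<Sum>b\<in>B. (2 * r * real (j b)) *\<^sub>R b) = - z0 + x" unfolding V_def by blast
      then show ?thesis by (simp add: P_def)
    qed
    have Pn: "norm (P j - z0) \<le> real n" if j: "j \<in> F" for j
    proof -
      have "norm (P j - z0) \<le> (\<Sum>b\<in>B. norm ((2 * r * real (j b)) *\<^sub>R b))" unfolding P_def add_diff_cancel_left' by (rule norm_sum)
      also have "\<dots> \<le> (\<Sum>b\<in>B. 1)"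
      proof (rule sum_mono)
        fix b assume b: "b \<in> B"
        then have "real (j b) \<le> real M" using j unfolding F_def by (auto simp: PiE_iff)
        then have "2 * r * real (j b) \<le> 2 * r * (1 / (2 * r))" using M(1) r by (intro mult_left_mono) auto
        then show "norm ((2 * r * real (j b)) *\<^sub>R b) \<le> 1" using B(3)[OF b] r by simp
      qed
      finally show ?thesis using B(5) dV by simp
    qed
    have inn: "(\<Sum>b\<in>B. (2 * r * real (j b)) *\<^sub>R b) \<bullet> b' = 2 * r * real (j b')" if b': "b' \<in> B" for j :: "'a \<Rightarrow> nat" and b'
    proof -
      have "(\<Sum>b\<in>B. (2 * r * real (j b)) *\<^sub>R b) \<bullet> b' = (\<Sum>b\<in>B. if b = b' then 2 * r * real (j b) else 0)"
        unfolding inner_sum_left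
      proof (rule sum.cong[OF refl])
        fix b assume b: "b \<in> B"
        show "(2 * r * real (j b)) *\<^sub>R b \<bullet> b' = (if b = b' then 2 * r * real (j b) else 0)"
        proof (cases "b = b'")
          case True
          then show ?thesis using B(3)[OF b'] by (simp add: norm_eq_1)
        next
          case False
          then have "b \<bullet> b' = 0" using B(2) b b' by (auto simp: pairwise_def orthogonal_def)
          then show ?thesis using False by simp
        qed
      qed
      also have "\<dots> = 2 * r * real (j b')" using fB b' by simp
      finally show ?thesis .
    qed
    have disj: "disjoint_family_on (\<lambda>j. ball (P j) r) F"
      unfolding disjoint_family_on_def
    proof (intro ballI impI)
      fix i j assume ij: "i \<in> F" "j \<in> F" "i \<noteq> j"
      then obtain b where b: "b \<in> B" "i b \<noteq> j b" unfolding F_def by (meson PiE_ext)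
      have "(P i - P j) \<bullet> b = 2 * r * (real (i b) - real (j b))"
        unfolding P_def using inn[OF b(1), of i] inn[OF b(1), of j] by (simp add: inner_diff_left inner_add_left right_diff_distrib)
      then have "\<bar>(P i - P j) \<bullet> b\<bar> = 2 * r * \<bar>real (i b) - real (j b)\<bar>" using r by (simp add: abs_mult)
      moreover have "\<bar>real (i b) - real (j b)\<bar> \<ge> 1" using b(2) by linarith
      then have "2 * r * 1 \<le> 2 * r * \<bar>real (i b) - real (j b)\<bar>" using r by (intro mult_left_mono) auto
      moreover have "\<bar>(P i - P j) \<bullet> b\<bar> \<le> norm (P i - P j) * norm b" by (rule Cauchy_Schwarz_ineq2)
      ultimately have "dist (P i) (P j) \<ge> 2 * r" using B(3)[OF b(1)] by (simp add: dist_norm)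
      then show "ball (P i) r \<inter> ball (P j) r = {}" by (intro disjoint_ballI) auto
    qed
    have "measure lborel S = (\<Sum>j\<in>F. measure lborel (ball (P j) r))"
      unfolding S_def using emeasure_lborel_ball_finite by (intro measure_finite_Union fF disj) (auto simp: less_top[symmetric])
    also have "\<dots> = real (card F) * (?W * r ^ DIM('a))" using r by (simp add: content_ball)
    also have "real (card F) = (real M + 1) ^ n" unfolding F_def using fB B(5) dV by (simp add: card_PiE add.commute)
    finally have vol: "measure lborel S = (real M + 1) ^ n * (?W * r ^ DIM('a))" .
    have "c * r ^ \<kappa> \<le> measure lborel S"
    proof -
      have "(1 / (2 * r)) ^ n \<le> (real M + 1) ^ n" using M(2) r by (intro power_mono) auto
      then have "(1 / (2 * r)) ^ n * (?W * r ^ DIM('a)) \<le> measure lborel S" unfolding vol using r by (intro mult_right_mono) auto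
      moreover have "r ^ DIM('a) = r ^ n * r ^ \<kappa>" using k by (simp add: n_def power_add[symmetric])
      then have "(1 / (2 * r)) ^ n * (?W * r ^ DIM('a)) = c * r ^ \<kappa>"
        using r by (simp add: c_def power_divide power_mult_distrib)
      ultimately show ?thesis by simp
    qed
    moreover have "S \<in> sets borel" unfolding S_def using fF by (intro sets.finite_UN) auto
    moreover have "S \<subseteq> ball z0 R"
    proof
      fix y assume "y \<in> S"
      then obtain j where j: "j \<in> F" "norm (y - P j) < r" unfolding S_def by (auto simp: dist_norm norm_minus_commute)
      have "norm (y - z0) \<le> norm (y - P j) + norm (P j - z0)" using norm_triangle_ineq[of "y - P j" "P j - z0"] by simp
      then show "y \<in> ball z0 R" using j Pn[OF j(1)] r by (simp add: dist_norm norm_minus_commute R_def)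
    qed
    moreover have "\<forall>y\<in>S. \<exists>a\<in>A. norm (y - a) \<le> r"
      using PA unfolding S_def by (auto simp: dist_norm norm_minus_commute intro!: bexI less_imp_le)
    ultimately show "\<exists>S. S \<in> sets borel \<and> S \<subseteq> ball z0 R \<and> (\<forall>y\<in>S. \<exists>a\<in>A. norm (y - a) \<le> r) \<and> c * r ^ \<kappa> \<le> measure lborel S"
      by blast
  qed
qed

text \<open>At equality in \<open>crit\<close> the influx from the tube is only of order
  \<open>1 / t\<close>, so its integral diverges logarithmically and the height of the barrier is a
  logarithm. For larger \<open>\<alpha>\<close> the influx is stronger still at times below 1, and
  the same barrier works.\<close>

lemma blow_up_at_time_zero:
  fixes u :: "real \<Rightarrow> 'a::euclidean_space \<Rightarrow> real"
  assumes s: "0 < s" "s < 1" and p: "p > 1" and \<beta>: "\<beta> > -1" and u: "absorption_sol s \<beta> p u"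
    and A: "affine A" and dim: "aff_dim A = int DIM('a) - int \<kappa>" and k: "\<kappa> \<le> DIM('a)" and z0: "z0 \<in> A"
    and c0: "c0 > 0" and del: "\<delta> > 0"
    and low: "\<And>t a x. t > 0 \<Longrightarrow> a \<in> A \<Longrightarrow> norm (x - a) \<le> \<delta> * t powr (1 / (2 * s)) \<Longrightarrow> c0 * t powr (- ((1 + \<beta>) / (p - 1))) \<le> u t x"
    and crit: "real \<kappa> / (2 * s) + 1 \<le> (1 + \<beta>) / (p - 1)"
    and R: "R > 0" and Am: "Am > 0"
  shows "\<exists>\<tau>>0. \<forall>t. 0 < t \<longrightarrow> t < \<tau> \<longrightarrow> (\<forall>x. Am * bump ((x - x0) /\<^sub>R R) \<le> u t x)"
proof (rule lower_barrier[OF s p, where 'a='a and \<beta>=\<beta>])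
  let ?al = "(1 + \<beta>) / (p - 1)" and ?e = "real DIM('a) + 2 * s" and ?A = "frac_const DIM('a) s"
  have Apos: "?A > 0" by (rule frac_const_pos[OF s])
  fix CL assume CL: "CL \<ge> 0" and LB: "\<And>(u :: real \<Rightarrow> 'a \<Rightarrow> real) x0 R t1 t2 h h' k.
    \<lbrakk>absorption_sol s \<beta> p u; R > 0; 0 < t1;
    \<And>t. t \<in> {t1..t2} \<Longrightarrow> h t \<ge> 0;
    \<And>t. t \<in> {t1..t2} \<Longrightarrow> (h has_real_derivative h' t) (at t within {t1..t2});
    \<And>x. h t1 * bump ((x - x0) /\<^sub>R R) \<le> u t1 x;
    \<And>t. t \<in> {t1<..t2} \<Longrightarrow> k t \<in> borel_measurable borel;
    \<And>t x z. t \<in> {t1<..t2} \<Longrightarrow> norm (x - x0) < R \<Longrightarrow> z \<noteq> x \<Longrightarrow> k t z \<le> jump_kernel s (z - x);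
    \<And>t z. t \<in> {t1<..t2} \<Longrightarrow> 0 \<le> k t z;
    \<And>t. t \<in> {t1<..t2} \<Longrightarrow> integrable lborel (\<lambda>z. max 0 (u t z - h t * bump ((z - x0) /\<^sub>R R)) * k t z);
    \<And>t. t \<in> {t1<..t2} \<Longrightarrow> h' t + CL * R powr (- (2 * s)) * h t + t powr \<beta> * h t powr p
      \<le> ?A * (LBINT z. max 0 (u t z - h t * bump ((z - x0) /\<^sub>R R)) * k t z)\<rbrakk>
    \<Longrightarrow> \<forall>t\<in>{t1..t2}. \<forall>x. h t * bump ((x - x0) /\<^sub>R R) \<le> u t x"
  obtain cV Rt where cV: "cV > 0" and Rt: "Rt > 0" and tube: "\<And>r. 0 < r \<and> r \<le> 1 \<Longrightarrow>
    (\<exists>S. S \<in> sets borel \<and> S \<subseteq> ball z0 Rt \<and> (\<forall>y\<in>S. \<exists>a\<in>A. norm (y - a) \<le> r) \<and> cV * r ^ \<kappa> \<le> measure lborel S)"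
    using tube_volume[OF A dim k z0] by blast
  obtain S where S: "\<And>r. 0 < r \<and> r \<le> 1 \<Longrightarrow> S r \<in> sets borel \<and> S r \<subseteq> ball z0 Rt \<and> (\<forall>y\<in>S r. \<exists>a\<in>A. norm (y - a) \<le> r) \<and> cV * r ^ \<kappa> \<le> measure lborel (S r)"
    using tube by metis
  \<comment> \<open>Bounds the length of all jumps from the support of the bump to the part of the
    tube in \<open>ball z0 Rt\<close>.\<close>
  define D where "D = norm (z0 - x0) + Rt + R"
  have D: "D > 0" unfolding D_def using Rt R by (intro add_nonneg_pos add_nonneg_nonneg) auto
  \<comment> \<open>Half of the guaranteed rate. Of the influx \<open>2 * \<eta> / t\<close>, one
    half raises \<open>h\<close>; the other pays for the linear cost and the absorption at height
    \<open>Am\<close>, which is condition \<open>e3\<close>.\<close>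
  define \<eta> where "\<eta> = ?A * (1 / D powr ?e) * (c0 / 2) * (cV * \<delta> ^ \<kappa>) / 2"
  have eta: "\<eta> > 0" unfolding \<eta>_def using Apos D c0 cV del by (intro divide_pos_pos mult_pos_pos) auto
  have al: "?al > 0" using p \<beta> by simp
  have e1: "\<forall>\<^sub>F t in at_right 0. \<delta> * t powr (1 / (2 * s)) < 1"
  proof -
    have "((\<lambda>t::real. t powr (1 / (2 * s))) \<longlongrightarrow> 0) (at_right 0)" using s by real_asymp
    then have "((\<lambda>t::real. \<delta> * t powr (1 / (2 * s))) \<longlongrightarrow> \<delta> * 0) (at_right 0)" by (intro tendsto_intros)
    then show ?thesis by (intro order_tendstoD(2)) auto
  qed
  \<comment> \<open>Then \<open>c0 * t powr (- ?al)\<close> exceeds \<open>2 * Am\<close>, and at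
    least half of it is left in the tube after the barrier has been subtracted.\<close>
  have e2: "\<forall>\<^sub>F t in at_right 0. 2 * Am / c0 < t powr (- ?al)"
  proof -
    have "filterlim (\<lambda>t::real. t powr (- ?al)) at_top (at_right 0)"
    proof -
      have "filterlim (\<lambda>t::real. t powr (- a)) at_top (at_right 0)" if "a > 0" for a :: real using that by real_asymp
      then show ?thesis using al by blast
    qed
    then show ?thesis unfolding filterlim_at_top_dense by blast
  qed
  have e3: "\<forall>\<^sub>F t in at_right 0. t * (CL * R powr (- (2 * s)) * Am) + t powr (1 + \<beta>) * Am powr p < \<eta>"
  proof -
    have "((\<lambda>t::real. t powr (1 + \<beta>)) \<longlongrightarrow> 0) (at_right 0)" using \<beta> by real_asymp
    then have "((\<lambda>t::real. t * (CL * R powr (- (2 * s)) * Am) + t powr (1 + \<beta>) * Am powr p) \<longlongrightarrow> 0 * (CL * R powr (- (2 * s)) * Am) + 0 * Am powr p) (at_right 0)"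
      by (intro tendsto_intros)
    then show ?thesis using eta by (intro order_tendstoD(2)) auto
  qed
  have e4: "\<forall>\<^sub>F t in at_right 0. t < (1::real)" by (auto simp: eventually_at_right_field intro: exI[of _ 1])
  obtain \<tau> where tau: "\<tau> > 0" "\<And>t. 0 < t \<Longrightarrow> t < \<tau> \<Longrightarrow> \<delta> * t powr (1 / (2 * s)) < 1 \<and> 2 * Am / c0 < t powr (- ?al) \<and>
      t * (CL * R powr (- (2 * s)) * Am) + t powr (1 + \<beta>) * Am powr p < \<eta> \<and> t < 1"
    using eventually_conj[OF e1 eventually_conj[OF e2 eventually_conj[OF e3 e4]]] unfolding eventually_at_right_field by auto
  show ?thesis
  proof (rule exI[of _ \<tau>], rule conjI[OF tau(1)], intro allI impI)
    fix t2 x assume t2: "0 < t2" "t2 < \<tau>"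
    define t1 where "t1 = t2 * exp (- (Am / \<eta>))"
    have t1: "0 < t1" "t1 \<le> t2" using t2 Am eta by (auto simp: t1_def)
    \<comment> \<open>The tube brings in mass at rate at least \<open>2 \<eta> / t\<close>, so \<open>h\<close> climbs from \<open>0\<close> to \<open>Am\<close> on \<open>[t1, t2]\<close>; the
      starting time \<open>t1\<close> can be taken small because \<open>1 / t\<close> is not integrable at \<open>0\<close>.\<close>
    define h where "h t = \<eta> * ln (t / t1)" for t
    let ?S = "\<lambda>t. S (\<delta> * t powr (1 / (2 * s)))"
    define kk where "kk t z = indicator (?S t) z * (1 / D powr ?e)" for t z
    have tt: "0 < t" "t < \<tau>" if "t \<in> {t1..t2}" for t using that t1 t2 by auto
    have "t2 / t1 = exp (Am / \<eta>)" unfolding t1_def using t2 by (simp add: exp_minus field_simps)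
    then have h2: "h t2 = Am" unfolding h_def using eta by simp
    have hh: "0 \<le> h t" "h t \<le> Am" if t: "t \<in> {t1..t2}" for t
    proof -
      show "0 \<le> h t" unfolding h_def using t t1 eta by (intro mult_nonneg_nonneg ln_ge_zero) auto
      have "h t \<le> h t2" unfolding h_def using t t1 eta by (intro mult_left_mono ln_mono divide_right_mono) auto
      then show "h t \<le> Am" by (simp add: h2)
    qed
    have SS: "?S t \<in> sets borel" "?S t \<subseteq> ball z0 Rt" "\<And>y. y \<in> ?S t \<Longrightarrow> \<exists>a\<in>A. norm (y - a) \<le> \<delta> * t powr (1 / (2 * s))"
      "cV * (\<delta> * t powr (1 / (2 * s))) ^ \<kappa> \<le> measure lborel (?S t)" if t: "t \<in> {t1..t2}" for t
      using S[of "\<delta> * t powr (1 / (2 * s))"] tau(2)[OF tt[OF t]] tt[OF t] del by auto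
    have "\<forall>t\<in>{t1..t2}. \<forall>x. h t * bump ((x - x0) /\<^sub>R R) \<le> u t x"
    proof (rule LB[OF u R t1(1), where h' = "\<lambda>t. \<eta> / t" and k=kk])
      fix t assume t: "t \<in> {t1..t2}"
      show "0 \<le> h t" by (rule hh(1)[OF t])
      show "(h has_real_derivative \<eta> / t) (at t within {t1..t2})"
        unfolding h_def[abs_def] using tt[OF t] t1 by (auto intro!: derivative_eq_intros simp: field_simps)
    next
      fix x
      have "h t1 = 0" using t1 by (simp add: h_def)
      then show "h t1 * bump ((x - x0) /\<^sub>R R) \<le> u t1 x" using sol_pos[OF u t1(1), of x] by simp
    next
      fix t assume "t \<in> {t1<..t2}"
      then have t: "t \<in> {t1..t2}" by auto
      note ts = tau(2)[OF tt[OF t]]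
      show mk: "kk t \<in> borel_measurable borel" unfolding kk_def[abs_def]
        using SS(1)[OF t] by (intro borel_measurable_times borel_measurable_indicator) auto
      show "0 \<le> kk t z" for z by (simp add: kk_def)
      show "kk t z \<le> jump_kernel s (z - y)" if y: "norm (y - x0) < R" "z \<noteq> y" for y z
      proof (cases "z \<in> ?S t")
        case True
        then have "norm (z - z0) < Rt" using SS(2)[OF t] by (auto simp: dist_norm norm_minus_commute)
        moreover have "norm (z - y) \<le> norm (z - z0) + norm (z0 - x0) + norm (y - x0)"
        proof -
          have "norm (z - y) = norm ((z - z0) + (z0 - x0) - (y - x0))" by simp
          also have "\<dots> \<le> norm ((z - z0) + (z0 - x0)) + norm (y - x0)" by (rule norm_triangle_ineq4)
          also have "\<dots> \<le> norm (z - z0) + norm (z0 - x0) + norm (y - x0)" by (intro add_right_mono norm_triangle_ineq)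
          finally show ?thesis .
        qed
        ultimately have "norm (z - y) \<le> D" using y unfolding D_def by linarith
        then have "1 / D powr ?e \<le> jump_kernel s (z - y)" using y by (intro jump_kernel_ge s) auto
        then show ?thesis using True by (simp add: kk_def)
      qed (simp add: kk_def)
      let ?m = "\<lambda>z. max 0 (u t z - h t * bump ((z - x0) /\<^sub>R R)) * kk t z"
      have up: "u t z > 0" for z by (rule sol_pos[OF u tt(1)[OF t]])
      show im: "integrable lborel ?m"
      proof (rule Bochner_Integration.integrable_bound[OF integrable_mult_right[OF sol_ball_integrable[OF u tt(1)[OF t], of z0 Rt], of "1 / D powr ?e"]])
        show "?m \<in> borel_measurable lborel" using sol_measurable[OF u tt(1)[OF t]] mk by measurable
        show "AE z in lborel. norm (?m z) \<le> norm (1 / D powr ?e * (indicator (ball z0 Rt) z * u t z))"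
        proof (rule AE_I2)
          fix z
          show "norm (?m z) \<le> norm (1 / D powr ?e * (indicator (ball z0 Rt) z * u t z))"
          proof (cases "z \<in> ?S t")
            case True
            then have "z \<in> ball z0 Rt" using SS(2)[OF t] by auto
            moreover have "max 0 (u t z - h t * bump ((z - x0) /\<^sub>R R)) \<le> u t z"
              using up[of z] hh(1)[OF t] by (auto simp: max_def)
            then have "max 0 (u t z - h t * bump ((z - x0) /\<^sub>R R)) * (1 / D powr ?e) \<le> u t z * (1 / D powr ?e)"
              by (intro mult_right_mono) auto
            ultimately show ?thesis using True up[of z] by (simp add: kk_def abs_mult)
          qed (simp add: kk_def)
        qed
      qed
      have fin: "emeasure lborel (?S t) < \<infinity>"
        using emeasure_mono[OF SS(2)[OF t], of lborel] emeasure_lborel_ball_finite[of z0 Rt] SS(1)[OF t] by (auto intro: le_less_trans)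
      have "(c0 / 2 * t powr (- ?al)) * (1 / D powr ?e) * measure lborel (?S t)
        = (LBINT z. (c0 / 2 * t powr (- ?al)) * (1 / D powr ?e) * indicator (?S t) z)"
        by simp
      also have "\<dots> \<le> integral\<^sup>L lborel ?m"
      proof (rule integral_mono[OF _ im])
        show "integrable lborel (\<lambda>z. (c0 / 2 * t powr (- ?al)) * (1 / D powr ?e) * indicator (?S t) z)"
          using fin SS(1)[OF t] by (intro integrable_mult_right integrable_real_indicator) auto
        fix z
        show "(c0 / 2 * t powr (- ?al)) * (1 / D powr ?e) * indicator (?S t) z \<le> ?m z"
        proof (cases "z \<in> ?S t")
          case True
          obtain a where a: "a \<in> A" "norm (z - a) \<le> \<delta> * t powr (1 / (2 * s))" using SS(3)[OF t True] by blast
          have 1: "c0 * t powr (- ?al) \<le> u t z" by (rule low[OF tt(1)[OF t] a])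
          have "h t * bump ((z - x0) /\<^sub>R R) \<le> Am * 1" using hh[OF t] Am by (intro mult_mono) auto
          moreover have "2 * Am < c0 * t powr (- ?al)" using ts c0 by (simp add: divide_less_eq mult.commute)
          ultimately have "c0 / 2 * t powr (- ?al) \<le> max 0 (u t z - h t * bump ((z - x0) /\<^sub>R R))" using 1 by linarith
          then have "(c0 / 2 * t powr (- ?al)) * (1 / D powr ?e) \<le> max 0 (u t z - h t * bump ((z - x0) /\<^sub>R R)) * (1 / D powr ?e)"
            by (intro mult_right_mono) auto
          then show ?thesis using True by (simp add: kk_def)
        qed (simp add: kk_def)
      qed
      finally have I: "(c0 / 2 * t powr (- ?al)) * (1 / D powr ?e) * measure lborel (?S t) \<le> integral\<^sup>L lborel ?m" .
      have "1 / t \<le> t powr (- ?al) * t powr (real \<kappa> / (2 * s))"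
      proof -
        have "t powr (- 1) \<le> t powr (- ?al + real \<kappa> / (2 * s))" using tt[OF t] ts crit by (intro powr_mono') auto
        then have "t powr (- 1) \<le> t powr (- ?al) * t powr (real \<kappa> / (2 * s))" by (simp only: powr_add)
        moreover have "t powr (- 1) = 1 / t" using tt[OF t] by (simp add: powr_minus_divide)
        ultimately show ?thesis by (simp only:)
      qed
      also have "t powr (real \<kappa> / (2 * s)) = (t powr (1 / (2 * s))) ^ \<kappa>"
      proof -
        have "(t powr (1 / (2 * s))) ^ \<kappa> = (t powr (1 / (2 * s))) powr real \<kappa>" using tt[OF t] by (simp add: powr_realpow)
        then show ?thesis by (simp only: powr_powr) simp
      qed
      finally have "(c0 / 2) * (1 / D powr ?e) * (cV * \<delta> ^ \<kappa>) * (1 / t) \<le> (c0 / 2) * (1 / D powr ?e) * (cV * \<delta> ^ \<kappa>) * (t powr (- ?al) * (t powr (1 / (2 * s))) ^ \<kappa>)"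
        using c0 D cV del by (intro mult_left_mono) auto
      also have "\<dots> = (c0 / 2 * t powr (- ?al)) * (1 / D powr ?e) * (cV * (\<delta> * t powr (1 / (2 * s))) ^ \<kappa>)"
        by (simp only: power_mult_distrib mult_ac)
      also have "\<dots> \<le> (c0 / 2 * t powr (- ?al)) * (1 / D powr ?e) * measure lborel (?S t)"
        using c0 by (intro mult_left_mono SS(4)[OF t]) auto
      finally have "(c0 / 2) * (1 / D powr ?e) * (cV * \<delta> ^ \<kappa>) * (1 / t) \<le> integral\<^sup>L lborel ?m" using I by linarith
      then have "?A * ((c0 / 2) * (1 / D powr ?e) * (cV * \<delta> ^ \<kappa>) * (1 / t)) \<le> ?A * integral\<^sup>L lborel ?m"
        using Apos by (intro mult_left_mono) auto
      moreover have "?A * ((c0 / 2) * (1 / D powr ?e) * (cV * \<delta> ^ \<kappa>) * (1 / t)) = 2 * \<eta> / t" by (simp add: \<eta>_def)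
      ultimately have drive: "2 * \<eta> / t \<le> ?A * integral\<^sup>L lborel ?m" by simp
      have "CL * R powr (- (2 * s)) * h t + t powr \<beta> * h t powr p \<le> CL * R powr (- (2 * s)) * Am + t powr \<beta> * Am powr p"
        using CL hh[OF t] p by (intro add_mono mult_left_mono powr_mono2) auto
      also have "\<dots> \<le> \<eta> / t"
      proof -
        have "t * (CL * R powr (- (2 * s)) * Am + t powr \<beta> * Am powr p) \<le> \<eta>"
          using ts tt[OF t] by (simp add: distrib_left powr_add mult_ac)
        then show ?thesis using tt[OF t] by (simp add: le_divide_eq mult.commute)
      qed
      finally have "CL * R powr (- (2 * s)) * h t + t powr \<beta> * h t powr p \<le> \<eta> / t" .
      moreover have "2 * \<eta> / t = \<eta> / t + \<eta> / t" by simp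
      ultimately show "\<eta> / t + CL * R powr (- (2 * s)) * h t + t powr \<beta> * h t powr p \<le> ?A * integral\<^sup>L lborel ?m"
        using drive by linarith
    qed
    then show "Am * bump ((x - x0) /\<^sub>R R) \<le> u t2 x" using h2 t1 by force
  qed
qed

section \<open>Rigidity\<close>

lemma flat_zero: "p > 1 \<Longrightarrow> \<beta> > -1 \<Longrightarrow> t > 0 \<Longrightarrow> flat_sol p \<beta> 0 t = U_flat p \<beta> t"
proof -
  assume a: "p > 1" "\<beta> > -1" "t > 0"
  have "flat_base p \<beta> 0 t = (p - 1) / (1 + \<beta>) * t powr (1 + \<beta>)" by (simp add: flat_base_def)
  then have "flat_sol p \<beta> 0 t = ((p - 1) / (1 + \<beta>)) powr (- (1 / (p - 1))) * (t powr (1 + \<beta>)) powr (- (1 / (p - 1)))"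
    using powr_mult[of "(p - 1) / (1 + \<beta>)" "t powr (1 + \<beta>)"] by (simp add: flat_sol_def)
  also have "(t powr (1 + \<beta>)) powr (- (1 / (p - 1))) = t powr (- ((1 + \<beta>) / (p - 1)))" by (simp add: powr_powr)
  also have "((p - 1) / (1 + \<beta>)) powr (- (1 / (p - 1))) = ((1 + \<beta>) / (p - 1)) powr (1 / (p - 1))"
  proof -
    have "((p - 1) / (1 + \<beta>)) powr (- (1 / (p - 1))) = 1 / ((p - 1) / (1 + \<beta>)) powr (1 / (p - 1))" by (rule powr_minus_divide)
    also have "\<dots> = (1 / ((p - 1) / (1 + \<beta>))) powr (1 / (p - 1))" using a by (subst powr_divide) simp_all
    finally show ?thesis by simp
  qed
  finally show ?thesis by (simp add: U_flat_def)
qed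

text \<open>The height starts at the finite value \<open>b powr (- (1 / (p - 1)))\<close>, available
  at a small time by \<open>bl\<close>, and follows the flat equation with a damping that pays for
  the cost of the bump; no jumps are exploited, \<open>k\<close> being 0. Along
  \<open>R = n + 1\<close> and \<open>b = 1 / (n + 1)\<close> both the damping and the finite start
  disappear.\<close>

lemma flat_lower:
  fixes u :: "real \<Rightarrow> 'a::euclidean_space \<Rightarrow> real"
  assumes s: "0 < s" "s < 1" and p: "p > 1" and \<beta>: "\<beta> > -1" and u: "absorption_sol s \<beta> p u"
    and bl: "\<And>x0 R Am. R > 0 \<Longrightarrow> Am > 0 \<Longrightarrow> \<exists>\<tau>>0. \<forall>t. 0 < t \<longrightarrow> t < \<tau> \<longrightarrow> (\<forall>x. Am * bump ((x - x0) /\<^sub>R R) \<le> u t x)"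
    and t: "t > 0"
  shows "U_flat p \<beta> t \<le> u t x"
proof (rule lower_barrier[OF s p, where 'a='a and \<beta>=\<beta>])
  fix CL assume CL: "CL \<ge> 0" and LB: "\<And>(u :: real \<Rightarrow> 'a \<Rightarrow> real) x0 R t1 t2 h h' k.
    \<lbrakk>absorption_sol s \<beta> p u; R > 0; 0 < t1;
    \<And>t. t \<in> {t1..t2} \<Longrightarrow> h t \<ge> 0;
    \<And>t. t \<in> {t1..t2} \<Longrightarrow> (h has_real_derivative h' t) (at t within {t1..t2});
    \<And>x. h t1 * bump ((x - x0) /\<^sub>R R) \<le> u t1 x;
    \<And>t. t \<in> {t1<..t2} \<Longrightarrow> k t \<in> borel_measurable borel;
    \<And>t x z. t \<in> {t1<..t2} \<Longrightarrow> norm (x - x0) < R \<Longrightarrow> z \<noteq> x \<Longrightarrow> k t z \<le> jump_kernel s (z - x);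
    \<And>t z. t \<in> {t1<..t2} \<Longrightarrow> 0 \<le> k t z;
    \<And>t. t \<in> {t1<..t2} \<Longrightarrow> integrable lborel (\<lambda>z. max 0 (u t z - h t * bump ((z - x0) /\<^sub>R R)) * k t z);
    \<And>t. t \<in> {t1<..t2} \<Longrightarrow> h' t + CL * R powr (- (2 * s)) * h t + t powr \<beta> * h t powr p
      \<le> frac_const DIM('a) s * (LBINT z. max 0 (u t z - h t * bump ((z - x0) /\<^sub>R R)) * k t z)\<rbrakk>
    \<Longrightarrow> \<forall>t\<in>{t1..t2}. \<forall>x. h t * bump ((x - x0) /\<^sub>R R) \<le> u t x"
  let ?q = "- (1 / (p - 1))"
  have main: "exp (- (CL * R powr (- (2 * s)) * t)) * (b + flat_base p \<beta> 0 t) powr ?q \<le> u t x" if R: "R > 0" and b: "b > 0" for R b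
  proof -
    obtain \<tau> where tau: "\<tau> > 0" "\<And>t' y. 0 < t' \<Longrightarrow> t' < \<tau> \<Longrightarrow> b powr ?q * bump ((y - x) /\<^sub>R R) \<le> u t' y"
      using bl[OF R, of "b powr ?q" x] b by auto
    define t1 where "t1 = min \<tau> t / 2"
    have t1: "0 < t1" "t1 < \<tau>" "t1 < t" using tau t by (auto simp: t1_def min_def)
    let ?K = "CL * R powr (- (2 * s))"
    have K: "?K \<ge> 0" using CL by simp
    define X where "X r = b + flat_base p \<beta> t1 r" for r
    define Y where "Y r = X r powr ?q" for r
    have Xp: "X r > 0" if "r \<ge> t1" for r
      using flat_base_pos[OF p \<beta> less_imp_le[OF t1(1)], of r] that b by (cases "r = t1") (auto simp: X_def flat_base_def)
    define h where "h r = exp (- (?K * (r - t1))) * Y r" for r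
    define h' where "h' r = - (?K * h r) + exp (- (?K * (r - t1))) * (- (r powr \<beta> * Y r powr p))" for r
    have dY: "(Y has_real_derivative - (r powr \<beta> * Y r powr p)) (at r)" if r: "r \<ge> t1" for r
    proof -
      have r0: "r > 0" using r t1 by simp
      have "(X has_real_derivative (p - 1) / (1 + \<beta>) * ((1 + \<beta>) * r powr \<beta>)) (at r)"
        unfolding X_def flat_base_def using r0 by (auto intro!: derivative_eq_intros)
      then have dX: "(X has_real_derivative (p - 1) * r powr \<beta>) (at r)" using \<beta> by simp
      have "(Y has_real_derivative ?q * X r powr (?q - 1) * ((p - 1) * r powr \<beta>)) (at r)"
        using DERIV_fun_powr[OF dX Xp[OF r], of ?q] by (simp add: Y_def[abs_def])
      moreover have "X r powr (?q - 1) = Y r powr p"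
      proof -
        have "?q - 1 = ?q * p" using p by (simp add: field_simps)
        then show ?thesis by (simp add: Y_def powr_powr)
      qed
      ultimately show ?thesis using p by (simp add: mult.commute)
    qed
    have all: "\<forall>r\<in>{t1..t}. \<forall>y. h r * bump ((y - x) /\<^sub>R R) \<le> u r y"
    proof (rule LB[OF u R t1(1), where h'=h' and k="\<lambda>_ _. 0"])
      fix r assume r: "r \<in> {t1..t}"
      show "0 \<le> h r" by (simp add: h_def Y_def)
      have "((\<lambda>r. exp (- (?K * (r - t1)))) has_real_derivative - ?K * exp (- (?K * (r - t1)))) (at r)"
        by (auto intro!: derivative_eq_intros)
      moreover have "r \<ge> t1" using r by simp
      ultimately have "(h has_real_derivative h' r) (at r)"
        using DERIV_mult[OF _ dY] by (fastforce simp: h_def[abs_def] h'_def algebra_simps)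
      then show "(h has_real_derivative h' r) (at r within {t1..t})" by (rule has_field_derivative_at_within)
    next
      fix y
      have "h t1 = b powr ?q" by (simp add: h_def Y_def X_def flat_base_def)
      then show "h t1 * bump ((y - x) /\<^sub>R R) \<le> u t1 y" using tau(2)[OF t1(1,2), of y] by simp
    next
      fix r assume r: "r \<in> {t1<..t}"
      have "exp (- (?K * (r - t1))) powr p \<le> exp (- (?K * (r - t1))) powr 1"
        using K r p by (intro powr_mono') (auto intro!: mult_nonneg_nonneg)
      then have "exp (- (?K * (r - t1))) powr p * Y r powr p \<le> exp (- (?K * (r - t1))) * Y r powr p"
        by (intro mult_right_mono) auto
      then have "h r powr p \<le> exp (- (?K * (r - t1))) * Y r powr p" by (simp add: h_def powr_mult)
      then have "r powr \<beta> * h r powr p \<le> r powr \<beta> * (exp (- (?K * (r - t1))) * Y r powr p)" by (intro mult_left_mono) auto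
      then show "h' r + CL * R powr (- (2 * s)) * h r + r powr \<beta> * h r powr p
        \<le> frac_const DIM('a) s * (LBINT z. max 0 (u r z - h r * bump ((z - x) /\<^sub>R R)) * 0)"
        by (simp add: h'_def mult_ac)
    qed auto
    have "t \<in> {t1..t}" using t1 by simp
    from spec[OF bspec[OF all this], of x] have "h t * bump ((x - x) /\<^sub>R R) \<le> u t x" .
    then have "h t \<le> u t x" by simp
    moreover have "exp (- (?K * t)) * (b + flat_base p \<beta> 0 t) powr ?q \<le> h t"
      unfolding h_def Y_def
    proof (rule mult_mono)
      show "exp (- (?K * t)) \<le> exp (- (?K * (t - t1)))" using K t1 by (simp add: mult_left_mono)
      have "X t \<le> b + flat_base p \<beta> 0 t" unfolding X_def flat_base_def using p \<beta> by (intro add_left_mono mult_left_mono) auto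
      then show "(b + flat_base p \<beta> 0 t) powr ?q \<le> X t powr ?q" using Xp[of t] t1 p by (intro powr_mono2') auto
    qed auto
    ultimately show ?thesis by linarith
  qed
  have F0: "flat_base p \<beta> 0 t > 0" by (rule flat_base_pos[OF p \<beta>]) (use t in auto)
  have "(\<lambda>n. exp (- (CL * (real (Suc n)) powr (- (2 * s)) * t)) * (1 / real (Suc n) + flat_base p \<beta> 0 t) powr ?q) \<longlonglongrightarrow> exp (- (CL * 0 * t)) * (0 + flat_base p \<beta> 0 t) powr ?q"
  proof (intro tendsto_intros)
    show "(\<lambda>n. (real (Suc n)) powr (- (2 * s))) \<longlonglongrightarrow> 0"
      using s by (intro tendsto_neg_powr filterlim_compose[OF filterlim_real_sequentially filterlim_Suc]) auto
    show "(\<lambda>n. 1 / real (Suc n)) \<longlonglongrightarrow> 0" using LIMSEQ_inverse_real_of_nat by (simp add: inverse_eq_divide)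
  qed (use F0 in auto)
  then have "exp (- (CL * 0 * t)) * (0 + flat_base p \<beta> 0 t) powr ?q \<le> u t x"
    by (rule LIMSEQ_le_const2) (use main in auto)
  then show ?thesis using flat_zero[OF p \<beta> t] by (simp add: flat_sol_def)
qed

section \<open>From the stated notions to Borel solutions, and the conclusion\<close>

lemma Ls_weight:
  fixes x :: "'a::euclidean_space"
  assumes "s > 0"
  shows "1 / (1 + norm x) powr (real DIM('a) + 2 * s) \<le> 2 / (1 + norm x powr (real DIM('a) + 2 * s))"
proof -
  let ?e = "real DIM('a) + 2 * s"
  have "1 powr ?e \<le> (1 + norm x) powr ?e" "norm x powr ?e \<le> (1 + norm x) powr ?e"
    using assms by (intro powr_mono2; simp)+
  then have "1 + norm x powr ?e \<le> 2 * (1 + norm x) powr ?e" by simp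
  moreover have "1 + norm x powr ?e > 0" by (simp add: add_pos_nonneg)
  moreover have "(1 + norm x) powr ?e > 0" using norm_ge_zero[of x] by (simp add: add_nonneg_eq_0_iff)
  ultimately show ?thesis by (simp add: divide_simps)
qed

text \<open>Continuity makes every \<open>u t\<close> Borel measurable, so integrals over the
  completed measure pass to \<open>lborel\<close>; positivity removes the absolute values, and
  \<open>Ls_weight\<close> exchanges the weights.\<close>

lemma classical_imp_absorption_sol:
  fixes u :: "real \<Rightarrow> 'a::euclidean_space \<Rightarrow> real"
  assumes s: "0 < s" and h: "positive_classical_solution s \<beta> p u"
  shows "absorption_sol s \<beta> p u"
    and "\<And>t. t > 0 \<Longrightarrow> integrable lborel (\<lambda>x. u t x / (1 + norm x powr (real DIM('a) + 2 * s)))"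
    and "\<And>t. t > 0 \<Longrightarrow> Ls_norm s (u t) = (LBINT x. u t x / (1 + norm x powr (real DIM('a) + 2 * s)))"
proof -
  let ?e = "real DIM('a) + 2 * s"
  have c: "continuous_on ({0<..} \<times> UNIV) (\<lambda>(t, x). u t x)" and pos: "\<And>t x. t > 0 \<Longrightarrow> u t x > 0"
    and ls: "\<And>t. t > 0 \<Longrightarrow> u t \<in> Ls_space s"
    and eq: "\<And>t x. t > 0 \<Longrightarrow> \<exists>ut L. ((\<lambda>\<tau>. u \<tau> x) has_real_derivative ut) (at t) \<and> has_frac_laplacian s (u t) x L \<and> ut + L + t powr \<beta> * u t x powr p = 0"
    using h unfolding positive_classical_solution_def Q_inf_def by auto
  have m [measurable]: "u t \<in> borel_measurable borel" if "t > 0" for t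
  proof (rule borel_measurable_continuous_onI)
    show "continuous_on UNIV (u t)"
      using continuous_on_compose2[OF c, of UNIV "\<lambda>x. (t, x)"] that by (force intro!: continuous_intros)
  qed
  have ab: "\<bar>u t x\<bar> = u t x" if "t > 0" for t x using pos[OF that, of x] by simp
  have mm: "(\<lambda>x. u t x / (1 + norm x powr ?e)) \<in> borel_measurable lborel" if "t > 0" for t using m[OF that] by measurable
  show i: "integrable lborel (\<lambda>x. u t x / (1 + norm x powr ?e))" if t: "t > 0" for t
    using ls[OF t] integrable_completion[of "\<lambda>x. u t x / (1 + norm x powr ?e)" lborel] mm[OF t] by (simp add: Ls_space_def ab[OF t])
  show "Ls_norm s (u t) = (LBINT x. u t x / (1 + norm x powr ?e))" if t: "t > 0" for t
    unfolding Ls_norm_def using integral_completion[OF mm[OF t]] by (simp add: ab[OF t])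
  have iw: "integrable lborel (\<lambda>y. u t y * (1 / (1 + norm y) powr ?e))" if t: "t > 0" for t
  proof (rule Bochner_Integration.integrable_bound[OF integrable_mult_right[OF i[OF t], of 2]])
    show "(\<lambda>y. u t y * (1 / (1 + norm y) powr ?e)) \<in> borel_measurable lborel" using m[OF t] by measurable
    show "AE y in lborel. norm (u t y * (1 / (1 + norm y) powr ?e)) \<le> norm (2 * (u t y / (1 + norm y powr ?e)))"
    proof (rule AE_I2)
      fix y
      have "u t y * (1 / (1 + norm y) powr ?e) \<le> u t y * (2 / (1 + norm y powr ?e))"
        using pos[OF t, of y] by (intro mult_left_mono Ls_weight s) auto
      moreover have "0 \<le> u t y * (1 / (1 + norm y) powr ?e)" using pos[OF t, of y] by simp
      ultimately show "norm (u t y * (1 / (1 + norm y) powr ?e)) \<le> norm (2 * (u t y / (1 + norm y powr ?e)))" using pos[OF t, of y] by (simp add: mult.commute)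
    qed
  qed
  show "absorption_sol s \<beta> p u" unfolding absorption_sol_def
  proof (intro conjI allI impI c iw pos)
    fix t :: real and x assume t: "t > 0"
    show "\<exists>ut L. ((\<lambda>\<tau>. u \<tau> x) has_real_derivative ut) (at t) \<and> frac_lap s (u t) x L \<and> ut + L + t powr \<beta> * u t x powr p = 0"
      using eq[OF t, of x] has_frac_laplacian_imp_frac_lap[OF m[OF t], of s x] by blast
  qed
qed

lemma LINT_ball:
  assumes u: "absorption_sol s \<beta> p u" and t: "t > 0"
  shows "(LINT x:ball z \<rho>|lebesgue. u t x) = (LBINT x. indicator (ball z \<rho>) x * u t x)"
  using integral_completion[OF borel_measurable_integrable[OF sol_ball_integrable[OF u t, of z \<rho>]]]
  by (simp add: set_lebesgue_integral_def)

lemma singular_imp_concentrates: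
  assumes u: "absorption_sol s \<beta> p u" and z: "z \<in> singular_set u"
  shows "concentrates u z"
  unfolding concentrates_def
proof (intro allI impI, rule ccontr)
  fix \<rho> M \<tau> :: real assume rho: "\<rho> > 0" and tau: "\<tau> > 0"
    and neg: "\<not> (\<exists>t. 0 < t \<and> t < \<tau> \<and> M < (LBINT x. indicator (ball z \<rho>) x * u t x))"
  have "\<forall>\<^sub>F t in at_right 0. ereal (LINT x:ball z \<rho>|lebesgue. u t x) \<le> ereal M"
    unfolding eventually_at_right_field
  proof (intro exI[of _ \<tau>] conjI tau allI impI)
    fix t assume t: "0 < t" "t < \<tau>"
    then have "\<not> M < (LBINT x. indicator (ball z \<rho>) x * u t x)" using neg by blast
    then show "ereal (LINT x:ball z \<rho>|lebesgue. u t x) \<le> ereal M" by (simp add: LINT_ball[OF u t(1)])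
  qed
  then have "Limsup (at_right 0) (\<lambda>t. ereal (LINT x:ball z \<rho>|lebesgue. u t x)) \<le> ereal M" by (rule Limsup_bounded)
  then show False using z rho unfolding singular_set_def by auto
qed

text \<open>The integral over any ball is at least a positive constant times
  \<open>t powr (- \<alpha>)\<close>, and \<open>\<alpha> > 0\<close>; the limit superior is then
  even a limit.\<close>

lemma flat_lower_imp_singular:
  fixes u :: "real \<Rightarrow> 'a::euclidean_space \<Rightarrow> real"
  assumes p: "p > 1" and \<beta>: "\<beta> > -1" and u: "absorption_sol s \<beta> p u" and low: "\<And>t x. t > 0 \<Longrightarrow> U_flat p \<beta> t \<le> u t x"
  shows "singular_set u = UNIV"
proof -
  have "Limsup (at_right 0) (\<lambda>t. ereal (LINT x:ball z \<rho>|lebesgue. u t x)) = \<infinity>" if rho: "\<rho> > 0" for z \<rho>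
  proof (rule lim_imp_Limsup)
    define c where "c = ((1 + \<beta>) / (p - 1)) powr (1 / (p - 1)) * measure lborel (ball z \<rho>)"
    have c: "c > 0" unfolding c_def using p \<beta> rho by (intro mult_pos_pos) auto
    have "filterlim (\<lambda>t::real. t powr (- a)) at_top (at_right 0)" if "a > 0" for a :: real using that by real_asymp
    then have "filterlim (\<lambda>t::real. t powr (- ((1 + \<beta>) / (p - 1)))) at_top (at_right 0)" using p \<beta> by simp
    then have frac_lap: "filterlim (\<lambda>t::real. c * t powr (- ((1 + \<beta>) / (p - 1)))) at_top (at_right 0)"
      using c by (intro filterlim_tendsto_pos_mult_at_top[OF tendsto_const])
    have ge: "c * t powr (- ((1 + \<beta>) / (p - 1))) \<le> (LINT x:ball z \<rho>|lebesgue. u t x)" if t: "t > 0" for t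
    proof -
      have "c * t powr (- ((1 + \<beta>) / (p - 1))) = (LBINT x. U_flat p \<beta> t * indicator (ball z \<rho>) x)"
        by (simp add: c_def U_flat_def)
      also have "\<dots> \<le> (LBINT x. indicator (ball z \<rho>) x * u t x)"
      proof (rule integral_mono[OF _ sol_ball_integrable[OF u t]])
        show "integrable lborel (\<lambda>x. U_flat p \<beta> t * indicator (ball z \<rho>) x)"
          using emeasure_lborel_ball_finite by (intro integrable_mult_right integrable_real_indicator) auto
        show "U_flat p \<beta> t * indicator (ball z \<rho>) x \<le> indicator (ball z \<rho>) x * u t x" for x
          using low[OF t, of x] by (auto split: split_indicator)
      qed
      finally show ?thesis using LINT_ball[OF u t] by simp
    qed
    show "((\<lambda>t. ereal (LINT x:ball z \<rho>|lebesgue. u t x)) \<longlongrightarrow> \<infinity>) (at_right 0)"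
      unfolding tendsto_PInfty
    proof
      fix r :: real
      have "\<forall>\<^sub>F t in at_right 0. r < c * t powr (- ((1 + \<beta>) / (p - 1)))" using frac_lap unfolding filterlim_at_top_dense by blast
      then show "\<forall>\<^sub>F t in at_right 0. ereal r < ereal (LINT x:ball z \<rho>|lebesgue. u t x)"
        using eventually_at_right_less[of "0::real"]
      proof eventually_elim
        case (elim t)
        then show ?case using ge[of t] by simp
      qed
    qed
  qed simp
  then show ?thesis unfolding singular_set_def by auto
qed

text \<open>The order of the limits matters. First \<open>R\<close> tends to infinity with
  \<open>a\<close> and \<open>\<Lambda>\<close> fixed: the tails vanish pointwise in time and are
  dominated by a multiple of \<open>Ls_norm\<close>, integrable on \<open>[a, b]\<close>. Then
  \<open>\<Lambda>\<close> is brought down to 1, and last \<open>a\<close> to 0.\<close>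

lemma flat_upper:
  fixes u :: "real \<Rightarrow> 'a::euclidean_space \<Rightarrow> real"
  assumes s: "0 < s" "s < 1" and p: "p > 1" and \<beta>: "\<beta> > -1" and pcs: "positive_classical_solution s \<beta> p u"
    and loc: "u \<in> L1_loc_Ls s" and b: "b > 0"
  shows "u b x0 \<le> U_flat p \<beta> b"
proof (rule upper_barrier[OF s p \<beta>, where 'a='a])
  let ?e = "real DIM('a) + 2 * s"
  fix C1 C2 assume C12: "C1 \<ge> 0" "C2 \<ge> 0" and UB: "\<And>(u :: real \<Rightarrow> 'a \<Rightarrow> real) x0 R a b \<Lambda> B.
    \<lbrakk>absorption_sol s \<beta> p u; R > 0; 0 < a; a < b; \<Lambda> > 1;
    C1 * R powr (- (2 * s)) < (\<Lambda> powr (p - 1) - 1) * ((1 + \<beta>) / ((p - 1) * b));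
    \<And>n. integral {a..b} (tail_cbox s R x0 u n) \<le> B\<rbrakk> \<Longrightarrow>
    u b x0 \<le> \<Lambda> * flat_sol p \<beta> a b + C2 * B"
  note u = classical_imp_absorption_sol(1)[OF s(1) pcs]
  define K where "K = ((1 + norm x0) / 1 + 1) powr ?e * 2"
  have K: "K \<ge> 0" by (simp add: K_def)
  have wle: "1 / (R + norm (z - x0)) powr ?e \<le> K * (1 / (1 + norm z powr ?e))" if "R \<ge> 1" for R and z :: 'a
  proof -
    have "1 / (R + norm (z - x0)) powr ?e \<le> 1 / (1 + norm (z - x0)) powr ?e"
    proof -
      have "R + norm (z - x0) > 0" "1 + norm (z - x0) > 0" using that norm_ge_zero[of "z - x0"] by linarith+
      then show ?thesis using that s by (intro divide_left_mono powr_mono2 mult_pos_pos) auto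
    qed
    also have "\<dots> \<le> ((1 + norm x0) / 1 + 1) powr ?e * (1 / (1 + norm z) powr ?e)"
      by (rule weight_compare) (use s in auto)
    also have "\<dots> \<le> ((1 + norm x0) / 1 + 1) powr ?e * (2 / (1 + norm z powr ?e))"
      by (intro mult_left_mono Ls_weight s) auto
    finally show ?thesis by (simp add: K_def)
  qed
  have tle: "tail s R x0 u t \<le> K * Ls_norm s (u t)" if "t > 0" "R \<ge> 1" for R t
    unfolding classical_imp_absorption_sol(3)[OF s(1) pcs that(1)] tail_def integral_mult_right_zero[symmetric]
  proof (rule integral_mono)
    show "integrable lborel (\<lambda>z. u t z * (1 / (R + norm (z - x0)) powr ?e))" by (rule tail_integrable[OF s u that(1)]) (use that in simp)
    show "integrable lborel (\<lambda>x. K * (u t x / (1 + norm x powr ?e)))" by (intro integrable_mult_right classical_imp_absorption_sol(2)[OF s(1) pcs that(1)])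
    fix z
    have "u t z * (1 / (R + norm (z - x0)) powr ?e) \<le> u t z * (K * (1 / (1 + norm z powr ?e)))"
      using sol_pos[OF u that(1), of z] by (intro mult_left_mono wle that) auto
    then show "u t z * (1 / (R + norm (z - x0)) powr ?e) \<le> K * (u t z / (1 + norm z powr ?e))" by (simp add: mult_ac)
  qed
  have tail0: "(\<lambda>n. tail s (real (Suc n)) x0 u t) \<longlonglongrightarrow> 0" if t: "t > 0" for t
  proof -
    have "(\<lambda>n. (LBINT z. u t z * (1 / (real (Suc n) + norm (z - x0)) powr ?e))) \<longlonglongrightarrow> (LBINT z::'a. 0)"
    proof (rule integral_dominated_convergence[where w="\<lambda>z. K * (u t z / (1 + norm z powr ?e))"])
      show "integrable lborel (\<lambda>x. K * (u t x / (1 + norm x powr ?e)))" by (intro integrable_mult_right classical_imp_absorption_sol(2)[OF s(1) pcs t])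
      show "(\<lambda>z. u t z * (1 / (real (Suc n) + norm (z - x0)) powr ?e)) \<in> borel_measurable lborel" for n
        by (rule borel_measurable_integrable[OF tail_integrable[OF s u t]]) simp
      show "AE z in lborel. (\<lambda>n. u t z * (1 / (real (Suc n) + norm (z - x0)) powr ?e)) \<longlonglongrightarrow> 0"
      proof (rule AE_I2)
        fix z
        have "filterlim (\<lambda>n. real (Suc n) + norm (z - x0)) at_top sequentially"
          by (rule filterlim_at_top_mono[OF filterlim_compose[OF filterlim_real_sequentially filterlim_Suc]]) auto
        then have "(\<lambda>n. (real (Suc n) + norm (z - x0)) powr (- ?e)) \<longlonglongrightarrow> 0" using s by (intro tendsto_neg_powr) (auto simp: add_pos_pos)
        then have "(\<lambda>n. u t z * (real (Suc n) + norm (z - x0)) powr (- ?e)) \<longlonglongrightarrow> u t z * 0" by (intro tendsto_intros)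
        then show "(\<lambda>n. u t z * (1 / (real (Suc n) + norm (z - x0)) powr ?e)) \<longlonglongrightarrow> 0" by (simp only: powr_minus_divide mult_zero_right)
      qed
      fix n
      show "AE z in lborel. norm (u t z * (1 / (real (Suc n) + norm (z - x0)) powr ?e)) \<le> K * (u t z / (1 + norm z powr ?e))"
      proof (rule AE_I2)
        fix z
        have "u t z * (1 / (real (Suc n) + norm (z - x0)) powr ?e) \<le> u t z * (K * (1 / (1 + norm z powr ?e)))"
          using sol_pos[OF u t, of z] by (intro mult_left_mono wle) auto
        moreover have "0 \<le> u t z * (1 / (real (Suc n) + norm (z - x0)) powr ?e)" using sol_pos[OF u t, of z] by simp
        ultimately show "norm (u t z * (1 / (real (Suc n) + norm (z - x0)) powr ?e)) \<le> K * (u t z / (1 + norm z powr ?e))" by (simp add: mult_ac)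
      qed
    qed simp
    then show ?thesis by (simp add: tail_def)
  qed
  have step: "u b x0 \<le> \<Lambda> * flat_sol p \<beta> a b" if a: "0 < a" "a < b" and L: "\<Lambda> > 1" for a \<Lambda>
  proof -
    let ?G = "\<lambda>t. K * Ls_norm s (u t)"
    have "(\<lambda>t. Ls_norm s (u t)) absolutely_integrable_on {a..b}" using loc a unfolding L1_loc_Ls_def by blast
    then have Gi: "?G integrable_on {a..b}"
      using absolutely_integrable_on_def integrable_on_mult_right by blast
    have tn: "integral {a..b} (tail_cbox s (real (Suc n)) x0 u m) \<le> integral {a..b} ?G" for n m
    proof (rule integral_le[OF _ Gi])
      show "tail_cbox s (real (Suc n)) x0 u m integrable_on {a..b}"
        by (rule integrable_continuous_interval, rule continuous_on_subset[OF tail_cbox_continuous[OF s u]]) (use a in auto)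
      fix t assume t: "t \<in> {a..b}"
      then have t0: "t > 0" using a by auto
      have "tail_cbox s (real (Suc n)) x0 u m t \<le> tail s (real (Suc n)) x0 u t"
        by (rule LIMSEQ_le_const[OF tailn_LIMSEQ[OF s u t0]]) (use tail_cbox_mono[OF s u t0] in \<open>auto intro!: exI[of _ m]\<close>)
      also have "\<dots> \<le> ?G t" by (rule tle[OF t0]) simp
      finally show "tail_cbox s (real (Suc n)) x0 u m t \<le> ?G t" .
    qed
    note prim = tail_primitive[OF s u a(1) less_imp_le[OF a(2)] _ tn]
    define J where "J n = integral {a..b} (tail s (real (Suc n)) x0 u)" for n
    have J0: "J \<longlonglongrightarrow> 0"
    proof -
      have "(\<lambda>n. integral {a..b} (tail s (real (Suc n)) x0 u)) \<longlonglongrightarrow> integral {a..b} (\<lambda>_. 0)"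
      proof (rule dominated_convergence(2)[OF _ Gi])
        show "tail s (real (Suc n)) x0 u integrable_on {a..b}" for n by (rule prim(1)) simp
        fix t assume t: "t \<in> {a..b}"
        then have t0: "t > 0" using a by auto
        show "norm (tail s (real (Suc n)) x0 u t) \<le> ?G t" for n
        proof -
          have "0 \<le> tail s (real (Suc n)) x0 u t" unfolding tail_def
            by (intro integral_nonneg_AE AE_I2 tail_term_nonneg[OF s u t0]) simp
          then show ?thesis using tle[OF t0, of "real (Suc n)"] by simp
        qed
        show "(\<lambda>n. tail s (real (Suc n)) x0 u t) \<longlonglongrightarrow> 0" by (rule tail0[OF t0])
      qed
      then show ?thesis by (simp add: J_def[abs_def])
    qed
    have ub: "u b x0 \<le> \<Lambda> * flat_sol p \<beta> a b + C2 * J n"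
      if c: "C1 * (real (Suc n)) powr (- (2 * s)) < (\<Lambda> powr (p - 1) - 1) * ((1 + \<beta>) / ((p - 1) * b))" for n
    proof (rule UB[OF u _ a L c])
      fix m
      have "integral {a..a} (tail s (real (Suc n)) x0 u) + integral {a..b} (tail_cbox s (real (Suc n)) x0 u m) \<le> integral {a..b} (tail s (real (Suc n)) x0 u)"
        by (rule prim(4)) (use a in auto)
      then show "integral {a..b} (tail_cbox s (real (Suc n)) x0 u m) \<le> J n" by (simp add: J_def)
    qed simp
    have "(\<lambda>n. C1 * (real (Suc n)) powr (- (2 * s))) \<longlonglongrightarrow> C1 * 0"
      using s by (intro tendsto_intros tendsto_neg_powr filterlim_compose[OF filterlim_real_sequentially filterlim_Suc]) auto
    moreover have "(\<Lambda> powr (p - 1) - 1) * ((1 + \<beta>) / ((p - 1) * b)) > C1 * 0"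
      using L p \<beta> b by (simp add: gr_one_powr)
    ultimately have "\<forall>\<^sub>F n in sequentially. C1 * (real (Suc n)) powr (- (2 * s)) < (\<Lambda> powr (p - 1) - 1) * ((1 + \<beta>) / ((p - 1) * b))"
      by (rule order_tendstoD(2))
    then have ev: "\<forall>\<^sub>F n in sequentially. u b x0 \<le> \<Lambda> * flat_sol p \<beta> a b + C2 * J n" by eventually_elim (rule ub)
    have "(\<lambda>n. \<Lambda> * flat_sol p \<beta> a b + C2 * J n) \<longlonglongrightarrow> \<Lambda> * flat_sol p \<beta> a b + C2 * 0" by (intro tendsto_intros J0)
    from tendsto_lowerbound[OF this ev] show ?thesis by simp
  qed
  have step2: "u b x0 \<le> flat_sol p \<beta> a b" if a: "0 < a" "a < b" for a
  proof (rule ccontr)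
    assume neg: "\<not> u b x0 \<le> flat_sol p \<beta> a b"
    have Y: "flat_sol p \<beta> a b > 0" by (rule flat_sol_pos[OF p \<beta>]) (use a in auto)
    \<comment> \<open>Midway between 1 and the ratio of \<open>u b x0\<close> to the flat solution,
      so that a ratio above 1 contradicts \<open>step\<close>.\<close>
    define \<Lambda> where "\<Lambda> = (1 + u b x0 / flat_sol p \<beta> a b) / 2"
    have "u b x0 / flat_sol p \<beta> a b > 1" using neg Y by simp
    then have "\<Lambda> > 1" by (simp add: \<Lambda>_def)
    from step[OF a this] have "u b x0 \<le> (flat_sol p \<beta> a b + u b x0) / 2" using Y by (simp add: \<Lambda>_def distrib_right)
    then show False using neg by simp
  qed
  \<comment> \<open>The starting times \<open>b / (n + 2)\<close> are strictly below
    \<open>b\<close>, also for \<open>n = 0\<close>.\<close>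
  have "(\<lambda>n. flat_sol p \<beta> (b / real (Suc (Suc n))) b) \<longlonglongrightarrow> ((p - 1) / (1 + \<beta>) * (b powr (1 + \<beta>) - 0)) powr (- (1 / (p - 1)))"
    unfolding flat_sol_def flat_base_def
  proof (intro tendsto_intros)
    have l0: "(\<lambda>n. b / real (Suc (Suc n))) \<longlonglongrightarrow> 0"
    proof -
      have "(\<lambda>n. b * inverse (real (Suc (Suc n)))) \<longlonglongrightarrow> b * 0"
        using LIMSEQ_Suc[OF LIMSEQ_inverse_real_of_nat] by (intro tendsto_intros)
      then show ?thesis by (simp add: divide_inverse)
    qed
    have "(\<lambda>n. (b / real (Suc (Suc n))) powr (1 + \<beta>)) \<longlonglongrightarrow> 0 powr (1 + \<beta>)"
      by (rule tendsto_powr2[OF l0 tendsto_const]) (use b \<beta> in auto)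
    then show "(\<lambda>n. (b / real (Suc (Suc n))) powr (1 + \<beta>)) \<longlonglongrightarrow> 0" by simp
  qed (use p \<beta> b in auto)
  then have "(\<lambda>n. flat_sol p \<beta> (b / real (Suc (Suc n))) b) \<longlonglongrightarrow> flat_sol p \<beta> 0 b"
    by (simp add: flat_sol_def flat_base_def)
  then have "u b x0 \<le> flat_sol p \<beta> 0 b"
    by (rule LIMSEQ_le_const) (use step2 b in \<open>auto simp: divide_less_eq\<close>)
  then show ?thesis using flat_zero[OF p \<beta> b] by simp
qed

text \<open>Serves both parts of the theorem, a point being a plane of codimension
  \<open>DIM('a)\<close>. The bound by \<open>p_star\<close> yields \<open>sub\<close>, used for the
  local estimate at concentration points; the bound with \<open>\<kappa>\<close> yields
  \<open>crit\<close>, used for the influx from the tube.\<close>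

lemma rigidity:
  fixes u :: "real \<Rightarrow> 'a::euclidean_space \<Rightarrow> real"
  assumes s: "0 < s" "s < 1" and \<beta>: "\<beta> > -1" and pcs: "positive_classical_solution s \<beta> p u"
    and p: "p > 1" "p < p_star DIM('a) s \<beta>" "p \<le> 1 + 2 * s * (1 + \<beta>) / (real \<kappa> + 2 * s)"
    and k: "\<kappa> \<le> DIM('a)" and A: "affine_plane_codim \<kappa> A" "A \<subseteq> singular_set u"
  shows "singular_set u = UNIV \<and> (\<forall>t>0. \<forall>x. u t x \<ge> U_flat p \<beta> t) \<and>
    (u \<in> L1_loc_Ls s \<longrightarrow> (\<forall>t>0. \<forall>x. u t x = U_flat p \<beta> t))"
proof -
  note u = classical_imp_absorption_sol(1)[OF s(1) pcs]
  have aff: "affine A" and dim: "aff_dim A = int DIM('a) - int \<kappa>" using A(1) by (auto simp: affine_plane_codim_def)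
  have "A \<noteq> {}" using dim k by auto
  then obtain z0 where z0: "z0 \<in> A" by blast
  have sub: "real DIM('a) / (2 * s) < (1 + \<beta>) / (p - 1)"
  proof -
    have "p - 1 < 2 * s * (1 + \<beta>) / real DIM('a)" using p(2) by (simp add: p_star_def)
    then have "(p - 1) * real DIM('a) < 2 * s * (1 + \<beta>)" by (simp add: less_divide_eq)
    then show ?thesis using p(1) s by (simp add: divide_less_eq less_divide_eq mult_ac)
  qed
  have crit: "real \<kappa> / (2 * s) + 1 \<le> (1 + \<beta>) / (p - 1)"
  proof -
    have ks: "real \<kappa> + 2 * s > 0" using s by (simp add: add_nonneg_pos)
    have "p - 1 \<le> 2 * s * (1 + \<beta>) / (real \<kappa> + 2 * s)" using p(3) by simp
    then have "(p - 1) * (real \<kappa> + 2 * s) \<le> 2 * s * (1 + \<beta>)" using ks by (simp only: pos_le_divide_eq)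
    moreover have "real \<kappa> / (2 * s) + 1 = (real \<kappa> + 2 * s) / (2 * s)" using s by (simp add: add_divide_distrib)
    ultimately show ?thesis using p(1) s by (simp only:) (simp add: divide_le_eq le_divide_eq mult_ac)
  qed
  obtain c \<delta> where c: "c > 0" and del: "\<delta> > 0" and low: "\<And>(u :: real \<Rightarrow> 'a \<Rightarrow> real) z t x. absorption_sol s \<beta> p u \<Longrightarrow> concentrates u z \<Longrightarrow> t > 0 \<Longrightarrow>
    norm (x - z) \<le> \<delta> * t powr (1 / (2 * s)) \<Longrightarrow> c * t powr (- ((1 + \<beta>) / (p - 1))) \<le> u t x"
    using singular_lower[OF s p(1) \<beta> sub] by blast
  have lowA: "c * t powr (- ((1 + \<beta>) / (p - 1))) \<le> u t x"
    if "t > 0" "a \<in> A" "norm (x - a) \<le> \<delta> * t powr (1 / (2 * s))" for t a x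
    using that A(2) by (intro low[OF u singular_imp_concentrates[OF u]]) auto
  have ge: "U_flat p \<beta> t \<le> u t x" if "t > 0" for t x
    by (rule flat_lower[OF s p(1) \<beta> u blow_up_at_time_zero[OF s p(1) \<beta> u aff dim k z0 c del lowA crit] that])
  moreover have "singular_set u = UNIV" by (rule flat_lower_imp_singular[OF p(1) \<beta> u ge])
  moreover have "u t x \<le> U_flat p \<beta> t" if "u \<in> L1_loc_Ls s" "t > 0" for t x
    by (rule flat_upper[OF s p(1) \<beta> pcs that])
  ultimately show ?thesis by (auto intro: antisym)
qed

theorem theoremG:
  fixes u :: "real \<Rightarrow> 'a::euclidean_space \<Rightarrow> real" and s \<beta> p :: real
  assumes "0 < s" and "s < 1" and "\<beta> > -1"
    and "positive_classical_solution s \<beta> p u"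
  shows
    "(p \<in> {1<..p_star_star DIM('a) s \<beta>} \<and> singular_set u \<noteq> {} \<longrightarrow>
        singular_set u = UNIV \<and>
        (\<forall>t>0. \<forall>x. u t x \<ge> U_flat p \<beta> t) \<and>
        (u \<in> L1_loc_Ls s \<longrightarrow> (\<forall>t>0. \<forall>x. u t x = U_flat p \<beta> t)))
     \<and>
     ((\<exists>\<kappa>::nat. \<kappa> \<in> {1..DIM('a)} \<and>
          p \<in> {1<..<p_star DIM('a) s \<beta>} \<inter>
              {1<..1 + 2 * s * (1 + \<beta>) / (real \<kappa> + 2 * s)} \<and>
          (\<exists>A. affine_plane_codim \<kappa> A \<and> A \<subseteq> singular_set u)) \<longrightarrow>
        singular_set u = UNIV \<and>
        (\<forall>t>0. \<forall>x. u t x \<ge> U_flat p \<beta> t) \<and>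
        (u \<in> L1_loc_Ls s \<longrightarrow> (\<forall>t>0. \<forall>x. u t x = U_flat p \<beta> t)))"
proof (rule conjI; intro impI)
  assume h: "p \<in> {1<..p_star_star DIM('a) s \<beta>} \<and> singular_set u \<noteq> {}"
  then obtain z where z: "z \<in> singular_set u" by blast
  \<comment> \<open>Since \<open>p_star_star\<close> is below \<open>p_star\<close>, the first part
    is the case \<open>\<kappa> = DIM('a)\<close> with the plane \<open>{z}\<close>.\<close>
  have "2 * s * (1 + \<beta>) / (real DIM('a) + 2 * s) < 2 * s * (1 + \<beta>) / real DIM('a)"
  proof (rule divide_strict_left_mono)
    show "0 < 2 * s * (1 + \<beta>)" using assms by simp
    show "0 < (real DIM('a) + 2 * s) * real DIM('a)" using assms by (intro mult_pos_pos add_nonneg_pos) auto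
  qed (use assms in simp)
  then have "p < p_star DIM('a) s \<beta>" using h by (simp add: p_star_star_def p_star_def)
  then show "singular_set u = UNIV \<and> (\<forall>t>0. \<forall>x. u t x \<ge> U_flat p \<beta> t) \<and>
        (u \<in> L1_loc_Ls s \<longrightarrow> (\<forall>t>0. \<forall>x. u t x = U_flat p \<beta> t))"
    using h z by (intro rigidity[OF assms, of "DIM('a)" "{z}"]) (auto simp: p_star_star_def affine_plane_codim_def)
next
  assume "\<exists>\<kappa>::nat. \<kappa> \<in> {1..DIM('a)} \<and>
          p \<in> {1<..<p_star DIM('a) s \<beta>} \<inter>
              {1<..1 + 2 * s * (1 + \<beta>) / (real \<kappa> + 2 * s)} \<and>
          (\<exists>A. affine_plane_codim \<kappa> A \<and> A \<subseteq> singular_set u)"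
  then obtain \<kappa> A where "\<kappa> \<in> {1..DIM('a)}" "p \<in> {1<..<p_star DIM('a) s \<beta>} \<inter> {1<..1 + 2 * s * (1 + \<beta>) / (real \<kappa> + 2 * s)}"
    "affine_plane_codim \<kappa> A" "A \<subseteq> singular_set u" by blast
  then show "singular_set u = UNIV \<and> (\<forall>t>0. \<forall>x. u t x \<ge> U_flat p \<beta> t) \<and>
        (u \<in> L1_loc_Ls s \<longrightarrow> (\<forall>t>0. \<forall>x. u t x = U_flat p \<beta> t))"
    by (intro rigidity[OF assms, of \<kappa> A]) auto
qed

end
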